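(* Let $X=\{x_1,\dots,x_n\}$ be an $n$-tuple of elements in a tracial von Neumann algebra $(M,\varphi)$ and let $F=(f_1,\dots,f_p)$ be a $p$-tuple of noncommutative $*$-polynomials in $n$ indeterminates. Then $$\delta_0(X)\ \le\ \mathrm{Nullity}(D^sF(X))+\delta_0(F(X):X)\ =\ 2n-\mathrm{Rank}(D^sF(X))+\delta_0(F(X):X).$$
   Context: A tracial von Neumann algebra $(M,\varphi)$ is a von Neumann algebra with a normal faithful tracial state. Microstates. Let $tr_k$ be the normalized trace on $M_k(\mathbb C)$ and equip $(M_k(\mathbb C))^n$ with $\|\xi\|_2=(\sum_i tr_k(\xi_i^*\xi_i))^{1/2}$. For $m,k\in\mathbb N$, $\gamma>0$, $\Gamma(X;m,k,\gamma)$ is the set of $\xi\in (M_k(\mathbb C))^n$ with $|\varphi(x_{i_1}^{j_1}\cdots x_{i_q}^{j_q})-tr_k(\xi_{i_1}^{j_1}\cdots\xi_{i_q}^{j_q})|<\gamma$ for all $1\le q\le m$, $1\le i_1,\dots,i_q\le n$, $j_1,\dots,j_q\in\{1,*\}$. For finite tuples $Y,X$, $\Gamma(Y:X;m,k,\gamma)$ is the set of $\eta$ for which there is $\xi$ with $(\eta,\xi)\in\Gamma(Y\cup X;m,k,\gamma)$, $Y\cup X$ being the concatenated tuple. $K_\epsilon(S)$ is the minimum number of open $\|\cdot\|_2$-balls of radius $\epsilon$ needed to cover $S$. $\mathbb K_\epsilon(X)=\inf_{m,\gamma}\limsup_{k\to\infty}k^{-2}\log K_\epsilon(\Gamma(X;m,k,\gamma))$,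 and $\delta_0(X)=\limsup_{\epsilon\to0}\mathbb K_\epsilon(X)/|\log\epsilon|$. $\mathbb K_\epsilon(Y:X)$ and $\delta_0(Y:X)$ are defined in the same way using $\Gamma(Y:X;m,k,\gamma)$. Convention: $\log 0=-\infty$. Derivative. $\mathfrak A_n$ is the universal unital complex $*$-algebra on generators $X_1,\dots,X_n$. For $1\le j\le n$ let $\partial_{sa,j},\partial_{sk,j}:\mathfrak A_n\to\mathfrak A_n\odot\mathfrak A_n^{op}$ be the complex linear maps given on $*$-monomials $w$ by $\partial_{sa,j}w=\sum_{w=uX_j^{s}v}u\odot v^{op}$ and $\partial_{sk,j}w=\sum_{w=uX_j^sv}(-1)^{\delta_{s,*}}u\odot v^{op}$, the sums being over all occurrences in $w$ of $X_j^s$, $s\in\{1,*\}$ (equivalently, they are the derivations killing all $X_i,X_i^*$ with $i\neq j$, with $\partial_{sa,j}X_j=\partial_{sa,j}X_j^*=\partial_{sk,j}X_j=I\odot I^{op}$, $\partial_{sk,j}X_j^*=-I\odot I^{op}$). For $f\in\mathfrak A_n$ put $f_{(1)}=(f+f^* )/2$, $f_{(2)}=(f-f^* )/2$, and let $\partial^s_jf(X)\in M_2(M\otimes M^{op})$ be the image of $\begin{bmatrix}\partial_{sa,j}f_{(1)}&\partial_{sk,j}f_{(1)}\\ \partial_{sa,j}f_{(2)}&\partial_{sk,j}f_{(2)}\end{bmatrix}$ under the entrywise evaluation $a\odot b^{op}\mapsto a(X)\otimes b(X)^{op}$ (von Neumann algebra tensor product). Then $D^sF(X)=[\partial^s_jf_i(X)]_{1\le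 i\le p,1\le j\le n}\in M_{p\times n}(M_2(M\otimes M^{op}))=M_{2p\times 2n}(M\otimes M^{op})$. With $\psi=tr_{2n}\otimes(\varphi\otimes\varphi^{op})$ and $T=D^sF(X)$: $\mathrm{Nullity}(T)=2n\,\psi(1_{\{0\}}(T^*T))$ and $\mathrm{Rank}(T)=2n\,\psi(1_{(0,\infty)}(T^*T))$. *)

theory Defs
  imports
    "HOL-Library.Poly_Mapping"
    "Jordan_Normal_Form.Schur_Decomposition"
    "HOL-Analysis.Analysis"
begin

no_notation vec_index (infixl \<open>$\<close> 100)

section \<open>Complex Hilbert spaces\<close>

text \<open>The inner product is linear in the first argument.\<close>

class complex_hilbert_space = banach +
  fixes scaleC :: "complex \<Rightarrow> 'a \<Rightarrow> 'a" (infixr \<open>*\<^sub>C\<close> 75)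
    and cinner :: "'a \<Rightarrow> 'a \<Rightarrow> complex"
  assumes scaleC_add_right: "c *\<^sub>C (x + y) = c *\<^sub>C x + c *\<^sub>C y"
    and scaleC_add_left: "(c + d) *\<^sub>C x = c *\<^sub>C x + d *\<^sub>C x"
    and scaleC_scaleC: "c *\<^sub>C d *\<^sub>C x = (c * d) *\<^sub>C x"
    and scaleC_of_real: "of_real r *\<^sub>C x = r *\<^sub>R x"
    and cinner_add_left: "cinner (x + y) z = cinner x z + cinner y z"
    and cinner_scaleC_left: "cinner (c *\<^sub>C x) y = c * cinner x y"
    and cinner_commute: "cinner y x = cnj (cinner x y)"
    and cinner_self: "cinner x x = of_real ((norm x)\<^sup>2)"

lemma scaleC_one [simp]: "1 *\<^sub>C x = x"
  using scaleC_of_real[of 1 x] by simp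

lemma scaleC_zero_left [simp]: "0 *\<^sub>C x = 0"
  using scaleC_of_real[of 0 x] by simp

lemma scaleC_zero_right [simp]: "c *\<^sub>C 0 = 0"
  using scaleC_add_right[of c 0 0] by simp

lemma scaleC_minus_right: "c *\<^sub>C (- x) = - (c *\<^sub>C x)"
  using scaleC_add_right[of c x "- x"] by (simp add: minus_unique)

lemma scaleC_diff_right: "c *\<^sub>C (x - y) = c *\<^sub>C x - c *\<^sub>C y"
  using scaleC_add_right[of c x "- y"] by (simp add: scaleC_minus_right)

lemma scaleR_scaleC: "c *\<^sub>C (r *\<^sub>R x) = r *\<^sub>R (c *\<^sub>C x)"
  by (simp add: scaleC_of_real[symmetric] scaleC_scaleC mult.commute)

lemma cinner_zero_left [simp]: "cinner 0 y = 0"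
  using cinner_scaleC_left[of 0 0 y] by simp

lemma cinner_zero_right [simp]: "cinner x 0 = 0"
  using cinner_commute[of x 0] by simp

lemma cinner_minus_left: "cinner (- x) y = - cinner x y"
  using cinner_add_left[of x "- x" y] by (simp add: eq_neg_iff_add_eq_0 add.commute)

lemma cinner_diff_left: "cinner (x - y) z = cinner x z - cinner y z"
  using cinner_add_left[of x "- y" z] by (simp add: cinner_minus_left)

lemma cinner_add_right: "cinner x (y + z) = cinner x y + cinner x z"
  using cinner_commute[of x "y + z"] cinner_commute[of x y] cinner_commute[of x z]
  by (simp add: cinner_add_left)

lemma cinner_diff_right: "cinner x (y - z) = cinner x y - cinner x z"
  using cinner_commute[of x "y - z"] cinner_commute[of x y] cinner_commute[of x z]
  by (simp add: cinner_diff_left)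

lemma cinner_scaleC_right: "cinner x (c *\<^sub>C y) = cnj c * cinner x y"
  using cinner_commute[of x "c *\<^sub>C y"] cinner_commute[of x y]
  by (simp add: cinner_scaleC_left)

lemma norm_scaleC: "norm (c *\<^sub>C x) = cmod c * norm x"
proof -
  have "complex_of_real ((norm (c *\<^sub>C x))\<^sup>2) = c * cnj c * of_real ((norm x)\<^sup>2)"
    by (simp only: cinner_self[symmetric] cinner_scaleC_left cinner_scaleC_right mult_ac)
  also have "\<dots> = of_real ((cmod c * norm x)\<^sup>2)"
    by (simp add: complex_mult_cnj cmod_power2 power_mult_distrib)
  finally have "(norm (c *\<^sub>C x))\<^sup>2 = (cmod c * norm x)\<^sup>2"
    using of_real_eq_iff by blast
  then show ?thesis by (simp add: power2_eq_iff_nonneg)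
qed

lemma norm2_diff: "(norm (x - y))\<^sup>2 = (norm x)\<^sup>2 - 2 * Re (cinner x y) + (norm y)\<^sup>2"
proof -
  have "complex_of_real ((norm (x - y))\<^sup>2)
      = of_real ((norm x)\<^sup>2) - (cinner x y + cnj (cinner x y)) + of_real ((norm y)\<^sup>2)"
    by (simp only: cinner_self[symmetric] cinner_diff_left cinner_diff_right
        cinner_commute[of y x]) simp
  also have "cinner x y + cnj (cinner x y) = of_real (2 * Re (cinner x y))"
    by (rule complex_add_cnj)
  finally have "complex_of_real ((norm (x - y))\<^sup>2)
      = of_real ((norm x)\<^sup>2 - 2 * Re (cinner x y) + (norm y)\<^sup>2)" by simp
  then show ?thesis using of_real_eq_iff by blast
qed

lemma norm2_add: "(norm (x + y))\<^sup>2 = (norm x)\<^sup>2 + 2 * Re (cinner x y) + (norm y)\<^sup>2"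
proof -
  have "cinner x (- y) = - cinner x y"
    using cinner_diff_right[of x 0 y] by simp
  then show ?thesis using norm2_diff[of x "- y"] by simp
qed

lemma parallelogram:
  "(norm (x + y :: 'a::complex_hilbert_space))\<^sup>2 + (norm (x - y))\<^sup>2 = 2 * (norm x)\<^sup>2 + 2 * (norm y)\<^sup>2"
  using norm2_add[of x y] norm2_diff[of x y] by simp

lemma cinner_sum_left:
  "cinner (\<Sum>i\<in>F. f i) y = (\<Sum>i\<in>F. cinner (f i) (y::'a::complex_hilbert_space))"
  by (induction F rule: infinite_finite_induct) (auto simp: cinner_add_left)

lemma scaleC_sum_right:
  "c *\<^sub>C (\<Sum>i\<in>F. f i) = (\<Sum>i\<in>F. c *\<^sub>C (f i :: 'a::complex_hilbert_space))"
  by (induction F rule: infinite_finite_induct) (auto simp: scaleC_add_right)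

section \<open>Finite direct sums\<close>

instantiation vec :: (complex_hilbert_space, finite) complex_hilbert_space
begin

definition "c *\<^sub>C (x :: 'a^'b) = (\<chi> i. c *\<^sub>C (x $ i))"

definition "cinner (x :: 'a^'b) y = (\<Sum>i\<in>UNIV. cinner (x $ i) (y $ i))"

instance
proof
  fix c d :: complex and r :: real and x y z :: "'a^'b"
  show "c *\<^sub>C (x + y) = c *\<^sub>C x + c *\<^sub>C y" "(c + d) *\<^sub>C x = c *\<^sub>C x + d *\<^sub>C x"
    "c *\<^sub>C d *\<^sub>C x = (c * d) *\<^sub>C x" "of_real r *\<^sub>C x = r *\<^sub>R x"
    by (simp_all add: scaleC_vec_def Finite_Cartesian_Product.vec_eq_iff scaleC_add_right
        scaleC_add_left scaleC_scaleC scaleC_of_real)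
  show "cinner (x + y) z = cinner x z + cinner y z"
    by (simp add: cinner_vec_def cinner_add_left sum.distrib)
  show "cinner (c *\<^sub>C x) y = c * cinner x y"
    by (simp add: cinner_vec_def scaleC_vec_def cinner_scaleC_left sum_distrib_left)
  show "cinner y x = cnj (cinner x y)"
    by (simp add: cinner_vec_def cinner_commute[symmetric])
  show "cinner x x = of_real ((norm x)\<^sup>2)"
    by (simp add: cinner_vec_def cinner_self norm_vec_def L2_set_def sum_nonneg)
qed

end


section \<open>Bounded operators, adjoints, orthonormal bases\<close>

definition bounded_clinear ::
    "('a::complex_hilbert_space \<Rightarrow> 'b::complex_hilbert_space) \<Rightarrow> bool" where
  "bounded_clinear T \<longleftrightarrow> bounded_linear T \<and> (\<forall>c x. T (c *\<^sub>C x) = c *\<^sub>C T x)"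

definition cadjoint ::
    "('a::complex_hilbert_space \<Rightarrow> 'b::complex_hilbert_space) \<Rightarrow> 'b \<Rightarrow> 'a" where
  "cadjoint T = (THE S. bounded_clinear S \<and> (\<forall>u v. cinner (T u) v = cinner u (S v)))"

definition orthonormal :: "'a::complex_hilbert_space set \<Rightarrow> bool" where
  "orthonormal B \<longleftrightarrow> (\<forall>x\<in>B. norm x = 1) \<and> (\<forall>x\<in>B. \<forall>y\<in>B. x \<noteq> y \<longrightarrow> cinner x y = 0)"

definition cspan :: "'a::complex_hilbert_space set \<Rightarrow> 'a set" where
  "cspan B = {(\<Sum>x\<in>F. c x *\<^sub>C x) | F c. finite F \<and> F \<subseteq> B}"

definition is_onb :: "'a::complex_hilbert_space set \<Rightarrow> bool" where
  "is_onb B \<longleftrightarrow> orthonormal B \<and> closure (cspan B) = UNIV"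

lemma cinner_sq_le:
  assumes "\<And>c. norm z \<le> norm (z - c *\<^sub>C s)"
  shows "cinner z (s::'a::complex_hilbert_space) = 0"
proof (cases "s = 0")
  case False
  define c where "c = cinner z s / of_real ((norm s)\<^sup>2)"
  have s0: "(norm s)\<^sup>2 > 0" using False by simp
  have "(norm z)\<^sup>2 \<le> (norm (z - c *\<^sub>C s))\<^sup>2"
    using assms by (simp add: power_mono)
  also have "\<dots> = (norm z)\<^sup>2 - 2 * Re (cnj c * cinner z s) + (cmod c)\<^sup>2 * (norm s)\<^sup>2"
    by (simp add: norm2_diff cinner_scaleC_right norm_scaleC power_mult_distrib)
  also have "cnj c * cinner z s = of_real ((cmod (cinner z s))\<^sup>2 / (norm s)\<^sup>2)"
    unfolding c_def
    by (simp only: complex_cnj_divide complex_cnj_complex_of_real of_real_divide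
        complex_norm_square) (simp add: mult.commute)
  also have "(cmod c)\<^sup>2 * (norm s)\<^sup>2 = (cmod (cinner z s))\<^sup>2 / (norm s)\<^sup>2"
  proof -
    have "cmod c = cmod (cinner z s) / (norm s)\<^sup>2"
      unfolding c_def norm_divide norm_of_real by simp
    then show ?thesis using s0 by (simp add: power_divide power2_eq_square)
  qed
  finally have "(cmod (cinner z s))\<^sup>2 / (norm s)\<^sup>2 \<le> 0" by simp
  then have "(cmod (cinner z s))\<^sup>2 \<le> 0"
    using s0 by (simp add: divide_le_0_iff)
  then show ?thesis by simp
qed simp

lemma exists_orthogonal_unit:
  fixes S :: "'a::complex_hilbert_space set"
  assumes cl: "closed S" and zero: "0 \<in> S" and add: "\<And>x y. x \<in> S \<Longrightarrow> y \<in> S \<Longrightarrow> x + y \<in> S"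
    and sc: "\<And>c x. x \<in> S \<Longrightarrow> c *\<^sub>C x \<in> S" and ne: "S \<noteq> UNIV"
  shows "\<exists>u. norm u = 1 \<and> (\<forall>s\<in>S. cinner u s = 0)"
proof -
  obtain x where x: "x \<notin> S" using ne by blast
  define d where "d = infdist x S"
  have d0: "d \<ge> 0" unfolding d_def by (rule infdist_nonneg)
  have dle: "d \<le> norm (x - s)" if "s \<in> S" for s
    using infdist_le[OF that, of x] by (simp add: d_def dist_norm)
  have "\<exists>s\<in>S. norm (x - s) < d + 1 / real (Suc n)" for n
  proof -
    have "\<exists>s\<in>S. dist x s < d + 1 / real (Suc n)"
    proof (rule ccontr)
      assume "\<not> ?thesis"
      then have "d + 1 / real (Suc n) \<le> (INF s\<in>S. dist x s)"
        using zero by (intro cINF_greatest) (auto simp: not_less)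
      also have "\<dots> = d"
        using zero unfolding d_def by (metis infdist_notempty empty_iff)
      finally have "d + 1 / real (Suc n) \<le> d" .
      then show False by simp
    qed
    then show ?thesis by (simp add: dist_norm)
  qed
  then obtain y where yS: "\<And>n. y n \<in> S" and yd: "\<And>n. norm (x - y n) < d + 1 / real (Suc n)"
    by metis
  have lim: "(\<lambda>n. norm (x - y n)) \<longlonglongrightarrow> d"
  proof (rule tendsto_sandwich[OF _ _ tendsto_const])
    show "(\<lambda>n. d + 1 / real (Suc n)) \<longlonglongrightarrow> d"
      using tendsto_add[OF tendsto_const LIMSEQ_inverse_real_of_nat, of d]
      by (simp add: inverse_eq_divide)
  qed (use yd yS dle in \<open>auto intro!: always_eventually less_imp_le\<close>)
  have key: "(norm (y m - y n))\<^sup>2 \<le> 2 * (norm (x - y m))\<^sup>2 + 2 * (norm (x - y n))\<^sup>2 - 4 * d\<^sup>2" for m n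
  proof -
    have "(1/2::complex) *\<^sub>C (y m + y n) \<in> S" using yS add sc by blast
    then have mS: "(1/2) *\<^sub>R (y m + y n) \<in> S"
      using scaleC_of_real[of "1/2" "y m + y n"] by simp
    have "d\<^sup>2 \<le> (norm (x - (1/2) *\<^sub>R (y m + y n)))\<^sup>2"
      using dle[OF mS] d0 by (simp add: power_mono)
    moreover have "(x - y m) + (x - y n) = 2 *\<^sub>R (x - (1/2) *\<^sub>R (y m + y n))"
      by (simp add: scaleR_diff_right scaleR_2)
    then have "(norm ((x - y m) + (x - y n)))\<^sup>2 = 4 * (norm (x - (1/2) *\<^sub>R (y m + y n)))\<^sup>2"
      by (simp add: power_mult_distrib)
    moreover have "(norm ((x - y m) - (x - y n)))\<^sup>2 = (norm (y m - y n))\<^sup>2"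
      by (simp add: norm_minus_commute)
    ultimately show ?thesis
      using parallelogram[of "x - y m" "x - y n"] by linarith
  qed
  have "Cauchy y"
  proof (rule CauchyI)
    fix e :: real assume e: "0 < e"
    have "(\<lambda>n. (norm (x - y n))\<^sup>2) \<longlonglongrightarrow> d\<^sup>2"
      by (intro tendsto_intros lim)
    moreover have "d\<^sup>2 < d\<^sup>2 + e\<^sup>2 / 4" using e by simp
    ultimately have "\<forall>\<^sub>F n in sequentially. (norm (x - y n))\<^sup>2 < d\<^sup>2 + e\<^sup>2 / 4"
      by (rule order_tendstoD)
    then obtain N where N: "\<And>n. n \<ge> N \<Longrightarrow> (norm (x - y n))\<^sup>2 < d\<^sup>2 + e\<^sup>2 / 4"
      by (auto simp: eventually_sequentially)
    have "norm (y m - y n) < e" if "m \<ge> N" "n \<ge> N" for m n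
    proof -
      have "(norm (y m - y n))\<^sup>2 < e\<^sup>2"
        using key[of m n] N[OF that(1)] N[OF that(2)] by linarith
      then show ?thesis using e by (simp add: power2_less_imp_less)
    qed
    then show "\<exists>M. \<forall>m\<ge>M. \<forall>n\<ge>M. norm (y m - y n) < e" by blast
  qed
  then obtain l where l: "y \<longlonglongrightarrow> l"
    using Cauchy_convergent_iff convergent_def by blast
  have lS: "l \<in> S" using cl l yS closed_sequentially by blast
  have "(\<lambda>n. norm (x - y n)) \<longlonglongrightarrow> norm (x - l)" by (intro tendsto_intros l)
  then have nl: "norm (x - l) = d" using lim LIMSEQ_unique by blast
  have dpos: "d > 0"
    using nl d0 lS x by (metis eq_iff_diff_eq_0 less_eq_real_def norm_eq_zero)
  define z where "z = x - l"
  have z0: "norm z = d" "z \<noteq> 0" using nl dpos by (auto simp: z_def)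
  have orth: "cinner z s = 0" if "s \<in> S" for s
  proof (rule cinner_sq_le)
    fix c
    have "l + c *\<^sub>C s \<in> S" using lS that add sc by blast
    from dle[OF this] show "norm z \<le> norm (z - c *\<^sub>C s)"
      using nl by (simp add: z_def diff_diff_eq)
  qed
  have "norm (of_real (1 / d) *\<^sub>C z) = 1"
    using dpos z0 by (simp add: norm_scaleC norm_divide)
  moreover have "\<forall>s\<in>S. cinner (of_real (1 / d) *\<^sub>C z) s = 0"
    using orth by (simp add: cinner_scaleC_left)
  ultimately show ?thesis by blast
qed

lemma bounded_linear_scaleC: "bounded_linear (\<lambda>x::'a::complex_hilbert_space. c *\<^sub>C x)"
  by (rule bounded_linear_intro[where K="cmod c"])
    (auto simp: scaleC_add_right scaleR_scaleC norm_scaleC mult.commute)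

lemma cspan_add:
  assumes "x \<in> cspan B" "y \<in> cspan (B::'a::complex_hilbert_space set)"
  shows "x + y \<in> cspan B"
proof -
  obtain F c where F: "finite F" "F \<subseteq> B" "x = (\<Sum>e\<in>F. c e *\<^sub>C e)"
    using assms(1) unfolding cspan_def by blast
  obtain G d where G: "finite G" "G \<subseteq> B" "y = (\<Sum>e\<in>G. d e *\<^sub>C e)"
    using assms(2) unfolding cspan_def by blast
  have "x = (\<Sum>e\<in>F \<union> G. (if e \<in> F then c e else 0) *\<^sub>C e)"
    unfolding F(3) using F(1) G(1) by (intro sum.mono_neutral_cong_left) auto
  moreover have "y = (\<Sum>e\<in>F \<union> G. (if e \<in> G then d e else 0) *\<^sub>C e)"
    unfolding G(3) using F(1) G(1) by (intro sum.mono_neutral_cong_left) auto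
  ultimately have "x + y = (\<Sum>e\<in>F \<union> G. ((if e \<in> F then c e else 0) + (if e \<in> G then d e else 0)) *\<^sub>C e)"
    by (simp add: scaleC_add_left sum.distrib)
  then show ?thesis
    unfolding cspan_def mem_Collect_eq
    by (intro exI[of _ "F \<union> G"] exI conjI) (use F G in auto)
qed

lemma cspan_scaleC:
  assumes "x \<in> cspan (B::'a::complex_hilbert_space set)"
  shows "a *\<^sub>C x \<in> cspan B"
proof -
  obtain F c where F: "finite F" "F \<subseteq> B" "x = (\<Sum>e\<in>F. c e *\<^sub>C e)"
    using assms unfolding cspan_def by blast
  then have "a *\<^sub>C x = (\<Sum>e\<in>F. (a * c e) *\<^sub>C e)"
    by (simp add: scaleC_sum_right scaleC_scaleC)
  then show ?thesis
    unfolding cspan_def mem_Collect_eq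
    by (intro exI[of _ F] exI conjI) (use F in auto)
qed

lemma cspan_base: "e \<in> B \<Longrightarrow> e \<in> cspan (B::'a::complex_hilbert_space set)"
  unfolding cspan_def mem_Collect_eq
  by (intro exI[of _ "{e}"] exI[of _ "\<lambda>_. 1"]) auto

lemma cspan_zero: "0 \<in> cspan (B::'a::complex_hilbert_space set)"
  unfolding cspan_def mem_Collect_eq
  by (intro exI[of _ "{}"] exI[of _ "\<lambda>_. 1"]) auto

lemma is_onb_exists: "\<exists>B. is_onb (B::'a::complex_hilbert_space set)"
proof -
  have "\<exists>B\<in>{B::'a set. orthonormal B}. \<forall>C\<in>{B. orthonormal B}. B \<subseteq> C \<longrightarrow> C = B"
  proof (rule subset_Zorn')
    fix C assume C: "subset.chain {B::'a set. orthonormal B} C"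
    have "cinner x y = 0" if XY: "X \<in> C" "x \<in> X" "Y \<in> C" "y \<in> Y" and "x \<noteq> y" for X Y x y
    proof -
      have "X \<subseteq> Y \<or> Y \<subseteq> X" using C XY unfolding subset_chain_def by blast
      then obtain Z where "Z \<in> C" "x \<in> Z" "y \<in> Z" using XY by blast
      then have "orthonormal Z" using C unfolding subset_chain_def by blast
      then show ?thesis using \<open>x \<in> Z\<close> \<open>y \<in> Z\<close> \<open>x \<noteq> y\<close> unfolding orthonormal_def by blast
    qed
    moreover have "norm x = 1" if "X \<in> C" "x \<in> X" for X x
    proof -
      have "orthonormal X" using C that(1) unfolding subset_chain_def by blast
      then show ?thesis using that(2) unfolding orthonormal_def by blast
    qed
    ultimately have "orthonormal (\<Union>C)"
      unfolding orthonormal_def by (metis UnionE)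
    then show "\<Union>C \<in> {B. orthonormal B}" by simp
  qed
  then obtain B where B: "orthonormal (B::'a set)"
    and "\<forall>C\<in>{B. orthonormal B}. B \<subseteq> C \<longrightarrow> C = B" by (elim bexE) simp
  then have max: "C = B" if "orthonormal C" "B \<subseteq> C" for C
    using that by simp
  have "closure (cspan B) = UNIV"
  proof (rule ccontr)
    assume ne: "closure (cspan B) \<noteq> UNIV"
    have "\<exists>u. norm u = 1 \<and> (\<forall>s\<in>closure (cspan B). cinner u s = 0)"
    proof (rule exists_orthogonal_unit[OF _ _ _ _ ne])
      show "0 \<in> closure (cspan B)" using cspan_zero closure_subset by blast
    next
      fix x y assume "x \<in> closure (cspan B)" "y \<in> closure (cspan B)"
      then obtain f g where f: "\<And>n. f n \<in> cspan B" "f \<longlonglongrightarrow> x"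
        and g: "\<And>n. g n \<in> cspan B" "g \<longlonglongrightarrow> y" by (auto simp: closure_sequential)
      have "(\<lambda>n. f n + g n) \<longlonglongrightarrow> x + y" by (intro tendsto_add f g)
      moreover have "\<forall>n. f n + g n \<in> cspan B" using f g cspan_add by blast
      ultimately show "x + y \<in> closure (cspan B)"
        unfolding closure_sequential by (intro exI[of _ "\<lambda>n. f n + g n"]) blast
    next
      fix c x assume "x \<in> closure (cspan B)"
      then obtain f where f: "\<And>n. f n \<in> cspan B" "f \<longlonglongrightarrow> x"
        by (auto simp: closure_sequential)
      have "(\<lambda>n. c *\<^sub>C f n) \<longlonglongrightarrow> c *\<^sub>C x"
        by (rule bounded_linear.tendsto[OF bounded_linear_scaleC f(2)])
      moreover have "\<forall>n. c *\<^sub>C f n \<in> cspan B" using f cspan_scaleC by blast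
      ultimately show "c *\<^sub>C x \<in> closure (cspan B)"
        unfolding closure_sequential by (intro exI[of _ "\<lambda>n. c *\<^sub>C f n"]) blast
    qed simp
    then obtain u where u: "norm u = 1" and uB: "\<forall>s\<in>closure (cspan B). cinner u s = 0"
      by blast
    have u0: "cinner u e = 0" if "e \<in> B" for e
    proof -
      have "e \<in> closure (cspan B)" using cspan_base[OF that] closure_subset by (rule rev_subsetD)
      with uB show ?thesis ..
    qed
    have u': "cinner e u = 0" if "e \<in> B" for e
      using cinner_commute[of e u] u0[OF that] by simp
    have "orthonormal (insert u B)"
      using B u u0 u' unfolding orthonormal_def by simp
    from max[OF this] have "u \<in> B" by (metis insertI1 subset_insertI)
    from u0[OF this] show False using u by (simp add: cinner_self)
  qed
  with B show ?thesis unfolding is_onb_def by blast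
qed


section \<open>Hilbert-Schmidt operators\<close>

text \<open>The space of Hilbert-Schmidt operators on \<open>H\<close> is the Hilbert space tensor product of
  \<open>H\<close> with its conjugate space; the elementary tensor of \<open>u\<close> and (the conjugate of) \<open>v\<close> is the
  rank one operator \<open>w \<mapsto> \<langle>w, v\<rangle> u\<close>.  Neither the class nor the inner product
  depends on the orthonormal basis used.\<close>

definition some_onb :: "'a::complex_hilbert_space set" where
  "some_onb = (SOME B. is_onb B)"

definition hilbert_schmidt :: "('a::complex_hilbert_space \<Rightarrow> 'a) \<Rightarrow> bool" where
  "hilbert_schmidt K \<longleftrightarrow>
     bounded_clinear K \<and> (\<lambda>e. (norm (K e))\<^sup>2) summable_on some_onb"

lemma some_onb: "is_onb some_onb"
  unfolding some_onb_def by (rule someI_ex[OF is_onb_exists])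

lemma bounded_clinear_zero: "bounded_clinear (\<lambda>_. 0)"
  by (simp add: bounded_clinear_def)

lemma bounded_clinear_add:
  "bounded_clinear S \<Longrightarrow> bounded_clinear T \<Longrightarrow> bounded_clinear (\<lambda>v. S v + T v)"
  by (simp add: bounded_clinear_def bounded_linear_add scaleC_add_right)

lemma bounded_clinear_scaleC:
  assumes "bounded_clinear T" shows "bounded_clinear (\<lambda>v. c *\<^sub>C T v)"
proof -
  have "bounded_linear (\<lambda>v. c *\<^sub>C T v)"
    using assms bounded_linear_compose[OF bounded_linear_scaleC, of T]
    by (simp add: bounded_clinear_def)
  then show ?thesis
    using assms by (simp add: bounded_clinear_def scaleC_scaleC mult.commute)
qed

lemma hs_summable_iff:
  "(\<lambda>e. (norm (K e))\<^sup>2) summable_on (B::'a::complex_hilbert_space set) \<longleftrightarrow>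
   (\<exists>C. \<forall>F. finite F \<and> F \<subseteq> B \<longrightarrow> L2_set (\<lambda>e. norm (K e)) F \<le> C)" (is "?l \<longleftrightarrow> ?r")
proof
  assume ?l
  then have "L2_set (\<lambda>e. norm (K e)) F \<le> sqrt (\<Sum>\<^sub>\<infinity>e\<in>B. (norm (K e))\<^sup>2)"
    if "finite F" "F \<subseteq> B" for F
    using that unfolding L2_set_def by (auto intro!: finite_sum_le_infsum)
  then show ?r by blast
next
  assume ?r
  then obtain C where C: "\<And>F. finite F \<Longrightarrow> F \<subseteq> B \<Longrightarrow> L2_set (\<lambda>e. norm (K e)) F \<le> C" by blast
  have "sum (\<lambda>e. (norm (K e))\<^sup>2) F \<le> C\<^sup>2" if "finite F" "F \<subseteq> B" for F
  proof -
    have "(L2_set (\<lambda>e. norm (K e)) F)\<^sup>2 \<le> C\<^sup>2" by (intro power_mono C that) simp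
    then show ?thesis by (simp add: L2_set_def sum_nonneg)
  qed
  then have "bdd_above (sum (\<lambda>e. (norm (K e))\<^sup>2) ` {F. F \<subseteq> B \<and> finite F})"
    by (intro bdd_aboveI[of _ "C\<^sup>2"]) auto
  then show ?l by (rule nonneg_bdd_above_summable_on[rotated]) simp
qed

lemma hs_norm_le_iff:
  assumes "(\<lambda>e. (norm (K e))\<^sup>2) summable_on (B::'a::complex_hilbert_space set)"
  shows "sqrt (\<Sum>\<^sub>\<infinity>e\<in>B. (norm (K e))\<^sup>2) \<le> C \<longleftrightarrow>
   (\<forall>F. finite F \<and> F \<subseteq> B \<longrightarrow> L2_set (\<lambda>e. norm (K e)) F \<le> C)" (is "?l \<longleftrightarrow> ?r")
proof
  assume ?l
  moreover have "L2_set (\<lambda>e. norm (K e)) F \<le> sqrt (\<Sum>\<^sub>\<infinity>e\<in>B. (norm (K e))\<^sup>2)"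
    if "finite F" "F \<subseteq> B" for F
    using that assms unfolding L2_set_def by (auto intro!: finite_sum_le_infsum)
  ultimately show ?r by (meson order_trans)
next
  assume r: ?r
  then have C0: "C \<ge> 0" by (metis L2_set_empty empty_subsetI finite.emptyI)
  have "(\<Sum>\<^sub>\<infinity>e\<in>B. (norm (K e))\<^sup>2) \<le> C\<^sup>2"
  proof (rule infsum_le_finite_sums[OF assms])
    fix F assume "finite F" "F \<subseteq> B"
    then have "(L2_set (\<lambda>e. norm (K e)) F)\<^sup>2 \<le> C\<^sup>2" using r by (intro power_mono) auto
    then show "(\<Sum>e\<in>F. (norm (K e))\<^sup>2) \<le> C\<^sup>2" by (simp add: L2_set_def sum_nonneg)
  qed
  then show ?l using C0 by (simp add: real_le_lsqrt)
qed

lemma hilbert_schmidt_zero: "hilbert_schmidt (\<lambda>_. 0)"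
  by (simp add: hilbert_schmidt_def bounded_clinear_zero)

lemma hilbert_schmidt_add:
  assumes "hilbert_schmidt S" "hilbert_schmidt T"
  shows "hilbert_schmidt (\<lambda>v. S v + T v)"
proof -
  obtain C where C: "\<forall>F. finite F \<and> F \<subseteq> some_onb \<longrightarrow> L2_set (\<lambda>e. norm (S e)) F \<le> C"
    using assms(1) unfolding hilbert_schmidt_def hs_summable_iff by (elim conjE exE) rule
  obtain D where D: "\<forall>F. finite F \<and> F \<subseteq> some_onb \<longrightarrow> L2_set (\<lambda>e. norm (T e)) F \<le> D"
    using assms(2) unfolding hilbert_schmidt_def hs_summable_iff by (elim conjE exE) rule
  have "L2_set (\<lambda>e. norm (S e + T e)) F \<le> C + D" if "finite F" "F \<subseteq> some_onb" for F
  proof -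
    have "L2_set (\<lambda>e. norm (S e + T e)) F \<le> L2_set (\<lambda>e. norm (S e) + norm (T e)) F"
      by (intro L2_set_mono norm_triangle_ineq) auto
    also have "\<dots> \<le> L2_set (\<lambda>e. norm (S e)) F + L2_set (\<lambda>e. norm (T e)) F"
      by (rule L2_set_triangle_ineq)
    also have "\<dots> \<le> C + D" using C D that by (intro add_mono) simp_all
    finally show ?thesis .
  qed
  then have "(\<lambda>e. (norm (S e + T e))\<^sup>2) summable_on some_onb"
    unfolding hs_summable_iff by (intro exI[of _ "C + D"]) simp
  then show ?thesis
    using assms bounded_clinear_add[of S T] by (simp add: hilbert_schmidt_def)
qed

lemma hilbert_schmidt_scaleC:
  assumes "hilbert_schmidt T" shows "hilbert_schmidt (\<lambda>v. c *\<^sub>C T v)"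
  unfolding hilbert_schmidt_def
proof
  show "bounded_clinear (\<lambda>v. c *\<^sub>C T v)"
    using assms by (intro bounded_clinear_scaleC) (simp add: hilbert_schmidt_def)
  have "(\<lambda>e. (cmod c)\<^sup>2 * (norm (T e))\<^sup>2) summable_on some_onb"
    using assms by (intro summable_on_cmult_right) (simp add: hilbert_schmidt_def)
  then show "(\<lambda>e. (norm (c *\<^sub>C T e))\<^sup>2) summable_on some_onb"
    by (simp add: norm_scaleC power_mult_distrib)
qed

lemma hs_cinner_summable:
  assumes "hilbert_schmidt S" "hilbert_schmidt T"
  shows "(\<lambda>e. cinner (S e) (T e)) summable_on some_onb"
proof -
  have le: "cmod (cinner x y) \<le> (norm x)\<^sup>2 + (norm y)\<^sup>2" for x y :: 'a
  proof (cases "cinner x y = 0")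
    case False
    define a where "a = cnj (cinner x y) / of_real (cmod (cinner x y))"
    have a1: "cmod a = 1" using False by (simp add: a_def norm_divide)
    have "a * cinner x y = (cinner x y * cnj (cinner x y)) / of_real (cmod (cinner x y))"
      by (simp add: a_def)
    also have "\<dots> = of_real (cmod (cinner x y))"
      unfolding complex_norm_square[symmetric] using False by (simp add: power2_eq_square)
    finally have "cinner (a *\<^sub>C x) y = of_real (cmod (cinner x y))"
      by (simp add: cinner_scaleC_left)
    then have "(norm (a *\<^sub>C x - y))\<^sup>2 = (norm x)\<^sup>2 - 2 * cmod (cinner x y) + (norm y)\<^sup>2"
      by (simp add: norm2_diff norm_scaleC a1)
    with zero_le_power2[of "norm (a *\<^sub>C x - y)"]
    have "0 \<le> (norm x)\<^sup>2 - 2 * cmod (cinner x y) + (norm y)\<^sup>2"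
      by simp
    then show ?thesis using norm_ge_zero[of "cinner x y"] by linarith
  qed simp
  have "(\<lambda>e. (norm (S e))\<^sup>2 + (norm (T e))\<^sup>2) summable_on some_onb"
    using assms unfolding hilbert_schmidt_def by (intro summable_on_add) auto
  then have "(\<lambda>e. norm (cinner (S e) (T e))) summable_on some_onb"
    by (rule summable_on_comparison_test) (use le in simp_all)
  then show ?thesis by (rule abs_summable_summable)
qed

lemma norm_le_hs:
  fixes K :: "'a::complex_hilbert_space \<Rightarrow> 'a"
  assumes K: "bounded_clinear K" and on: "is_onb B"
    and C: "\<And>F. finite F \<Longrightarrow> F \<subseteq> B \<Longrightarrow> L2_set (\<lambda>e. norm (K e)) F \<le> C"
  shows "norm (K x) \<le> C * norm x"
proof -
  have lin: "bounded_linear K" using K by (simp add: bounded_clinear_def)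
  have span: "norm (K x) \<le> C * norm x" if xs: "x \<in> cspan B" for x
  proof -
    obtain F c where F: "finite F" "F \<subseteq> B" and x: "x = (\<Sum>e\<in>F. c e *\<^sub>C e)"
      using xs unfolding cspan_def by blast
    have ortho: "orthonormal B" using on unfolding is_onb_def by simp
    have orth: "cinner e f = (if e = f then 1 else 0)" if "e \<in> F" "f \<in> F" for e f
    proof (cases "e = f")
      case True
      have "norm f = 1" using ortho that(2) F(2) unfolding orthonormal_def by (elim conjE) auto
      then show ?thesis using True by (simp add: cinner_self)
    next
      case False
      then have "cinner e f = 0"
        using ortho that F(2) unfolding orthonormal_def by (elim conjE) auto
      then show ?thesis using False by simp
    qed
    have "cinner e x = cnj (c e)" if e: "e \<in> F" for e
    proof -
      have "cinner x e = (\<Sum>f\<in>F. if f = e then c f else 0)"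
        unfolding x cinner_sum_left cinner_scaleC_left using orth e by (intro sum.cong) auto
      then have "cinner x e = c e" using F e by simp
      then show ?thesis using cinner_commute[of e x] by simp
    qed
    then have "(\<Sum>e\<in>F. c e * cinner e x) = (\<Sum>e\<in>F. c e * cnj (c e))" by simp
    moreover have xy: "cinner x y = (\<Sum>e\<in>F. c e * cinner e y)" for y
      unfolding x cinner_sum_left cinner_scaleC_left ..
    ultimately have "cinner x x = (\<Sum>e\<in>F. c e * cnj (c e))" using xy[of x] by simp
    also have "\<dots> = of_real (\<Sum>e\<in>F. (cmod (c e))\<^sup>2)"
      by (simp only: of_real_sum complex_norm_square)
    finally have "(norm x)\<^sup>2 = (\<Sum>e\<in>F. (cmod (c e))\<^sup>2)"
      by (simp only: cinner_self of_real_eq_iff)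
    then have nx: "L2_set (\<lambda>e. cmod (c e)) F = norm x"
      unfolding L2_set_def by (intro real_sqrt_unique) simp_all
    have "K x = (\<Sum>e\<in>F. c e *\<^sub>C K e)"
      unfolding x linear_sum[OF bounded_linear.linear[OF lin]]
      using K unfolding bounded_clinear_def by (intro sum.cong) simp_all
    then have "norm (K x) \<le> (\<Sum>e\<in>F. norm (c e *\<^sub>C K e))"
      by (simp only: norm_sum)
    also have "\<dots> = (\<Sum>e\<in>F. \<bar>cmod (c e)\<bar> * \<bar>norm (K e)\<bar>)"
      by (simp add: norm_scaleC)
    also have "\<dots> \<le> L2_set (\<lambda>e. cmod (c e)) F * L2_set (\<lambda>e. norm (K e)) F"
      by (rule L2_set_mult_ineq)
    also have "\<dots> \<le> norm x * C" unfolding nx by (intro mult_left_mono C F) simp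
    finally show ?thesis by (simp add: mult.commute)
  qed
  have "x \<in> closure (cspan B)" using on by (simp add: is_onb_def)
  then obtain f where f: "\<And>n. f n \<in> cspan B" "f \<longlonglongrightarrow> x" by (auto simp: closure_sequential)
  have "(\<lambda>n. norm (K (f n))) \<longlonglongrightarrow> norm (K x)"
    by (intro tendsto_norm bounded_linear.tendsto[OF lin] f)
  moreover have "(\<lambda>n. C * norm (f n)) \<longlonglongrightarrow> C * norm x"
    by (intro tendsto_intros f)
  ultimately show ?thesis
    by (rule LIMSEQ_le) (intro exI[of _ 0] allI impI span f)
qed

typedef (overloaded) 'a hs = "{K :: 'a::complex_hilbert_space \<Rightarrow> 'a. hilbert_schmidt K}"
  morphisms hs_op Hs
  using hilbert_schmidt_zero by blast

setup_lifting type_definition_hs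

lift_definition hs_scaleC :: "complex \<Rightarrow> 'a::complex_hilbert_space hs \<Rightarrow> 'a hs" is "\<lambda>c T v. c *\<^sub>C T v"
  by (rule hilbert_schmidt_scaleC)

instantiation hs :: (complex_hilbert_space) real_normed_vector
begin

lift_definition zero_hs :: "'a hs" is "\<lambda>_. 0" by (rule hilbert_schmidt_zero)

lift_definition plus_hs :: "'a hs \<Rightarrow> 'a hs \<Rightarrow> 'a hs" is "\<lambda>S T v. S v + T v"
  by (rule hilbert_schmidt_add)

lift_definition norm_hs :: "'a hs \<Rightarrow> real" is
  "\<lambda>T. sqrt (\<Sum>\<^sub>\<infinity>e\<in>some_onb. (norm (T e))\<^sup>2)" .

definition scaleR_hs :: "real \<Rightarrow> 'a hs \<Rightarrow> 'a hs" where
  "scaleR_hs r T = hs_scaleC (of_real r) T"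

definition uminus_hs :: "'a hs \<Rightarrow> 'a hs" where "uminus_hs T = hs_scaleC (- 1) T"

definition minus_hs :: "'a hs \<Rightarrow> 'a hs \<Rightarrow> 'a hs" where "minus_hs S T = S + hs_scaleC (- 1) T"

definition dist_hs :: "'a hs \<Rightarrow> 'a hs \<Rightarrow> real" where "dist_hs S T = norm (S - T)"

definition sgn_hs :: "'a hs \<Rightarrow> 'a hs" where "sgn_hs T = scaleR (inverse (norm T)) T"

definition uniformity_hs :: "('a hs \<times> 'a hs) filter" where
  "uniformity_hs = (INF e\<in>{0 <..}. principal {(x :: 'a hs, y). dist x y < e})"

definition open_hs :: "'a hs set \<Rightarrow> bool" where
  "open_hs S \<longleftrightarrow> (\<forall>x\<in>S. \<forall>\<^sub>F (x', y) in uniformity. x' = x \<longrightarrow> y \<in> S)"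

lemma hs_norm_le_iff':
  "norm (T :: 'a::complex_hilbert_space hs) \<le> C \<longleftrightarrow>
   (\<forall>F. finite F \<and> F \<subseteq> some_onb \<longrightarrow> L2_set (\<lambda>e. norm (hs_op T e)) F \<le> C)"
  using hs_norm_le_iff hs_op[of T] unfolding norm_hs.rep_eq hilbert_schmidt_def by blast

lemma hs_op_bound: "norm (hs_op (T :: 'a::complex_hilbert_space hs) x) \<le> norm T * norm x"
  by (rule norm_le_hs[OF _ some_onb])
    (use hs_op[of T] hs_norm_le_iff'[of T "norm T"] in \<open>auto simp: hilbert_schmidt_def\<close>)

lemma hs_op_minus: "hs_op (S - T :: 'a::complex_hilbert_space hs) v = hs_op S v - hs_op T v"
  using scaleC_of_real[of "-1" "hs_op T v"]
  by (simp add: minus_hs_def plus_hs.rep_eq hs_scaleC.rep_eq)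

instance
proof
  fix S T U :: "'a hs" and r s :: real
  show "S + T + U = S + (T + U)" "S + T = T + S" "0 + S = S"
    by (transfer; simp add: add_ac)+
  show "- S + S = 0" unfolding uminus_hs_def
    by transfer (metis (no_types) add.commute add.right_inverse scaleC_add_left scaleC_one scaleC_zero_left)
  show "S - T = S + - T" by (simp add: uminus_hs_def minus_hs_def)
  have scd: "hs_scaleC c (S + T) = hs_scaleC c S + hs_scaleC c T" for c and S T :: "'a hs"
    by transfer (simp add: scaleC_add_right)
  have sca: "hs_scaleC (c + d) S = hs_scaleC c S + hs_scaleC d S" for c d and S :: "'a hs"
    by transfer (simp add: scaleC_add_left)
  have scm: "hs_scaleC c (hs_scaleC d S) = hs_scaleC (c * d) S" for c d and S :: "'a hs"
    by transfer (simp add: scaleC_scaleC)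
  show "r *\<^sub>R (S + T) = r *\<^sub>R S + r *\<^sub>R T" by (simp only: scaleR_hs_def of_real_add of_real_mult scd)
  show "(r + s) *\<^sub>R S = r *\<^sub>R S + s *\<^sub>R S" by (simp only: scaleR_hs_def of_real_add of_real_mult sca)
  show "r *\<^sub>R s *\<^sub>R S = (r * s) *\<^sub>R S" by (simp only: scaleR_hs_def of_real_add of_real_mult scm)
  show "1 *\<^sub>R S = S" unfolding scaleR_hs_def by transfer simp
  show "dist S T = norm (S - T)" by (rule dist_hs_def)
  show "sgn S = scaleR (inverse (norm S)) S" by (rule sgn_hs_def)
  show "uniformity = (INF e\<in>{0 <..}. principal {(x, y :: 'a hs). dist x y < e})"
    by (rule uniformity_hs_def)
  show "open A = (\<forall>x\<in>A. \<forall>\<^sub>F (x', y) in uniformity. x' = x \<longrightarrow> y \<in> A)" for A :: "'a hs set"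
    by (rule open_hs_def)
  show "norm (r *\<^sub>R S) = \<bar>r\<bar> * norm S"
    unfolding scaleR_hs_def
    by transfer (simp add: norm_scaleC power_mult_distrib infsum_cmult_right' real_sqrt_mult)
  show "norm S = 0 \<longleftrightarrow> S = 0"
  proof
    assume "norm S = 0"
    then have "hs_op S x = 0" for x using hs_op_bound[of S x] by simp
    then show "S = 0" by transfer auto
  next
    assume "S = 0" then show "norm S = 0" by simp (transfer, simp)
  qed
  show "norm (S + T) \<le> norm S + norm T"
    unfolding hs_norm_le_iff'
  proof (intro allI impI)
    fix F assume F: "finite F \<and> F \<subseteq> (some_onb :: 'a set)"
    have "L2_set (\<lambda>e. norm (hs_op (S + T) e)) F
        \<le> L2_set (\<lambda>e. norm (hs_op S e) + norm (hs_op T e)) F"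
      by (intro L2_set_mono) (auto simp: plus_hs.rep_eq norm_triangle_ineq)
    also have "\<dots> \<le> L2_set (\<lambda>e. norm (hs_op S e)) F + L2_set (\<lambda>e. norm (hs_op T e)) F"
      by (rule L2_set_triangle_ineq)
    also have "\<dots> \<le> norm S + norm T"
      using F hs_norm_le_iff'[of S "norm S"] hs_norm_le_iff'[of T "norm T"]
      by (intro add_mono) auto
    finally show "L2_set (\<lambda>e. norm (hs_op (S + T) e)) F \<le> norm S + norm T" .
  qed
qed

end

lemma hs_complete:
  fixes X :: "nat \<Rightarrow> 'a::complex_hilbert_space hs"
  assumes cauchy: "\<And>e. e > 0 \<Longrightarrow> \<exists>N. \<forall>m\<ge>N. \<forall>n\<ge>N. norm (X m - X n) < e"
  shows "\<exists>L. \<forall>e>0. \<exists>N. \<forall>n\<ge>N. norm (X n - L) < e"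
proof -
  have pt: "Cauchy (\<lambda>n. hs_op (X n) v)" for v
  proof (rule CauchyI)
    fix e :: real assume "0 < e"
    then have "0 < e / (norm v + 1)" by (simp add: add_nonneg_pos)
    from cauchy[OF this] obtain N
      where N: "\<forall>m\<ge>N. \<forall>n\<ge>N. norm (X m - X n) < e / (norm v + 1)" ..
    have "norm (hs_op (X m) v - hs_op (X n) v) < e" if "m \<ge> N" "n \<ge> N" for m n
    proof -
      have v1: "norm v + 1 > 0" by (simp add: add_nonneg_pos)
      have "norm (hs_op (X m) v - hs_op (X n) v) \<le> norm (X m - X n) * norm v"
        using hs_op_bound[of "X m - X n" v] by (simp add: hs_op_minus)
      also have "\<dots> \<le> (e / (norm v + 1)) * norm v"
        using N that by (intro mult_right_mono) (auto intro: less_imp_le)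
      also have "\<dots> < (e / (norm v + 1)) * (norm v + 1)"
        using \<open>0 < e\<close> v1 by (intro mult_strict_left_mono) auto
      also have "\<dots> = e" using v1 by simp
      finally show ?thesis .
    qed
    then show "\<exists>M. \<forall>m\<ge>M. \<forall>n\<ge>M. norm (hs_op (X m) v - hs_op (X n) v) < e" by blast
  qed
  define L where "L v = lim (\<lambda>n. hs_op (X n) v)" for v
  have L: "(\<lambda>n. hs_op (X n) v) \<longlonglongrightarrow> L v" for v
    using pt[of v] unfolding L_def by (simp add: Cauchy_convergent_iff convergent_LIMSEQ_iff)
  have clin: "bounded_clinear (hs_op (X n))" for n
    using hs_op[of "X n"] by (simp add: hilbert_schmidt_def)
  have Ladd: "L (u + v) = L u + L v" for u v
  proof (rule LIMSEQ_unique[OF L])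
    have "hs_op (X n) (u + v) = hs_op (X n) u + hs_op (X n) v" for n
      using clin[of n] by (simp add: bounded_clinear_def linear_simps)
    then show "(\<lambda>n. hs_op (X n) (u + v)) \<longlonglongrightarrow> L u + L v"
      by (simp add: tendsto_add L)
  qed
  have LscC: "L (c *\<^sub>C v) = c *\<^sub>C L v" for c v
  proof (rule LIMSEQ_unique[OF L])
    have "hs_op (X n) (c *\<^sub>C v) = c *\<^sub>C hs_op (X n) v" for n
      using clin[of n] by (simp add: bounded_clinear_def)
    then show "(\<lambda>n. hs_op (X n) (c *\<^sub>C v)) \<longlonglongrightarrow> c *\<^sub>C L v"
      by (simp add: bounded_linear.tendsto[OF bounded_linear_scaleC L])
  qed
  have tail: "L2_set (\<lambda>x. norm (hs_op (X n) x - L x)) F \<le> e"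
    if N: "\<forall>m\<ge>N. \<forall>n\<ge>N. norm (X m - X n) < e" and "n \<ge> N" and F: "finite F" "F \<subseteq> some_onb"
    for N e n F
  proof (rule LIMSEQ_le_const2)
    show "(\<lambda>m. L2_set (\<lambda>x. norm (hs_op (X n) x - hs_op (X m) x)) F)
        \<longlonglongrightarrow> L2_set (\<lambda>x. norm (hs_op (X n) x - L x)) F"
      unfolding L2_set_def by (intro tendsto_intros L)
    have "L2_set (\<lambda>x. norm (hs_op (X n) x - hs_op (X m) x)) F \<le> e" if "m \<ge> N" for m
      using hs_norm_le_iff'[of "X n - X m" e] N that \<open>n \<ge> N\<close> F
      by (simp add: hs_op_minus less_imp_le)
    then show "\<exists>M. \<forall>m\<ge>M. L2_set (\<lambda>x. norm (hs_op (X n) x - hs_op (X m) x)) F \<le> e" by blast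
  qed
  obtain N1 where N1: "\<forall>m\<ge>N1. \<forall>n\<ge>N1. norm (X m - X n) < 1" using cauchy[of 1] by auto
  define D where "D = norm (X N1) + 1"
  have LF: "L2_set (\<lambda>x. norm (L x)) F \<le> D" if F: "finite F" "F \<subseteq> some_onb" for F
  proof -
    have "L2_set (\<lambda>x. norm (L x)) F
        \<le> L2_set (\<lambda>x. norm (hs_op (X N1) x) + norm (hs_op (X N1) x - L x)) F"
      by (intro L2_set_mono) (auto, metis norm_triangle_sub norm_minus_commute)
    also have "\<dots> \<le> L2_set (\<lambda>x. norm (hs_op (X N1) x)) F
        + L2_set (\<lambda>x. norm (hs_op (X N1) x - L x)) F"
      by (rule L2_set_triangle_ineq)
    also have "\<dots> \<le> D"
      unfolding D_def using tail[OF N1 _ F, of N1] hs_norm_le_iff'[of "X N1" "norm (X N1)"] F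
      by (intro add_mono) auto
    finally show ?thesis .
  qed
  have bound: "norm (L v) \<le> norm v * D" for v
  proof (rule LIMSEQ_le_const2)
    show "(\<lambda>n. norm (hs_op (X n) v)) \<longlonglongrightarrow> norm (L v)" by (intro tendsto_norm L)
    have "norm (hs_op (X n) v) \<le> norm v * D" if "n \<ge> N1" for n
    proof -
      have "norm (hs_op (X n - X N1) v) \<le> norm (X n - X N1) * norm v" by (rule hs_op_bound)
      also have "\<dots> \<le> 1 * norm v" using N1 that by (intro mult_right_mono) (auto intro: less_imp_le)
      finally have "norm (hs_op (X n) v - hs_op (X N1) v) \<le> norm v" by (simp add: hs_op_minus)
      moreover have "norm (hs_op (X N1) v) \<le> norm (X N1) * norm v" by (rule hs_op_bound)
      ultimately show ?thesis
        using norm_triangle_sub[of "hs_op (X n) v" "hs_op (X N1) v"]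
        by (simp add: D_def algebra_simps)
    qed
    then show "\<exists>N. \<forall>n\<ge>N. norm (hs_op (X n) v) \<le> norm v * D" by blast
  qed
  have LscR: "L (r *\<^sub>R v) = r *\<^sub>R L v" for r v
    using LscC[of "of_real r" v] by (simp add: scaleC_of_real)
  have "bounded_linear L"
    by (rule bounded_linear_intro[of L D]) (rule Ladd LscR bound)+
  then have "bounded_clinear L"
    using LscC by (simp add: bounded_clinear_def)
  then have hsL: "hilbert_schmidt L"
    unfolding hilbert_schmidt_def hs_summable_iff using LF by (intro conjI exI[of _ D]) simp_all
  have op: "hs_op (Hs L) = L" using hsL by (simp add: Hs_inverse)
  show ?thesis
  proof (intro exI[of _ "Hs L"] allI impI)
    fix e :: real assume "0 < e"
    then obtain N where N: "\<forall>m\<ge>N. \<forall>n\<ge>N. norm (X m - X n) < e / 2"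
      using cauchy[of "e / 2"] by auto
    have "norm (X n - Hs L) < e" if "n \<ge> N" for n
    proof -
      have "norm (X n - Hs L) \<le> e / 2"
        unfolding hs_norm_le_iff' using tail[OF N that] by (simp add: hs_op_minus op)
      also have "\<dots> < e" using \<open>0 < e\<close> by simp
      finally show ?thesis .
    qed
    then show "\<exists>N. \<forall>n\<ge>N. norm (X n - Hs L) < e" by blast
  qed
qed

instance hs :: (complex_hilbert_space) banach
proof
  show "convergent X" if "Cauchy X" for X :: "nat \<Rightarrow> 'a hs"
    using that hs_complete[of X]
    unfolding Cauchy_def convergent_def LIMSEQ_def dist_norm by blast
qed

instantiation hs :: (complex_hilbert_space) complex_hilbert_space
begin

definition scaleC_hs :: "complex \<Rightarrow> 'a hs \<Rightarrow> 'a hs" where "scaleC_hs = hs_scaleC"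

lift_definition cinner_hs :: "'a hs \<Rightarrow> 'a hs \<Rightarrow> complex" is
  "\<lambda>S T. \<Sum>\<^sub>\<infinity>e\<in>some_onb. cinner (S e) (T e)" .

instance
proof
  fix S T U :: "'a hs" and c d :: complex and r :: real
  show "c *\<^sub>C (S + T) = c *\<^sub>C S + c *\<^sub>C T"
    unfolding scaleC_hs_def by transfer (simp add: scaleC_add_right)
  show "(c + d) *\<^sub>C S = c *\<^sub>C S + d *\<^sub>C S"
    unfolding scaleC_hs_def by transfer (simp add: scaleC_add_left)
  show "c *\<^sub>C d *\<^sub>C S = (c * d) *\<^sub>C S"
    unfolding scaleC_hs_def by transfer (simp add: scaleC_scaleC)
  show "of_real r *\<^sub>C S = r *\<^sub>R S" by (simp add: scaleR_hs_def scaleC_hs_def)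
  show "cinner (S + T) U = cinner S U + cinner T U"
    by transfer (simp add: cinner_add_left infsum_add hs_cinner_summable)
  show "cinner (c *\<^sub>C S) T = c * cinner S T"
    unfolding scaleC_hs_def by transfer (simp add: cinner_scaleC_left infsum_cmult_right')
  show "cinner T S = cnj (cinner S T)"
    by transfer (simp only: infsum_cnj[symmetric] cinner_commute[symmetric])
  show "cinner S S = of_real ((norm S)\<^sup>2)"
  proof transfer
    fix S :: "'a \<Rightarrow> 'a" assume "hilbert_schmidt S"
    then have "(\<lambda>e. (norm (S e))\<^sup>2) summable_on some_onb"
      by (simp add: hilbert_schmidt_def)
    then have "(\<Sum>\<^sub>\<infinity>e\<in>some_onb. cinner (S e) (S e))
        = of_real (\<Sum>\<^sub>\<infinity>e\<in>some_onb. (norm (S e))\<^sup>2)"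
      unfolding cinner_self by (rule infsumI[OF has_sum_bounded_linear[OF bounded_linear_of_real has_sum_infsum]])
    also have "(\<Sum>\<^sub>\<infinity>e\<in>some_onb. (norm (S e))\<^sup>2)
        = (sqrt (\<Sum>\<^sub>\<infinity>e\<in>some_onb. (norm (S e))\<^sup>2))\<^sup>2"
      by (simp add: infsum_nonneg)
    finally show "(\<Sum>\<^sub>\<infinity>e\<in>some_onb. cinner (S e) (S e))
        = of_real ((sqrt (\<Sum>\<^sub>\<infinity>e\<in>some_onb. (norm (S e))\<^sup>2))\<^sup>2)" .
  qed
qed

end


section \<open>Tracial von Neumann algebras\<close>

definition commutant :: "('a::complex_hilbert_space \<Rightarrow> 'a) set \<Rightarrow> ('a \<Rightarrow> 'a) set" where
  "commutant M = {T. bounded_clinear T \<and> (\<forall>S\<in>M. T \<circ> S = S \<circ> T)}"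

definition von_neumann_algebra :: "('a::complex_hilbert_space \<Rightarrow> 'a) set \<Rightarrow> bool" where
  "von_neumann_algebra M \<longleftrightarrow>
     (\<forall>T\<in>M. bounded_clinear T \<and> cadjoint T \<in> M) \<and> commutant (commutant M) = M"

text \<open>Normal means ultraweakly (\<open>\<sigma>\<close>-weakly) continuous; the ultraweakly continuous linear
  functionals on \<open>M\<close> are exactly the following ones.\<close>

definition normal_functional ::
    "('a::complex_hilbert_space \<Rightarrow> 'a) set \<Rightarrow> (('a \<Rightarrow> 'a) \<Rightarrow> complex) \<Rightarrow> bool" where
  "normal_functional M \<phi> \<longleftrightarrow>
     (\<exists>u v. summable (\<lambda>k. (norm (u k))\<^sup>2) \<and> summable (\<lambda>k. (norm (v k))\<^sup>2) \<and>
            (\<forall>T\<in>M. (\<lambda>k::nat. cinner (T (u k)) (v k)) sums \<phi> T))"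

definition tracial_von_neumann_algebra ::
    "('a::complex_hilbert_space \<Rightarrow> 'a) set \<Rightarrow> (('a \<Rightarrow> 'a) \<Rightarrow> complex) \<Rightarrow> bool" where
  "tracial_von_neumann_algebra M \<phi> \<longleftrightarrow>
     von_neumann_algebra M \<and> normal_functional M \<phi> \<and> \<phi> id = 1 \<and>
     (\<forall>T\<in>M. \<phi> (cadjoint T \<circ> T) \<in> \<real>\<^sub>\<ge>\<^sub>0) \<and>
     (\<forall>T\<in>M. \<phi> (cadjoint T \<circ> T) = 0 \<longrightarrow> T = (\<lambda>_. 0)) \<and>
     (\<forall>S\<in>M. \<forall>T\<in>M. \<phi> (S \<circ> T) = \<phi> (T \<circ> S))"

text \<open>With \<open>M\<^sup>o\<^sup>p\<close> acting on the conjugate Hilbert space by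
  \<open>b\<^sup>o\<^sup>p (conj v) = conj (b\<^sup>* v)\<close>, the operator \<open>a \<otimes> b\<^sup>o\<^sup>p\<close> on the tensor product, that is on
  Hilbert-Schmidt operators, is \<open>K \<mapsto> a K b\<close>.  The von Neumann algebra tensor product of
  \<open>M\<close> and \<open>M\<^sup>o\<^sup>p\<close> is the von Neumann algebra generated by these operators, and the trace on it
  is the unique normal functional with value \<open>\<phi> a * \<phi> b\<close> at \<open>a \<otimes> b\<^sup>o\<^sup>p\<close>.\<close>

definition op_tensor ::
    "('a::complex_hilbert_space \<Rightarrow> 'a) \<Rightarrow> ('a \<Rightarrow> 'a) \<Rightarrow> 'a hs \<Rightarrow> 'a hs" where
  "op_tensor a b = (\<lambda>K. Hs (a \<circ> hs_op K \<circ> b))"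

definition tensor_op_algebra ::
    "('a::complex_hilbert_space \<Rightarrow> 'a) set \<Rightarrow> ('a hs \<Rightarrow> 'a hs) set" where
  "tensor_op_algebra M = commutant (commutant {op_tensor a b | a b. a \<in> M \<and> b \<in> M})"

definition tensor_op_trace ::
    "('a::complex_hilbert_space \<Rightarrow> 'a) set \<Rightarrow> (('a \<Rightarrow> 'a) \<Rightarrow> complex) \<Rightarrow> ('a hs \<Rightarrow> 'a hs) \<Rightarrow> complex"
  where
  "tensor_op_trace M \<phi> =
     (THE \<tau>. \<tau> \<in> extensional (tensor_op_algebra M) \<and> normal_functional (tensor_op_algebra M) \<tau> \<and>
        (\<forall>a\<in>M. \<forall>b\<in>M. \<tau> (op_tensor a b) = \<phi> a * \<phi> b))"


section \<open>Spectral projections, nullity and rank\<close>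

text \<open>\<open>E\<close> is the resolution of the identity of the self-adjoint operator \<open>A\<close>: a projection
  valued Borel measure on the real line with \<open>A = \<integral> t dE(t)\<close> (in the weak sense).\<close>

definition spectral_measure ::
    "('a::complex_hilbert_space \<Rightarrow> 'a) \<Rightarrow> (real set \<Rightarrow> 'a \<Rightarrow> 'a) \<Rightarrow> bool" where
  "spectral_measure A E \<longleftrightarrow>
     (\<forall>B\<in>sets borel. bounded_clinear (E B) \<and> cadjoint (E B) = E B \<and> E B \<circ> E B = E B) \<and>
     E UNIV = id \<and>
     (\<forall>B v. range B \<subseteq> sets borel \<and> disjoint_family B \<longrightarrow>
        (\<lambda>k::nat. E (B k) v) sums E (\<Union>k. B k) v) \<and>
     (\<forall>v. has_bochner_integral
        (measure_of UNIV (sets borel) (\<lambda>B. ennreal (Re (cinner (E B v) v))))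
        complex_of_real (cinner (A v) v))"

definition spectral_projection ::
    "('a::complex_hilbert_space \<Rightarrow> 'a) \<Rightarrow> real set \<Rightarrow> 'a \<Rightarrow> 'a" where
  "spectral_projection A B = (THE P. \<exists>E. spectral_measure A E \<and> P = E B)"

text \<open>A matrix of operators on \<open>'a\<close> is identified with an operator between direct sums of
  copies of \<open>'a\<close>; \<open>amplified_trace \<tau>\<close> is the tensor product of the normalized matrix trace
  with \<open>\<tau>\<close>.\<close>

definition matrix_entry ::
    "('a::complex_hilbert_space^'j \<Rightarrow> 'a^'i) \<Rightarrow> 'i \<Rightarrow> 'j \<Rightarrow> 'a \<Rightarrow> 'a" where
  "matrix_entry T i j = (\<lambda>v. T (axis j v) $ i)"

definition amplified_trace ::
    "(('a::complex_hilbert_space \<Rightarrow> 'a) \<Rightarrow> complex) \<Rightarrow> ('a^'j \<Rightarrow> 'a^'j) \<Rightarrow> complex" where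
  "amplified_trace \<tau> P = (\<Sum>j\<in>UNIV. \<tau> (matrix_entry P j j)) / of_nat CARD('j)"

definition Nullity ::
    "(('a::complex_hilbert_space \<Rightarrow> 'a) \<Rightarrow> complex) \<Rightarrow> ('a^'j \<Rightarrow> 'a^'i) \<Rightarrow> real" where
  "Nullity \<tau> T =
     real CARD('j) * Re (amplified_trace \<tau> (spectral_projection (cadjoint T \<circ> T) {0}))"

definition Rank ::
    "(('a::complex_hilbert_space \<Rightarrow> 'a) \<Rightarrow> complex) \<Rightarrow> ('a^'j \<Rightarrow> 'a^'i) \<Rightarrow> real" where
  "Rank \<tau> T =
     real CARD('j) * Re (amplified_trace \<tau> (spectral_projection (cadjoint T \<circ> T) {0<..}))"


section \<open>Noncommutative star-polynomials and their derivatives\<close>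

text \<open>The letter \<open>(i, False)\<close> is \<open>X\<^sub>i\<close> and \<open>(i, True)\<close> is \<open>X\<^sub>i\<^sup>*\<close>.  The universal unital
  \<open>*\<close>-algebra has the \<open>*\<close>-monomials as a linear basis, and its algebraic tensor product with its
  opposite has the pairs \<open>u \<otimes> v\<^sup>o\<^sup>p\<close> of \<open>*\<close>-monomials as a linear basis.\<close>

type_synonym 'n star_word = "('n \<times> bool) list"
type_synonym 'n star_poly = "'n star_word \<Rightarrow>\<^sub>0 complex"
type_synonym 'n star_poly_tensor = "('n star_word \<times> 'n star_word) \<Rightarrow>\<^sub>0 complex"

definition pm_scale :: "complex \<Rightarrow> ('w \<Rightarrow>\<^sub>0 complex) \<Rightarrow> ('w \<Rightarrow>\<^sub>0 complex)" where
  "pm_scale c f = Poly_Mapping.map ((*) c) f"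

definition word_star :: "'n star_word \<Rightarrow> 'n star_word" where
  "word_star w = rev (map (\<lambda>(i, s). (i, \<not> s)) w)"

definition poly_star :: "'n star_poly \<Rightarrow> 'n star_poly" where
  "poly_star f =
     (\<Sum>w\<in>Poly_Mapping.keys f. Poly_Mapping.single (word_star w) (cnj (Poly_Mapping.lookup f w)))"

text \<open>\<open>f\<^sub>(\<^sub>1\<^sub>)\<close> for \<open>False\<close>, \<open>f\<^sub>(\<^sub>2\<^sub>)\<close> for \<open>True\<close>.\<close>

definition poly_part :: "bool \<Rightarrow> 'n star_poly \<Rightarrow> 'n star_poly" where
  "poly_part r f = pm_scale (1 / 2) (if r then f - poly_star f else f + poly_star f)"

text \<open>\<open>\<partial>\<^sub>s\<^sub>a\<^sub>,\<^sub>j\<close> for \<open>False\<close>, \<open>\<partial>\<^sub>s\<^sub>k\<^sub>,\<^sub>j\<close> for \<open>True\<close>.\<close>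

definition word_deriv :: "bool \<Rightarrow> 'n \<Rightarrow> 'n star_word \<Rightarrow> 'n star_poly_tensor" where
  "word_deriv sk j w =
     (\<Sum>l | l < length w \<and> fst (w ! l) = j.
        Poly_Mapping.single (take l w, drop (Suc l) w) (if sk \<and> snd (w ! l) then - 1 else 1))"

definition poly_deriv :: "bool \<Rightarrow> 'n \<Rightarrow> 'n star_poly \<Rightarrow> 'n star_poly_tensor" where
  "poly_deriv sk j f =
     (\<Sum>w\<in>Poly_Mapping.keys f. pm_scale (Poly_Mapping.lookup f w) (word_deriv sk j w))"

definition word_op :: "('n \<Rightarrow> 'a::complex_hilbert_space \<Rightarrow> 'a) \<Rightarrow> 'n star_word \<Rightarrow> 'a \<Rightarrow> 'a" where
  "word_op X w = foldr (\<lambda>(i, s) T. (if s then cadjoint (X i) else X i) \<circ> T) w id"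

definition poly_op :: "('n \<Rightarrow> 'a::complex_hilbert_space \<Rightarrow> 'a) \<Rightarrow> 'n star_poly \<Rightarrow> 'a \<Rightarrow> 'a" where
  "poly_op X f = (\<lambda>v. \<Sum>w\<in>Poly_Mapping.keys f. Poly_Mapping.lookup f w *\<^sub>C word_op X w v)"

definition tensor_op ::
    "('n \<Rightarrow> 'a::complex_hilbert_space \<Rightarrow> 'a) \<Rightarrow> 'n star_poly_tensor \<Rightarrow> 'a hs \<Rightarrow> 'a hs" where
  "tensor_op X g = (\<lambda>K. \<Sum>(u, v)\<in>Poly_Mapping.keys g.
     Poly_Mapping.lookup g (u, v) *\<^sub>C op_tensor (word_op X u) (word_op X v) K)"

text \<open>The row index \<open>(i, r)\<close> stands for the part \<open>r\<close> of \<open>f\<^sub>i\<close>, the column index \<open>(j, s)\<close> for the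
  derivation of kind \<open>s\<close> with respect to \<open>X\<^sub>j\<close>.\<close>

definition Ds ::
    "('p::finite \<Rightarrow> 'n::finite star_poly) \<Rightarrow> ('n \<Rightarrow> 'a::complex_hilbert_space \<Rightarrow> 'a) \<Rightarrow>
     'a hs ^ ('n \<times> bool) \<Rightarrow> 'a hs ^ ('p \<times> bool)" where
  "Ds F X = (\<lambda>v. \<chi> ir. \<Sum>js\<in>UNIV.
     tensor_op X (poly_deriv (snd js) (fst js) (poly_part (snd ir) (F (fst ir)))) (v $ js))"


section \<open>Microstates and free entropy dimension\<close>

definition normalized_trace :: "nat \<Rightarrow> complex mat \<Rightarrow> complex" where
  "normalized_trace k A = (\<Sum>i<k. A $$ (i, i)) / of_nat k"

definition mat_tuples :: "nat \<Rightarrow> ('n \<Rightarrow> complex mat) set" where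
  "mat_tuples k = {\<xi>. \<forall>i. \<xi> i \<in> carrier_mat k k}"

definition tuple_norm2 :: "nat \<Rightarrow> ('n::finite \<Rightarrow> complex mat) \<Rightarrow> real" where
  "tuple_norm2 k \<xi> = sqrt (\<Sum>i\<in>UNIV. Re (normalized_trace k (mat_adjoint (\<xi> i) * \<xi> i)))"

definition word_mat :: "nat \<Rightarrow> ('n \<Rightarrow> complex mat) \<Rightarrow> 'n star_word \<Rightarrow> complex mat" where
  "word_mat k \<xi> w = foldr (\<lambda>(i, s) A. (if s then mat_adjoint (\<xi> i) else \<xi> i) * A) w (1\<^sub>m k)"

definition microstates ::
    "(('a::complex_hilbert_space \<Rightarrow> 'a) \<Rightarrow> complex) \<Rightarrow> ('n \<Rightarrow> 'a \<Rightarrow> 'a) \<Rightarrow>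
     nat \<Rightarrow> nat \<Rightarrow> real \<Rightarrow> ('n \<Rightarrow> complex mat) set" where
  "microstates \<phi> X m k \<gamma> =
     {\<xi> \<in> mat_tuples k. \<forall>w. 1 \<le> length w \<and> length w \<le> m \<longrightarrow>
        cmod (\<phi> (word_op X w) - normalized_trace k (word_mat k \<xi> w)) < \<gamma>}"

definition rel_microstates ::
    "(('a::complex_hilbert_space \<Rightarrow> 'a) \<Rightarrow> complex) \<Rightarrow> ('p \<Rightarrow> 'a \<Rightarrow> 'a) \<Rightarrow> ('n \<Rightarrow> 'a \<Rightarrow> 'a) \<Rightarrow>
     nat \<Rightarrow> nat \<Rightarrow> real \<Rightarrow> ('p \<Rightarrow> complex mat) set" where
  "rel_microstates \<phi> Y X m k \<gamma> =
     {\<eta>. \<exists>\<xi>. case_sum \<eta> \<xi> \<in> microstates \<phi> (case_sum Y X) m k \<gamma>}"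

definition tuple_ball :: "nat \<Rightarrow> ('n::finite \<Rightarrow> complex mat) \<Rightarrow> real \<Rightarrow> ('n \<Rightarrow> complex mat) set" where
  "tuple_ball k \<eta> \<epsilon> = {\<xi> \<in> mat_tuples k. tuple_norm2 k (\<lambda>i. \<xi> i - \<eta> i) < \<epsilon>}"

text \<open>The value is \<open>\<infinity>\<close> if no finite cover exists.\<close>

definition covering_number :: "nat \<Rightarrow> real \<Rightarrow> ('n::finite \<Rightarrow> complex mat) set \<Rightarrow> enat" where
  "covering_number k \<epsilon> S =
     (INF C\<in>{C. finite C \<and> C \<subseteq> mat_tuples k \<and> S \<subseteq> (\<Union>\<eta>\<in>C. tuple_ball k \<eta> \<epsilon>)}. enat (card C))"

fun log_enat :: "enat \<Rightarrow> ereal" where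
  "log_enat (enat n) = (if n = 0 then - \<infinity> else ereal (ln (real n)))"
| "log_enat \<infinity> = \<infinity>"

definition covering_entropy ::
    "(nat \<Rightarrow> nat \<Rightarrow> real \<Rightarrow> ('n::finite \<Rightarrow> complex mat) set) \<Rightarrow> real \<Rightarrow> ereal" where
  "covering_entropy \<Gamma> \<epsilon> =
     (INF m. INF \<gamma>\<in>{0<..}.
        limsup (\<lambda>k. log_enat (covering_number k \<epsilon> (\<Gamma> m k \<gamma>)) / ereal ((real k)\<^sup>2)))"

definition covering_dimension ::
    "(nat \<Rightarrow> nat \<Rightarrow> real \<Rightarrow> ('n::finite \<Rightarrow> complex mat) set) \<Rightarrow> ereal" where
  "covering_dimension \<Gamma> = Limsup (at_right 0) (\<lambda>\<epsilon>. covering_entropy \<Gamma> \<epsilon> / ereal \<bar>ln \<epsilon>\<bar>)"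

definition delta0 ::
    "(('a::complex_hilbert_space \<Rightarrow> 'a) \<Rightarrow> complex) \<Rightarrow> ('n::finite \<Rightarrow> 'a \<Rightarrow> 'a) \<Rightarrow> ereal" where
  "delta0 \<phi> X = covering_dimension (microstates \<phi> X)"

definition rel_delta0 ::
    "(('a::complex_hilbert_space \<Rightarrow> 'a) \<Rightarrow> complex) \<Rightarrow> ('p::finite \<Rightarrow> 'a \<Rightarrow> 'a) \<Rightarrow>
     ('n::finite \<Rightarrow> 'a \<Rightarrow> 'a) \<Rightarrow> ereal" where
  "rel_delta0 \<phi> Y X = covering_dimension (rel_microstates \<phi> Y X)"

end

theory Submission
 imports Defs "HOL-Probability.Hoeffding" "HOL-Probability.Distribution_Functions"
begin

text \<open>
  A tuple \<open>v\<close> of \<open>k \<times> k\<close> matrices that is tangent to a level set of \<open>F\<close> at a microstate \<open>xi\<close> is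
  almost in the kernel of \<open>D\<^sup>sF(xi)\<close>, a real linear map whose Gram matrix has the same spectral
  moments, up to a small error, as \<open>D\<^sup>sF(X)\<^sup>* D\<^sup>sF(X)\<close>.  Hence the span of its small eigenvalues has
  dimension at most \<open>k\<^sup>2 (Nullity + o(1))\<close>, and a piece of a level set of diameter \<open>d\<close> is covered by
  about \<open>(const / r)\<close> to that power many pieces of diameter \<open>r d\<close>.  The second order error of the
  linearization is quadratic in \<open>d\<close> only if \<open>d\<close> is measured in operator norm, whereas the
  coordinates control the 2-norm.  Rounding the entries of a matrix to a lattice without
  increasing the operator norm of the error turns the one into the other at the cost of a
  factor \<open>exp (const k\<^sup>2)\<close> per step, which is negligible against \<open>log (1 / r)\<close> as \<open>r\<close> tends to 0.
\<close>

section \<open>Operators on Hilbert space\<close>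

text \<open>The definition of microstates has no cutoff for the operator norm, so a microstate is
  controlled only through finitely many moments. Its Schatten norms with dyadic exponents up to a
  fixed level are such moments, and a Hoelder inequality for dyadic exponents takes the place of the
  operator norm in estimates of products. For the same reason the spectrum of the Gram matrix at a
  microstate need not lie in the interval from 0 to R that contains the spectrum over the algebra.
  Small eigenvalues are therefore counted with the polynomial (1 - t / R) ^ (2 m), which is
  nonnegative for every real t. Its traces are combinations of moments, and over the algebra they
  converge to the nullity, because 1 - A / R is a positive contraction whose fixed space is the
  kernel of A.

  The splitting of each polynomial into self-adjoint and skew-adjoint parts makes the Gram matrix
  real in the 2 n k^2 real coordinates of a tuple of matrices, so that eigenvalue counts are real
  dimensions. The level sets arise by pulling a cover of the microstates of F(X) back under F: on
  the preimage of a ball, F is constant up to twice the radius.\<close>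

lemma cinner_cauchy_schwarz: "cmod (cinner x y) <= norm x * norm (y::'a::complex_hilbert_space)"
proof (cases "y = 0")
 case False
 define c where "c = cinner x y / of_real ((norm y)^2)"
 have y0: "(norm y)^2 > 0" using False by simp
 have "0 <= (norm (x - c *\<^sub>C y))^2" by simp
 also have "... = (norm x)^2 - 2 * Re (cnj c * cinner x y) + (cmod c)^2 * (norm y)^2"
  by (simp add: norm2_diff cinner_scaleC_right norm_scaleC power_mult_distrib)
 also have "cnj c * cinner x y = of_real ((cmod (cinner x y))^2 / (norm y)^2)"
  unfolding c_def
  by (simp only: complex_cnj_divide complex_cnj_complex_of_real of_real_divide
    complex_norm_square) (simp add: mult.commute)
 also have "(cmod c)^2 * (norm y)^2 = (cmod (cinner x y))^2 / (norm y)^2"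
 proof -
  have "cmod c = cmod (cinner x y) / (norm y)^2"
   unfolding c_def norm_divide norm_of_real by simp
  then show ?thesis using y0 by (simp add: power_divide power2_eq_square)
 qed
 finally have "(cmod (cinner x y))^2 / (norm y)^2 <= (norm x)^2" by simp
 then have "(cmod (cinner x y))^2 <= (norm x * norm y)^2"
  using y0 by (simp add: divide_le_eq power_mult_distrib)
 then show ?thesis by (rule power2_le_imp_le) simp
qed simp

lemma scaleC_minus_left: "(- c) *\<^sub>C x = - (c *\<^sub>C (x::'a::complex_hilbert_space))"
 using scaleC_add_left[of c "- c" x] by (simp add: eq_neg_iff_add_eq_0 add.commute)

lemma scaleR_via_scaleC: "r *\<^sub>R x = of_real r *\<^sub>C (x::'a::complex_hilbert_space)"
 by (simp add: scaleC_of_real)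

lemma cinner_scaleR_left [simp]:
 "cinner (r *\<^sub>R x) y = of_real r * cinner x (y::'a::complex_hilbert_space)"
 by (simp add: scaleR_via_scaleC cinner_scaleC_left)

lemma cinner_scaleR_right [simp]:
 "cinner x (r *\<^sub>R y) = of_real r * cinner x (y::'a::complex_hilbert_space)"
 by (simp add: scaleR_via_scaleC cinner_scaleC_right)

lemma cinner_minus_right: "cinner x (- y) = - cinner x (y::'a::complex_hilbert_space)"
 using cinner_diff_right[of x 0 y] by simp

lemma cinner_sum_right:
 "cinner y (\<Sum>i\<in>F. f i) = (\<Sum>i\<in>F. cinner y (f i ::'a::complex_hilbert_space))"
 by (induction F rule: infinite_finite_induct) (auto simp: cinner_add_right)

lemma bounded_linear_cinner_left: "bounded_linear (%x. cinner x (y::'a::complex_hilbert_space))"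
 by (rule bounded_linear_intro[where K="norm y"])
  (auto simp: cinner_add_left cinner_cauchy_schwarz scaleR_conv_of_real)

lemma tendsto_cinner [tendsto_intros]:
 fixes f g :: "'b => 'a::complex_hilbert_space"
 assumes "(f \<longlongrightarrow> x) F" "(g \<longlongrightarrow> y) F"
 shows "((%t. cinner (f t) (g t)) \<longlongrightarrow> cinner x y) F"
proof -
 have "bounded_bilinear (%x y. cinner x (y::'a))"
  by standard (auto simp: cinner_add_left cinner_add_right scaleR_conv_of_real
    intro!: exI[of _ 1] cinner_cauchy_schwarz)
 then show ?thesis using assms by (rule bounded_bilinear.tendsto)
qed

lemma tendsto_scaleC [tendsto_intros]:
 fixes f :: "'b => 'a::complex_hilbert_space"
 assumes "(f \<longlongrightarrow> x) F" shows "((%t. c *\<^sub>C f t) \<longlongrightarrow> c *\<^sub>C x) F"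
 by (rule bounded_linear.tendsto[OF bounded_linear_scaleC assms])

lemma cinner_ext:
 assumes "!!z. cinner x z = cinner y (z::'a::complex_hilbert_space)" shows "x = y"
proof -
 have "cinner (x - y) (x - y) = 0" using assms by (simp add: cinner_diff_left)
 then show ?thesis by (simp add: cinner_self)
qed

lemma Re_cinner_self: "Re (cinner x x) = (norm (x::'a::complex_hilbert_space))^2"
 by (simp add: cinner_self)

lemma Re_cinner_commute: "Re (cinner x y) = Re (cinner y (x::'a::complex_hilbert_space))"
 by (subst cinner_commute) simp

lemma bounded_clinearD:
 assumes "bounded_clinear T"
 shows "bounded_linear T" "T (x + y) = T x + T y" "T (x - y) = T x - T y" "T (- x) = - T x" "T 0 = 0"
  "T (c *\<^sub>C x) = c *\<^sub>C T x" "T (r *\<^sub>R x) = r *\<^sub>R T x" "T (\<Sum>i\<in>F. f i) = (\<Sum>i\<in>F. T (f i))"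
proof -
 show b: "bounded_linear T" using assms by (simp add: bounded_clinear_def)
 show "T (x + y) = T x + T y" "T (x - y) = T x - T y" "T (- x) = - T x" "T 0 = 0"
  "T (r *\<^sub>R x) = r *\<^sub>R T x"
  using b by (simp_all add: linear_simps)
 show "T (c *\<^sub>C x) = c *\<^sub>C T x" using assms by (simp add: bounded_clinear_def)
 show "T (\<Sum>i\<in>F. f i) = (\<Sum>i\<in>F. T (f i))" by (rule linear_sum[OF bounded_linear.linear[OF b]])
qed

lemma bounded_clinearI:
 assumes "!!x y. T (x + y) = T x + T y" "!!c x. T (c *\<^sub>C x) = c *\<^sub>C T x"
  "!!x. norm (T x) <= norm x * K"
 shows "bounded_clinear T"
 unfolding bounded_clinear_def
proof (intro conjI allI assms)
 show "bounded_linear T"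
  by (rule bounded_linear_intro[where K=K]) (use assms in \<open>auto simp: scaleR_via_scaleC\<close>)
qed

lemma bounded_clinear_bound:
 assumes "bounded_clinear T" obtains K where "K > 0" "!!x. norm (T x) <= norm x * K"
 using bounded_linear.pos_bounded[OF bounded_clinearD(1)[OF assms]] by blast

lemma bounded_clinear_tendsto:
 assumes "bounded_clinear T" "(f \<longlongrightarrow> x) F" shows "((%t. T (f t)) \<longlongrightarrow> T x) F"
 by (rule bounded_linear.tendsto[OF bounded_clinearD(1)[OF assms(1)] assms(2)])

lemma bounded_clinear_id [simp]: "bounded_clinear id" "bounded_clinear (%x. x)"
 by (auto simp: bounded_clinear_def id_def)

lemma bounded_clinear_compose:
 assumes "bounded_clinear S" "bounded_clinear T" shows "bounded_clinear (S \<circ> T)"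
 using assms bounded_linear_compose[of S T] by (simp add: bounded_clinear_def o_def)

lemma bounded_clinear_diff:
 assumes "bounded_clinear S" "bounded_clinear T" shows "bounded_clinear (%v. S v - T v)"
 using bounded_clinear_add[OF assms(1) bounded_clinear_scaleC[OF assms(2), of "-1"]]
 by (simp add: scaleC_minus_left)

lemma bounded_clinear_scaleR:
 assumes "bounded_clinear T" shows "bounded_clinear (%v. r *\<^sub>R T v)"
 using bounded_clinear_scaleC[OF assms, of "of_real r"] by (simp add: scaleC_of_real)

lemma bounded_clinear_sum:
 assumes "!!i. i \<in> F ==> bounded_clinear (T i)"
 shows "bounded_clinear (%v. \<Sum>i\<in>F. T i v)"
 using assms
 by (induction F rule: infinite_finite_induct) (auto simp: bounded_clinear_zero bounded_clinear_add)

lemma bounded_clinear_funpow: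
 "bounded_clinear (T :: 'a::complex_hilbert_space => 'a) ==> bounded_clinear (T ^^ n)"
 by (induction n) (auto intro: bounded_clinear_compose)

section \<open>Closed subspaces and orthogonal projections\<close>

definition csubspace :: "'a::complex_hilbert_space set => bool" where
 "csubspace S \<longleftrightarrow> 0 \<in> S \<and> (\<forall>x\<in>S. \<forall>y\<in>S. x + y \<in> S) \<and> (\<forall>c. \<forall>x\<in>S. c *\<^sub>C x \<in> S)"

lemma csubspace_diff: "csubspace S ==> x \<in> S ==> y \<in> S ==> x - y \<in> S"
 unfolding csubspace_def using scaleC_minus_left[of 1 y] by (metis scaleC_one uminus_add_conv_diff add.commute)

text \<open>The sum \<open>W\<close> of \<open>S\<close> and its orthogonal complement is closed,
  since by Pythagoras the components in \<open>S\<close> of a convergent sequence of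
  \<open>W\<close> are again Cauchy. If \<open>W\<close> were proper, a unit vector orthogonal to
  \<open>W\<close> would lie in the complement of \<open>S\<close> and so be orthogonal to
  itself.\<close>

lemma orthogonal_decomposition:
 fixes S :: "'a::complex_hilbert_space set"
 assumes cl: "closed S" and sub: "csubspace S"
 shows "\<exists>p\<in>S. \<forall>s\<in>S. cinner (x - p) s = 0"
proof -
 define N where "N = {q. \<forall>s\<in>S. cinner q s = 0}"
 define W where "W = {p + q | p q. p \<in> S \<and> q \<in> N}"
 have subN: "csubspace N" unfolding N_def csubspace_def by (auto simp: cinner_add_left cinner_scaleC_left)
 have "N = (\<Inter>s\<in>S. (%q. cinner q s) -` {0})" unfolding N_def by auto
 moreover have "closed ((%q. cinner q s) -` {0})" for s :: 'a
  by (rule closed_vimage[OF closed_singleton linear_continuous_on[OF bounded_linear_cinner_left]])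
 ultimately have clN: "closed N" by (simp add: closed_INT)
 have WI: "p + q \<in> W" if "p \<in> S" "q \<in> N" for p q using that unfolding W_def by blast
 have S0: "0 \<in> S" "0 \<in> N" using sub subN by (auto simp: csubspace_def)
 have "W = UNIV"
 proof (rule ccontr)
  assume ne: "W \<noteq> UNIV"
  have "\<exists>u. norm u = 1 \<and> (\<forall>s\<in>W. cinner u s = 0)"
  proof (rule exists_orthogonal_unit[OF _ _ _ _ ne])
   show "0 \<in> W" using WI[OF S0] by simp
   show "x + y \<in> W" if xy: "x \<in> W" "y \<in> W" for x y
   proof -
    obtain p q p' q' where "x = p + q" "y = p' + q'" "p \<in> S" "q \<in> N" "p' \<in> S" "q' \<in> N"
     using xy unfolding W_def by blast
    moreover have "x + y = (p + p') + (q + q')" using calculation by simp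
    ultimately show ?thesis using sub subN WI[of "p + p'" "q + q'"] unfolding csubspace_def by metis
   qed
   show "c *\<^sub>C x \<in> W" if xW: "x \<in> W" for c x
   proof -
    obtain p q where "x = p + q" "p \<in> S" "q \<in> N" using xW unfolding W_def by blast
    then show ?thesis using sub subN WI[of "c *\<^sub>C p" "c *\<^sub>C q"]
     by (simp add: csubspace_def scaleC_add_right)
   qed
   show "closed W"
    unfolding closed_sequential_limits
   proof (intro allI impI, elim conjE)
    fix f l assume f: "\<forall>n. f n \<in> W" and l: "f \<longlonglongrightarrow> l"
    have "\<forall>n. \<exists>p. p \<in> S \<and> f n - p \<in> N"
    proof
     fix n
     obtain p q where "f n = p + q" "p \<in> S" "q \<in> N" using f unfolding W_def by blast
     then show "\<exists>p. p \<in> S \<and> f n - p \<in> N" by (intro exI[of _ p]) simp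
    qed
    then obtain p where p: "!!n. p n \<in> S" "!!n. f n - p n \<in> N" by metis
    define q where "q n = f n - p n" for n
    have pq: "!!n. f n = p n + q n" "!!n. p n \<in> S" "!!n. q n \<in> N"
     using p by (auto simp: q_def)
    have pyth: "norm (p m - p n) <= norm (f m - f n)" for m n
    proof -
     have "q m - q n \<in> N" "p m - p n \<in> S" using pq sub subN csubspace_diff by blast+
     then have o: "cinner (q m - q n) (p m - p n) = 0" unfolding N_def by blast
     have "f m - f n = (q m - q n) + (p m - p n)" by (simp add: pq)
     then have "(norm (f m - f n))^2 = (norm (q m - q n))^2 + (norm (p m - p n))^2"
      using norm2_add[of "q m - q n" "p m - p n"] o by simp
     then have "(norm (p m - p n))^2 <= (norm (f m - f n))^2" by simp
     then show ?thesis by (rule power2_le_imp_le) simp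
    qed
    have "Cauchy f" using l LIMSEQ_imp_Cauchy by blast
    have "Cauchy p"
    proof (rule CauchyI)
     fix e :: real assume "0 < e"
     then obtain M where "\<forall>m\<ge>M. \<forall>n\<ge>M. norm (f m - f n) < e"
      using CauchyD[OF \<open>Cauchy f\<close>] by blast
     then show "\<exists>M. \<forall>m\<ge>M. \<forall>n\<ge>M. norm (p m - p n) < e"
      using pyth le_less_trans by (intro exI[of _ M]) blast
    qed
    then obtain a where a: "p \<longlonglongrightarrow> a" using Cauchy_convergent_iff convergent_def by blast
    have "q = (%n. f n - p n)" by (auto simp: q_def)
    then have b: "q \<longlonglongrightarrow> l - a" using tendsto_diff[OF l a] by simp
    have "a \<in> S" using a cl pq(2) closed_sequentially by blast
    moreover have "l - a \<in> N" using b clN pq(3) closed_sequentially by blast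
    ultimately show "l \<in> W" using WI[of a "l - a"] by simp
   qed
  qed
  then obtain u where u: "norm u = 1" "!!s. s \<in> W ==> cinner u s = 0" by blast
  have SW: "s \<in> W" if "s \<in> S" for s using WI[OF that S0(2)] by simp
  have NW: "s \<in> W" if "s \<in> N" for s using WI[OF S0(1) that] by simp
  have "u \<in> N" unfolding N_def using u(2) SW by blast
  then have "cinner u u = 0" using u(2) NW by blast
  then show False using u(1) by (simp add: cinner_self)
 qed
 then obtain p q where "x = p + q" "p \<in> S" "q \<in> N" unfolding W_def by blast
 then show ?thesis unfolding N_def by (intro bexI[of _ p]) auto
qed

definition proj :: "'a::complex_hilbert_space set => 'a => 'a" where
 "proj S x = (SOME p. p \<in> S \<and> (\<forall>s\<in>S. cinner (x - p) s = 0))"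

context
 fixes S :: "'a::complex_hilbert_space set"
 assumes cl: "closed S" and sub: "csubspace S"
begin

lemma proj_in: "proj S x \<in> S" and proj_orth: "s \<in> S ==> cinner (x - proj S x) s = 0"
 using someI_ex[of "%p. p \<in> S \<and> (\<forall>s\<in>S. cinner (x - p) s = 0)"] orthogonal_decomposition[OF cl sub, of x]
 unfolding proj_def by blast+

lemma proj_eqI:
 assumes "p \<in> S" "!!s. s \<in> S ==> cinner (x - p) s = 0" shows "proj S x = p"
proof -
 have "proj S x - p \<in> S" using assms proj_in sub csubspace_diff by blast
 then have "cinner (x - p) (proj S x - p) = 0" "cinner (x - proj S x) (proj S x - p) = 0"
  using assms proj_orth by blast+
 then have "cinner (proj S x - p) (proj S x - p) = 0" by (simp add: cinner_diff_left)
 then show ?thesis by (simp add: cinner_self)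
qed

lemma proj_fixed: "s \<in> S ==> proj S s = s"
 by (rule proj_eqI) auto

lemma proj_norm: "(norm x)^2 = (norm (proj S x))^2 + (norm (x - proj S x))^2"
 using norm2_add[of "x - proj S x" "proj S x"] proj_orth[OF proj_in, of x x] by simp

lemma proj_bounded_clinear: "bounded_clinear (proj S)"
proof (rule bounded_clinearI[where K=1])
 show "proj S (x + y) = proj S x + proj S y" for x y
 proof (rule proj_eqI)
  have "x + y - (proj S x + proj S y) = (x - proj S x) + (y - proj S y)" by simp
  then show "cinner (x + y - (proj S x + proj S y)) s = 0" if "s \<in> S" for s
   using that by (simp only: cinner_add_left proj_orth) simp
 qed (use sub proj_in in \<open>auto simp: csubspace_def\<close>)
 show "proj S (c *\<^sub>C x) = c *\<^sub>C proj S x" for c x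
  by (rule proj_eqI) (use sub proj_in in \<open>auto simp: csubspace_def cinner_scaleC_left proj_orth
     scaleC_diff_right[symmetric]\<close>)
 show "norm (proj S x) <= norm x * 1" for x
 proof -
  have "(norm (proj S x))^2 <= (norm x)^2" using proj_norm[of x] by simp
  then show ?thesis by (auto dest: power2_le_imp_le)
 qed
qed

lemma proj_selfadjoint: "cinner (proj S x) y = cinner x (proj S y)"
proof -
 have "cinner (x - proj S x) (proj S y) = 0" using proj_orth proj_in by blast
 moreover have "cinner (y - proj S y) (proj S x) = 0" using proj_orth proj_in by blast
 then have "cinner (proj S x) (y - proj S y) = 0" by (subst cinner_commute) simp
 ultimately show ?thesis by (simp add: cinner_diff_left cinner_diff_right)
qed

lemma proj_idem: "proj S (proj S x) = proj S x"
 by (rule proj_fixed[OF proj_in])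

lemma proj_zero_iff: "proj S x = 0 \<longleftrightarrow> (\<forall>s\<in>S. cinner x s = 0)"
 using proj_orth[of _ x] proj_eqI[of 0 x] sub by (auto simp: csubspace_def)

end

section \<open>Riesz representation and adjoints\<close>

lemma riesz_representation:
 fixes f :: "'a::complex_hilbert_space => complex"
 assumes bl: "bounded_linear f" and C: "!!c x. f (c *\<^sub>C x) = c * f x"
 shows "\<exists>w. \<forall>x. f x = cinner x w"
proof (cases "\<forall>x. f x = 0")
 case False
 define K where "K = f -` {0}"
 have "closed K" unfolding K_def
  by (rule closed_vimage[OF closed_singleton linear_continuous_on[OF bl]])
 moreover have "K \<noteq> UNIV" using False unfolding K_def by auto
 moreover have "0 \<in> K" "!!x y. x \<in> K ==> y \<in> K ==> x + y \<in> K" "!!c x. x \<in> K ==> c *\<^sub>C x \<in> K"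
  using bl C unfolding K_def by (auto simp: linear_simps)
 ultimately obtain u where u: "norm u = 1" "!!s. s \<in> K ==> cinner u s = 0"
  using exists_orthogonal_unit[of K] by blast
 \<comment> \<open>The vector f(u) x - f(x) u lies in the kernel of f, and u is a unit vector
   orthogonal to that kernel.\<close>
 have "f x = cinner x (cnj (f u) *\<^sub>C u)" for x
 proof -
  have "f u *\<^sub>C x - f x *\<^sub>C u \<in> K" unfolding K_def using bl C by (simp add: linear_simps mult.commute)
  from u(2)[OF this] have "cinner (f u *\<^sub>C x - f x *\<^sub>C u) u = 0"
   by (subst cinner_commute) simp
  then show ?thesis using u(1) by (simp add: cinner_diff_left cinner_scaleC_left cinner_scaleC_right cinner_self)
 qed
 then show ?thesis by blast
qed (auto intro!: exI[of _ 0])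

lemma adjoint_exists:
 assumes T: "bounded_clinear (T :: 'a::complex_hilbert_space => 'b::complex_hilbert_space)"
 shows "\<exists>S. bounded_clinear S \<and> (\<forall>u v. cinner (T u) v = cinner u (S v))"
proof -
 have "\<exists>w. \<forall>u. cinner (T u) v = cinner u w" for v
 proof (rule riesz_representation)
  show "bounded_linear (%u. cinner (T u) v)"
   using bounded_linear_compose[OF bounded_linear_cinner_left bounded_clinearD(1)[OF T]] by simp
 qed (simp add: bounded_clinearD[OF T] cinner_scaleC_left)
 then obtain S where S: "!!u v. cinner (T u) v = cinner u (S v)" by metis
 have S': "cinner (S v) u = cinner v (T u)" for u v
  using S[of u v] by (metis cinner_commute)
 obtain K where K: "K > 0" "!!x. norm (T x) <= norm x * K" using bounded_clinear_bound[OF T] by blast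
 have "bounded_clinear S"
 proof (rule bounded_clinearI[where K=K])
  show "S (x + y) = S x + S y" for x y by (rule cinner_ext) (simp add: S' cinner_add_left)
  show "S (c *\<^sub>C x) = c *\<^sub>C S x" for c x by (rule cinner_ext) (simp add: S' cinner_scaleC_left)
  show "norm (S x) <= norm x * K" for x
  proof (cases "S x = 0")
   case False
   have "(norm (S x))^2 = Re (cinner x (T (S x)))" by (simp add: Re_cinner_self[symmetric] S')
   also have "... <= norm x * norm (T (S x))"
    using cinner_cauchy_schwarz complex_Re_le_cmod order_trans by blast
   also have "... <= norm x * (norm (S x) * K)" by (intro mult_left_mono K) simp
   finally show ?thesis using False by (simp add: power2_eq_square)
  qed (use K in simp)
 qed
 then show ?thesis using S by blast
qed

text \<open>The duality relation determines its operator, so any operator that satisfies it resolves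
  the \<open>THE\<close> in \<open>cadjoint\<close>.\<close>

lemma cadjoint_eqI:
 assumes "bounded_clinear S" "!!u v. cinner (T u) v = cinner u (S v)"
 shows "cadjoint T = S"
 unfolding cadjoint_def
proof (rule the_equality)
 fix S' assume S': "bounded_clinear S' \<and> (\<forall>u v. cinner (T u) v = cinner u (S' v))"
 show "S' = S"
 proof
  fix v show "S' v = S v"
   by (rule cinner_ext) (metis assms(2) S' cinner_commute)
 qed
qed (use assms in blast)

lemma
 assumes "bounded_clinear T"
 shows bounded_clinear_cadjoint: "bounded_clinear (cadjoint T)"
  and cinner_cadjoint: "cinner (T u) v = cinner u (cadjoint T v)"
  and cinner_cadjoint': "cinner u' (T v') = cinner (cadjoint T u') v'"
proof -
 obtain S where S: "bounded_clinear S" "!!u v. cinner (T u) v = cinner u (S v)"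
  using adjoint_exists[OF assms] by blast
 then have eq: "cadjoint T = S" by (rule cadjoint_eqI)
 show "bounded_clinear (cadjoint T)" "cinner (T u) v = cinner u (cadjoint T v)" using S eq by auto
 show "cinner u' (T v') = cinner (cadjoint T u') v'" using S eq by (metis cinner_commute)
qed

lemma cadjoint_cadjoint:
 assumes "bounded_clinear T" shows "cadjoint (cadjoint T) = T"
 by (rule cadjoint_eqI[OF assms]) (metis assms cinner_cadjoint')

lemma cadjoint_compose:
 assumes "bounded_clinear S" "bounded_clinear T" shows "cadjoint (S \<circ> T) = cadjoint T \<circ> cadjoint S"
 by (rule cadjoint_eqI)
  (simp_all add: bounded_clinear_compose assms[THEN bounded_clinear_cadjoint] assms[THEN cinner_cadjoint])

lemma cadjoint_id [simp]: "cadjoint id = id"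
 by (rule cadjoint_eqI) auto

section \<open>The spectral theorem for bounded self-adjoint operators\<close>

definition selfadj :: "('a::complex_hilbert_space => 'a) => bool" where
 "selfadj A \<longleftrightarrow> bounded_clinear A \<and> (\<forall>u v. cinner (A u) v = cinner u (A v))"

lemma selfadjD: "selfadj A ==> bounded_clinear A" "selfadj A ==> cinner (A u) v = cinner u (A v)"
 by (auto simp: selfadj_def)

lemma selfadj_cadjoint: "selfadj A ==> cadjoint A = A"
 by (rule cadjoint_eqI) (auto simp: selfadj_def)

lemma selfadj_Re: "selfadj A ==> cinner (A v) v = of_real (Re (cinner (A v) v))"
 using cinner_commute[of v "A v"] selfadjD(2)[of A v v]
 by (metis complex_cnj_cancel_iff complex_is_Real_iff Reals_cnj_iff of_real_Re)

text \<open>A self-adjoint operator that preserves \<open>S\<close> preserves its orthogonal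
  complement too, so it respects the decomposition that defines the projection.\<close>

lemma proj_comm:
 assumes S: "closed S" "csubspace S" and C: "selfadj C" and inv: "!!s. s \<in> S ==> C s \<in> S"
 shows "C (proj S v) = proj S (C v)"
proof (rule proj_eqI[OF S, symmetric])
 fix s assume "s \<in> S"
 then have "cinner (v - proj S v) (C s) = 0" using inv proj_orth[OF S] by blast
 then show "cinner (C v - C (proj S v)) s = 0"
  using selfadjD[OF C] by (simp add: bounded_clinearD(3)[OF selfadjD(1)[OF C], symmetric])
qed (use inv proj_in[OF S] in blast)

text \<open>The iteration converges to \<open>Y = 1 - sqrt (1 - B)\<close>; the scalar recursion \<open>y\<close> dominates it.\<close>

lemma operator_sqrt:
 assumes B: "selfadj B" and B1: "!!v. norm (B v) <= norm v"
 shows "\<exists>W. selfadj W \<and> (\<forall>v. 0 <= Re (cinner (W v) v)) \<and> (\<forall>v. W (W v) = v - B v) \<and>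
   (\<forall>C. bounded_clinear C --> (\<forall>v. C (B v) = B (C v)) --> (\<forall>v. C (W v) = W (C v)))"
proof -
 define Y where "Y = rec_nat (%_. 0) (%n T v. (1/2) *\<^sub>R (B v + T (T v)))"
 have Y0: "Y 0 v = 0" and YS: "Y (Suc n) v = (1/2) *\<^sub>R (B v + Y n (Y n v))" for n v
  by (simp_all add: Y_def)
 define y :: "nat => real" where "y = rec_nat 0 (%n t. (1 + t^2) / 2)"
 have y0: "y 0 = 0" and yS: "y (Suc n) = (1 + (y n)^2) / 2" for n by (simp_all add: y_def)
 have y01: "0 <= y n \<and> y n <= 1" for n
  by (induction n) (auto simp: y0 yS abs_square_le_1 power_le_one)
 have yinc: "y n <= y (Suc n)" for n
  using zero_le_power2[of "1 - y n"] by (simp add: yS power2_eq_square algebra_simps)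
 then have yinc': "incseq y" by (rule incseq_SucI)
 have bB: "bounded_clinear B" using B by (rule selfadjD)
 have bY: "bounded_clinear (Y n)" for n
 proof (induction n)
  case 0 have "Y 0 = (%_. 0)" by (auto simp: Y0) then show ?case by (simp add: bounded_clinear_zero)
 next
  case (Suc n)
  have "Y (Suc n) = (%v. (1/2) *\<^sub>R (B v + (Y n \<circ> Y n) v))" by (auto simp: YS)
  then show ?case using Suc bB by (simp only: bounded_clinear_scaleR bounded_clinear_add bounded_clinear_compose)
 qed
 have nY: "norm (Y n v) <= y n * norm v" for n v
 proof (induction n arbitrary: v)
  case (Suc n)
  have "norm (Y (Suc n) v) <= (norm (B v) + norm (Y n (Y n v))) / 2"
   using norm_triangle_ineq[of "B v" "Y n (Y n v)"] by (simp add: YS)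
  also have "norm (Y n (Y n v)) <= y n * (y n * norm v)"
   using Suc[of "Y n v"] Suc[of v] y01[of n] by (meson mult_left_mono order_trans)
  finally show ?case using B1[of v] by (simp add: yS power2_eq_square field_simps)
 qed (simp add: Y0 y0)
 have comm: "C (Y n v) = Y n (C v)" if C: "bounded_clinear C" and CB: "!!v. C (B v) = B (C v)" for C n v
  by (induction n arbitrary: v) (auto simp: Y0 YS bounded_clinearD[OF C] CB)
 have YB: "Y n (B v) = B (Y n v)" for n v using comm[OF bB] by simp
 have YY: "Y m (Y n v) = Y n (Y m v)" for m n v using comm[OF bY YB] by simp
 have diff: "norm (Y (Suc n) v - Y n v) <= (y (Suc n) - y n) * norm v" for n v
 proof (induction n arbitrary: v)
  case 0 then show ?case using B1[of v] by (simp add: Y0 YS y0 yS)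
 next
  case (Suc n)
  let ?w = "Y (Suc n) v + Y n v"
  have "Y (Suc (Suc n)) v - Y (Suc n) v = (1/2) *\<^sub>R (Y (Suc n) (Y (Suc n) v) - Y n (Y n v))"
   unfolding YS[of "Suc n"] by (subst (3) YS) (simp add: scaleR_diff_right[symmetric])
  \<comment> \<open>The iterates commute, so the difference of their squares is the difference of
    the operators applied to their sum. The scalar sequence \<open>y\<close> satisfies the same
    identity.\<close>
  also have "Y (Suc n) (Y (Suc n) v) - Y n (Y n v) = Y (Suc n) ?w - Y n ?w"
   by (simp only: bounded_clinearD(2)[OF bY] YY[of n "Suc n"]) simp
  finally have "norm (Y (Suc (Suc n)) v - Y (Suc n) v) = norm (Y (Suc n) ?w - Y n ?w) / 2" by simp
  also have "norm (Y (Suc n) ?w - Y n ?w) <= (y (Suc n) - y n) * norm ?w" by (rule Suc.IH)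
  also have "norm ?w <= y (Suc n) * norm v + y n * norm v"
   using norm_triangle_ineq[of "Y (Suc n) v" "Y n v"] nY[of "Suc n" v] nY[of n v] by linarith
  finally have "norm (Y (Suc (Suc n)) v - Y (Suc n) v)
    <= (y (Suc n) - y n) * (y (Suc n) * norm v + y n * norm v) / 2"
   using yinc[of n] by (simp add: mult_left_mono)
  also have "... = ((y (Suc n))^2 - (y n)^2) / 2 * norm v" by (simp add: power2_eq_square algebra_simps)
  also have "((y (Suc n))^2 - (y n)^2) / 2 = (1 + (y (Suc n))^2) / 2 - (1 + (y n)^2) / 2"
   by (simp add: field_simps)
  also have "... = y (Suc (Suc n)) - y (Suc n)" by (simp only: yS[of "Suc n", symmetric] yS[of n, symmetric])
  finally show ?case .
 qed
 have diff': "norm (Y (n + k) v - Y n v) <= (y (n + k) - y n) * norm v" for n k v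
 proof (induction k)
  case (Suc k)
  have "norm (Y (n + Suc k) v - Y n v) <= norm (Y (Suc (n + k)) v - Y (n + k) v) + norm (Y (n + k) v - Y n v)"
   using norm_triangle_ineq[of "Y (Suc (n + k)) v - Y (n + k) v" "Y (n + k) v - Y n v"] by simp
  then show ?case using Suc diff[of "n + k" v] by (simp add: algebra_simps)
 qed simp
 obtain l where "y \<longlonglongrightarrow> l" using incseq_convergent[OF yinc', of 1] y01 by blast
 then have cy: "Cauchy y" by (rule LIMSEQ_imp_Cauchy)
 have "Cauchy (%n. Y n v)" for v
 proof (rule CauchyI')
  fix e :: real assume e: "0 < e"
  then have "0 < e / (norm v + 1)" by (simp add: add_nonneg_pos)
  then obtain M where M: "!!m n. m >= M ==> n >= M ==> norm (y m - y n) < e / (norm v + 1)"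
   using CauchyD[OF cy] by blast
  have "norm (Y m v - Y n v) < e" if mn: "m >= M" "m < n" for m n
  proof -
   have "norm (Y m v - Y n v) <= (y n - y m) * norm v"
    using diff'[of m "n - m" v] mn by (simp add: norm_minus_commute)
   also have "... <= e / (norm v + 1) * norm v"
    using M[of n m] mn by (intro mult_right_mono) (auto simp: abs_less_iff)
   also have "... < e / (norm v + 1) * (norm v + 1)"
    using e by (intro mult_strict_left_mono) (auto simp: add_nonneg_pos)
   also have "... = e" by (simp add: add_nonneg_pos less_imp_neq[symmetric])
   finally show ?thesis .
  qed
  then show "\<exists>M. \<forall>m\<ge>M. \<forall>n>m. dist (Y m v) (Y n v) < e" unfolding dist_norm by blast
 qed
 then have "\<forall>v. \<exists>w. (%n. Y n v) \<longlonglongrightarrow> w" using Cauchy_convergent_iff convergent_def by blast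
 then obtain Z where Z: "!!v. (%n. Y n v) \<longlonglongrightarrow> Z v" by metis
 have nZ: "norm (Z v) <= norm v" for v
 proof (rule LIMSEQ_le_const2[OF tendsto_norm[OF Z]])
  show "\<exists>N. \<forall>n\<ge>N. norm (Y n v) <= norm v"
   using nY[of _ v] y01 by (metis mult_left_le_one_le norm_ge_zero order_trans)
 qed
 have bZ: "bounded_clinear Z"
 proof (rule bounded_clinearI[where K=1])
  show "Z (u + v) = Z u + Z v" for u v
   by (rule LIMSEQ_unique[OF Z]) (simp add: bounded_clinearD(2)[OF bY] tendsto_add Z)
  show "Z (c *\<^sub>C v) = c *\<^sub>C Z v" for c v
   by (rule LIMSEQ_unique[OF Z]) (simp add: bounded_clinearD(6)[OF bY] tendsto_scaleC Z)
 qed (simp add: nZ)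
 have commZ: "C (Z v) = Z (C v)" if C: "bounded_clinear C" and CB: "!!v. C (B v) = B (C v)" for C v
  by (rule LIMSEQ_unique[OF bounded_clinear_tendsto[OF C Z]]) (simp add: comm[OF that] Z)
 have ZZ: "(%n. Y n (Y n v)) \<longlonglongrightarrow> Z (Z v)" for v
 proof -
  have "(%n. Y n (Y n v - Z v)) \<longlonglongrightarrow> 0"
  proof (rule Lim_null_comparison)
   show "(%n. norm (Y n v - Z v)) \<longlonglongrightarrow> 0" using Z[of v] by (simp add: LIM_zero tendsto_norm_zero)
   show "\<forall>\<^sub>F n in sequentially. norm (Y n (Y n v - Z v)) <= norm (Y n v - Z v)"
    using nY y01 by (intro always_eventually allI) (metis mult_left_le_one_le norm_ge_zero order_trans)
  qed
  from tendsto_add[OF this Z[of "Z v"]] show ?thesis by (simp add: bounded_clinearD(3)[OF bY])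
 qed
 have Zeq: "Z v = (1/2) *\<^sub>R (B v + Z (Z v))" for v
 proof (rule LIMSEQ_unique)
  show "(%n. Y (Suc n) v) \<longlonglongrightarrow> Z v" by (rule LIMSEQ_Suc[OF Z])
  show "(%n. Y (Suc n) v) \<longlonglongrightarrow> (1/2) *\<^sub>R (B v + Z (Z v))"
   unfolding YS by (intro tendsto_intros ZZ)
 qed
 have saY: "cinner (Y n u) v = cinner u (Y n v)" for n u v
  by (induction n arbitrary: u v) (auto simp: Y0 YS cinner_add_left cinner_add_right selfadjD[OF B])
 have saZ: "cinner (Z u) v = cinner u (Z v)" for u v
 proof (rule LIMSEQ_unique)
  show "(%n. cinner (Y n u) v) \<longlonglongrightarrow> cinner (Z u) v" by (intro tendsto_intros Z)
  show "(%n. cinner (Y n u) v) \<longlonglongrightarrow> cinner u (Z v)" unfolding saY by (intro tendsto_intros Z)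
 qed
 define W where "W v = v - Z v" for v
 show ?thesis
 proof (intro exI[of _ W] conjI allI impI)
  show "selfadj W" unfolding selfadj_def W_def
   using bounded_clinear_diff[OF bounded_clinear_id(2) bZ]
   by (auto simp: cinner_diff_left cinner_diff_right saZ)
  show "0 <= Re (cinner (W v) v)" for v
  proof -
   have "Re (cinner (Z v) v) <= norm (Z v) * norm v"
    using cinner_cauchy_schwarz complex_Re_le_cmod order_trans by blast
   also have "... <= norm v * norm v" by (intro mult_right_mono nZ) simp
   finally show ?thesis by (simp add: W_def cinner_diff_left Re_cinner_self power2_eq_square)
  qed
  show "W (W v) = v - B v" for v
  proof -
   have "2 *\<^sub>R Z v = B v + Z (Z v)" by (subst Zeq) simp
   then show ?thesis by (simp add: W_def bounded_clinearD(3)[OF bZ] scaleR_2 algebra_simps)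
  qed
  show "C (W v) = W (C v)" if "bounded_clinear C" "\<forall>v. C (B v) = B (C v)" for C v
   using that commZ[of C] by (simp add: W_def bounded_clinearD(3))
 qed
qed

text \<open>After scaling \<open>S\<close> to a contraction \<open>T\<close>, the square root
  \<open>W\<close> of the square of \<open>T\<close> is its absolute value, and \<open>K\<close> is
  the kernel of \<open>W + T\<close>. On \<open>K\<close> the form of \<open>T\<close> is minus that
  of \<open>W\<close>. The vectors \<open>W v - T v\<close> lie in \<open>K\<close>, so for
  \<open>v\<close> orthogonal to \<open>K\<close> the forms of \<open>T\<close> and \<open>W\<close>
  agree at \<open>v\<close>. Whatever commutes with \<open>S\<close> commutes with \<open>W\<close>
  and hence preserves \<open>K\<close>.\<close>

lemma spectral_split:
 assumes S: "selfadj S"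
 shows "\<exists>K. closed K \<and> csubspace K \<and> (\<forall>v\<in>K. Re (cinner (S v) v) <= 0) \<and>
   (\<forall>v. (\<forall>s\<in>K. cinner v s = 0) --> 0 <= Re (cinner (S v) v)) \<and>
   (\<forall>C. bounded_clinear C --> (\<forall>v. C (S v) = S (C v)) --> (\<forall>v\<in>K. C v \<in> K))"
proof -
 have bS: "bounded_clinear S" using S by (rule selfadjD)
 obtain c where c: "c > 0" "!!x. norm (S x) <= norm x * c" using bounded_clinear_bound[OF bS] by blast
 define T where "T v = (1/c) *\<^sub>R S v" for v
 have bT: "bounded_clinear T" unfolding T_def using bounded_clinear_scaleR[OF bS] .
 have saT: "selfadj T" using bT unfolding selfadj_def by (simp add: T_def selfadjD[OF S])
 have nT: "norm (T v) <= norm v" for v using c(1) c(2)[of v] by (simp add: T_def field_simps)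
 define B where "B v = v - T (T v)" for v
 have bB: "bounded_clinear B" unfolding B_def
  using bounded_clinear_diff[OF bounded_clinear_id(2) bounded_clinear_compose[OF bT bT]] by (simp add: o_def)
 have saB: "selfadj B" using bB unfolding selfadj_def
  by (simp add: B_def cinner_diff_left cinner_diff_right selfadjD[OF saT])
 have "norm (B v) <= norm v" for v
 proof -
  have "(norm (B v))^2 = (norm v)^2 - 2 * Re (cinner v (T (T v))) + (norm (T (T v)))^2"
   unfolding B_def by (rule norm2_diff)
  also have "cinner v (T (T v)) = of_real ((norm (T v))^2)"
   by (simp add: selfadjD(2)[OF saT, symmetric] cinner_self)
  finally have "(norm (B v))^2 = (norm v)^2 - 2 * (norm (T v))^2 + (norm (T (T v)))^2" by simp
  moreover have "(norm (T (T v)))^2 <= (norm (T v))^2" by (intro power_mono nT) simp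
  moreover have "0 <= (norm (T v))^2" by simp
  ultimately have "(norm (B v))^2 <= (norm v)^2" by linarith
  then show ?thesis by (rule power2_le_imp_le) simp
 qed
 from operator_sqrt[OF saB this] obtain W where W: "selfadj W" "!!v. 0 <= Re (cinner (W v) v)"
  "!!v. W (W v) = v - B v"
  and WC: "!!C v. bounded_clinear C ==> \<forall>v. C (B v) = B (C v) ==> C (W v) = W (C v)" by blast
 have bW: "bounded_clinear W" using W(1) by (rule selfadjD)
 have WW: "W (W v) = T (T v)" for v using W(3) by (simp add: B_def)
 have TW: "T (W v) = W (T v)" for v
  by (rule WC[OF bT]) (simp add: B_def bounded_clinearD(3)[OF bT])
 define K where "K = {v. W v + T v = 0}"
 have "K = (%v. W v + T v) -` {0}" unfolding K_def by auto
 then have "closed K"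
  using closed_vimage[OF closed_singleton linear_continuous_on[OF bounded_clinearD(1)[OF bounded_clinear_add[OF bW bT]]]]
  by simp
 moreover have "csubspace K" unfolding K_def csubspace_def
 proof (safe)
  show "W (x + y) + T (x + y) = 0" if "W x + T x = 0" "W y + T y = 0" for x y
  proof -
   have "W (x + y) + T (x + y) = (W x + T x) + (W y + T y)"
    by (simp add: bounded_clinearD(2)[OF bW] bounded_clinearD(2)[OF bT])
   then show ?thesis using that by simp
  qed
  show "W (c *\<^sub>C x) + T (c *\<^sub>C x) = 0" if "W x + T x = 0" for c x
   using that by (simp add: bounded_clinearD(6)[OF bW] bounded_clinearD(6)[OF bT] scaleC_add_right[symmetric])
 qed (simp add: bounded_clinearD(5)[OF bW] bounded_clinearD(5)[OF bT])
 moreover have "Re (cinner (S v) v) <= 0" if "v \<in> K" for v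
 proof -
  have "T v = - W v" using that unfolding K_def by (simp add: eq_neg_iff_add_eq_0 add.commute)
  then have "Re (cinner (T v) v) <= 0" using W(2)[of v] by (simp add: cinner_minus_left)
  then show ?thesis using c(1) by (simp add: T_def divide_le_0_iff)
 qed
 moreover have "0 <= Re (cinner (S v) v)" if v: "\<forall>s\<in>K. cinner v s = 0" for v
 proof -
  have "W v - T v \<in> K" unfolding K_def
   by (simp add: bounded_clinearD(3)[OF bW] bounded_clinearD(3)[OF bT] WW TW)
  then have "cinner v (W v - T v) = 0" using v by blast
  then have "cinner v (T v) = cinner v (W v)" by (simp add: cinner_diff_right)
  then have "cinner (T v) v = cinner (W v) v" by (metis selfadjD(2)[OF saT] selfadjD(2)[OF W(1)])
  then have "0 <= Re (cinner (T v) v)" using W(2)[of v] by simp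
  then show ?thesis using c(1) by (simp add: T_def zero_le_mult_iff zero_le_divide_iff)
 qed
 moreover have "C v \<in> K" if C: "bounded_clinear C" "\<forall>v. C (S v) = S (C v)" "v \<in> K" for C v
 proof -
  have CT: "C (T v) = T (C v)" for v using C by (simp add: T_def bounded_clinearD(7)[OF C(1)])
  then have "\<forall>v. C (B v) = B (C v)" by (simp add: B_def bounded_clinearD(3)[OF C(1)])
  then have "W (C v) + T (C v) = C (W v + T v)"
   using WC[OF C(1)] CT by (simp add: bounded_clinearD(2)[OF C(1)])
  then show ?thesis using C(3) bounded_clinearD(5)[OF C(1)] unfolding K_def by simp
 qed
 ultimately show ?thesis by blast
qed

section \<open>Projections, spectral subspaces and spectral measures\<close>

definition is_proj :: "('a::complex_hilbert_space => 'a) => bool" where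
 "is_proj E \<longleftrightarrow> selfadj E \<and> (\<forall>v. E (E v) = E v)"

lemma is_projD:
 assumes "is_proj E"
 shows "selfadj E" "bounded_clinear E" "E (E v) = E v" "cinner (E u) v = cinner u (E v)"
 using assms by (auto simp: is_proj_def selfadj_def)

lemma is_proj_proj: "closed S ==> csubspace S ==> is_proj (proj S)"
 by (simp add: is_proj_def selfadj_def proj_bounded_clinear proj_selfadjoint proj_idem)

lemma is_proj_cinner: "is_proj E ==> cinner (E v) v = of_real ((norm (E v))^2)"
 by (metis cinner_self is_projD(3,4))

lemma is_proj_pyth:
 assumes "is_proj E" shows "(norm v)^2 = (norm (E v))^2 + (norm (v - E v))^2"
proof -
 have "cinner v (E v) = of_real ((norm (E v))^2)"
  using is_proj_cinner[OF assms] is_projD(4)[OF assms] by metis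
 then show ?thesis using norm2_diff[of v "E v"] by simp
qed

lemma is_proj_le: "is_proj E ==> norm (E v) <= norm v"
 by (rule power2_le_imp_le) (use is_proj_pyth[of E v] in auto)

lemma is_proj_compl: "is_proj E ==> is_proj (%v. v - E v)"
 unfolding is_proj_def selfadj_def
 by (auto simp: bounded_clinear_diff cinner_diff_left cinner_diff_right bounded_clinearD(3))

text \<open>Equality of norms at \<open>E v\<close> together with Pythagoras for \<open>F\<close>
  shows that \<open>F\<close> fixes \<open>E v\<close>; equality at \<open>v - E v\<close>, which
  \<open>E\<close> kills, shows that \<open>F\<close> kills it too.\<close>

lemma is_proj_eqI:
 assumes E: "is_proj E" and F: "is_proj F" and eq: "!!v. (norm (E v))^2 = (norm (F v))^2"
 shows "E = F"
proof
 fix v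
 have "F (E v) = E v"
  using is_proj_pyth[OF F, of "E v"] eq[of "E v"] is_projD(3)[OF E] by simp
 moreover have "E (v - E v) = 0" by (simp add: bounded_clinearD(3)[OF is_projD(2)[OF E]] is_projD(3)[OF E])
 then have "F (v - E v) = 0" using eq[of "v - E v"] by simp
 ultimately show "E v = F v" by (simp add: bounded_clinearD(3)[OF is_projD(2)[OF F]])
qed

text \<open>For increasing projections the squared distance of \<open>Q n v\<close> and
  \<open>Q m v\<close> is the difference of their squared norms, and these norms form a bounded
  increasing sequence.\<close>

lemma is_proj_incseq_limit:
 assumes Q: "!!n. is_proj (Q n)" and le: "!!m n v. m <= n ==> Q n (Q m v) = Q m v"
 shows "\<exists>P. is_proj P \<and> (\<forall>v. (%n. Q n v) \<longlonglongrightarrow> P v)"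
proof -
 have pyth: "(norm (Q n v - Q m v))^2 = (norm (Q n v))^2 - (norm (Q m v))^2" if "m <= n" for m n v
 proof -
  have "cinner (Q n v) (Q m v) = cinner (Q m v) v"
   using le[OF that] is_projD(4)[OF Q, of n v "Q m v"] is_projD(4)[OF Q, of m v v]
   by (metis is_projD(4)[OF Q])
  then show ?thesis using norm2_diff[of "Q n v" "Q m v"] is_proj_cinner[OF Q, of m v] by simp
 qed
 have "incseq (%n. (norm (Q n v))^2)" for v
  unfolding incseq_def using pyth by (metis diff_ge_0_iff_ge zero_le_power2)
 moreover have "\<forall>n. (norm (Q n v))^2 <= (norm v)^2" for v
  using is_proj_le[OF Q] by (simp add: power_mono)
 ultimately have cq: "Cauchy (%n. (norm (Q n v))^2)" for v
  by (rule incseq_convergent[of "%n. (norm (Q n v))^2" "(norm v)^2"]) (erule LIMSEQ_imp_Cauchy)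
 have "Cauchy (%n. Q n v)" for v
 proof (rule CauchyI')
  fix e :: real assume e: "0 < e"
  then obtain M where M: "!!m n. m >= M ==> n >= M ==> norm ((norm (Q m v))^2 - (norm (Q n v))^2) < e^2"
   using CauchyD[OF cq[of v], of "e^2"] by auto
  have "norm (Q m v - Q n v) < e" if mn: "m >= M" "m < n" for m n
  proof -
   have "(norm (Q n v - Q m v))^2 < e^2" using pyth[of m n v] M[of n m] mn by (simp add: abs_less_iff)
   then show ?thesis using e by (simp add: norm_minus_commute power2_less_imp_less)
  qed
  then show "\<exists>M. \<forall>m\<ge>M. \<forall>n>m. dist (Q m v) (Q n v) < e" unfolding dist_norm by blast
 qed
 then have "\<forall>v. \<exists>w. (%n. Q n v) \<longlonglongrightarrow> w" using Cauchy_convergent_iff convergent_def by blast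
 then obtain P where P: "!!v. (%n. Q n v) \<longlonglongrightarrow> P v" by metis
 have "bounded_clinear P"
 proof (rule bounded_clinearI[where K=1])
  show "P (u + v) = P u + P v" for u v
   by (rule LIMSEQ_unique[OF P]) (simp add: bounded_clinearD(2)[OF is_projD(2)[OF Q]] tendsto_add P)
  show "P (c *\<^sub>C v) = c *\<^sub>C P v" for c v
   by (rule LIMSEQ_unique[OF P]) (simp add: bounded_clinearD(6)[OF is_projD(2)[OF Q]] tendsto_scaleC P)
  show "norm (P v) <= norm v * 1" for v
   by (rule LIMSEQ_le_const2[OF tendsto_norm[OF P]]) (simp add: is_proj_le[OF Q])
 qed
 moreover have "cinner (P u) v = cinner u (P v)" for u v
 proof (rule LIMSEQ_unique)
  show "(%n. cinner (Q n u) v) \<longlonglongrightarrow> cinner (P u) v" by (intro tendsto_intros P)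
  show "(%n. cinner (Q n u) v) \<longlonglongrightarrow> cinner u (P v)"
   unfolding is_projD(4)[OF Q] by (intro tendsto_intros P)
 qed
 moreover have "P (P v) = P v" for v
 proof -
  have "P (Q m v) = Q m v" for m
  proof (rule LIMSEQ_unique[OF P])
   show "(%n. Q n (Q m v)) \<longlonglongrightarrow> Q m v"
    by (rule Lim_transform_eventually[OF tendsto_const])
     (use le in \<open>auto simp: eventually_sequentially intro!: exI[of _ m]\<close>)
  qed
  then show ?thesis
   using LIMSEQ_unique[OF bounded_clinear_tendsto[OF \<open>bounded_clinear P\<close> P[of v]]] P[of v] by simp
 qed
 ultimately show ?thesis using P unfolding is_proj_def selfadj_def by blast
qed

text \<open>\<open>H l\<close> stands for the spectral subspace of \<open>A\<close> for the
  half-line up to and including \<open>l\<close>. It is described by form inequalities: the form of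
  \<open>A\<close> is at most \<open>l\<close> on \<open>H l\<close> and at least \<open>l\<close>
  on its orthogonal complement. The family is continuous from the right and trivial outside the
  interval from \<open>-R\<close> to \<open>R\<close>.\<close>

definition spectral_flag :: "('a::complex_hilbert_space => 'a) => (real => 'a set) => real => bool" where
 "spectral_flag A H R \<longleftrightarrow> R > 0 \<and> (\<forall>l. closed (H l) \<and> csubspace (H l)) \<and> (\<forall>l m. l <= m --> H l \<subseteq> H m) \<and>
  (\<forall>l. (\<Inter>m\<in>{l<..}. H m) \<subseteq> H l) \<and> (\<forall>l v. v \<in> H l --> A v \<in> H l) \<and>
  (\<forall>l v. v \<in> H l --> Re (cinner (A v) v) <= l * (norm v)^2) \<and>
  (\<forall>l v. (\<forall>s\<in>H l. cinner v s = 0) --> l * (norm v)^2 <= Re (cinner (A v) v)) \<and>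
  (\<forall>l\<le>-R. H l = {0}) \<and> (\<forall>l\<ge>R. H l = UNIV)"

text \<open>\<open>K \<mu>\<close> comes from splitting \<open>A - \<mu>\<close>. It increases with
  \<open>\<mu>\<close>: the component of a vector of \<open>K \<mu>\<close> orthogonal to a later
  \<open>K \<nu>\<close> stays in \<open>K \<mu>\<close>, so its form is both at most
  \<open>\<mu>\<close> and at least \<open>\<nu>\<close> times its squared norm. The properties
  taken from \<open>spectral_split\<close> do not include continuity from the right; the
  intersection over all larger parameters supplies it.\<close>

lemma spectral_family:
 assumes A: "selfadj A"
 shows "\<exists>H R. spectral_flag A H R"
proof -
 have bA: "bounded_clinear A" using A by (rule selfadjD)
 obtain R where R: "R > 0" "!!x. norm (A x) <= norm x * R" using bounded_clinear_bound[OF bA] by blast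
 have AR: "\<bar>Re (cinner (A v) v)\<bar> <= R * (norm v)^2" for v
 proof -
  have "\<bar>Re (cinner (A v) v)\<bar> <= norm (A v) * norm v"
   using cinner_cauchy_schwarz abs_Re_le_cmod order_trans by blast
  also have "... <= norm v * R * norm v" by (intro mult_right_mono R) simp
  finally show ?thesis by (simp add: power2_eq_square mult_ac)
 qed
 define S where "S \<mu> v = A v - \<mu> *\<^sub>R v" for \<mu> :: real and v
 have bS: "bounded_clinear (S \<mu>)" for \<mu>
  unfolding S_def by (intro bounded_clinear_diff bA bounded_clinear_scaleR bounded_clinear_id)
 have sS: "selfadj (S \<mu>)" for \<mu>
  unfolding selfadj_def using bS by (auto simp: S_def cinner_diff_left cinner_diff_right selfadjD[OF A])
 have SRe: "Re (cinner (S \<mu> v) v) = Re (cinner (A v) v) - \<mu> * (norm v)^2" for \<mu> v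
  by (simp add: S_def cinner_diff_left Re_cinner_self)
 have "\<forall>\<mu>. \<exists>K. closed K \<and> csubspace K \<and> (\<forall>v\<in>K. Re (cinner (S \<mu> v) v) <= 0) \<and>
   (\<forall>v. (\<forall>s\<in>K. cinner v s = 0) --> 0 <= Re (cinner (S \<mu> v) v)) \<and>
   (\<forall>C. bounded_clinear C --> (\<forall>v. C (S \<mu> v) = S \<mu> (C v)) --> (\<forall>v\<in>K. C v \<in> K))"
  using spectral_split[OF sS] by blast
 then obtain K where K: "!!\<mu>. closed (K \<mu>)" "!!\<mu>. csubspace (K \<mu>)"
  and Kle: "!!\<mu> v. v \<in> K \<mu> ==> Re (cinner (S \<mu> v) v) <= 0"
  and Kge: "!!\<mu> v. \<forall>s\<in>K \<mu>. cinner v s = 0 ==> 0 <= Re (cinner (S \<mu> v) v)"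
  and KC': "!!\<mu> C v. bounded_clinear C ==> \<forall>v. C (S \<mu> v) = S \<mu> (C v) ==> v \<in> K \<mu> ==> C v \<in> K \<mu>"
  by metis
 have KC: "C v \<in> K \<mu>" if "bounded_clinear C" "!!v. C (A v) = A (C v)" "v \<in> K \<mu>" for \<mu> C v
  by (rule KC'[OF that(1) _ that(3)]) (simp add: S_def bounded_clinearD[OF that(1)] that(2))
 have KA: "A v \<in> K \<mu>" if "v \<in> K \<mu>" for \<mu> v using KC[OF bA] that by blast
 have Kmono: "K \<mu> \<subseteq> K \<nu>" if "\<mu> < \<nu>" for \<mu> \<nu>
 proof
  fix v assume v: "v \<in> K \<mu>"
  define w where "w = v - proj (K \<nu>) v"
  have "proj (K \<nu>) v \<in> K \<mu>"
   by (rule KC[OF proj_bounded_clinear[OF K] _ v]) (rule proj_comm[OF K A, symmetric], rule KA)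
  then have "w \<in> K \<mu>" unfolding w_def using csubspace_diff[OF K(2) v] by blast
  then have "Re (cinner (A w) w) <= \<mu> * (norm w)^2" using Kle[of w \<mu>] SRe by simp
  moreover have "\<forall>s\<in>K \<nu>. cinner w s = 0" unfolding w_def using proj_orth[OF K] by blast
  then have "\<nu> * (norm w)^2 <= Re (cinner (A w) w)" using Kge[of \<nu> w] SRe by simp
  ultimately have "(\<nu> - \<mu>) * (norm w)^2 <= 0" by (simp add: left_diff_distrib)
  then have "w = 0" using that by (simp add: mult_le_0_iff)
  then have "v = proj (K \<nu>) v" by (simp add: w_def)
  then show "v \<in> K \<nu>" using proj_in[OF K] by metis
 qed
 define H where "H l = (\<Inter>m\<in>{l<..}. K m)" for l
 have HK: "K l \<subseteq> H l" for l unfolding H_def using Kmono by auto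
 have cs: "csubspace (H l)" for l using K(2) unfolding csubspace_def H_def by simp
 have Hle: "Re (cinner (A v) v) <= l * (norm v)^2" if "v \<in> H l" for l v
 proof (cases "v = 0")
  case False
  show ?thesis
  proof (rule field_le_epsilon)
   fix e :: real assume e: "0 < e"
   define m where "m = l + e / (norm v)^2"
   have "v \<in> K m" using that e False unfolding H_def m_def by simp
   then have "Re (cinner (A v) v) <= m * (norm v)^2" using Kle[of v m] SRe by simp
   also have "... = l * (norm v)^2 + e" using False by (simp add: m_def field_simps)
   finally show "Re (cinner (A v) v) <= l * (norm v)^2 + e" .
  qed
 qed simp
 have Hge: "l * (norm v)^2 <= Re (cinner (A v) v)" if "\<forall>s\<in>H l. cinner v s = 0" for l v
  using Kge[of l v] that HK[of l] SRe[of l v] by auto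
 \<comment> \<open>One more than the norm bound \<open>R\<close> makes the two bounds for the form
   contradict each other strictly, which forces the vector to vanish.\<close>
 have H0: "H l = {0}" if "l <= - (R + 1)" for l
 proof -
  have "v = 0" if v: "v \<in> H l" for v
  proof -
   have "- R * (norm v)^2 <= l * (norm v)^2" using Hle[OF v] AR[of v] by (simp add: abs_le_iff)
   then have "(- R - l) * (norm v)^2 <= 0" by (simp add: left_diff_distrib)
   then show "v = 0" using \<open>l <= - (R + 1)\<close> by (simp add: mult_le_0_iff)
  qed
  then show ?thesis using cs[of l] unfolding csubspace_def by auto
 qed
 have H1: "H l = UNIV" if "l >= R + 1" for l
 proof -
  have cl: "closed (H l)" unfolding H_def using K(1) by auto
  have "v \<in> H l" for v
  proof -
   let ?w = "v - proj (H l) v"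
   have "l * (norm ?w)^2 <= R * (norm ?w)^2"
    using Hge[of l ?w] AR[of ?w] proj_orth[OF cl cs] by (simp add: abs_le_iff)
   then have "(l - R) * (norm ?w)^2 <= 0" by (simp add: left_diff_distrib)
   then have "?w = 0" using \<open>l >= R + 1\<close> by (simp add: mult_le_0_iff)
   then show ?thesis using proj_in[OF cl cs, of v] by simp
  qed
  then show ?thesis by auto
 qed
 have "spectral_flag A H (R + 1)" unfolding spectral_flag_def
 proof (intro conjI allI impI)
  show "closed (H l)" for l unfolding H_def using K(1) by auto
  show "H l \<subseteq> H m" if "l <= m" for l m unfolding H_def using that by auto
  show "(\<Inter>m\<in>{l<..}. H m) \<subseteq> H l" for l
  proof
   fix v assume v: "v \<in> (\<Inter>m\<in>{l<..}. H m)"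
   show "v \<in> H l" unfolding H_def
   proof
    fix m assume "m \<in> {l<..}"
    then obtain k where "l < k" "k < m" using dense by auto
    then show "v \<in> K m" using v unfolding H_def by auto
   qed
  qed
  show "A v \<in> H l" if "v \<in> H l" for l v using that KA unfolding H_def by auto
 qed (use R cs Hle Hge H0 H1 in auto)
 then show ?thesis by blast
qed

text \<open>The error function \<open>J\<close> is Lipschitz with respect to the bounded increasing \<open>F\<close> with
  arbitrarily small constants, hence constant.\<close>

lemma small_increments_const:
 fixes J F :: "real => real"
 assumes ab: "a < b" and J: "!!x y. a <= x ==> x <= y ==> y <= b ==> \<bar>J y - J x\<bar> <= (y - x) * (F y - F x)"
 shows "J b = J a"
proof -
 have bound: "\<bar>J b - J a\<bar> <= (b - a) / real n * (F b - F a)" if n: "n > 0" for n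
 proof -
  define x where "x i = a + (b - a) * real i / real n" for i
  have x: "x 0 = a" "x n = b" "x (Suc i) - x i = (b - a) / real n" for i
   using n by (auto simp: x_def field_simps)
  have xin: "a <= x i" for i using ab n by (simp add: x_def)
  have xin': "x i <= b" if "i <= n" for i
  proof -
   have "(b - a) * (real i / real n) <= b - a" using ab that n by (intro mult_left_le) auto
   then show ?thesis by (simp add: x_def)
  qed
  have "\<bar>J (x i) - J a\<bar> <= (b - a) / real n * (F (x i) - F a)" if "i <= n" for i
   using that
  proof (induction i)
   case (Suc i)
   have "\<bar>J (x (Suc i)) - J (x i)\<bar> <= (x (Suc i) - x i) * (F (x (Suc i)) - F (x i))"
   proof (rule J)
    have "0 <= (b - a) / real n" using ab by simp
    then show "x i <= x (Suc i)" using x(3)[of i] by linarith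
   qed (use xin xin'[OF Suc.prems] in auto)
   moreover have "\<bar>J (x (Suc i)) - J a\<bar> <= \<bar>J (x (Suc i)) - J (x i)\<bar> + \<bar>J (x i) - J a\<bar>" by simp
   moreover have "\<bar>J (x i) - J a\<bar> <= (b - a) / real n * (F (x i) - F a)" using Suc by simp
   ultimately show ?case unfolding x(3) right_diff_distrib by linarith
  qed (simp add: x)
  from this[of n] show ?thesis by (simp add: x)
 qed
 have "(%n. (b - a) * (F b - F a) * (1 / real n)) \<longlonglongrightarrow> (b - a) * (F b - F a) * 0"
  by (intro tendsto_intros lim_1_over_n)
 then have "\<bar>J b - J a\<bar> <= (b - a) * (F b - F a) * 0"
  by (rule LIMSEQ_le_const) (use bound in \<open>auto intro!: exI[of _ 1]\<close>)
 then show ?thesis by simp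
qed

text \<open>\<open>F v\<close> is the distribution function of a finite measure
  \<open>\<mu> v\<close>, and \<open>E B\<close> is the only projection with
  \<open>(norm (E B v))^2 = measure (\<mu> v) B\<close> for all \<open>v\<close>. Half-lines have
  such a projection, and complements and disjoint countable unions inherit it, so every Borel set
  has one by induction over the Dynkin class. Additivity of \<open>E\<close> follows from
  uniqueness.\<close>

lemma spectral_measure_exists:
 fixes A :: "'a::complex_hilbert_space => 'a"
 assumes A: "selfadj A"
 shows "\<exists>E. spectral_measure A E"
proof -
 have bA: "bounded_clinear A" using A by (rule selfadjD)
 obtain H R where flag: "spectral_flag A H R" using spectral_family[OF A] by blast
 have R: "R > 0" and cl: "!!l. closed (H l)" and cs: "!!l. csubspace (H l)"
  and mono: "!!l m. l <= m ==> H l \<subseteq> H m" and rc: "!!l. (\<Inter>m\<in>{l<..}. H m) \<subseteq> H l"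
  and HA: "!!l v. v \<in> H l ==> A v \<in> H l"
  and H0: "!!l. l <= -R ==> H l = {0}" and H1: "!!l. l >= R ==> H l = UNIV"
  using flag unfolding spectral_flag_def by simp_all
 have Hle: "Re (cinner (A v) v) <= l * (norm v)^2" if "v \<in> H l" for l v
  using flag that unfolding spectral_flag_def by (elim conjE) simp
 have Hge: "l * (norm v)^2 <= Re (cinner (A v) v)" if "\<forall>s\<in>H l. cinner v s = 0" for l v
  using flag that unfolding spectral_flag_def by (elim conjE) simp
 define P where "P l = proj (H l)" for l
 have isP: "is_proj (P l)" for l unfolding P_def by (rule is_proj_proj[OF cl cs])
 have bP: "bounded_clinear (P l)" for l by (rule is_projD(2)[OF isP])
 have PH: "P l v \<in> H l" for l v unfolding P_def by (rule proj_in[OF cl cs])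
 have PP: "P m (P l v) = P l v" if "l <= m" for l m v
  unfolding P_def by (rule proj_fixed[OF cl cs]) (use mono[OF that] PH[of l v] in \<open>auto simp: P_def\<close>)
 have PP': "P l (P m v) = P l v" if "l <= m" for l m v
  by (rule cinner_ext) (metis PP[OF that] is_projD(4)[OF isP])
 have PA: "A (P l v) = P l (A v)" for l v unfolding P_def by (rule proj_comm[OF cl cs A HA])
 define F where "F v l = (norm (P l v))^2" for v l
 have pythP: "(norm (P m v - P l v))^2 = F v m - F v l" if "l <= m" for l m v
 proof -
  have "cinner (P m v) (P l v) = cinner (P l v) v"
   by (metis PP[OF that] is_projD(4)[OF isP])
  then show ?thesis
   using norm2_diff[of "P m v" "P l v"] is_proj_cinner[OF isP, of l v] by (simp add: F_def)
 qed
 have Fmono: "F v l <= F v m" if "l <= m" for v l m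
  using pythP[OF that, of v] by (metis diff_ge_0_iff_ge zero_le_power2)
 have F0: "F v l = 0" if "l <= -R" for v l using PH[of l v] H0[OF that] by (simp add: F_def)
 have P1: "P l v = v" if "l >= R" for v l
  unfolding P_def by (rule proj_fixed[OF cl cs]) (simp add: H1[OF that])
 have F1: "F v l = (norm v)^2" if "l >= R" for v l by (simp add: F_def P1[OF that])
 \<comment> \<open>The complements of the projections increase and therefore converge. The limit
   lies in \<open>H m\<close> for every \<open>m > l\<close>, hence in \<open>H l\<close> by
   continuity from the right, and is the projection of \<open>v\<close>.\<close>
 have Pseq: "(%n. P (l + 1 / real (Suc n)) v) \<longlonglongrightarrow> P l v" for l v
 proof -
  define Q where "Q n v = v - P (l + 1 / real (Suc n)) v" for n v
  have isQ: "is_proj (Q n)" for n unfolding Q_def by (rule is_proj_compl[OF isP])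
  have QQ: "Q n (Q m v) = Q m v" if "m <= n" for m n v
  proof -
   have "l + 1 / real (Suc n) <= l + 1 / real (Suc m)" using that by (simp add: frac_le)
   from PP'[OF this] show ?thesis by (simp add: Q_def bounded_clinearD(3)[OF bP])
  qed
  obtain P' where P': "!!v. (%n. Q n v) \<longlonglongrightarrow> P' v" "is_proj P'"
   using is_proj_incseq_limit[of Q, OF isQ QQ] by blast
  have lim: "(%n. P (l + 1 / real (Suc n)) v) \<longlonglongrightarrow> v - P' v"
   using tendsto_diff[OF tendsto_const[of v] P'(1)[of v]] by (simp add: Q_def)
  have "v - P' v \<in> H m" if "m > l" for m
  proof -
   obtain N where N: "1 / real (Suc N) < m - l" using reals_Archimedean[of "m - l"] \<open>m > l\<close>
    by (auto simp: inverse_eq_divide)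
   have "P (l + 1 / real (Suc (n + N))) v \<in> H m" for n
   proof -
    have "1 / real (Suc (n + N)) <= 1 / real (Suc N)" by (simp add: frac_le)
    then have "l + 1 / real (Suc (n + N)) <= m" using N by simp
    then show ?thesis using PH mono by blast
   qed
   moreover have "(%n. P (l + 1 / real (Suc (n + N))) v) \<longlonglongrightarrow> v - P' v"
    using LIMSEQ_ignore_initial_segment[OF lim, of N] by simp
   ultimately show ?thesis by (rule closed_sequentially[OF cl])
  qed
  then have "v - P' v \<in> H l" using rc[of l] by auto
  moreover have "cinner (v - (v - P' v)) s = 0" if "s \<in> H l" for s
  proof -
   have "Q n s = 0" for n
   proof -
    have "s \<in> H (l + 1 / real (Suc n))" using that mono[of l "l + 1 / real (Suc n)"] by auto
    then have "P (l + 1 / real (Suc n)) s = s" unfolding P_def by (rule proj_fixed[OF cl cs])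
    then show ?thesis unfolding Q_def by simp
   qed
   then have "(%n. Q n s) = (%n. 0)" by (rule ext)
   then have "P' s = 0" using P'(1)[of s] by (simp add: LIMSEQ_const_iff)
   then show ?thesis using is_projD(4)[OF P'(2), of v s] by simp
  qed
  ultimately have "P l v = v - P' v" unfolding P_def by (rule proj_eqI[OF cl cs])
  then show ?thesis using lim by simp
 qed
 have Frc: "continuous (at_right l) (F v)" for l v
  unfolding continuous_within
 proof (rule order_tendstoI)
  fix a assume a: "a < F v l"
  have "a < F v x" if "l < x" for x using a Fmono[of l x v] that by linarith
  then show "\<forall>\<^sub>F x in at_right l. a < F v x"
   by (rule eventually_mono[OF eventually_at_right_less[of l]])
 next
  fix a assume "F v l < a"
  moreover have "(%n. F v (l + 1 / real (Suc n))) \<longlonglongrightarrow> F v l"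
   unfolding F_def by (intro tendsto_intros Pseq)
  ultimately have "\<forall>\<^sub>F n in sequentially. F v (l + 1 / real (Suc n)) < a" by (intro order_tendstoD(2))
  then obtain n where n: "F v (l + 1 / real (Suc n)) < a" unfolding eventually_sequentially by blast
  have "F v x < a" if "x < l + 1 / real (Suc n)" for x
   using Fmono[of x "l + 1 / real (Suc n)" v] that n by linarith
  then show "\<forall>\<^sub>F x in at_right l. F v x < a"
   unfolding eventually_at_right_field
   by (intro exI[of _ "l + 1 / real (Suc n)"] conjI allI impI) simp_all
 qed
 have Fbot: "(F v \<longlongrightarrow> 0) at_bot" for v
  by (rule tendsto_eventually) (auto simp: eventually_at_bot_linorder F0 intro!: exI[of _ "-R"])
 have Ftop: "(F v \<longlongrightarrow> (norm v)^2) at_top" for v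
  by (rule tendsto_eventually) (auto simp: eventually_at_top_linorder F1 intro!: exI[of _ R])
 define \<mu> where "\<mu> v = interval_measure (F v)" for v
 have sets\<mu> [simp]: "sets (\<mu> v) = sets borel" "space (\<mu> v) = UNIV" for v by (simp_all add: \<mu>_def)
 have mb [simp]: "(borel_measurable (\<mu> v) :: (real => real) set) = borel_measurable borel" for v
  by (rule measurable_cong_sets) auto
 have emU: "emeasure (\<mu> v) UNIV = ennreal ((norm v)^2)" for v
  unfolding \<mu>_def by (rule interval_measure_UNIV[OF Fmono Frc Fbot Ftop]) auto
 have fin: "finite_measure (\<mu> v)" for v by (rule finite_measureI) (simp add: emU)
 have mU: "measure (\<mu> v) UNIV = (norm v)^2" for v using emU[of v] by (simp add: measure_def)
 have mI: "measure (\<mu> v) {..l} = F v l" for v l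
  unfolding \<mu>_def by (rule measure_interval_measure_Iic[OF Fmono Frc Fbot]) auto
 define ok where "ok B E \<longleftrightarrow> is_proj E \<and> (\<forall>v. (norm (E v))^2 = measure (\<mu> v) B)" for B E
 have ok_unique: "E = E'" if "ok B E" "ok B E'" for B E E'
  using that is_proj_eqI[of E E'] unfolding ok_def by auto
 \<comment> \<open>The measure of \<open>E' v\<close> has its whole mass on \<open>B'\<close>, so
   none is left for the disjoint set \<open>B\<close>.\<close>
 have ok_disj: "E (E' v) = 0" if "ok B E" "ok B' E'" "B \<inter> B' = {}" "B \<in> sets borel" "B' \<in> sets borel" for B B' E E' v
 proof -
  interpret finite_measure "\<mu> (E' v)" by (rule fin)
  have "measure (\<mu> (E' v)) B + measure (\<mu> (E' v)) B' = measure (\<mu> (E' v)) (B \<union> B')"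
   using that by (intro finite_measure_Union[symmetric]) auto
  also have "... <= measure (\<mu> (E' v)) UNIV" using bounded_measure[of "B \<union> B'"] by simp
  also have "... = (norm (E' v))^2" by (rule mU)
  also have "measure (\<mu> (E' v)) B' = (norm (E' (E' v)))^2" using that unfolding ok_def by simp
  also have "E' (E' v) = E' v" using that(2) is_projD(3) unfolding ok_def by blast
  finally have "(norm (E (E' v)))^2 <= 0" using that unfolding ok_def by simp
  then show ?thesis by simp
 qed
 \<comment> \<open>The projections of disjoint sets annihilate each other, so the partial sums
   \<open>Q n\<close> are increasing projections and converge strongly.\<close>
 have ok_union: "\<exists>E. ok (\<Union>i. B i) E \<and> (\<forall>v. (%i. Es i v) sums E v)"
  if ok: "!!i. ok (B i) (Es i)" and disj: "disjoint_family B" and B: "range B \<subseteq> sets borel" for B :: "nat => real set" and Es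
 proof -
  have isE: "is_proj (Es i)" for i using ok unfolding ok_def by blast
  have EE: "Es i (Es j v) = (if i = j then Es j v else 0)" for i j v
   using ok_disj[OF ok ok, of i j v] disj B is_projD(3)[OF isE] by (auto simp: disjoint_family_on_def)
  define Q where "Q n v = (\<Sum>i<n. Es i v)" for n v
  have bQ: "bounded_clinear (Q n)" for n unfolding Q_def
   by (rule bounded_clinear_sum) (rule is_projD(2)[OF isE])
  have EQ: "Es i (Q n v) = (if i < n then Es i v else 0)" for i n v
   unfolding Q_def bounded_clinearD(8)[OF is_projD(2)[OF isE]] by (simp add: EE if_distrib sum.delta' cong: if_cong)
  have QQ: "Q n (Q m v) = Q m v" if "m <= n" for m n v
  proof -
   have "Q n (Q m v) = (\<Sum>i<n. if i < m then Es i v else 0)" unfolding Q_def[of n] by (simp add: EQ)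
   also have "... = (\<Sum>i\<in>{..<n} \<inter> {..<m}. Es i v)" by (simp add: sum.inter_restrict lessThan_def)
   also have "{..<n} \<inter> {..<m} = {..<m}" using that by auto
   finally show ?thesis by (simp add: Q_def)
  qed
  have "selfadj (Q n)" for n unfolding selfadj_def
   using bQ by (auto simp: Q_def cinner_sum_left cinner_sum_right is_projD(4)[OF isE])
  then have isQ: "is_proj (Q n)" for n unfolding is_proj_def using QQ by simp
  obtain E where E: "is_proj E" "!!v. (%n. Q n v) \<longlonglongrightarrow> E v"
   using is_proj_incseq_limit[of Q, OF isQ QQ] by blast
  have nQ: "(norm (Q n v))^2 = (\<Sum>i<n. measure (\<mu> v) (B i))" for n v
  proof -
   have "complex_of_real ((norm (Q n v))^2) = cinner (Q n v) v" by (rule is_proj_cinner[OF isQ, symmetric])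
   also have "... = of_real (\<Sum>i<n. (norm (Es i v))^2)"
    by (simp add: Q_def cinner_sum_left is_proj_cinner[OF isE])
   finally have "(norm (Q n v))^2 = (\<Sum>i<n. (norm (Es i v))^2)" using of_real_eq_iff by blast
   then show ?thesis using ok unfolding ok_def by simp
  qed
  have "(norm (E v))^2 = measure (\<mu> v) (\<Union>i. B i)" for v
  proof (rule LIMSEQ_unique)
   interpret finite_measure "\<mu> v" by (rule fin)
   show "(%n. (norm (Q n v))^2) \<longlonglongrightarrow> (norm (E v))^2" by (intro tendsto_intros E)
   show "(%n. (norm (Q n v))^2) \<longlonglongrightarrow> measure (\<mu> v) (\<Union>i. B i)"
    unfolding nQ using finite_measure_UNION[of B] B disj by (simp add: sums_def)
  qed
  then show ?thesis using E unfolding ok_def sums_def Q_def by blast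
 qed
 have ok_ex: "\<exists>E. ok B E" if "B \<in> sets borel" for B
 proof -
  have "Int_stable (range (%a. {..a::real}))" unfolding Int_stable_def by auto
  moreover have "range (%a. {..a::real}) \<subseteq> Pow UNIV" by simp
  moreover have "B \<in> sigma_sets UNIV (range (%a. {..a::real}))"
   using that unfolding borel_eq_atMost by simp
  ultimately show ?thesis
  proof (induction rule: sigma_sets_induct_disjoint)
   case (basic B)
   then obtain a where "B = {..a}" by blast
   then have "ok B (P a)" using isP[of a] mI unfolding ok_def F_def by simp
   then show ?case by blast
  next
   case empty
   have "is_proj (%_. 0)" by (simp add: is_proj_def selfadj_def bounded_clinear_zero)
   then show ?case unfolding ok_def by auto
  next
   case (compl B)
   then obtain E where E: "ok B E" by blast
   have "B \<in> sets borel" using compl unfolding borel_eq_atMost by simp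
   then have "measure (\<mu> v) (UNIV - B) = (norm v)^2 - measure (\<mu> v) B" for v
    using finite_measure.finite_measure_compl[OF fin, of B v] by (simp add: mU)
   then have "ok (UNIV - B) (%v. v - E v)"
    using E is_proj_compl[of E] is_proj_pyth[of E] unfolding ok_def by (metis add_diff_cancel_left')
   then show ?case by blast
  next
   case (union B)
   then obtain Es where "!!i. ok (B i) (Es i)" by metis
   moreover have "range B \<subseteq> sets borel" using union unfolding borel_eq_atMost by simp
   ultimately show ?case using ok_union[of B Es] union by blast
  qed
 qed
 define E where "E B = (SOME E. ok B E)" for B
 have E: "ok B (E B)" if "B \<in> sets borel" for B unfolding E_def using ok_ex[OF that] by (rule someI_ex)
 have isE: "is_proj (E B)" if "B \<in> sets borel" for B using E[OF that] unfolding ok_def by blast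
 have "has_bochner_integral (\<mu> v) (%t. t) (Re (cinner (A v) v))" for v
 proof -
  interpret finite_measure "\<mu> v" by (rule fin)
  have nullc: "measure (\<mu> v) (- {-R<..R}) = 0"
  proof -
   have "measure (\<mu> v) {-R<..R} = F v R - F v (-R)"
    unfolding \<mu>_def using R by (intro measure_interval_measure_Ioc Fmono Frc) auto
   then have "measure (\<mu> v) {-R<..R} = measure (\<mu> v) (space (\<mu> v))" by (simp add: F0 F1 mU)
   then show ?thesis using finite_measure_compl[of "{-R<..R}"] by (simp add: Compl_eq_Diff_UNIV mU)
  qed
  have ae: "AE t in \<mu> v. t \<in> {-R<..R}"
   by (rule AE_I[of _ _ "- {-R<..R}"]) (auto simp: nullc emeasure_eq_measure)
  have int: "integrable (\<mu> v) (%t. t)"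
  proof (rule integrable_const_bound[of _ R])
   show "AE t in \<mu> v. norm t <= R" using ae by eventually_elim auto
  qed simp
  \<comment> \<open>\<open>J\<close> is the error in the first moment truncated at \<open>x\<close>.
    Over \<open>{x<..y}\<close> both of its terms grow by an amount between \<open>x\<close> and
    \<open>y\<close> times the increment of \<open>F v\<close>, so \<open>J\<close> changes by no
    more than \<open>small_increments_const\<close> allows.\<close>
  define J where "J x = (LINT t|\<mu> v. indicator {..x} t * t) - Re (cinner (A (P x v)) v)" for x
  have inti: "integrable (\<mu> v) (%t. indicator B t * t)" if "B \<in> sets borel" for B
   using integrable_mult_indicator[OF _ int, of B] that by simp
  have "J R = J (-R)"
  proof (rule small_increments_const[where J=J and F="F v"])
   fix x y assume "-R <= x" and xy: "x <= y" and "y <= R"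
   have m: "measure (\<mu> v) {x<..y} = F v y - F v x"
    unfolding \<mu>_def using xy by (intro measure_interval_measure_Ioc Fmono Frc) auto
   have I: "(LINT t|\<mu> v. indicator {..y} t * t) - (LINT t|\<mu> v. indicator {..x} t * t)
     = (LINT t|\<mu> v. indicator {x<..y} t * t)"
   proof -
    have "(LINT t|\<mu> v. indicator {x<..y} t * t)
      = (LINT t|\<mu> v. indicator {..y} t * t - indicator {..x} t * t)"
     using xy by (intro Bochner_Integration.integral_cong) (auto split: split_indicator)
    also have "... = (LINT t|\<mu> v. indicator {..y} t * t) - (LINT t|\<mu> v. indicator {..x} t * t)"
     by (rule Bochner_Integration.integral_diff) (auto intro: inti)
    finally show ?thesis by simp
   qed
   have Ile: "(LINT t|\<mu> v. indicator {x<..y} t * t) <= (LINT t|\<mu> v. indicator {x<..y} t * y)"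
    by (intro integral_mono inti integrable_real_indicator integrable_mult_left)
     (auto split: split_indicator simp: emeasure_finite less_top[symmetric])
   have Ige: "(LINT t|\<mu> v. indicator {x<..y} t * x) <= (LINT t|\<mu> v. indicator {x<..y} t * t)"
    by (intro integral_mono inti integrable_real_indicator integrable_mult_left)
     (auto split: split_indicator simp: emeasure_finite less_top[symmetric])
   define w where "w = P y v - P x v"
   have Aw: "cinner (A w) w = cinner (A (P y v)) v - cinner (A (P x v)) v"
   proof -
    have "cinner (A w) w = cinner (P y (A w) - P x (A w)) v"
     unfolding w_def by (simp add: cinner_diff_left cinner_diff_right is_projD(4)[OF isP])
    also have "P y (A w) - P x (A w) = A (P y w - P x w)"
     by (simp add: PA bounded_clinearD(3)[OF bA])
    also have "P y w - P x w = w"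
     unfolding w_def by (simp add: bounded_clinearD(3)[OF bP] PP[OF xy] PP'[OF xy] PP[OF order_refl])
    finally show ?thesis by (simp add: w_def bounded_clinearD(3)[OF bA] cinner_diff_left)
   qed
   have nw: "(norm w)^2 = F v y - F v x" unfolding w_def by (rule pythP[OF xy])
   have "w \<in> H y" unfolding w_def using PH mono[OF xy] by (intro csubspace_diff[OF cs]) auto
   then have w1: "Re (cinner (A w) w) <= y * (F v y - F v x)" using Hle nw by metis
   have "P x w = 0" unfolding w_def by (simp add: bounded_clinearD(3)[OF bP] PP'[OF xy] PP[OF order_refl])
   then have "\<forall>s\<in>H x. cinner w s = 0" using proj_zero_iff[OF cl cs] unfolding P_def by blast
   then have w2: "x * (F v y - F v x) <= Re (cinner (A w) w)" using Hge nw by metis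
   have "J y - J x = (LINT t|\<mu> v. indicator {x<..y} t * t) - Re (cinner (A w) w)"
    unfolding J_def Aw using I by simp
   then show "\<bar>J y - J x\<bar> <= (y - x) * (F v y - F v x)"
    using Ile Ige w1 w2 m by (simp add: left_diff_distrib abs_le_iff mult.commute)
  qed (use R in simp)
  moreover have "J (-R) = 0"
  proof -
   have "(LINT t|\<mu> v. indicator {..-R} t * t) = (LINT t|\<mu> v. 0)"
   proof (rule integral_cong_AE)
    show "AE t in \<mu> v. indicator {..-R} t * t = 0" using ae by eventually_elim (auto simp: indicator_def)
   qed auto
   moreover have "P (-R) v = 0" using PH[of "-R" v] H0[of "-R"] by simp
   ultimately show ?thesis by (simp add: J_def bounded_clinearD(5)[OF bA])
  qed
  moreover have "(LINT t|\<mu> v. indicator {..R} t * t) = (LINT t|\<mu> v. t)"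
  proof (rule integral_cong_AE)
   show "AE t in \<mu> v. indicator {..R} t * t = t" using ae by eventually_elim (auto simp: indicator_def)
  qed auto
  ultimately have "(LINT t|\<mu> v. t) = Re (cinner (A v) v)"
   by (simp add: J_def P1[OF order_refl])
  then show ?thesis using int by (simp add: has_bochner_integral_iff)
 qed
 then have "has_bochner_integral (\<mu> v) complex_of_real (complex_of_real (Re (cinner (A v) v)))" for v
  using has_bochner_integral_bounded_linear[OF bounded_linear_of_real] by blast
 then have hb: "has_bochner_integral (\<mu> v) complex_of_real (cinner (A v) v)" for v
  using selfadj_Re[OF A] by simp
 have meq: "measure_of UNIV (sets borel) (%B. ennreal (Re (cinner (E B v) v))) = \<mu> v" for v
 proof -
  interpret finite_measure "\<mu> v" by (rule fin)
  have "measure_of UNIV (sets borel) (%B. ennreal (Re (cinner (E B v) v)))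
    = measure_of UNIV (sets borel) (emeasure (\<mu> v))"
  proof (rule measure_of_eq)
   fix B assume "B \<in> sigma_sets UNIV (sets (borel :: real measure))"
   then have B: "B \<in> sets borel" by (simp add: sigma_algebra.sigma_sets_eq[OF sets.sigma_algebra_axioms, of borel, simplified])
   then have "Re (cinner (E B v) v) = measure (\<mu> v) B"
    using is_proj_cinner[OF isE] E[OF B] unfolding ok_def by simp
   then show "ennreal (Re (cinner (E B v) v)) = emeasure (\<mu> v) B" by (simp add: emeasure_eq_measure)
  qed simp
  also have "... = \<mu> v" using measure_of_of_measure[of "\<mu> v"] by simp
  finally show ?thesis .
 qed
 have "spectral_measure A E"
  unfolding spectral_measure_def
 proof (intro conjI ballI allI impI)
  fix B :: "real set" assume B: "B \<in> sets borel"
  show "bounded_clinear (E B)" "cadjoint (E B) = E B" "E B \<circ> E B = E B"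
   using isE[OF B] by (auto simp: is_proj_def selfadj_cadjoint selfadj_def)
 next
  have "ok UNIV id" unfolding ok_def is_proj_def selfadj_def by (simp add: mU)
  then show "E UNIV = id" using ok_unique[OF E] by auto
 next
  fix B :: "nat => real set" and v assume B: "range B \<subseteq> sets borel \<and> disjoint_family B"
  then have "ok (B i) (E (B i))" for i using E by auto
  then obtain E' where E': "ok (\<Union>i. B i) E'" "(%i. E (B i) v) sums E' v"
   using ok_union[of B "%i. E (B i)"] B by blast
  have "(\<Union>i. B i) \<in> sets borel" using B by auto
  then have "E (\<Union>i. B i) = E'" using ok_unique[OF E E'(1)] by blast
  then show "(%i. E (B i) v) sums E (\<Union>i. B i) v" using E'(2) by simp
 qed (simp add: meq hb)
 then show ?thesis by blast
qed

text \<open>The form at \<open>v - t *\<^sub>R A v\<close> is \<open>- 2 * t * b + t^2 * c\<close>,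
  where \<open>b\<close> is the squared norm of \<open>A v\<close>. For small positive
  \<open>t\<close> this can be nonnegative only if \<open>b\<close> vanishes.\<close>

lemma pos_op_zero:
 assumes A: "selfadj A" and pos: "!!v. 0 <= Re (cinner (A v) v)" and z: "Re (cinner (A v) v) = 0"
 shows "A v = 0"
proof (rule ccontr)
 assume ne: "A v \<noteq> 0"
 have bA: "bounded_clinear A" using A by (rule selfadjD)
 define b where "b = (norm (A v))^2"
 define c where "c = Re (cinner (A (A v)) (A v))"
 have b0: "b > 0" using ne by (simp add: b_def)
 have quad: "0 <= - 2 * t * b + t^2 * c" for t
 proof -
  have "0 <= Re (cinner (A (v - t *\<^sub>R A v)) (v - t *\<^sub>R A v))" by (rule pos)
  also have "... = - 2 * t * b + t^2 * c"
   using z Re_cinner_commute[of "A (A v)" v] selfadjD(2)[OF A, of "A v" v]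
   by (simp add: bounded_clinearD[OF bA] cinner_diff_left cinner_diff_right selfadjD(2)[OF A]
     b_def c_def cinner_self power2_eq_square algebra_simps)
  finally show ?thesis .
 qed
 have tc: "2 * b <= t * c" if "t > 0" for t
 proof -
  have "0 <= t * (t * c - 2 * b)" using quad[of t] by (simp add: power2_eq_square algebra_simps)
  then show ?thesis using that by (simp add: zero_le_mult_iff)
 qed
 have c0: "c >= 0" unfolding c_def by (rule pos)
 then have "2 * b <= b / (c + 1) * c" using b0 by (intro tc) auto
 also have "... = b * (c / (c + 1))" by simp
 also have "... <= b * 1" using b0 c0 by (intro mult_left_mono) auto
 finally show False using b0 by simp
qed

definition kernel :: "('a::complex_hilbert_space => 'b::complex_hilbert_space) => 'a set" where
 "kernel A = {v. A v = 0}"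

lemma kernel_closed:
 assumes "bounded_clinear A" shows "closed (kernel A)" "csubspace (kernel A)"
proof -
 have "kernel A = A -` {0}" by (auto simp: kernel_def)
 then show "closed (kernel A)"
  using closed_vimage[OF closed_singleton linear_continuous_on[OF bounded_clinearD(1)[OF assms]]] by simp
 show "csubspace (kernel A)" by (simp add: csubspace_def kernel_def bounded_clinearD[OF assms])
qed

text \<open>Positivity of \<open>A\<close> makes the first moment of the spectral distribution of a vector decide
  whether it is concentrated at \<open>0\<close>.\<close>

lemma spectral_measure_kernel:
 fixes A :: "'a::complex_hilbert_space => 'a"
 assumes A: "selfadj A" and pos: "!!v. 0 <= Re (cinner (A v) v)" and sm: "spectral_measure A E"
 shows "E {0} = proj (kernel A)" "E {0<..} = (%v. v - proj (kernel A) v)"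
proof -
 have bA: "bounded_clinear A" using A by (rule selfadjD)
 have E: "!!B. B \<in> sets borel ==> bounded_clinear (E B) \<and> cadjoint (E B) = E B \<and> E B \<circ> E B = E B"
  and EU: "E UNIV = id"
  and Esum: "!!B v. range B \<subseteq> sets borel ==> disjoint_family B ==> (%k::nat. E (B k) v) sums E (\<Union>k. B k) v"
  and Eint: "!!v. has_bochner_integral (measure_of UNIV (sets borel) (%B. ennreal (Re (cinner (E B v) v))))
    complex_of_real (cinner (A v) v)"
  using sm unfolding spectral_measure_def by simp_all
 have isE: "is_proj (E B)" if "B \<in> sets borel" for B
  unfolding is_proj_def selfadj_def
  using E[OF that] cinner_cadjoint[of "E B"] by (metis comp_apply)
 have E0: "E {} v = 0" for v
 proof -
  have "(%k::nat. E {} v) sums E {} v" using Esum[of "%_. {}" v] by (auto simp: disjoint_family_on_def)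
  then have "(%k::nat. E {} v) \<longlonglongrightarrow> 0" by (intro summable_LIMSEQ_zero sums_summable)
  then show ?thesis by (simp add: LIMSEQ_const_iff)
 qed
 have Eadd: "E (B \<union> C) v = E B v + E C v" if "B \<in> sets borel" "C \<in> sets borel" "B \<inter> C = {}" for B C v
 proof -
  define D where "D k = (if k = 0 then B else if k = 1 then C else {})" for k :: nat
  have "(%k. E (D k) v) sums E (\<Union>k. D k) v"
   by (rule Esum) (use that in \<open>auto simp: D_def disjoint_family_on_def\<close>)
  moreover have "(\<Union>k. D k) = B \<union> C" by (auto simp: D_def split: if_splits)
  moreover have "(%k. E (D k) v) sums (\<Sum>k\<in>{0,1}. E (D k) v)"
   by (rule sums_finite) (auto simp: D_def E0)
  ultimately show ?thesis using sums_unique2 by (fastforce simp: D_def)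
 qed
 have Eorth: "E B (E C v) = 0" if B: "B \<in> sets borel" and C: "C \<in> sets borel" and "B \<inter> C = {}" for B C v
 proof -
  define w where "w = E C v"
  have w: "E C w = w" unfolding w_def using is_projD(3)[OF isE[OF C]] .
  have BC: "is_proj (E (B \<union> C))" using B C by (intro isE) auto
  have "complex_of_real ((norm (E (B \<union> C) w))^2) = cinner (E B w) w + cinner (E C w) w"
   unfolding is_proj_cinner[OF BC, symmetric] by (simp add: Eadd[OF that] cinner_add_left)
  also have "... = of_real ((norm (E B w))^2 + (norm w)^2)"
   by (simp add: is_proj_cinner[OF isE[OF B]] w cinner_self)
  finally have "(norm (E (B \<union> C) w))^2 = (norm (E B w))^2 + (norm w)^2" using of_real_eq_iff by blast
  moreover have "(norm (E (B \<union> C) w))^2 <= (norm w)^2" using is_proj_le[OF BC] by (simp add: power_mono)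
  ultimately have "(norm (E B w))^2 <= 0" by simp
  then show ?thesis by (simp add: w_def)
 qed
 define N where "N v = measure_of UNIV (sets borel) (%B. ennreal (Re (cinner (E B v) v)))" for v
 have sN: "sets (N v) = sets borel" "space (N v) = UNIV" for v
  by (simp_all add: N_def sets.sigma_sets_eq[of borel, simplified])
 have emN: "emeasure (N v) B = ennreal ((norm (E B v))^2)" if B: "B \<in> sets borel" for B v
 proof -
  have "emeasure (N v) B = ennreal (Re (cinner (E B v) v))"
   unfolding N_def
  proof (rule emeasure_measure_of_sigma)
   show "sigma_algebra UNIV (sets (borel :: real measure))"
    using sets.sigma_algebra_axioms[of "borel :: real measure"] by simp
   show "positive (sets borel) (%B. ennreal (Re (cinner (E B v) v)))"
    by (simp add: positive_def E0)
   show "countably_additive (sets borel) (%B. ennreal (Re (cinner (E B v) v)))"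
   proof (rule countably_additiveI)
    fix D :: "nat => real set" assume D: "range D \<subseteq> sets borel" "disjoint_family D"
    have "(%k. Re (cinner (E (D k) v) v)) sums Re (cinner (E (\<Union>k. D k) v) v)"
     by (rule bounded_linear.sums[OF bounded_linear_Re bounded_linear.sums[OF bounded_linear_cinner_left Esum[OF D]]])
    moreover have "0 <= Re (cinner (E (D k) v) v)" for k
     using is_proj_cinner[OF isE, of "D k" v] D(1) by auto
    ultimately show "suminf (%k. ennreal (Re (cinner (E (D k) v) v))) = ennreal (Re (cinner (E (\<Union>k. D k) v) v))"
     by (simp add: suminf_ennreal2 sums_iff)
   qed
  qed (use B in simp)
  then show ?thesis using is_proj_cinner[OF isE[OF B]] by simp
 qed
 have int: "integrable (N v) (%t. t)" "(LINT t|N v. t) = Re (cinner (A v) v)" for v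
 proof -
  have hb: "has_bochner_integral (N v) complex_of_real (cinner (A v) v)" using Eint unfolding N_def .
  have "has_bochner_integral (N v) (%t. Re (complex_of_real t)) (Re (cinner (A v) v))"
   by (rule has_bochner_integral_bounded_linear[OF bounded_linear_Re hb])
  then show "integrable (N v) (%t. t)" "(LINT t|N v. t) = Re (cinner (A v) v)"
   by (auto simp: has_bochner_integral_iff)
 qed
 have aeN: "AE t in N v. t \<notin> B" if "B \<in> sets borel" "E B v = 0" for B v
  by (rule AE_I[of _ _ B]) (use that emN sN in auto)
 have nonzero: "AE t in N v. f t = 0" if "integrable (N v) f" "(LINT t|N v. f t) = 0" "AE t in N v. 0 <= f t" for f :: "real => real" and v
  using integral_nonneg_eq_0_iff_AE[OF that(1,3)] that(2) by simp
 \<comment> \<open>The measure of \<open>w\<close> lives on the negative numbers, while its mean is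
   the nonnegative form of \<open>A\<close> at \<open>w\<close>. Hence its total mass, the squared
   norm of \<open>w\<close>, vanishes.\<close>
 have neg0: "E {..<0} v = 0" for v
 proof -
  define w where "w = E {..<0} v"
  have b: "{..<0::real} \<in> sets borel" by simp
  have "E {0..} w = 0" unfolding w_def by (rule Eorth) auto
  then have ae: "AE t in N w. t < 0" using aeN[of "{0..}" w] by (auto simp: not_le elim: eventually_mono)
  have "(LINT t|N w. - t) >= 0" by (rule integral_nonneg_AE) (use ae in \<open>auto elim: eventually_mono\<close>)
  then have "Re (cinner (A w) w) = 0" using int[of w] pos[of w] by simp
  then have "AE t in N w. - t = 0" using int[of w] ae by (intro nonzero) (auto elim: eventually_mono)
  with ae have "AE t in N w. False" by eventually_elim auto
  then have "emeasure (N w) UNIV = 0" using AE_iff_measurable[of UNIV "N w" "%_. False"] sN by simp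
  then have "w = 0" using emN[of UNIV w] EU by simp
  then show ?thesis by (simp add: w_def)
 qed
 have split: "v = E {0} v + E {0<..} v" for v
 proof -
  have "UNIV = {..<0} \<union> ({0} \<union> {(0::real)<..})" by auto
  moreover have "E ({..<0} \<union> ({0} \<union> {0<..})) v = E {..<0} v + E ({0} \<union> {0<..}) v" by (rule Eadd) auto
  ultimately have "E UNIV v = E {..<0} v + E ({0} \<union> {0<..}) v" by simp
  also have "E ({0} \<union> {0<..}) v = E {0} v + E {0<..} v" by (rule Eadd) auto
  finally show ?thesis using EU neg0 by simp
 qed
 have ker1: "A (E {0} v) = 0" for v
 proof -
  let ?w = "E {0} v"
  have "E (-{0}) ?w = 0" by (rule Eorth) auto
  then have "AE t in N ?w. t = 0" using aeN[of "-{0}" ?w] by auto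
  then have "(LINT t|N ?w. t) = (LINT t|N ?w. 0)" using sN by (intro integral_cong_AE) (auto cong: measurable_cong_sets)
  then show ?thesis using pos_op_zero[OF A pos] int by simp
 qed
 have ker2: "E {0} v = v" if "A v = 0" for v
 proof -
  have ae: "AE t in N v. 0 <= t" using aeN[of "{..<0}" v] neg0 by (auto simp: not_less)
  have "AE t in N v. t = 0" using int[of v] ae that by (intro nonzero) auto
  then have "AE t in N v. \<not> 0 < t" by eventually_elim simp
  then have "emeasure (N v) {0<..} = 0"
   by (subst (asm) AE_iff_measurable[OF _ refl]) (auto simp: sN greaterThan_def)
  then have "E {0<..} v = 0" using emN[of "{0<..}" v] by simp
  then show ?thesis using split[of v] by simp
 qed
 show 1: "E {0} = proj (kernel A)"
 proof
  fix v
  show "E {0} v = proj (kernel A) v"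
  proof (rule proj_eqI[OF kernel_closed[OF bA], symmetric])
   show "E {0} v \<in> kernel A" using ker1 by (simp add: kernel_def)
   fix s assume "s \<in> kernel A"
   then have "E {0} s = s" using ker2 by (simp add: kernel_def)
   then show "cinner (v - E {0} v) s = 0"
    using is_projD(4)[OF isE, of "{0}" v s] by (simp add: cinner_diff_left)
  qed
 qed
 show "E {0<..} = (%v. v - proj (kernel A) v)"
 proof
  fix v show "E {0<..} v = v - proj (kernel A) v" using split[of v] unfolding 1 by (metis add_diff_cancel_left')
 qed
qed

text \<open>A spectral measure exists, and all spectral measures take the same values at these two
  sets. This is what resolves the \<open>THE\<close> in \<open>spectral_projection\<close>.\<close>

lemma spectral_projection_pos:
 fixes A :: "'a::complex_hilbert_space => 'a"
 assumes A: "selfadj A" and pos: "!!v. 0 <= Re (cinner (A v) v)"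
 shows "spectral_projection A {0} = proj (kernel A)"
  and "spectral_projection A {0<..} = (%v. v - proj (kernel A) v)"
proof -
 obtain E where "spectral_measure A E" using spectral_measure_exists[OF A] by blast
 then show "spectral_projection A {0} = proj (kernel A)"
  "spectral_projection A {0<..} = (%v. v - proj (kernel A) v)"
  unfolding spectral_projection_def
  using spectral_measure_kernel[OF A pos] by (intro the_equality; metis)+
qed

text \<open>The vectors whose iterates tend to 0 form a closed subspace \<open>S\<close>. It
  contains every \<open>w - C w\<close>, because the squared norm of
  \<open>(C ^^ N) (w - C w)\<close> is at most the decrement of the convergent sequence of squared
  norms of \<open>(C ^^ N) w\<close>. A vector orthogonal to all \<open>w - C w\<close> is fixed by
  \<open>C\<close>, so the component of \<open>v\<close> orthogonal to \<open>S\<close> is the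
  limit.\<close>

lemma contraction_powers_tendsto:
 fixes C :: "'a::complex_hilbert_space => 'a"
 assumes C: "selfadj C" and pos: "!!v. 0 <= Re (cinner (C v) v)"
  and le1: "!!v. Re (cinner (C v) v) <= (norm v)^2"
 shows "norm ((C ^^ N) v) <= norm v"
  and "(%N. (C ^^ N) v) \<longlonglongrightarrow> proj {v. C v = v} v"
proof -
 have bC: "bounded_clinear C" using C by (rule selfadjD)
 have sq: "(norm (C u))^2 <= Re (cinner (C u) u)" for u
 proof -
  have "0 <= Re (cinner (C (u - C u)) (u - C u))" by (rule pos)
  also have "... = Re (cinner (C u) u) - 2 * (norm (C u))^2 + Re (cinner (C (C u)) (C u))"
   using Re_cinner_commute[of "C (C u)" u] selfadjD(2)[OF C, of "C u" u]
   by (simp add: bounded_clinearD[OF bC] cinner_diff_left cinner_diff_right selfadjD(2)[OF C] cinner_self)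
  finally show ?thesis using le1[of "C u"] by linarith
 qed
 have n1: "norm (C u) <= norm u" for u
  by (rule power2_le_imp_le[OF order_trans[OF sq le1]]) simp
 show nN: "norm ((C ^^ N) v) <= norm v" for N v
  by (induction N) (use n1 order_trans in auto)
 have bN: "bounded_clinear (C ^^ N)" for N by (rule bounded_clinear_funpow[OF bC])
 have saN: "cinner ((C ^^ N) u) v = cinner u ((C ^^ N) v)" for N u v
  by (induction N arbitrary: u v) (auto simp: selfadjD(2)[OF C] funpow_swap1)
 define S where "S = {v. (%N. (C ^^ N) v) \<longlonglongrightarrow> 0}"
 have cS: "csubspace S" unfolding csubspace_def S_def
 proof (safe)
  show "(%N. (C ^^ N) 0) \<longlonglongrightarrow> 0" by (simp add: bounded_clinearD(5)[OF bN])
  show "(%N. (C ^^ N) (x + y)) \<longlonglongrightarrow> 0" if "(%N. (C ^^ N) x) \<longlonglongrightarrow> 0" "(%N. (C ^^ N) y) \<longlonglongrightarrow> 0" for x y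
   using tendsto_add[OF that] by (simp add: bounded_clinearD(2)[OF bN])
  show "(%N. (C ^^ N) (c *\<^sub>C x)) \<longlonglongrightarrow> 0" if "(%N. (C ^^ N) x) \<longlonglongrightarrow> 0" for c x
   using tendsto_scaleC[OF that, of c] by (simp add: bounded_clinearD(6)[OF bN])
 qed
 have clS: "closed S"
  unfolding closed_sequential_limits
 proof (intro allI impI, elim conjE)
  fix f l assume f: "\<forall>n. f n \<in> S" and l: "f \<longlonglongrightarrow> l"
  have "(%N. norm ((C ^^ N) l)) \<longlonglongrightarrow> 0"
  proof (rule LIMSEQ_I)
   fix r :: real assume r: "0 < r"
   obtain n where n: "norm (f n - l) < r / 2" using LIMSEQ_D[OF l, of "r/2"] r by auto
   have "(%N. (C ^^ N) (f n)) \<longlonglongrightarrow> 0" using f unfolding S_def by blast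
   then obtain M where M: "!!N. N >= M ==> norm ((C ^^ N) (f n)) < r / 2"
    using LIMSEQ_D[of _ 0 "r/2"] r by auto
   have "norm ((C ^^ N) l) < r" if "N >= M" for N
   proof -
    have "(C ^^ N) l = (C ^^ N) (f n) - (C ^^ N) (f n - l)" by (simp add: bounded_clinearD(3)[OF bN])
    then have "norm ((C ^^ N) l) <= norm ((C ^^ N) (f n)) + norm ((C ^^ N) (f n - l))"
     using norm_triangle_ineq4 by metis
    then show ?thesis using M[OF that] n nN[of N "f n - l"] by linarith
   qed
   then show "\<exists>no. \<forall>n\<ge>no. norm (norm ((C ^^ n) l) - 0) < r" by auto
  qed
  then show "l \<in> S" unfolding S_def by (simp add: tendsto_norm_zero_iff)
 qed
 have ran: "w - C w \<in> S" for w
 proof -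
  have dec: "(norm ((C ^^ Suc N) w))^2 <= (norm ((C ^^ N) w))^2" for N using n1 by (simp add: power_mono)
  have "decseq (%N. (norm ((C ^^ N) w))^2)" using dec by (rule decseq_SucI)
  then obtain L where L: "(%N. (norm ((C ^^ N) w))^2) \<longlonglongrightarrow> L"
   using decseq_convergent[of "%N. (norm ((C ^^ N) w))^2" 0] by auto
  have "(%N. (norm ((C ^^ N) w))^2 - (norm ((C ^^ Suc N) w))^2) \<longlonglongrightarrow> L - L"
   by (intro tendsto_diff L LIMSEQ_Suc[OF L])
  then have lim0: "(%N. (norm ((C ^^ N) w))^2 - (norm ((C ^^ Suc N) w))^2) \<longlonglongrightarrow> 0" by simp
  have "(%N. (norm ((C ^^ N) (w - C w)))^2) \<longlonglongrightarrow> 0"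
  proof (rule tendsto_sandwich[OF _ _ tendsto_const lim0])
   have "(norm ((C ^^ N) (w - C w)))^2 <= (norm ((C ^^ N) w))^2 - (norm ((C ^^ Suc N) w))^2" for N
   proof -
    let ?u = "(C ^^ N) w"
    have "(C ^^ N) (w - C w) = ?u - C ?u" by (simp add: bounded_clinearD(3)[OF bN] funpow_swap1)
    then have "(norm ((C ^^ N) (w - C w)))^2 = (norm ?u)^2 - 2 * Re (cinner ?u (C ?u)) + (norm (C ?u))^2"
     by (simp add: norm2_diff)
    then show ?thesis using sq[of ?u] by (simp add: selfadjD(2)[OF C])
   qed
   then show "\<forall>\<^sub>F N in sequentially. (norm ((C ^^ N) (w - C w)))^2 <= (norm ((C ^^ N) w))^2 - (norm ((C ^^ Suc N) w))^2"
    by simp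
  qed simp
  from tendsto_real_sqrt[OF this] show ?thesis unfolding S_def by (simp add: tendsto_norm_zero_iff)
 qed
 have ker: "{v. C v = v} = kernel (%v. v - C v)" unfolding kernel_def by auto
 have kc: "closed {v. C v = v}" "csubspace {v. C v = v}"
  unfolding ker using kernel_closed[OF bounded_clinear_diff[OF bounded_clinear_id(2) bC]] by auto
 define z where "z = v - proj S v"
 have "cinner z (w - C w) = 0" for w unfolding z_def by (rule proj_orth[OF clS cS ran])
 then have "cinner z w = cinner (C z) w" for w by (simp add: cinner_diff_right selfadjD(2)[OF C])
 then have Cz: "C z = z" using cinner_ext by metis
 then have CNz: "(C ^^ N) z = z" for N by (induction N) auto
 have pS: "(%N. (C ^^ N) (proj S v)) \<longlonglongrightarrow> 0" using proj_in[OF clS cS, of v] unfolding S_def by simp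
 have "(C ^^ N) v = (C ^^ N) (proj S v) + z" for N
  using bounded_clinearD(2)[OF bN, of N "proj S v" z] CNz by (simp add: z_def)
 then have lim: "(%N. (C ^^ N) v) \<longlonglongrightarrow> z" using tendsto_add[OF pS tendsto_const[of z]] by simp
 have "proj {v. C v = v} v = z"
 proof (rule proj_eqI[OF kc])
  show "z \<in> {v. C v = v}" using Cz by simp
  fix s assume "s \<in> {v. C v = v}"
  then have "(C ^^ N) s = s" for N by (induction N) auto
  then have "cinner (proj S v) s = cinner ((C ^^ N) (proj S v)) s" for N by (simp add: saN)
  moreover have "(%N. cinner ((C ^^ N) (proj S v)) s) \<longlonglongrightarrow> cinner 0 s" by (intro tendsto_intros pS)
  ultimately show "cinner (v - z) s = 0" by (simp add: z_def LIMSEQ_const_iff)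
 qed
 then show "(%N. (C ^^ N) v) \<longlonglongrightarrow> proj {v. C v = v} v" using lim by simp
qed

section \<open>Square-summable sequences of vectors\<close>

text \<open>A normal functional, which is a series of \<open>cinner (T (u k)) (v k)\<close>, becomes
  a single vector functional on this infinite amplification. The bicommutant argument is then an
  argument about one vector.\<close>

typedef (overloaded) 'a ell2 = "{f :: nat => 'a::complex_hilbert_space. summable (%k. (norm (f k))^2)}"
 morphisms ell2_nth Ell2
 by (rule exI[of _ "%_. 0"]) simp

setup_lifting type_definition_ell2

lemma l2_summable_iff:
 "summable (%k. (norm (f k :: 'a::real_normed_vector))^2) \<longleftrightarrow> (\<exists>C. \<forall>n. L2_set (%k. norm (f k)) {..<n} <= C)"
proof
 assume s: "summable (%k. (norm (f k))^2)"
 show "\<exists>C. \<forall>n. L2_set (%k. norm (f k)) {..<n} <= C"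
  unfolding L2_set_def
  by (intro exI[of _ "sqrt (suminf (%k. (norm (f k))^2))"] allI real_sqrt_le_mono sum_le_suminf s) auto
next
 assume "\<exists>C. \<forall>n. L2_set (%k. norm (f k)) {..<n} <= C"
 then obtain C where C: "!!n. L2_set (%k. norm (f k)) {..<n} <= C" by blast
 show "summable (%k. (norm (f k))^2)"
 proof (rule summableI_nonneg_bounded)
  fix n
  have "sum (%k. (norm (f k))^2) {..<n} = (L2_set (%k. norm (f k)) {..<n})^2"
   by (simp add: L2_set_def sum_nonneg)
  also have "... <= C^2" by (intro power_mono C) simp
  finally show "sum (%k. (norm (f k))^2) {..<n} <= C^2" .
 qed simp
qed

lemma l2_summable_add:
 assumes "summable (%k. (norm (f k :: 'a::real_normed_vector))^2)" "summable (%k. (norm (g k))^2)"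
 shows "summable (%k. (norm (f k + g k))^2)"
proof (rule summable_comparison_test')
 show "summable (%k. 2 * (norm (f k))^2 + 2 * (norm (g k))^2)"
  by (intro summable_add summable_mult assms)
 fix k :: nat
 have "(norm (f k + g k))^2 <= (norm (f k) + norm (g k))^2"
  by (intro power_mono norm_triangle_ineq) simp
 also have "... <= 2 * (norm (f k))^2 + 2 * (norm (g k))^2"
  using zero_le_power2[of "norm (f k) - norm (g k)"] by (simp add: power2_eq_square algebra_simps)
 finally show "norm ((norm (f k + g k))^2) <= 2 * (norm (f k))^2 + 2 * (norm (g k))^2" by simp
qed

lemma l2_summable_scaleC:
 "summable (%k. (norm (f k))^2) ==> summable (%k. (norm (c *\<^sub>C f k))^2)"
 by (simp add: norm_scaleC power_mult_distrib summable_mult)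

lemma l2_cinner_summable:
 assumes "summable (%k. (norm (f k :: 'a::complex_hilbert_space))^2)" "summable (%k. (norm (g k))^2)"
 shows "summable (%k. norm (cinner (f k) (g k)))"
proof (rule summable_comparison_test')
 show "summable (%k. (norm (f k))^2 + (norm (g k))^2)" by (intro summable_add assms)
 fix k :: nat
 have "cmod (cinner (f k) (g k)) <= norm (f k) * norm (g k)" by (rule cinner_cauchy_schwarz)
 also have "... <= (norm (f k))^2 + (norm (g k))^2"
 proof -
  have "0 <= (norm (f k) - norm (g k))^2 + (norm (f k))^2 + (norm (g k))^2" by simp
  then show ?thesis by (simp add: power2_eq_square algebra_simps)
 qed
 finally show "norm (norm (cinner (f k) (g k))) <= (norm (f k))^2 + (norm (g k))^2" by simp
qed

instantiation ell2 :: (complex_hilbert_space) real_normed_vector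
begin

lift_definition zero_ell2 :: "'a ell2" is "%_. 0" by simp
lift_definition plus_ell2 :: "'a ell2 => 'a ell2 => 'a ell2" is "%f g k. f k + g k"
 by (rule l2_summable_add)
lift_definition scaleR_ell2 :: "real => 'a ell2 => 'a ell2" is "%r f k. r *\<^sub>R f k"
 by (simp add: power_mult_distrib summable_mult)
definition uminus_ell2 :: "'a ell2 => 'a ell2" where "uminus_ell2 f = (- 1) *\<^sub>R f"
definition minus_ell2 :: "'a ell2 => 'a ell2 => 'a ell2" where "minus_ell2 f g = f + (- 1) *\<^sub>R g"
lift_definition norm_ell2 :: "'a ell2 => real" is "%f. sqrt (suminf (%k. (norm (f k))^2))" .
definition dist_ell2 :: "'a ell2 => 'a ell2 => real" where "dist_ell2 f g = norm (f - g)"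
definition sgn_ell2 :: "'a ell2 => 'a ell2" where "sgn_ell2 f = inverse (norm f) *\<^sub>R f"
definition uniformity_ell2 :: "('a ell2 \<times> 'a ell2) filter" where
 "uniformity_ell2 = (INF e\<in>{0 <..}. principal {(x :: 'a ell2, y). dist x y < e})"
definition open_ell2 :: "'a ell2 set => bool" where
 "open_ell2 S \<longleftrightarrow> (\<forall>x\<in>S. \<forall>\<^sub>F (x', y) in uniformity. x' = x --> y \<in> S)"

lemma ell2_norm_le_iff:
 "norm (f :: 'a ell2) <= C \<longleftrightarrow> (\<forall>n. L2_set (%k. norm (ell2_nth f k)) {..<n} <= C)"
proof transfer
 fix f :: "nat => 'a" and C :: real assume s: "summable (%k. (norm (f k))^2)"
 show "sqrt (suminf (%k. (norm (f k))^2)) <= C \<longleftrightarrow> (\<forall>n. L2_set (%k. norm (f k)) {..<n} <= C)"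
 proof
  assume "sqrt (suminf (%k. (norm (f k))^2)) <= C"
  moreover have "L2_set (%k. norm (f k)) {..<n} <= sqrt (suminf (%k. (norm (f k))^2))" for n
   unfolding L2_set_def by (intro real_sqrt_le_mono sum_le_suminf s) auto
  ultimately show "\<forall>n. L2_set (%k. norm (f k)) {..<n} <= C" using order_trans by blast
 next
  assume "\<forall>n. L2_set (%k. norm (f k)) {..<n} <= C"
  moreover have "(%n. L2_set (%k. norm (f k)) {..<n}) \<longlonglongrightarrow> sqrt (suminf (%k. (norm (f k))^2))"
   unfolding L2_set_def by (intro tendsto_real_sqrt summable_LIMSEQ s)
  ultimately show "sqrt (suminf (%k. (norm (f k))^2)) <= C" by (intro LIMSEQ_le_const2) auto
 qed
qed

lemma ell2_nth_le: "norm (ell2_nth f k) <= norm (f :: 'a ell2)"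
proof -
 have "norm (ell2_nth f k) <= L2_set (%k. norm (ell2_nth f k)) {..<Suc k}"
  by (rule member_le_L2_set) auto
 then show ?thesis using ell2_norm_le_iff[of f "norm f"] order_trans by blast
qed

instance
proof
 fix f g h :: "'a ell2" and r s :: real
 show "f + g + h = f + (g + h)" "f + g = g + f" "0 + f = f" "r *\<^sub>R (f + g) = r *\<^sub>R f + r *\<^sub>R g"
  "(r + s) *\<^sub>R f = r *\<^sub>R f + s *\<^sub>R f" "r *\<^sub>R s *\<^sub>R f = (r * s) *\<^sub>R f" "1 *\<^sub>R f = f"
  by (transfer; simp add: algebra_simps)+
 show "- f + f = 0" unfolding uminus_ell2_def by transfer simp
 show "f - g = f + - g" by (simp add: uminus_ell2_def minus_ell2_def)
 show "dist f g = norm (f - g)" by (rule dist_ell2_def)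
 show "sgn f = inverse (norm f) *\<^sub>R f" by (rule sgn_ell2_def)
 show "uniformity = (INF e\<in>{0 <..}. principal {(x, y :: 'a ell2). dist x y < e})"
  by (rule uniformity_ell2_def)
 show "open A = (\<forall>x\<in>A. \<forall>\<^sub>F (x', y) in uniformity. x' = x --> y \<in> A)" for A :: "'a ell2 set"
  by (rule open_ell2_def)
 show "norm (r *\<^sub>R f) = \<bar>r\<bar> * norm f"
  by transfer (simp add: power_mult_distrib suminf_mult real_sqrt_mult)
 show "norm f = 0 \<longleftrightarrow> f = 0"
 proof
  assume "norm f = 0"
  then have "ell2_nth f k = 0" for k using ell2_nth_le[of f k] by simp
  then show "f = 0" by transfer auto
 next
  assume "f = 0" then show "norm f = 0" by simp (transfer, simp)
 qed
 show "norm (f + g) <= norm f + norm g"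
  unfolding ell2_norm_le_iff
 proof
  fix n
  have "L2_set (%k. norm (ell2_nth (f + g) k)) {..<n} <= L2_set (%k. norm (ell2_nth f k) + norm (ell2_nth g k)) {..<n}"
   by (intro L2_set_mono) (auto simp: plus_ell2.rep_eq norm_triangle_ineq)
  also have "... <= L2_set (%k. norm (ell2_nth f k)) {..<n} + L2_set (%k. norm (ell2_nth g k)) {..<n}"
   by (rule L2_set_triangle_ineq)
  also have "... <= norm f + norm g"
   using ell2_norm_le_iff[of f "norm f"] ell2_norm_le_iff[of g "norm g"] by (intro add_mono) auto
  finally show "L2_set (%k. norm (ell2_nth (f + g) k)) {..<n} <= norm f + norm g" .
 qed
qed

end

lemma ell2_nth_diff: "ell2_nth (f - g) k = ell2_nth f k - ell2_nth g k"
 unfolding minus_ell2_def plus_ell2.rep_eq scaleR_ell2.rep_eq by simp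

lemma ell2_complete:
 fixes X :: "nat => 'a::complex_hilbert_space ell2"
 assumes X: "Cauchy X" shows "convergent X"
proof -
 have "Cauchy (%n. ell2_nth (X n) k)" for k
 proof (rule CauchyI)
  fix e :: real assume "0 < e"
  then obtain M where M: "!!m n. m >= M ==> n >= M ==> norm (X m - X n) < e" using CauchyD[OF X] by blast
  have "norm (ell2_nth (X m) k - ell2_nth (X n) k) < e" if "m >= M" "n >= M" for m n
   using ell2_nth_le[of "X m - X n" k] M[OF that] by (simp add: ell2_nth_diff)
  then show "\<exists>M. \<forall>m\<ge>M. \<forall>n\<ge>M. norm (ell2_nth (X m) k - ell2_nth (X n) k) < e" by blast
 qed
 then have "\<forall>k. \<exists>l. (%n. ell2_nth (X n) k) \<longlonglongrightarrow> l" using Cauchy_convergent_iff convergent_def by blast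
 then obtain L where L: "!!k. (%n. ell2_nth (X n) k) \<longlonglongrightarrow> L k" by metis
 have tail: "L2_set (%k. norm (ell2_nth (X n) k - L k)) {..<j} <= e"
  if N: "!!m n. m >= N ==> n >= N ==> norm (X m - X n) < e" and n: "n >= N" for N e n j
 proof (rule LIMSEQ_le_const2)
  show "(%m. L2_set (%k. norm (ell2_nth (X n) k - ell2_nth (X m) k)) {..<j})
    \<longlonglongrightarrow> L2_set (%k. norm (ell2_nth (X n) k - L k)) {..<j}"
   unfolding L2_set_def by (intro tendsto_intros L)
  have "L2_set (%k. norm (ell2_nth (X n) k - ell2_nth (X m) k)) {..<j} <= e" if "m >= N" for m
   using ell2_norm_le_iff[of "X n - X m" e] N[OF n that] by (simp add: ell2_nth_diff less_imp_le)
  then show "\<exists>M. \<forall>m\<ge>M. L2_set (%k. norm (ell2_nth (X n) k - ell2_nth (X m) k)) {..<j} <= e" by blast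
 qed
 obtain N1 where N1: "!!m n. m >= N1 ==> n >= N1 ==> norm (X m - X n) < 1"
  using CauchyD[OF X, of 1] by auto
 have "summable (%k. (norm (ell2_nth (X N1) k - L k))^2)"
  unfolding l2_summable_iff using tail[OF N1 order_refl] by blast
 moreover have "summable (%k. (norm (ell2_nth (X N1) k))^2)" using ell2_nth[of "X N1"] by simp
 ultimately have "summable (%k. (norm ((- 1) *\<^sub>R (ell2_nth (X N1) k - L k) + ell2_nth (X N1) k))^2)"
  by (intro l2_summable_add) (simp_all add: norm_minus_commute)
 then have sL: "summable (%k. (norm (L k))^2)" by simp
 define Y where "Y = Ell2 L"
 have Y: "ell2_nth Y = L" unfolding Y_def by (rule Ell2_inverse) (simp add: sL)
 have "X \<longlonglongrightarrow> Y"
 proof (rule LIMSEQ_I)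
  fix e :: real assume e: "0 < e"
  obtain N where N: "!!m n. m >= N ==> n >= N ==> norm (X m - X n) < e / 2"
   using CauchyD[OF X, of "e/2"] e by auto
  have "norm (X n - Y) < e" if "n >= N" for n
  proof -
   have "norm (X n - Y) <= e / 2"
    unfolding ell2_norm_le_iff ell2_nth_diff Y using tail[OF N that] by blast
   then show ?thesis using e by simp
  qed
  then show "\<exists>no. \<forall>n\<ge>no. norm (X n - Y) < e" by blast
 qed
 then show ?thesis by (rule convergentI)
qed

instance ell2 :: (complex_hilbert_space) banach
 by standard (rule ell2_complete)

instantiation ell2 :: (complex_hilbert_space) complex_hilbert_space
begin

lift_definition scaleC_ell2 :: "complex => 'a ell2 => 'a ell2" is "%c f k. c *\<^sub>C f k"
 by (rule l2_summable_scaleC)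
lift_definition cinner_ell2 :: "'a ell2 => 'a ell2 => complex" is
 "%f g. suminf (%k. cinner (f k) (g k))" .

instance
proof
 fix f g h :: "'a ell2" and c d :: complex and r :: real
 show "c *\<^sub>C (f + g) = c *\<^sub>C f + c *\<^sub>C g" "(c + d) *\<^sub>C f = c *\<^sub>C f + d *\<^sub>C f"
  "c *\<^sub>C d *\<^sub>C f = (c * d) *\<^sub>C f" "of_real r *\<^sub>C f = r *\<^sub>R f"
  by (transfer; simp add: scaleC_add_right scaleC_add_left scaleC_scaleC scaleC_of_real)+
 show "cinner (f + g) h = cinner f h + cinner g h"
  by transfer (simp add: cinner_add_left suminf_add l2_cinner_summable summable_norm_cancel)
 show "cinner (c *\<^sub>C f) g = c * cinner f g"
  by transfer (simp add: cinner_scaleC_left suminf_mult l2_cinner_summable summable_norm_cancel)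
 show "cinner g f = cnj (cinner f g)"
 proof transfer
  fix f g :: "nat => 'a" assume fg: "summable (%k. (norm (f k))^2)" "summable (%k. (norm (g k))^2)"
  have "(%k. cnj (cinner (f k) (g k))) sums cnj (suminf (%k. cinner (f k) (g k)))"
   using summable_sums[OF summable_norm_cancel[OF l2_cinner_summable[OF fg]]] by (simp add: sums_cnj)
  then show "suminf (%k. cinner (g k) (f k)) = cnj (suminf (%k. cinner (f k) (g k)))"
   by (simp add: sums_iff cinner_commute[symmetric])
 qed
 show "cinner f f = of_real ((norm f)^2)"
 proof transfer
  fix f :: "nat => 'a" assume s: "summable (%k. (norm (f k))^2)"
  have "suminf (%k. cinner (f k) (f k)) = of_real (suminf (%k. (norm (f k))^2))"
   unfolding cinner_self by (rule suminf_of_real[OF s, symmetric])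
  then show "suminf (%k. cinner (f k) (f k)) = of_real ((sqrt (suminf (%k. (norm (f k))^2)))^2)"
   by (simp add: suminf_nonneg s)
 qed
qed

end

lemma closure_csubspace:
 assumes "csubspace (S :: 'a::complex_hilbert_space set)" shows "csubspace (closure S)"
 unfolding csubspace_def
proof (intro conjI ballI allI)
 show "0 \<in> closure S" using assms closure_subset unfolding csubspace_def by blast
 fix x assume "x \<in> closure S"
 then obtain f where f: "!!n. f n \<in> S" "f \<longlonglongrightarrow> x" by (auto simp: closure_sequential)
 show "x + y \<in> closure S" if y: "y \<in> closure S" for y
 proof -
  obtain g where g: "!!n. g n \<in> S" "g \<longlonglongrightarrow> y" using y by (auto simp: closure_sequential)
  have "(%n. f n + g n) \<longlonglongrightarrow> x + y" by (intro tendsto_add f g)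
  then show ?thesis unfolding closure_sequential
   using assms f g unfolding csubspace_def by (intro exI[of _ "%n. f n + g n"]) blast
 qed
 show "c *\<^sub>C x \<in> closure S" for c
  unfolding closure_sequential using assms f tendsto_scaleC[OF f(2), of c] unfolding csubspace_def
  by (intro exI[of _ "%n. c *\<^sub>C f n"]) blast
qed

lemma csubspace_cspan: "csubspace (cspan B)"
 by (simp add: csubspace_def cspan_zero cspan_add cspan_scaleC)

lemma cspan_induct':
 assumes "x \<in> cspan B" "csubspace S" "B \<subseteq> S" shows "x \<in> S"
proof -
 obtain F c where F: "finite F" "F \<subseteq> B" "x = (\<Sum>e\<in>F. c e *\<^sub>C e)" using assms(1) unfolding cspan_def by blast
 from F(1,2) have "(\<Sum>e\<in>F. c e *\<^sub>C e) \<in> S"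
  by (induction F rule: finite_induct) (use assms in \<open>auto simp: csubspace_def\<close>)
 then show ?thesis using F by simp
qed

section \<open>Density in the bicommutant\<close>

definition amp :: "('a::complex_hilbert_space => 'a) => 'a ell2 => 'a ell2" where
 "amp T f = Ell2 (%k. T (ell2_nth f k))"

definition ell2_inj :: "nat => 'a::complex_hilbert_space => 'a ell2" where
 "ell2_inj l x = Ell2 (%k. if k = l then x else 0)"

lemma ell2_nth_inj: "ell2_nth (ell2_inj l x) k = (if k = l then x else 0)"
proof -
 have "summable (%k. (norm (if k = l then x else 0))^2)"
  by (rule summable_finite[of "{l}"]) auto
 then show ?thesis unfolding ell2_inj_def by (subst Ell2_inverse) auto
qed

lemma ell2_ext: "(!!k. ell2_nth f k = ell2_nth g k) ==> f = g"
 using ell2_nth_inject by blast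

lemma ell2_nth_simps [simp]:
 "ell2_nth (f + g) k = ell2_nth f k + ell2_nth g k" "ell2_nth (f - g) k = ell2_nth f k - ell2_nth g k"
 "ell2_nth (c *\<^sub>C f) k = c *\<^sub>C ell2_nth f k" "ell2_nth 0 k = 0"
 by (simp_all add: plus_ell2.rep_eq scaleC_ell2.rep_eq zero_ell2.rep_eq ell2_nth_diff)

lemma ell2_nth_sum [simp]: "ell2_nth (\<Sum>i\<in>F. f i) k = (\<Sum>i\<in>F. ell2_nth (f i) k)"
 by (induction F rule: infinite_finite_induct) auto

lemma ell2_norm_le_mult:
 assumes "!!k. norm (ell2_nth g k) <= norm (ell2_nth f k) * K" "K >= 0"
 shows "norm g <= norm f * K"
 unfolding ell2_norm_le_iff
proof
 fix n
 have "L2_set (%k. norm (ell2_nth g k)) {..<n} <= L2_set (%k. norm (ell2_nth f k) * K) {..<n}"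
  by (intro L2_set_mono assms) auto
 also have "... = L2_set (%k. norm (ell2_nth f k)) {..<n} * K" by (rule L2_set_left_distrib[OF assms(2), symmetric])
 also have "... <= norm f * K" using ell2_norm_le_iff[of f "norm f"] assms(2) by (intro mult_right_mono) auto
 finally show "L2_set (%k. norm (ell2_nth g k)) {..<n} <= norm f * K" .
qed

lemma amp_nth:
 assumes "bounded_clinear T" shows "ell2_nth (amp T f) k = T (ell2_nth f k)"
proof -
 obtain K where K: "K > 0" "!!x. norm (T x) <= norm x * K" using bounded_clinear_bound[OF assms] by blast
 have "summable (%k. (norm (T (ell2_nth f k)))^2)"
 proof (rule summable_comparison_test')
  show "summable (%k. K^2 * (norm (ell2_nth f k))^2)" using ell2_nth[of f] by (intro summable_mult) simp
  show "norm ((norm (T (ell2_nth f k)))^2) <= K^2 * (norm (ell2_nth f k))^2" for k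
   using power_mono[OF K(2)[of "ell2_nth f k"], of 2] by (simp add: power_mult_distrib mult.commute)
 qed
 then show ?thesis unfolding amp_def by (subst Ell2_inverse) auto
qed

lemma amp_bounded_clinear:
 assumes T: "bounded_clinear T" shows "bounded_clinear (amp T)"
proof -
 obtain K where K: "K > 0" "!!x. norm (T x) <= norm x * K" using bounded_clinear_bound[OF T] by blast
 show ?thesis
  by (rule bounded_clinearI[where K=K])
   (auto intro!: ell2_ext ell2_norm_le_mult simp: amp_nth[OF T] bounded_clinearD[OF T] K less_imp_le)
qed

lemma cinner_ell2: "cinner f g = suminf (%k. cinner (ell2_nth f k) (ell2_nth g k))"
 by (rule cinner_ell2.rep_eq)

lemma cinner_amp:
 assumes "bounded_clinear T" shows "cinner (amp T f) g = cinner f (amp (cadjoint T) g)"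
 by (simp add: cinner_ell2 amp_nth assms bounded_clinear_cadjoint cinner_cadjoint[OF assms])

lemma ell2_inj_sums: "(%n. \<Sum>l<n. ell2_inj l (ell2_nth f l)) \<longlonglongrightarrow> f"
proof -
 let ?g = "%n. f - (\<Sum>l<n. ell2_inj l (ell2_nth f l))"
 have nth: "ell2_nth (?g n) k = (if k < n then 0 else ell2_nth f k)" for n k
  by (simp add: ell2_nth_inj if_distrib sum.delta cong: if_cong)
 have s: "summable (%k. (norm (ell2_nth f k))^2)" using ell2_nth[of f] by simp
 have "(norm (?g n))^2 = suminf (%k. (norm (ell2_nth f (k + n)))^2)" for n
 proof -
  have s': "summable (%k. (norm (ell2_nth (?g n) k))^2)" using ell2_nth[of "?g n"] by simp
  have "(norm (?g n))^2 = suminf (%k. (norm (ell2_nth (?g n) k))^2)"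
   using s' by (simp only: norm_ell2.rep_eq real_sqrt_pow2 suminf_nonneg zero_le_power2)
  also have "... = suminf (%k. (norm (ell2_nth (?g n) (k + n)))^2)"
   using suminf_split_initial_segment[OF s', of n] by (simp only: nth) simp
  finally show ?thesis by (simp only: nth) simp
 qed
 moreover have "(%n. suminf (%k. (norm (ell2_nth f (k + n)))^2)) \<longlonglongrightarrow> 0" by (rule suminf_exist_split2[OF s])
 ultimately have "(%n. (norm (?g n))^2) \<longlonglongrightarrow> 0" by simp
 from tendsto_real_sqrt[OF this] have "?g \<longlonglongrightarrow> 0" by (simp add: tendsto_norm_zero_iff)
 from tendsto_diff[OF tendsto_const[of f] this] show ?thesis by simp
qed

lemma commutantD: "T \<in> commutant N ==> bounded_clinear T" "T \<in> commutant N ==> S \<in> N ==> T (S x) = S (T x)"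
 unfolding commutant_def by (auto simp: fun_eq_iff)

lemma commutantI: "bounded_clinear T ==> (!!S x. S \<in> N ==> T (S x) = S (T x)) ==> T \<in> commutant N"
 unfolding commutant_def by (auto simp: fun_eq_iff)

text \<open>Von Neumann's density argument in the amplification. \<open>p\<close> projects onto the
  closed span \<open>L\<close> of the orbit of \<open>U\<close> under \<open>N\<close>.
  \<open>L\<close> is invariant under the self-adjoint set \<open>N\<close>, so \<open>p\<close>
  commutes with it and the matrix coefficients of \<open>p\<close> lie in the commutant of
  \<open>N\<close>. Hence \<open>T\<close> commutes with the coefficients, \<open>amp T\<close>
  commutes with \<open>p\<close>, and \<open>amp T U\<close> stays in \<open>L\<close>, to which
  \<open>V\<close> is orthogonal.\<close>

lemma bicommutant_functional_zero:
 fixes N :: "('a::complex_hilbert_space => 'a) set"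
 assumes b: "!!T. T \<in> N ==> bounded_clinear T" and i: "id \<in> N"
  and comp: "!!S T. S \<in> N ==> T \<in> N ==> S \<circ> T \<in> N" and adj: "!!T. T \<in> N ==> cadjoint T \<in> N"
  and u: "summable (%k. (norm (u k))^2)" and v: "summable (%k. (norm (v k))^2)"
  and zero: "!!T. T \<in> N ==> (%k. cinner (T (u k)) (v k)) sums 0"
  and T: "T \<in> commutant (commutant N)"
 shows "(%k. cinner (T (u k)) (v k)) sums 0"
proof -
 have bT: "bounded_clinear T" using T by (rule commutantD)
 define U where "U = Ell2 u" define V where "V = Ell2 v"
 have U: "ell2_nth U = u" unfolding U_def by (rule Ell2_inverse) (simp add: u)
 have V: "ell2_nth V = v" unfolding V_def by (rule Ell2_inverse) (simp add: v)
 have UV: "cinner (amp S U) V = suminf (%k. cinner (S (u k)) (v k))" if "bounded_clinear S" for S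
  by (simp add: cinner_ell2 amp_nth[OF that] U V)
 define L where "L = closure (cspan {amp S U | S. S \<in> N})"
 have cl: "closed L" "csubspace L" unfolding L_def by (auto intro: closure_csubspace csubspace_cspan)
 define p where "p = proj L"
 have bp: "bounded_clinear p" unfolding p_def by (rule proj_bounded_clinear[OF cl])
 have LS: "amp S f \<in> L" if S: "S \<in> N" and f: "f \<in> L" for S f
 proof -
  have cs: "csubspace (amp S -` L)"
   using cl(2) unfolding csubspace_def by (simp add: bounded_clinearD[OF amp_bounded_clinear[OF b[OF S]]])
  have "{amp S U | S. S \<in> N} \<subseteq> amp S -` L"
  proof clarsimp
   fix S' assume S': "S' \<in> N"
   have eq: "amp S (amp S' U) = amp (S \<circ> S') U"
    by (rule ell2_ext) (simp add: amp_nth b S S' comp)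
   have "amp (S \<circ> S') U \<in> {amp S U | S. S \<in> N}" using comp[OF S S'] by blast
   then have "amp S (amp S' U) \<in> cspan {amp S U | S. S \<in> N}" unfolding eq by (rule cspan_base)
   then show "amp S (amp S' U) \<in> L" unfolding L_def by (rule subsetD[OF closure_subset])
  qed
  then have "cspan {amp S U | S. S \<in> N} \<subseteq> amp S -` L" by (intro subsetI) (erule cspan_induct'[OF _ cs])
  moreover have "closed (amp S -` L)"
   by (rule closed_vimage[OF cl(1) linear_continuous_on[OF bounded_clinearD(1)[OF amp_bounded_clinear[OF b[OF S]]]]])
  ultimately have "L \<subseteq> amp S -` L" unfolding L_def by (rule closure_minimal)
  then show ?thesis using f by auto
 qed
 have pS: "p (amp S f) = amp S (p f)" if S: "S \<in> N" for S f
  unfolding p_def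
 proof (rule proj_eqI[OF cl])
  show "amp S (proj L f) \<in> L" by (rule LS[OF S proj_in[OF cl]])
  fix s assume s: "s \<in> L"
  have "amp S f - amp S (proj L f) = amp S (f - proj L f)"
   by (simp add: bounded_clinearD(3)[OF amp_bounded_clinear[OF b[OF S]]])
  then show "cinner (amp S f - amp S (proj L f)) s = 0"
   using proj_orth[OF cl LS[OF adj[OF S] s]] by (simp add: cinner_amp[OF b[OF S]])
 qed
 have pT_inj: "amp T (p (ell2_inj l x)) = p (amp T (ell2_inj l x))" for l x
 proof (rule ell2_ext)
  fix k
  define q where "q y = ell2_nth (p (ell2_inj l y)) k" for y
  have inj_lin: "ell2_inj l (y + z) = ell2_inj l y + ell2_inj l z" "ell2_inj l (c *\<^sub>C y) = c *\<^sub>C ell2_inj l y" for y z :: 'a and c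
   by (auto intro!: ell2_ext simp: ell2_nth_inj)
  have amp_inj: "amp S (ell2_inj l y) = ell2_inj l (S y)" if "bounded_clinear S" for S and y :: 'a
   by (rule ell2_ext) (simp add: amp_nth[OF that] ell2_nth_inj bounded_clinearD(5)[OF that])
  have "q \<in> commutant N"
  proof (rule commutantI)
   have "norm (ell2_inj l y) <= norm y" for y :: 'a unfolding ell2_norm_le_iff
    by (auto simp: L2_set_def ell2_nth_inj if_distrib[of norm] if_distrib[of "%t. t^2"] sum.delta cong: if_cong)
   moreover have "norm (p f) <= norm f" for f using is_proj_le[OF is_proj_proj[OF cl]] unfolding p_def .
   ultimately have "norm (q y) <= norm y * 1" for y
    unfolding q_def using ell2_nth_le order_trans by (metis mult.right_neutral)
   then show "bounded_clinear q"
    by (intro bounded_clinearI[where K=1]) (auto simp: q_def inj_lin bounded_clinearD[OF bp])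
   show "q (S y) = S (q y)" if S: "S \<in> N" for S y
    unfolding q_def amp_inj[OF b[OF S], symmetric] pS[OF S] by (rule amp_nth[OF b[OF S]])
  qed
  then have "T (q x) = q (T x)" using commutantD(2)[OF T] by blast
  then show "ell2_nth (amp T (p (ell2_inj l x))) k = ell2_nth (p (amp T (ell2_inj l x))) k"
   by (simp add: amp_nth[OF bT] amp_inj[OF bT] q_def)
 qed
 have pT: "amp T (p f) = p (amp T f)" for f
 proof (rule LIMSEQ_unique)
  have bAT: "bounded_clinear (amp T)" by (rule amp_bounded_clinear[OF bT])
  let ?f = "%n. \<Sum>l<n. ell2_inj l (ell2_nth f l)"
  show "(%n. amp T (p (?f n))) \<longlonglongrightarrow> amp T (p f)"
   by (intro bounded_clinear_tendsto[OF bAT] bounded_clinear_tendsto[OF bp] ell2_inj_sums)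
  have "(%n. p (amp T (?f n))) \<longlonglongrightarrow> p (amp T f)"
   by (intro bounded_clinear_tendsto[OF bAT] bounded_clinear_tendsto[OF bp] ell2_inj_sums)
  then show "(%n. amp T (p (?f n))) \<longlonglongrightarrow> p (amp T f)"
   by (simp add: bounded_clinearD(8)[OF bAT] bounded_clinearD(8)[OF bp] pT_inj)
 qed
 have "amp id U = U" by (rule ell2_ext) (simp add: amp_nth)
 then have "U \<in> {amp S U | S. S \<in> N}" using i by (intro CollectI exI[of _ id]) simp
 then have "U \<in> cspan {amp S U | S. S \<in> N}" by (rule cspan_base)
 then have "U \<in> L" unfolding L_def by (rule subsetD[OF closure_subset])
 then have "p U = U" unfolding p_def by (rule proj_fixed[OF cl])
 then have TL: "amp T U \<in> L" using pT[of U] proj_in[OF cl] unfolding p_def by metis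
 have "cspan {amp S U | S. S \<in> N} \<subseteq> {f. cinner f V = 0}"
 proof
  fix f assume "f \<in> cspan {amp S U | S. S \<in> N}"
  then show "f \<in> {f. cinner f V = 0}"
  proof (rule cspan_induct')
   show "csubspace {f. cinner f V = 0}" by (simp add: csubspace_def cinner_add_left cinner_scaleC_left)
   show "{amp S U | S. S \<in> N} \<subseteq> {f. cinner f V = 0}" using zero b UV by (auto simp: sums_iff)
  qed
 qed
 moreover have "{f. cinner f V = 0} = (%f. cinner f V) -` {0}" by auto
 then have "closed {f. cinner f V = 0}"
  using closed_vimage[OF closed_singleton linear_continuous_on[OF bounded_linear_cinner_left]] by metis
 ultimately have "L \<subseteq> {f. cinner f V = 0}" unfolding L_def by (rule closure_minimal)
 then have "suminf (%k. cinner (T (u k)) (v k)) = 0" using TL UV[OF bT] by auto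
 moreover have "summable (%k. norm (cinner (T (u k)) (v k)))"
  using l2_cinner_summable[of "ell2_nth (amp T U)" v] ell2_nth[of "amp T U"] v
  by (simp add: amp_nth[OF bT] U)
 ultimately show ?thesis by (simp add: sums_iff summable_norm_cancel)
qed

section \<open>Hilbert-Schmidt operators and the trace on the tensor product\<close>

text \<open>The free coefficients \<open>c\<close> serve two purposes: the Fourier coefficients give
  Bessel's inequality, and arbitrary ones show in \<open>parseval\<close> that no element of the
  span comes closer to \<open>y\<close> than the partial sum allows.\<close>

lemma bessel:
 assumes B: "orthonormal B" and F: "finite F" "F \<subseteq> (B :: 'a::complex_hilbert_space set)"
 shows "(norm (y - (\<Sum>e\<in>F. c e *\<^sub>C e)))^2
  = (norm y)^2 - (\<Sum>e\<in>F. (cmod (cinner y e))^2) + (\<Sum>e\<in>F. (cmod (cinner y e - c e))^2)"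
proof -
 have orth: "cinner e f = (if e = f then 1 else 0)" if "e \<in> F" "f \<in> F" for e f
  using B F that unfolding orthonormal_def by (auto simp: cinner_self)
 let ?s = "\<Sum>e\<in>F. c e *\<^sub>C e"
 have "cinner e ?s = cnj (c e)" if "e \<in> F" for e
  using that F by (simp add: cinner_sum_right cinner_scaleC_right orth if_distrib sum.delta cong: if_cong)
 then have "(\<Sum>e\<in>F. c e * cinner e ?s) = (\<Sum>e\<in>F. c e * cnj (c e))" by simp
 then have "complex_of_real ((norm ?s)^2) = (\<Sum>e\<in>F. c e * cnj (c e))"
  unfolding cinner_self[symmetric] by (subst cinner_sum_left) (simp only: cinner_scaleC_left)
 also have "... = of_real (\<Sum>e\<in>F. (cmod (c e))^2)" by (simp only: of_real_sum complex_norm_square)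
 finally have ns: "(norm ?s)^2 = (\<Sum>e\<in>F. (cmod (c e))^2)" using of_real_eq_iff by blast
 have "(cmod (cinner y e - c e))^2 = (cmod (cinner y e))^2 - 2 * Re (cnj (c e) * cinner y e) + (cmod (c e))^2" for e
  unfolding cmod_power2 by (simp add: power2_eq_square algebra_simps)
 then have "(\<Sum>e\<in>F. (cmod (cinner y e - c e))^2)
   = (\<Sum>e\<in>F. (cmod (cinner y e))^2) - 2 * (\<Sum>e\<in>F. Re (cnj (c e) * cinner y e)) + (\<Sum>e\<in>F. (cmod (c e))^2)"
  by (simp add: sum.distrib sum_subtractf sum_distrib_left)
 then show ?thesis
  by (simp add: norm2_diff ns cinner_sum_right cinner_scaleC_right)
qed

lemma bessel_le:
 assumes B: "orthonormal B" and F: "finite F" "F \<subseteq> (B :: 'a::complex_hilbert_space set)"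
 shows "(\<Sum>e\<in>F. (cmod (cinner y e))^2) <= (norm y)^2"
 using bessel[OF assms, of y "%e. cinner y e"] zero_le_power2[of "norm (y - (\<Sum>e\<in>F. cinner y e *\<^sub>C e))"]
 by simp

lemma parseval:
 assumes B: "is_onb (B :: 'a::complex_hilbert_space set)"
 shows "((%e. (cmod (cinner y e))^2) has_sum (norm y)^2) B"
proof -
 have o: "orthonormal B" using B by (simp add: is_onb_def)
 let ?f = "%e. (cmod (cinner y e))^2"
 have "bdd_above (sum ?f ` {F. F \<subseteq> B \<and> finite F})"
  by (rule bdd_aboveI[of _ "(norm y)^2"]) (auto intro: bessel_le[OF o])
 then have s: "?f summable_on B" by (rule nonneg_bdd_above_summable_on[rotated]) simp
 have "infsum ?f B = (norm y)^2"
 proof (rule antisym)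
  show "infsum ?f B <= (norm y)^2" by (rule infsum_le_finite_sums[OF s]) (rule bessel_le[OF o])
  show "(norm y)^2 <= infsum ?f B"
  proof (rule field_le_epsilon)
   fix e :: real assume e: "0 < e"
   have "y \<in> closure (cspan B)" using B by (simp add: is_onb_def)
   moreover have "0 < sqrt e" using e by simp
   ultimately obtain x where x: "x \<in> cspan B" "dist x y < sqrt e" unfolding closure_approachable by blast
   then obtain F c where F: "finite F" "F \<subseteq> B" "x = (\<Sum>e\<in>F. c e *\<^sub>C e)" unfolding cspan_def by blast
   have "(norm (y - x))^2 <= e"
    using power_mono[of "norm (y - x)" "sqrt e" 2] x(2) e by (simp add: dist_norm norm_minus_commute)
   moreover have "(norm (y - x))^2 >= (norm y)^2 - sum ?f F"
    unfolding F(3) bessel[OF o F(1,2)] by (simp add: sum_nonneg)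
   moreover have "sum ?f F <= infsum ?f B" by (rule finite_sum_le_infsum[OF s F(1,2)]) simp
   ultimately show "(norm y)^2 <= infsum ?f B + e" by linarith
  qed
 qed
 then show ?thesis using has_sum_infsum[OF s] by simp
qed

lemma onb_orthonormal: "orthonormal (some_onb :: 'a::complex_hilbert_space set)"
 using some_onb[where 'a='a] by (simp add: is_onb_def)

lemma hs_clinear: "bounded_clinear (hs_op K)"
 using hs_op[of K] by (simp add: hilbert_schmidt_def)

lemma hs_op_simps [simp]: "hs_op (S + T) v = hs_op S v + hs_op T v" "hs_op (c *\<^sub>C S) v = c *\<^sub>C hs_op S v"
 "hs_op 0 v = 0"
 by (simp_all add: plus_hs.rep_eq scaleC_hs_def hs_scaleC.rep_eq zero_hs.rep_eq)

lemma hs_ext: "(!!v. hs_op S v = hs_op T v) ==> S = T"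
 using hs_op_inject by blast

lemma hilbert_schmidtI:
 assumes "bounded_clinear K" "!!F. finite F ==> F \<subseteq> some_onb ==> L2_set (%e. norm (K e)) F <= C"
 shows "hs_op (Hs K) = K" "norm (Hs K) <= C"
proof -
 have "hilbert_schmidt K" unfolding hilbert_schmidt_def hs_summable_iff using assms by blast
 then show 1: "hs_op (Hs K) = K" by (simp add: Hs_inverse)
 show "norm (Hs K) <= C" unfolding hs_norm_le_iff' 1 using assms by blast
qed

section \<open>Rank one operators and the two-sided action on Hilbert-Schmidt operators\<close>

definition rank1 :: "'a::complex_hilbert_space => 'a => 'a hs" where
 "rank1 x y = Hs (%w. cinner w y *\<^sub>C x)"

lemma rank1_op: "hs_op (rank1 x y) w = cinner w y *\<^sub>C x" and rank1_norm: "norm (rank1 x y) <= norm x * norm y"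
proof -
 have b: "bounded_clinear (%w. cinner w y *\<^sub>C x)"
 proof (rule bounded_clinearI[where K="norm y * norm x"])
  show "norm (cinner w y *\<^sub>C x) <= norm w * (norm y * norm x)" for w
   using mult_right_mono[OF cinner_cauchy_schwarz[of w y], of "norm x"] by (simp add: norm_scaleC mult_ac)
 qed (simp_all add: cinner_add_left scaleC_add_left cinner_scaleC_left scaleC_scaleC)
 have L: "L2_set (%e. norm (cinner e y *\<^sub>C x)) F <= norm x * norm y" if F: "finite F" "F \<subseteq> some_onb" for F
 proof -
  have "L2_set (%e. norm (cinner e y *\<^sub>C x)) F = L2_set (%e. cmod (cinner y e)) F * norm x"
   by (simp add: L2_set_left_distrib norm_scaleC) (metis cinner_commute complex_mod_cnj)
  also have "L2_set (%e. cmod (cinner y e)) F <= norm y"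
   unfolding L2_set_def by (rule real_le_lsqrt) (auto intro: bessel_le[OF onb_orthonormal F] sum_nonneg)
  finally show ?thesis by (simp add: mult_right_mono mult.commute)
 qed
 show "hs_op (rank1 x y) w = cinner w y *\<^sub>C x" "norm (rank1 x y) <= norm x * norm y"
  unfolding rank1_def using hilbert_schmidtI[OF b L] by simp_all
qed

text \<open>The inner product is defined through the fixed basis \<open>some_onb\<close>. Both sides
  are bounded and linear in \<open>y\<close> and agree when \<open>y\<close> is a basis vector,
  where one term of the sum remains; density of the span does the rest. In this way rank one
  operators test equality of Hilbert-Schmidt operators independently of the basis.\<close>

lemma cinner_rank1: "cinner K (rank1 x y) = cinner (hs_op K y) x"
proof -
 define g where "g y = cinner K (rank1 x y) - cinner (hs_op K y) x" for y
 have radd: "rank1 x (y + z) = rank1 x y + rank1 x z" for y z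
  by (rule hs_ext) (simp add: rank1_op cinner_add_right scaleC_add_left)
 have rsc: "rank1 x (c *\<^sub>C y) = cnj c *\<^sub>C rank1 x y" for c y
  by (rule hs_ext) (simp add: rank1_op cinner_scaleC_right scaleC_scaleC)
 have gadd: "g (y + z) = g y + g z" for y z
  by (simp add: g_def radd cinner_add_right cinner_add_left bounded_clinearD[OF hs_clinear])
 have gsc: "g (c *\<^sub>C y) = c * g y" for c y
  by (simp add: g_def rsc cinner_scaleC_right cinner_scaleC_left bounded_clinearD[OF hs_clinear] algebra_simps)
 have "bounded_linear g"
 proof (rule bounded_linear_intro[where K="2 * norm K * norm x"])
  show "g (r *\<^sub>R y) = r *\<^sub>R g y" for r y using gsc[of "of_real r" y] by (simp add: scaleC_of_real scaleR_conv_of_real)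
  show "norm (g y) <= norm y * (2 * norm K * norm x)" for y
  proof -
   have "cmod (cinner K (rank1 x y)) <= norm K * (norm x * norm y)"
    using cinner_cauchy_schwarz[of K "rank1 x y"] mult_left_mono[OF rank1_norm[of x y], of "norm K"] by simp
   moreover have "cmod (cinner (hs_op K y) x) <= norm K * norm y * norm x"
    using cinner_cauchy_schwarz[of "hs_op K y" x] mult_right_mono[OF hs_op_bound[of K y], of "norm x"] by simp
   moreover have "cmod (g y) <= cmod (cinner K (rank1 x y)) + cmod (cinner (hs_op K y) x)"
    unfolding g_def by (rule norm_triangle_ineq4)
   ultimately show ?thesis by (simp add: mult_ac)
  qed
 qed (rule gadd)
 then have cl: "closed (g -` {0})" by (intro closed_vimage[OF closed_singleton] linear_continuous_on)
 have cs: "csubspace (g -` {0})" using gadd gsc gsc[of 0 0] by (simp add: csubspace_def)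
 have onb: "some_onb \<subseteq> g -` {0}"
 proof
  fix e :: 'a assume e: "e \<in> some_onb"
  then have ne: "norm e = 1" using onb_orthonormal[where 'a='a] unfolding orthonormal_def by blast
  have "cinner K (rank1 x e) = (\<Sum>\<^sub>\<infinity>e'\<in>some_onb. cinner (hs_op K e') (cinner e' e *\<^sub>C x))"
   by (simp add: cinner_hs.rep_eq rank1_op)
  also have "... = (\<Sum>\<^sub>\<infinity>e'\<in>{e}. cinner (hs_op K e') (cinner e' e *\<^sub>C x))"
   by (rule infsum_cong_neutral) (use e onb_orthonormal in \<open>auto simp: orthonormal_def\<close>)
  also have "... = cinner (hs_op K e) x"
   by (simp add: ne cinner_self)
  finally show "e \<in> g -` {0}" by (simp add: g_def)
 qed
 have "cspan some_onb \<subseteq> g -` {0}" by (intro subsetI) (erule cspan_induct'[OF _ cs onb])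
 then have "closure (cspan some_onb) \<subseteq> g -` {0}" using cl by (rule closure_minimal)
 then have "y \<in> g -` {0}" using some_onb by (auto simp: is_onb_def)
 then show ?thesis by (simp add: g_def)
qed

text \<open>The double sum of the squared coefficients of \<open>hs_op K\<close> can be taken in
  either order. Parseval over one index gives the norms of the adjoint at basis vectors, and Bessel
  over the other bounds the sum by the norm of \<open>K\<close>.\<close>

lemma hs_adjoint:
 fixes K :: "'a::complex_hilbert_space hs"
 shows "hs_op (Hs (cadjoint (hs_op K))) = cadjoint (hs_op K)" "norm (Hs (cadjoint (hs_op K))) <= norm K"
proof -
 let ?A = "cadjoint (hs_op K)"
 have bA: "bounded_clinear ?A" by (rule bounded_clinear_cadjoint[OF hs_clinear])
 have "L2_set (%e. norm (?A e)) F <= norm K" if F: "finite F" "F \<subseteq> some_onb" for F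
 proof -
  have hs: "((%f. \<Sum>e\<in>F. (cmod (cinner (?A e) f))^2) has_sum (\<Sum>e\<in>F. (norm (?A e))^2)) some_onb"
   using F(1) by (induction F rule: finite_induct) (auto intro!: has_sum_add parseval[OF some_onb])
  have "(\<Sum>e\<in>F. (norm (?A e))^2) <= (norm K)^2"
  proof (rule has_sum_le_finite_sums[OF hs])
   fix G :: "'a set" assume G: "finite G" "G \<subseteq> some_onb"
   have "(\<Sum>f\<in>G. \<Sum>e\<in>F. (cmod (cinner (?A e) f))^2) = (\<Sum>f\<in>G. \<Sum>e\<in>F. (cmod (cinner (hs_op K f) e))^2)"
    by (intro sum.cong refl)
     (simp add: cinner_cadjoint'[OF hs_clinear, symmetric], metis cinner_commute complex_mod_cnj)
   also have "... <= (\<Sum>f\<in>G. (norm (hs_op K f))^2)" by (intro sum_mono bessel_le[OF onb_orthonormal F])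
   also have "... = (L2_set (%f. norm (hs_op K f)) G)^2" by (simp add: L2_set_def sum_nonneg)
   also have "... <= (norm K)^2" using hs_norm_le_iff'[of K "norm K"] G by (intro power_mono) auto
   finally show "(\<Sum>f\<in>G. \<Sum>e\<in>F. (cmod (cinner (?A e) f))^2) <= (norm K)^2" .
  qed
  then show ?thesis unfolding L2_set_def by (intro real_le_lsqrt) (auto intro: sum_nonneg)
 qed
 then show "hs_op (Hs ?A) = ?A" "norm (Hs ?A) <= norm K" using hilbert_schmidtI[OF bA] by blast+
qed

lemma hs_left:
 assumes a: "bounded_clinear a" and C: "!!x. norm (a x) <= norm x * C" "C >= 0"
 shows "hs_op (Hs (a \<circ> hs_op K)) = a \<circ> hs_op K" "norm (Hs (a \<circ> hs_op K)) <= norm K * C"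
proof -
 have "L2_set (%e. norm ((a \<circ> hs_op K) e)) F <= norm K * C" if F: "finite F" "F \<subseteq> some_onb" for F
 proof -
  have "L2_set (%e. norm ((a \<circ> hs_op K) e)) F <= L2_set (%e. norm (hs_op K e) * C) F"
   by (intro L2_set_mono) (auto simp: C)
  also have "... = L2_set (%e. norm (hs_op K e)) F * C" by (rule L2_set_left_distrib[OF C(2), symmetric])
  also have "... <= norm K * C" using hs_norm_le_iff'[of K "norm K"] F C(2) by (intro mult_right_mono) auto
  finally show ?thesis .
 qed
 then show "hs_op (Hs (a \<circ> hs_op K)) = a \<circ> hs_op K" "norm (Hs (a \<circ> hs_op K)) <= norm K * C"
  using hilbert_schmidtI[OF bounded_clinear_compose[OF a hs_clinear]] by blast+
qed

lemma cadjoint_bound: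
 assumes a: "bounded_clinear a" and C: "!!x. norm (a x) <= norm x * C" "C >= 0"
 shows "norm (cadjoint a x) <= norm x * C"
proof (cases "cadjoint a x = 0")
 case False
 let ?z = "cadjoint a x"
 have "(norm ?z)^2 = Re (cinner x (a ?z))" by (simp add: Re_cinner_self[symmetric] cinner_cadjoint'[OF a])
 also have "... <= norm x * norm (a ?z)" using cinner_cauchy_schwarz complex_Re_le_cmod order_trans by blast
 also have "... <= norm x * (norm ?z * C)" by (intro mult_left_mono C) simp
 finally show ?thesis using False by (simp add: power2_eq_square)
qed (simp add: C)

text \<open>Taking adjoints turns multiplication on the right into multiplication on the left, where
  the bound holds term by term.\<close>

lemma hs_right:
 assumes b: "bounded_clinear b" and C: "!!x. norm (b x) <= norm x * C" "C >= 0"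
 shows "hs_op (Hs (hs_op K \<circ> b)) = hs_op K \<circ> b" "norm (Hs (hs_op K \<circ> b)) <= norm K * C"
proof -
 define L where "L = Hs (cadjoint (hs_op K))"
 have L: "hs_op L = cadjoint (hs_op K)" "norm L <= norm K" unfolding L_def by (rule hs_adjoint)+
 have bb: "bounded_clinear (cadjoint b)" by (rule bounded_clinear_cadjoint[OF b])
 define N where "N = Hs (cadjoint b \<circ> hs_op L)"
 have N: "hs_op N = cadjoint b \<circ> hs_op L" "norm N <= norm L * C"
  unfolding N_def using hs_left[OF bb cadjoint_bound[OF b C] C(2)] by blast+
 have "cadjoint (hs_op N) = hs_op K \<circ> b"
  unfolding N L by (simp add: cadjoint_compose bb bounded_clinear_cadjoint hs_clinear cadjoint_cadjoint b)
 then show "hs_op (Hs (hs_op K \<circ> b)) = hs_op K \<circ> b" "norm (Hs (hs_op K \<circ> b)) <= norm K * C"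
  using hs_adjoint[of N] N(2) mult_right_mono[OF L(2) C(2)] by auto
qed

lemma
 assumes a: "bounded_clinear a" and b: "bounded_clinear b"
 shows op_tensor_op: "hs_op (op_tensor a b K) v = a (hs_op K (b v))"
  and op_tensor_clinear: "bounded_clinear (op_tensor a b)"
proof -
 obtain C where C: "C > 0" "!!x. norm (a x) <= norm x * C" using bounded_clinear_bound[OF a] by blast
 obtain D where D: "D > 0" "!!x. norm (b x) <= norm x * D" using bounded_clinear_bound[OF b] by blast
 have R: "hs_op (Hs (hs_op K \<circ> b)) = hs_op K \<circ> b" "norm (Hs (hs_op K \<circ> b)) <= norm K * D" for K
  using hs_right[OF b D(2)] D(1) by auto
 have op: "hs_op (op_tensor a b K) = a \<circ> hs_op K \<circ> b" "norm (op_tensor a b K) <= norm K * (D * C)" for K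
 proof -
  have eq: "op_tensor a b K = Hs (a \<circ> hs_op (Hs (hs_op K \<circ> b)))" unfolding op_tensor_def R by (simp add: o_assoc)
  show "hs_op (op_tensor a b K) = a \<circ> hs_op K \<circ> b"
   unfolding eq using hs_left(1)[OF a C(2), of "Hs (hs_op K \<circ> b)"] C(1) by (simp add: R o_assoc)
  have "norm (op_tensor a b K) <= norm (Hs (hs_op K \<circ> b)) * C" unfolding eq using hs_left(2)[OF a C(2)] C(1) by simp
  also have "... <= norm K * D * C" using R(2)[of K] C(1) by (intro mult_right_mono) auto
  finally show "norm (op_tensor a b K) <= norm K * (D * C)" by (simp add: mult_ac)
 qed
 show 1: "hs_op (op_tensor a b K) v = a (hs_op K (b v))" for K v by (simp add: op)
 show "bounded_clinear (op_tensor a b)"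
  by (rule bounded_clinearI[where K="D * C"])
   (auto intro!: hs_ext simp: op bounded_clinearD[OF a])
qed

lemma op_tensor_compose:
 assumes "bounded_clinear a" "bounded_clinear b" "bounded_clinear a'" "bounded_clinear b'"
 shows "op_tensor a b \<circ> op_tensor a' b' = op_tensor (a \<circ> a') (b' \<circ> b)"
 by (rule ext, rule hs_ext) (simp add: op_tensor_op assms bounded_clinear_compose)

lemma op_tensor_id: "op_tensor id id = id"
 by (rule ext, rule hs_ext) (simp add: op_tensor_op)

text \<open>\<open>op_tensor a b\<close> maps rank one operators to rank one operators, and by
  \<open>cinner_rank1\<close> these separate Hilbert-Schmidt operators.\<close>

lemma cadjoint_op_tensor:
 assumes a: "bounded_clinear a" and b: "bounded_clinear b"
 shows "cadjoint (op_tensor a b) = op_tensor (cadjoint a) (cadjoint b)"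
proof
 fix L
 have ba: "bounded_clinear (cadjoint a)" "bounded_clinear (cadjoint b)" using a b bounded_clinear_cadjoint by blast+
 have ot: "op_tensor a b (rank1 x y) = rank1 (a x) (cadjoint b y)" for x y
  by (rule hs_ext) (simp add: op_tensor_op a b rank1_op cinner_cadjoint[OF b] bounded_clinearD[OF a])
 have "cinner (cadjoint (op_tensor a b) L) (rank1 x y) = cinner (op_tensor (cadjoint a) (cadjoint b) L) (rank1 x y)" for x y
 proof -
  have "cinner (cadjoint (op_tensor a b) L) (rank1 x y) = cinner L (op_tensor a b (rank1 x y))"
   by (rule cinner_cadjoint'[OF op_tensor_clinear[OF a b], symmetric])
  then show ?thesis by (simp add: ot cinner_rank1 op_tensor_op ba cinner_cadjoint'[OF a])
 qed
 then have "cinner (hs_op (cadjoint (op_tensor a b) L) y) x = cinner (hs_op (op_tensor (cadjoint a) (cadjoint b) L) y) x" for x y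
  by (simp add: cinner_rank1)
 then show "cadjoint (op_tensor a b) L = op_tensor (cadjoint a) (cadjoint b) L"
  by (intro hs_ext cinner_ext)
qed

section \<open>Commutants, normal functionals and the product trace\<close>

lemma commutant_compose: "S \<in> commutant N ==> T \<in> commutant N ==> S \<circ> T \<in> commutant N"
 by (intro commutantI bounded_clinear_compose) (auto simp: commutantD)

lemma commutant_id: "(!!S. S \<in> N ==> bounded_clinear S) ==> id \<in> commutant N"
 by (intro commutantI) auto

lemma commutant_add:
 assumes "!!S. S \<in> N ==> bounded_clinear S" "S \<in> commutant N" "T \<in> commutant N"
 shows "(%v. S v + T v) \<in> commutant N"
 by (intro commutantI bounded_clinear_add)
  (auto simp: commutantD[OF assms(2)] commutantD[OF assms(3)] bounded_clinearD(2)[OF assms(1)])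

lemma commutant_scaleC:
 assumes "!!S. S \<in> N ==> bounded_clinear S" "T \<in> commutant N"
 shows "(%v. c *\<^sub>C T v) \<in> commutant N"
 by (intro commutantI bounded_clinear_scaleC)
  (auto simp: commutantD[OF assms(2)] bounded_clinearD(6)[OF assms(1)])

lemma bicommutant_supset: "(!!T. T \<in> N ==> bounded_clinear T) ==> N \<subseteq> commutant (commutant N)"
 by (auto intro!: commutantI simp: commutantD)

lemma commutant_limit:
 assumes N: "!!S. S \<in> N ==> bounded_clinear S" and f: "!!n. f n \<in> commutant N"
  and lim: "!!v. (%n. f n v) \<longlonglongrightarrow> T v" and T: "bounded_clinear T"
 shows "T \<in> commutant N"
proof (rule commutantI[OF T])
 fix S x assume S: "S \<in> N"
 show "T (S x) = S (T x)"
  using LIMSEQ_unique[OF lim[of "S x"]] bounded_clinear_tendsto[OF N[OF S] lim[of x]]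
  by (simp add: commutantD(2)[OF f S])
qed

lemma sums_if_complex:
 fixes g :: "nat => complex"
 assumes "g sums x" "f sums y"
 shows "(%n. if even n then f (n div 2) else g ((n - 1) div 2)) sums (x + y)"
proof -
 have "(%n. if even n then h (f (n div 2)) else h (g ((n - 1) div 2))) sums (h x + h y)"
  if "bounded_linear (h :: complex => real)" for h
  by (rule sums_if) (use bounded_linear.sums[OF that] assms in auto)
 from this[OF bounded_linear_Re] this[OF bounded_linear_Im] show ?thesis
  by (simp add: sums_complex_iff if_distrib cong: if_cong)
qed

lemma summable_if_nonneg:
 assumes "summable f" "summable g" "!!n. 0 <= f n" "!!n. 0 <= g (n::nat)"
 shows "summable (%n. if even n then f (n div 2) else g ((n - 1) div 2) :: real)"
 using sums_if[OF summable_sums[OF assms(2)] summable_sums[OF assms(1)]] by (rule sums_summable)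

text \<open>Two normal functionals are compared by interleaving the vector sequences that represent them.\<close>

lemma normal_functional_unique:
 assumes b: "!!T. T \<in> N ==> bounded_clinear T" and i: "id \<in> N"
  and comp: "!!S T. S \<in> N ==> T \<in> N ==> S \<circ> T \<in> N" and adj: "!!T. T \<in> N ==> cadjoint T \<in> N"
  and n1: "normal_functional (commutant (commutant N)) \<tau>" and n2: "normal_functional (commutant (commutant N)) \<sigma>"
  and eq: "!!T. T \<in> N ==> \<tau> T = \<sigma> T" and T: "T \<in> commutant (commutant N)"
 shows "\<tau> T = \<sigma> T"
proof -
 obtain u v where uv: "summable (%k. (norm (u k))^2)" "summable (%k. (norm (v k))^2)"
  "!!T. T \<in> commutant (commutant N) ==> (%k::nat. cinner (T (u k)) (v k)) sums \<tau> T"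
  using n1 unfolding normal_functional_def by blast
 obtain x y where xy: "summable (%k. (norm (x k))^2)" "summable (%k. (norm (y k))^2)"
  "!!T. T \<in> commutant (commutant N) ==> (%k::nat. cinner (T (x k)) (y k)) sums \<sigma> T"
  using n2 unfolding normal_functional_def by blast
 define U where "U n = (if even n then u (n div 2) else x ((n - 1) div 2))" for n
 \<comment> \<open>The minus sign makes the interleaved series represent \<open>\<tau>\<close> minus
   \<open>\<sigma>\<close>, which vanishes on \<open>N\<close>.\<close>
 define V where "V n = (if even n then v (n div 2) else - y ((n - 1) div 2))" for n
 have sU: "summable (%n. (norm (U n))^2)"
 proof -
  have "(%n. (norm (U n))^2) = (%n. if even n then (norm (u (n div 2)))^2 else (norm (x ((n - 1) div 2)))^2)"
   by (auto simp: U_def)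
  then show ?thesis using summable_if_nonneg[OF uv(1) xy(1)] by simp
 qed
 have sV: "summable (%n. (norm (V n))^2)"
 proof -
  have "(%n. (norm (V n))^2) = (%n. if even n then (norm (v (n div 2)))^2 else (norm (y ((n - 1) div 2)))^2)"
   by (auto simp: V_def)
  then show ?thesis using summable_if_nonneg[OF uv(2) xy(2)] by simp
 qed
 have s: "(%n. cinner (T (U n)) (V n)) sums (- \<sigma> T + \<tau> T)" if "T \<in> commutant (commutant N)" for T
 proof -
  have "(%n. cinner (T (U n)) (V n)) = (%n. if even n then cinner (T (u (n div 2))) (v (n div 2))
    else - cinner (T (x ((n - 1) div 2))) (y ((n - 1) div 2)))"
   by (auto simp: U_def V_def cinner_minus_right)
  then show ?thesis using sums_if_complex[OF sums_minus[OF xy(3)[OF that]] uv(3)[OF that]] by simp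
 qed
 have "(%n. cinner (T (U n)) (V n)) sums 0" if "T \<in> N" for T
  using s[of T] eq[OF that] bicommutant_supset[of N, OF b] that by auto
 from bicommutant_functional_zero[OF b i comp adj sU sV this T] s[OF T]
 have "- \<sigma> T + \<tau> T = 0" using sums_unique2 by blast
 then show ?thesis by (simp add: add_eq_0_iff)
qed

text \<open>If \<open>u\<close> and \<open>v\<close> represent \<open>\<phi>\<close>, the families
  \<open>rank1 (u k) (v l)\<close> and \<open>rank1 (v k) (u l)\<close> represent the product,
  because \<open>K \<mapsto> a K b\<close> has the coefficient
  \<open>cinner (a (u k)) (v k) * cinner (b (u l)) (v l)\<close> between them. The second arguments
  are exchanged since the second factor acts on the conjugate space. Absolute convergence permits
  the enumeration by \<open>prod_decode\<close>.\<close>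

lemma normal_functional_tensor:
 assumes M: "!!T. T \<in> M ==> bounded_clinear T" and n: "normal_functional M \<phi>"
  and Q: "!!T. T \<in> Q ==> bounded_clinear T"
 shows "\<exists>\<tau>. \<tau> \<in> extensional Q \<and> normal_functional Q \<tau> \<and>
  (\<forall>a\<in>M. \<forall>b\<in>M. op_tensor a b \<in> Q --> \<tau> (op_tensor a b) = \<phi> a * \<phi> b)"
proof -
 obtain u v where uv: "summable (%k. (norm (u k))^2)" "summable (%k. (norm (v k))^2)"
  "!!T. T \<in> M ==> (%k::nat. cinner (T (u k)) (v k)) sums \<phi> T"
  using n unfolding normal_functional_def by blast
 define U where "U n = (case prod_decode n of (k, l) => rank1 (u k) (v l))" for n
 define V where "V n = (case prod_decode n of (k, l) => rank1 (v k) (u l))" for n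
 have prod_sum: "((%n. case prod_decode n of (k, l) => f k * g l) has_sum (x * y)) UNIV"
  if f: "summable (%k. norm (f k))" "f sums x" and g: "summable (%k. norm (g k))" "g sums y"
  for f g :: "nat => 'c::{banach,real_normed_field}" and x y
 proof -
  have fs: "(f has_sum x) UNIV" "(g has_sum y) UNIV" using f g norm_summable_imp_has_sum by blast+
  have na: "(%k. norm (f k)) summable_on UNIV" "(%k. norm (g k)) summable_on UNIV"
   using f g by (auto intro: norm_summable_imp_summable_on)
  have "(%(k, l). norm (f k) * norm (g l)) summable_on (UNIV \<times> UNIV)"
  proof (rule summable_on_SigmaI)
   show "((%l. case (k, l) of (k, l) => norm (f k) * norm (g l)) has_sum (norm (f k) * infsum (%l. norm (g l)) UNIV)) UNIV" for k
    using has_sum_cmult_right[OF has_sum_infsum[OF na(2)]] by simp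
   show "(%k. norm (f k) * infsum (%l. norm (g l)) UNIV) summable_on UNIV"
    by (intro summable_on_cmult_left na)
  qed auto
  then have "(%p. norm (case p of (k, l) => f k * g l)) summable_on (UNIV \<times> UNIV)"
   by (simp add: case_prod_unfold norm_mult)
  then have "(%(k, l). f k * g l) summable_on (UNIV \<times> UNIV)" by (rule abs_summable_summable)
  moreover have "((%l. f k * g l) has_sum (f k * y)) UNIV" for k by (rule has_sum_cmult_right[OF fs(2)])
  moreover have "((%k. f k * y) has_sum (x * y)) UNIV" by (rule has_sum_cmult_left[OF fs(1)])
  ultimately have "((%(k, l). f k * g l) has_sum (x * y)) (UNIV \<times> UNIV)"
   by (intro has_sum_SigmaI[where g="%k. f k * y"]) auto
  then have "((%(k, l). f k * g l) has_sum (x * y)) UNIV" by simp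
  then show ?thesis
   by (subst has_sum_reindex_bij_betw[OF bij_prod_decode, of "%(k, l). f k * g l"])
 qed
 have sq: "summable (%n. (norm (case prod_decode n of (k, l) => rank1 (f k) (g l)))^2)"
  if "summable (%k. (norm (f k))^2)" "summable (%k. (norm (g k))^2)" for f g :: "nat => 'a"
 proof (rule summable_comparison_test')
  have "((%n. case prod_decode n of (k, l) => (norm (f k))^2 * (norm (g l))^2) has_sum
    (suminf (%k. (norm (f k))^2) * suminf (%k. (norm (g k))^2))) UNIV"
   using that by (intro prod_sum summable_sums) auto
  then show "summable (%n. case prod_decode n of (k, l) => (norm (f k))^2 * (norm (g l))^2)"
   using has_sum_imp_sums sums_summable by blast
  fix n
  show "norm ((norm (case prod_decode n of (k, l) => rank1 (f k) (g l)))^2)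
    <= (case prod_decode n of (k, l) => (norm (f k))^2 * (norm (g l))^2)"
   using power_mono[OF rank1_norm, of _ _ 2] by (auto simp: power_mult_distrib split: prod.split)
 qed
 have sU: "summable (%n. (norm (U n))^2)" unfolding U_def by (rule sq[OF uv(1,2)])
 have sV: "summable (%n. (norm (V n))^2)" unfolding V_def by (rule sq[OF uv(2,1)])
 have sm: "summable (%n. norm (cinner (T (U n)) (V n)))" if T: "bounded_clinear T" for T
 proof (rule l2_cinner_summable[OF _ sV])
  obtain K where K: "K > 0" "!!x. norm (T x) <= norm x * K" using bounded_clinear_bound[OF T] by blast
  show "summable (%n. (norm (T (U n)))^2)"
  proof (rule summable_comparison_test')
   show "summable (%n. K^2 * (norm (U n))^2)" by (intro summable_mult sU)
   show "norm ((norm (T (U n)))^2) <= K^2 * (norm (U n))^2" for n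
    using power_mono[OF K(2)[of "U n"], of 2] by (simp add: power_mult_distrib mult.commute)
  qed
 qed
 define \<tau> where "\<tau> = restrict (%T. suminf (%n. cinner (T (U n)) (V n))) Q"
 have "\<tau> \<in> extensional Q" by (simp add: \<tau>_def)
 moreover have "normal_functional Q \<tau>"
  unfolding normal_functional_def
  by (intro exI[of _ U] exI[of _ V] conjI sU sV ballI)
   (simp add: \<tau>_def Q sm summable_norm_cancel summable_sums)
 moreover have "\<tau> (op_tensor a b) = \<phi> a * \<phi> b" if ab: "a \<in> M" "b \<in> M" "op_tensor a b \<in> Q" for a b
 proof -
  have bab: "bounded_clinear a" "bounded_clinear b" using ab M by auto
  have nn: "summable (%k. norm (cinner (c (u k)) (v k)))" if c: "bounded_clinear c" for c
  proof -
   obtain K where K: "K > 0" "!!x. norm (c x) <= norm x * K" using bounded_clinear_bound[OF c] by blast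
   have "summable (%n. (norm (c (u n)))^2)"
   proof (rule summable_comparison_test')
    show "summable (%n. K^2 * (norm (u n))^2)" by (intro summable_mult uv)
    show "norm ((norm (c (u n)))^2) <= K^2 * (norm (u n))^2" for n
     using power_mono[OF K(2)[of "u n"], of 2] by (simp add: power_mult_distrib mult.commute)
   qed
   then show ?thesis by (rule l2_cinner_summable[OF _ uv(2)])
  qed
  have "cinner (op_tensor a b (U n)) (V n)
    = (case prod_decode n of (k, l) => cinner (a (u k)) (v k) * cinner (b (u l)) (v l))" for n
   by (auto simp: U_def V_def cinner_rank1 op_tensor_op bab rank1_op bounded_clinearD[OF bab(1)]
     cinner_scaleC_left split: prod.split)
  then have "((%n. cinner (op_tensor a b (U n)) (V n)) has_sum (\<phi> a * \<phi> b)) UNIV"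
   using prod_sum[OF nn[OF bab(1)] uv(3)[OF ab(1)] nn[OF bab(2)] uv(3)[OF ab(2)]] by simp
  from has_sum_imp_sums[OF this] show ?thesis using ab(3) by (simp add: \<tau>_def sums_iff)
 qed
 ultimately show ?thesis by blast
qed

lemma von_neumann_algebraD:
 assumes "von_neumann_algebra M"
 shows "T \<in> M ==> bounded_clinear T" "T \<in> M ==> cadjoint T \<in> M" "id \<in> M"
  "S \<in> M ==> T \<in> M ==> S \<circ> T \<in> M" "S \<in> M ==> T \<in> M ==> (%v. S v + T v) \<in> M"
  "T \<in> M ==> (%v. c *\<^sub>C T v) \<in> M"
proof -
 have M: "commutant (commutant M) = M" "!!T. T \<in> M ==> bounded_clinear T" "!!T. T \<in> M ==> cadjoint T \<in> M"
  using assms unfolding von_neumann_algebra_def by auto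
 show "T \<in> M ==> bounded_clinear T" "T \<in> M ==> cadjoint T \<in> M" using M by auto
 have bc: "S \<in> commutant M ==> bounded_clinear S" for S by (rule commutantD)
 show "id \<in> M" "S \<in> M ==> T \<in> M ==> S \<circ> T \<in> M" "S \<in> M ==> T \<in> M ==> (%v. S v + T v) \<in> M"
  "T \<in> M ==> (%v. c *\<^sub>C T v) \<in> M"
  using commutant_id[of "commutant M"] commutant_compose[of S "commutant M" T]
   commutant_add[of "commutant M" S T] commutant_scaleC[of "commutant M" T c] bc
  unfolding M(1) by blast+
qed

text \<open>The elementary tensors form a self-adjoint set that contains the identity and is closed
  under composition, so two normal functionals that agree on them agree on the bicommutant. Together
  with existence this resolves the \<open>THE\<close> in the definition, where
  \<open>extensional\<close> fixes the values outside the algebra.\<close>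

lemma tensor_op_trace:
 assumes tv: "tracial_von_neumann_algebra M \<phi>"
 shows "normal_functional (tensor_op_algebra M) (tensor_op_trace M \<phi>)"
  and "a \<in> M ==> b \<in> M ==> tensor_op_trace M \<phi> (op_tensor a b) = \<phi> a * \<phi> b"
  and "a \<in> M ==> b \<in> M ==> op_tensor a b \<in> tensor_op_algebra M"
proof -
 have vN: "von_neumann_algebra M" and nf: "normal_functional M \<phi>"
  using tv by (simp_all add: tracial_von_neumann_algebra_def)
 note M = von_neumann_algebraD[OF vN]
 define N where "N = {op_tensor a b | a b. a \<in> M \<and> b \<in> M}"
 have Q: "tensor_op_algebra M = commutant (commutant N)" by (simp add: tensor_op_algebra_def N_def)
 have NI: "op_tensor a b \<in> N" if "a \<in> M" "b \<in> M" for a b using that by (auto simp: N_def)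
 have bN: "bounded_clinear T" if "T \<in> N" for T
  using that by (auto simp: N_def intro: op_tensor_clinear M(1))
 have idN: "id \<in> N" using NI[OF M(3) M(3)] by (simp add: op_tensor_id)
 have compN: "S \<circ> T \<in> N" if "S \<in> N" "T \<in> N" for S T
  using that unfolding N_def by (auto simp: op_tensor_compose M) (metis M(4))
 have adjN: "cadjoint T \<in> N" if "T \<in> N" for T
  using that unfolding N_def by (auto simp: cadjoint_op_tensor M(1)) (metis M(2))
 have sup: "T \<in> N ==> T \<in> tensor_op_algebra M" for T
  using bicommutant_supset[of N, OF bN] by (auto simp: Q)
 show mem: "op_tensor a b \<in> tensor_op_algebra M" if "a \<in> M" "b \<in> M" for a b by (rule sup[OF NI[OF that]])
 let ?P = "%\<tau>. \<tau> \<in> extensional (tensor_op_algebra M) \<and> normal_functional (tensor_op_algebra M) \<tau> \<and>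
    (\<forall>a\<in>M. \<forall>b\<in>M. \<tau> (op_tensor a b) = \<phi> a * \<phi> b)"
 have bQ: "bounded_clinear T" if "T \<in> tensor_op_algebra M" for T using that unfolding Q by (rule commutantD)
 have "\<exists>\<tau>. \<tau> \<in> extensional (tensor_op_algebra M) \<and> normal_functional (tensor_op_algebra M) \<tau> \<and>
  (\<forall>a\<in>M. \<forall>b\<in>M. op_tensor a b \<in> tensor_op_algebra M --> \<tau> (op_tensor a b) = \<phi> a * \<phi> b)"
  by (rule normal_functional_tensor[OF _ nf]) (erule M(1), erule bQ)
 then obtain \<tau> where t: "\<tau> \<in> extensional (tensor_op_algebra M)" "normal_functional (tensor_op_algebra M) \<tau>"
  "\<forall>a\<in>M. \<forall>b\<in>M. op_tensor a b \<in> tensor_op_algebra M --> \<tau> (op_tensor a b) = \<phi> a * \<phi> b"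
  by (elim exE conjE) (rule that)
 have \<tau>: "?P \<tau>"
  by (intro conjI t ballI) (use t(3) mem in simp)
 have "\<sigma> = \<tau>" if \<sigma>: "?P \<sigma>" for \<sigma>
 proof
  fix T
  show "\<sigma> T = \<tau> T"
  proof (cases "T \<in> tensor_op_algebra M")
   case True
   have "\<sigma> S = \<tau> S" if S: "S \<in> N" for S
   proof -
    obtain a b where ab: "a \<in> M" "b \<in> M" "S = op_tensor a b" using S unfolding N_def by blast
    have "\<sigma> (op_tensor a b) = \<phi> a * \<phi> b" using \<sigma> ab(1,2) by (elim conjE) simp
    moreover have "\<tau> (op_tensor a b) = \<phi> a * \<phi> b" using \<tau> ab(1,2) by (elim conjE) simp
    ultimately show ?thesis by (simp add: ab(3))
   qed
   moreover have "normal_functional (commutant (commutant N)) \<sigma>"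
    using conjunct1[OF conjunct2[OF \<sigma>]] unfolding Q .
   moreover have "normal_functional (commutant (commutant N)) \<tau>"
    using conjunct1[OF conjunct2[OF \<tau>]] unfolding Q .
   ultimately show ?thesis using True unfolding Q
    by (intro normal_functional_unique[OF bN idN compN adjN, of \<sigma> \<tau> T])
  next
   case False
   then show ?thesis using \<sigma> \<tau> by (simp add: extensional_def)
  qed
 qed
 with \<tau> have "?P (THE \<tau>. ?P \<tau>)" by (rule theI)
 then have "?P (tensor_op_trace M \<phi>)" unfolding tensor_op_trace_def .
 then show "normal_functional (tensor_op_algebra M) (tensor_op_trace M \<phi>)"
  "a \<in> M ==> b \<in> M ==> tensor_op_trace M \<phi> (op_tensor a b) = \<phi> a * \<phi> b"
  by (elim conjE; simp)+
qed

section \<open>Matrices over the tensor product as formal sums of pairs of words\<close>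

text \<open>A triple \<open>(c, u, v)\<close> stands for \<open>c\<close> times the tensor of
  \<open>u\<close> with the opposite of \<open>v\<close>. The lists are not normalized. The Gram
  matrix and its powers are written down once, formally, and evaluated both in the algebra, by
  \<open>evX\<close>, and at matrices, by \<open>evM\<close>.\<close>

type_synonym 'n tlist = "(complex \<times> 'n star_word \<times> 'n star_word) list"

definition ulist :: "'i::finite list" where "ulist = (SOME xs. set xs = UNIV \<and> distinct xs)"

lemma sum_list_ulist: "sum_list (map f (ulist :: 'i::finite list)) = (\<Sum>i\<in>UNIV. f i)"
proof -
 have "set (ulist :: 'i list) = UNIV \<and> distinct (ulist :: 'i list)"
  unfolding ulist_def by (rule someI_ex) (metis finite_distinct_list finite)
 then show ?thesis by (metis sum_list_distinct_conv_sum_set)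
qed

text \<open>The second words are concatenated in reverse order because they belong to the opposite
  algebra.\<close>

definition tmul :: "'n tlist => 'n tlist => 'n tlist" where
 "tmul s t = concat (map (%(c, u, v). map (%(d, u', v'). (c * d, u @ u', v' @ v)) t) s)"

definition tadj :: "'n tlist => 'n tlist" where
 "tadj t = map (%(c, u, v). (cnj c, word_star u, word_star v)) t"

definition tmm :: "('i => 'j::finite => 'n tlist) => ('j => 'k => 'n tlist) => 'i => 'k => 'n tlist" where
 "tmm P Q i k = concat (map (%j. tmul (P i j) (Q j k)) ulist)"

primrec tpow :: "('j => 'j::finite => 'n tlist) => nat => 'j => 'j => 'n tlist" where
 "tpow P 0 = (%i k. if i = k then [(1, [], [])] else [])"
| "tpow P (Suc m) = tmm P (tpow P m)"

definition tlist_of :: "'n star_poly_tensor => 'n tlist" where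
 "tlist_of g = map (%(u, v). (Poly_Mapping.lookup g (u, v), u, v))
   (SOME xs. set xs = Poly_Mapping.keys g \<and> distinct xs)"

text \<open>The Gram matrix of the formal matrix of partial derivatives.\<close>

definition dlist :: "('p => 'n star_poly) => 'p \<times> bool => 'n \<times> bool => 'n tlist" where
 "dlist F ir js = tlist_of (poly_deriv (snd js) (fst js) (poly_part (snd ir) (F (fst ir))))"

definition glist :: "('p::finite => 'n star_poly) => 'n \<times> bool => 'n \<times> bool => 'n tlist" where
 "glist F = tmm (%js ir. tadj (dlist F ir js)) (dlist F)"

lemma tlist_of_sum:
 "(\<Sum>(c, u, v)\<leftarrow>tlist_of g. f c u v) = (\<Sum>(u, v)\<in>Poly_Mapping.keys g. f (Poly_Mapping.lookup g (u, v)) u v)"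
proof -
 define xs where "xs = (SOME xs. set xs = Poly_Mapping.keys g \<and> distinct xs)"
 have "set xs = Poly_Mapping.keys g \<and> distinct xs"
  unfolding xs_def by (rule someI_ex) (metis finite_distinct_list finite_keys)
 then show ?thesis
  unfolding tlist_of_def xs_def[symmetric]
  by (simp add: sum_list_distinct_conv_sum_set o_def case_prod_unfold)
qed

lemma bounded_clinear_nth: "bounded_clinear (%v :: 'a::complex_hilbert_space ^ 'j. v $ j)"
 by (rule bounded_clinearI[where K=1])
  (simp_all add: scaleC_vec_def Finite_Cartesian_Product.norm_nth_le)

lemma bounded_clinear_axis: "bounded_clinear (%x :: 'a::complex_hilbert_space. axis j x :: 'a ^ 'j)"
proof (rule bounded_clinearI[where K=1])
 show "norm (axis j x :: 'a ^ 'j) <= norm x * 1" for x :: 'a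
 proof -
  have "norm (axis j x :: 'a ^ 'j) = norm x"
   unfolding norm_vec_def L2_set_def axis_def
   by (simp add: if_distrib[of norm] if_distrib[of "%t. t^2"] sum.delta cong: if_cong)
  then show ?thesis by simp
 qed
qed (auto simp: vec_eq_iff axis_def scaleC_vec_def)

lemma axis_sum: "(\<Sum>j\<in>UNIV. axis j (v $ j)) = (v :: 'a::complex_hilbert_space ^ 'j)"
 by (simp add: vec_eq_iff axis_def if_distrib sum.delta cong: if_cong)

lemma matrix_entry_clinear: "bounded_clinear T ==> bounded_clinear (matrix_entry T i j)"
 unfolding matrix_entry_def
 using bounded_clinear_compose[OF bounded_clinear_nth bounded_clinear_compose[OF _ bounded_clinear_axis]]
 by (simp add: o_def)

lemma matrix_entry_sum:
 assumes "bounded_clinear T" shows "T v $ i = (\<Sum>j\<in>UNIV. matrix_entry T i j (v $ j))"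
proof -
 have "T v = T (\<Sum>j\<in>UNIV. axis j (v $ j))" by (simp add: axis_sum)
 then show ?thesis by (simp add: bounded_clinearD(8)[OF assms] matrix_entry_def)
qed

lemma matrix_entry_compose:
 assumes "bounded_clinear S"
 shows "matrix_entry (S \<circ> T) i k v = (\<Sum>j\<in>UNIV. matrix_entry S i j (matrix_entry T j k v))"
 unfolding matrix_entry_def[of "S \<circ> T"] o_apply matrix_entry_sum[OF assms, of "T (axis k v)"]
 by (simp add: matrix_entry_def)

lemma cinner_axis: "cinner (axis j x) v = cinner x (v $ j)" "cinner v (axis j x) = cinner (v $ j) x"
 by (simp_all add: cinner_vec_def axis_def if_distrib if_distribR sum.delta cong: if_cong)

lemma matrix_entry_cadjoint:
 assumes "bounded_clinear T"
 shows "matrix_entry (cadjoint T) j i = cadjoint (matrix_entry T i j)"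
proof (rule sym, rule cadjoint_eqI)
 show "bounded_clinear (matrix_entry (cadjoint T) j i)"
  by (intro matrix_entry_clinear bounded_clinear_cadjoint assms)
 fix u v
 have "cinner (matrix_entry T i j u) v = cinner (T (axis j u)) (axis i v)"
  by (simp add: matrix_entry_def cinner_axis)
 also have "... = cinner (axis j u) (cadjoint T (axis i v))" by (rule cinner_cadjoint[OF assms])
 finally show "cinner (matrix_entry T i j u) v = cinner u (matrix_entry (cadjoint T) j i v)"
  by (simp add: matrix_entry_def cinner_axis)
qed

lemma matrix_op_clinear:
 assumes "!!i j. bounded_clinear (e i j)"
 shows "bounded_clinear (%v :: 'a::complex_hilbert_space ^ 'j. (\<chi> i. \<Sum>j\<in>UNIV. e i j (v $ j)) :: 'a ^ 'i)"
proof -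
 have "(%v :: 'a ^ 'j. (\<chi> i. \<Sum>j\<in>UNIV. e i j (v $ j)) :: 'a ^ 'i)
   = (%v. \<Sum>i\<in>UNIV. axis i (\<Sum>j\<in>UNIV. e i j (v $ j)))"
  by (rule ext) (subst axis_sum[symmetric], simp)
 moreover have "bounded_clinear (%v :: 'a ^ 'j. axis i (\<Sum>j\<in>UNIV. e i j (v $ j)) :: 'a ^ 'i)" for i
 proof -
  have "bounded_clinear (%v :: 'a ^ 'j. e i j (v $ j))" for j
   using bounded_clinear_compose[OF assms bounded_clinear_nth] by (simp add: o_def)
  then have "bounded_clinear (%v :: 'a ^ 'j. \<Sum>j\<in>UNIV. e i j (v $ j))"
   by (rule bounded_clinear_sum)
  from bounded_clinear_compose[OF bounded_clinear_axis this] show ?thesis by (simp add: o_def)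
 qed
 ultimately show ?thesis by (simp add: bounded_clinear_sum)
qed

section \<open>The nullity as a limit of moments\<close>

lemma word_op_Cons: "word_op X ((i, s) # w) = (if s then cadjoint (X i) else X i) \<circ> word_op X w"
 by (simp add: word_op_def)

lemma word_op_append: "word_op X (u @ v) = word_op X u \<circ> word_op X v"
 by (induction u) (auto simp: word_op_def o_assoc)

locale tracial_tuple =
 fixes M :: "('a::complex_hilbert_space => 'a) set" and \<phi> :: "('a => 'a) => complex"
  and X :: "'n::finite => 'a => 'a" and F :: "'p::finite => 'n star_poly"
 assumes tv: "tracial_von_neumann_algebra M \<phi>" and XM: "!!i. X i \<in> M"
begin

lemma vN: "von_neumann_algebra M" using tv by (simp add: tracial_von_neumann_algebra_def)

lemmas MD = von_neumann_algebraD[OF vN]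

lemma word_op_in: "word_op X w \<in> M"
proof (induction w)
 case Nil then show ?case using MD(3)[unfolded id_def] by (simp add: word_op_def id_def)
next
 case (Cons l w)
 obtain i s where l: "l = (i, s)" by (cases l)
 have "(if s then cadjoint (X i) else X i) \<in> M" using MD(2)[OF XM] XM by simp
 then show ?case unfolding l word_op_Cons using Cons by (rule MD(4))
qed

lemma word_op_clinear: "bounded_clinear (word_op X w)" by (rule MD(1)[OF word_op_in])

lemma cadjoint_word_op: "cadjoint (word_op X w) = word_op X (word_star w)"
proof (induction w)
 case Nil then show ?case using cadjoint_id[unfolded id_def] by (simp add: word_op_def word_star_def id_def)
next
 case (Cons l w)
 obtain i s where l: "l = (i, s)" by (cases l)
 have bX: "bounded_clinear (X i)" by (rule MD(1)[OF XM])
 have b: "bounded_clinear (if s then cadjoint (X i) else X i)" using bX bounded_clinear_cadjoint by auto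
 have "word_op X (l # w) = (if s then cadjoint (X i) else X i) \<circ> word_op X w" by (simp add: word_op_def l)
 then have "cadjoint (word_op X (l # w)) = word_op X (word_star w) \<circ> cadjoint (if s then cadjoint (X i) else X i)"
  using cadjoint_compose[OF b word_op_clinear] Cons by simp
 also have "cadjoint (if s then cadjoint (X i) else X i) = word_op X [(i, \<not> s)]"
  using cadjoint_cadjoint[OF bX] by (auto simp: word_op_def)
 also have "word_op X (word_star w) \<circ> word_op X [(i, \<not> s)] = word_op X (word_star (l # w))"
  by (simp add: word_op_append[symmetric] word_star_def l)
 finally show ?case .
qed

definition Q where "Q = tensor_op_algebra M"
definition \<tau> where "\<tau> = tensor_op_trace M \<phi>"

definition evX :: "'n tlist => 'a hs => 'a hs" where
 "evX t K = (\<Sum>(c, u, v)\<leftarrow>t. c *\<^sub>C op_tensor (word_op X u) (word_op X v) K)"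

definition trX :: "'n tlist => complex" where
 "trX t = (\<Sum>(c, u, v)\<leftarrow>t. c * (\<phi> (word_op X u) * \<phi> (word_op X v)))"

lemma ot_clinear: "bounded_clinear (op_tensor (word_op X u) (word_op X v))"
 by (rule op_tensor_clinear[OF word_op_clinear word_op_clinear])

lemma evX_Nil: "evX [] K = 0" by (simp add: evX_def)

lemma evX_Cons: "evX ((c, u, v) # t) K = c *\<^sub>C op_tensor (word_op X u) (word_op X v) K + evX t K"
 by (simp add: evX_def)

lemma evX_append: "evX (s @ t) K = evX s K + evX t K" by (simp add: evX_def)

lemma evX_concat: "evX (concat ts) K = sum_list (map (%t. evX t K) ts)"
 by (induction ts) (auto simp: evX_append evX_Nil)

lemma evX_clinear: "bounded_clinear (evX t)"
proof (induction t)
 case Nil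
 have "evX [] = (%_. 0)" by (rule ext) (simp add: evX_Nil)
 then show ?case by (simp add: bounded_clinear_zero)
next
 case (Cons l t)
 obtain c u v where l: "l = (c, u, v)" by (cases l)
 have "evX (l # t) = (%K. c *\<^sub>C op_tensor (word_op X u) (word_op X v) K + evX t K)"
  by (rule ext) (simp add: l evX_Cons)
 then show ?case using Cons ot_clinear by (simp add: bounded_clinear_add bounded_clinear_scaleC)
qed

lemma evX_tmul: "evX (tmul s t) K = evX s (evX t K)"
proof (induction s)
 case Nil then show ?case by (simp add: tmul_def evX_Nil)
next
 case (Cons l s)
 obtain c u v where l: "l = (c, u, v)" by (cases l)
 have "evX (map (%(d, u', v'). (c * d, u @ u', v' @ v)) t) K = c *\<^sub>C op_tensor (word_op X u) (word_op X v) (evX t K)"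
 proof (induction t)
  case Nil then show ?case by (simp add: evX_Nil bounded_clinearD(5)[OF ot_clinear])
 next
  case (Cons m t)
  obtain d u' v' where m: "m = (d, u', v')" by (cases m)
  have "op_tensor (word_op X (u @ u')) (word_op X (v' @ v)) K
    = op_tensor (word_op X u) (word_op X v) (op_tensor (word_op X u') (word_op X v') K)"
   using fun_cong[OF op_tensor_compose[OF word_op_clinear word_op_clinear word_op_clinear word_op_clinear], of u v u' v' K]
   by (simp add: word_op_append)
  then show ?case using Cons
   by (simp add: m evX_Cons bounded_clinearD(2,6)[OF ot_clinear] scaleC_add_right scaleC_scaleC)
 qed
 then show ?case using Cons by (simp add: tmul_def l evX_append evX_Cons)
qed

lemma evX_tmm: "evX (tmm P R i k) K = (\<Sum>j\<in>UNIV. evX (P i j) (evX (R j k) K))"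
 by (simp add: tmm_def evX_concat o_def evX_tmul sum_list_ulist)

lemma evX_tadj: "cadjoint (evX t) = evX (tadj t)"
proof (rule cadjoint_eqI[OF evX_clinear])
 fix K L
 show "cinner (evX t K) L = cinner K (evX (tadj t) L)"
 proof (induction t)
  case (Cons l t)
  obtain c u v where l: "l = (c, u, v)" by (cases l)
  have "cinner (op_tensor (word_op X u) (word_op X v) K) L
    = cinner K (op_tensor (word_op X (word_star u)) (word_op X (word_star v)) L)"
   using cinner_cadjoint[OF ot_clinear, of u v K L]
   by (simp add: cadjoint_op_tensor word_op_clinear cadjoint_word_op)
  then show ?case using Cons
   by (simp add: l evX_Cons tadj_def cinner_add_left cinner_add_right cinner_scaleC_left cinner_scaleC_right)
 qed (simp add: evX_Nil tadj_def)
qed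

lemma Q_supset: "op_tensor (word_op X u) (word_op X v) \<in> Q"
 unfolding Q_def by (rule tensor_op_trace(3)[OF tv word_op_in word_op_in])

lemma Q_gen: "Q = commutant (commutant {op_tensor a b | a b. a \<in> M \<and> b \<in> M})"
 by (simp add: Q_def tensor_op_algebra_def)

lemma Q_add: "S \<in> Q ==> T \<in> Q ==> (%v. S v + T v) \<in> Q"
 unfolding Q_gen by (rule commutant_add) (auto dest: commutantD)

lemma Q_scaleC: "T \<in> Q ==> (%v. c *\<^sub>C T v) \<in> Q"
 unfolding Q_gen by (rule commutant_scaleC) (auto dest: commutantD)

lemma Q_id: "id \<in> Q"
 using Q_supset[of "[]" "[]"] by (simp add: word_op_def op_tensor_id)

lemma Q_limit:
 "(!!n. f n \<in> Q) ==> (!!v. (%n. f n v) \<longlonglongrightarrow> T v) ==> bounded_clinear T ==> T \<in> Q"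
 unfolding Q_gen by (rule commutant_limit) (auto dest: commutantD)

lemma Q_zero: "(%_. 0) \<in> Q" using Q_scaleC[OF Q_id, of 0] by simp

lemma evX_in: "evX t \<in> Q"
proof (induction t)
 case Nil
 have "evX [] = (%_. 0)" by (rule ext) (simp add: evX_Nil)
 then show ?case by (simp add: Q_zero)
next
 case (Cons l t)
 obtain c u v where l: "l = (c, u, v)" by (cases l)
 have "evX (l # t) = (%K. c *\<^sub>C op_tensor (word_op X u) (word_op X v) K + evX t K)"
  by (rule ext) (simp add: l evX_Cons)
 then show ?case using Cons Q_supset by (simp add: Q_add Q_scaleC)
qed

lemma tau_vectors:
 obtains u v where "summable (%k. (norm (u k))^2)" "summable (%k. (norm (v k))^2)"
  "!!T. T \<in> Q ==> (%k::nat. cinner (T (u k)) (v k)) sums \<tau> T"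
 using tensor_op_trace(1)[OF tv] unfolding normal_functional_def Q_def \<tau>_def by blast

lemma tau_add: assumes "S \<in> Q" "T \<in> Q" shows "\<tau> (%v. S v + T v) = \<tau> S + \<tau> T"
proof (rule tau_vectors)
 fix u v :: "nat => 'a hs" assume s: "!!T. T \<in> Q ==> (%k::nat. cinner (T (u k)) (v k)) sums \<tau> T"
 show ?thesis
  using sums_unique2[OF s[OF Q_add[OF assms]]] sums_add[OF s[OF assms(1)] s[OF assms(2)]]
  by (simp add: cinner_add_left)
qed

lemma tau_scaleC: assumes "T \<in> Q" shows "\<tau> (%v. c *\<^sub>C T v) = c * \<tau> T"
proof (rule tau_vectors)
 fix u v :: "nat => 'a hs" assume s: "!!T. T \<in> Q ==> (%k::nat. cinner (T (u k)) (v k)) sums \<tau> T"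
 show ?thesis
  using sums_unique2[OF s[OF Q_scaleC[OF assms]]] sums_mult[OF s[OF assms], of c]
  by (simp add: cinner_scaleC_left)
qed

lemma tau_zero: "\<tau> (%_. 0) = 0" using tau_scaleC[OF Q_id, of 0] by simp

lemma tau_sum:
 assumes "finite I" "!!i. i \<in> I ==> T i \<in> Q"
 shows "(%v. \<Sum>i\<in>I. c i *\<^sub>C T i v) \<in> Q \<and> \<tau> (%v. \<Sum>i\<in>I. c i *\<^sub>C T i v) = (\<Sum>i\<in>I. c i * \<tau> (T i))"
 using assms
 by (induction I rule: finite_induct) (auto simp: Q_zero tau_zero Q_add Q_scaleC tau_add tau_scaleC)

lemma tau_id: "\<tau> id = 1"
 using tensor_op_trace(2)[OF tv MD(3) MD(3)] tv
 by (simp add: \<tau>_def op_tensor_id tracial_von_neumann_algebra_def)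

lemma tau_evX: "\<tau> (evX t) = trX t"
proof (induction t)
 case Nil
 have "evX [] = (%_. 0)" by (rule ext) (simp add: evX_Nil)
 then show ?case by (simp add: tau_zero trX_def)
next
 case (Cons l t)
 obtain c u v where l: "l = (c, u, v)" by (cases l)
 have "evX (l # t) = (%K. c *\<^sub>C op_tensor (word_op X u) (word_op X v) K + evX t K)"
  by (rule ext) (simp add: l evX_Cons)
 moreover have "\<tau> (op_tensor (word_op X u) (word_op X v)) = \<phi> (word_op X u) * \<phi> (word_op X v)"
  unfolding \<tau>_def by (rule tensor_op_trace(2)[OF tv word_op_in word_op_in])
 ultimately show ?case using Cons
  by (simp add: tau_add tau_scaleC Q_supset Q_scaleC evX_in trX_def l)
qed

text \<open>Normality in the form of dominated convergence: the terms of the series for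
  \<open>\<tau> (f n)\<close> are bounded by \<open>(norm (u k))^2 + (norm (v k))^2\<close>, which
  is summable and independent of \<open>n\<close>.\<close>

lemma tau_limit:
 assumes f: "!!n. f n \<in> Q" and T: "T \<in> Q" and lim: "!!v. (%n. f n v) \<longlonglongrightarrow> T v"
  and bd: "!!n v. norm (f n v) <= norm v"
 shows "(%n. \<tau> (f n)) \<longlonglongrightarrow> \<tau> T"
proof (rule tau_vectors)
 fix u v :: "nat => 'a hs"
 assume u: "summable (%k. (norm (u k))^2)" and v: "summable (%k. (norm (v k))^2)"
  and s: "!!T. T \<in> Q ==> (%k::nat. cinner (T (u k)) (v k)) sums \<tau> T"
 have "norm (cinner (f n (u k)) (v k)) <= (norm (u k))^2 + (norm (v k))^2" for n k
 proof -
  have "norm (cinner (f n (u k)) (v k)) <= norm (u k) * norm (v k)"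
   using cinner_cauchy_schwarz[of "f n (u k)" "v k"] mult_right_mono[OF bd[of n "u k"], of "norm (v k)"] by simp
  also have "... <= (norm (u k))^2 + (norm (v k))^2"
  proof -
   have "0 <= (norm (u k) - norm (v k))^2 + (norm (u k))^2 + (norm (v k))^2" by simp
   then show ?thesis by (simp add: power2_eq_square algebra_simps)
  qed
  finally show ?thesis .
 qed
 moreover have "(%n. cinner (f n (u k)) (v k)) \<longlonglongrightarrow> cinner (T (u k)) (v k)" for k
  by (intro tendsto_intros lim)
 moreover have "summable (%k. (norm (u k))^2 + (norm (v k))^2)" by (intro summable_add u v)
 ultimately have "(%n. suminf (%k. cinner (f n (u k)) (v k))) \<longlonglongrightarrow> suminf (%k. cinner (T (u k)) (v k))"
  using tannerys_theorem[of "%k n. cinner (f n (u k)) (v k)" "%k. cinner (T (u k)) (v k)" sequentially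
    "%k. (norm (u k))^2 + (norm (v k))^2"] by (simp add: case_prod_unfold)
 then show ?thesis using s[OF f] s[OF T] by (simp add: sums_iff)
qed

abbreviation T where "T \<equiv> Ds F X"
definition A where "A = cadjoint T \<circ> T"

lemma tensor_op_evX: "tensor_op X g = evX (tlist_of g)"
 by (rule ext) (simp add: tensor_op_def evX_def tlist_of_sum)

lemma T_eq: "T = (%v. \<chi> ir. \<Sum>js\<in>UNIV. evX (dlist F ir js) (v $ js))"
 by (simp add: Ds_def dlist_def tensor_op_evX)

lemma T_clinear: "bounded_clinear T"
 unfolding T_eq by (rule matrix_op_clinear[OF evX_clinear])

lemma T_entry: "matrix_entry T ir js = evX (dlist F ir js)"
proof
 fix K
 have "evX (dlist F ir j) (axis js K $ j) = (if j = js then evX (dlist F ir js) K else 0)" for j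
  by (simp add: axis_def bounded_clinearD(5)[OF evX_clinear])
 then show "matrix_entry T ir js K = evX (dlist F ir js) K"
  by (simp add: matrix_entry_def T_eq)
qed

lemma A_clinear: "bounded_clinear A"
 unfolding A_def by (intro bounded_clinear_compose bounded_clinear_cadjoint T_clinear)

lemma A_cinner: "cinner (A u) v = cinner (T u) (T v)"
 by (simp add: A_def cinner_cadjoint'[OF T_clinear, symmetric])

lemma A_selfadj: "selfadj A"
 unfolding selfadj_def using A_clinear A_cinner cinner_commute by metis

lemma A_pos: "0 <= Re (cinner (A v) v)" by (simp add: A_cinner Re_cinner_self)

lemma A_entry: "matrix_entry A i k = evX (glist F i k)"
 by (rule ext) (simp add: A_def matrix_entry_compose bounded_clinear_cadjoint T_clinear
   matrix_entry_cadjoint T_entry evX_tadj glist_def evX_tmm)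

lemma A_pow_entry: "matrix_entry (A ^^ m) i k = evX (tpow (glist F) m i k)"
proof (induction m arbitrary: i)
 case 0
 show ?case
  by (rule ext) (auto simp: matrix_entry_def axis_def evX_def word_op_def op_tensor_id[unfolded id_def] op_tensor_id)
next
 case (Suc m)
 have "A ^^ Suc m = A \<circ> A ^^ m" by simp
 then show ?case
  by (intro ext) (simp only: matrix_entry_compose[OF A_clinear] A_entry Suc tpow.simps evX_tmm)
qed

text \<open>The matrix trace without normalization, that is \<open>CARD('n \<times> bool)\<close>
  times \<open>amplified_trace \<tau>\<close>; its value at the kernel projection has the nullity as
  real part.\<close>

definition S :: "('a hs ^ ('n \<times> bool) => 'a hs ^ ('n \<times> bool)) => complex" where
 "S B = (\<Sum>c\<in>UNIV. \<tau> (matrix_entry B c c))"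

definition P where "P = proj (kernel A)"

lemma kc: "closed (kernel A)" "csubspace (kernel A)" using kernel_closed[OF A_clinear] by auto

lemma Nullity_eq: "Nullity \<tau> T = Re (S P)"
 unfolding Nullity_def amplified_trace_def A_def[symmetric] P_def[symmetric] S_def
 using spectral_projection_pos(1)[OF A_selfadj A_pos] by (simp add: P_def)

end

section \<open>Expansion of the powers of 1 - r A\<close>

primrec bc :: "real => nat => nat => real" where
 "bc r 0 j = (if j = 0 then 1 else 0)"
| "bc r (Suc m) j = bc r m j - r * (if j = 0 then 0 else bc r m (j - 1))"

lemma bc_zero: "m < j ==> bc r m j = 0"
 by (induction m arbitrary: j) auto

text \<open>\<open>bc r m j\<close> is the coefficient of \<open>t ^ j\<close> in \<open>(1 - r t) ^ m\<close>.\<close>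

lemma bc_Suc:
 fixes f :: "nat => 'v::real_vector"
 shows "(\<Sum>j\<le>Suc m. bc r (Suc m) j *\<^sub>R f j)
  = (\<Sum>j\<le>m. bc r m j *\<^sub>R f j) - r *\<^sub>R (\<Sum>j\<le>m. bc r m j *\<^sub>R f (Suc j))"
proof -
 have "(\<Sum>j\<le>Suc m. (if j = 0 then 0 else bc r m (j - 1)) *\<^sub>R f j) = (\<Sum>j\<le>m. bc r m j *\<^sub>R f (Suc j))"
  by (subst sum.atMost_Suc_shift) simp
 moreover have "(\<Sum>j\<le>Suc m. bc r m j *\<^sub>R f j) = (\<Sum>j\<le>m. bc r m j *\<^sub>R f j)" by (simp add: bc_zero)
 ultimately show ?thesis
  by (simp only: bc.simps scaleR_diff_left sum_subtractf scaleR_scaleR[symmetric] scaleR_sum_right[symmetric])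
qed

lemma bc_power: "(\<Sum>j\<le>m. bc r m j * x ^ j) = (1 - r * x) ^ m"
proof (induction m)
 case (Suc m)
 have "(\<Sum>j\<le>Suc m. bc r (Suc m) j * x ^ j) = (\<Sum>j\<le>m. bc r m j * x ^ j) - r * (\<Sum>j\<le>m. bc r m j * x ^ Suc j)"
  using bc_Suc[of r m "%j. x ^ j"] by simp
 also have "(\<Sum>j\<le>m. bc r m j * x ^ Suc j) = x * (\<Sum>j\<le>m. bc r m j * x ^ j)"
  by (simp add: sum_distrib_left mult_ac)
 finally show ?case using Suc by (simp add: algebra_simps)
qed simp

lemma bc_op:
 fixes A :: "'v::real_normed_vector => 'v"
 assumes "bounded_linear A"
 shows "((%v. v - r *\<^sub>R A v) ^^ m) v = (\<Sum>j\<le>m. bc r m j *\<^sub>R (A ^^ j) v)"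
proof (induction m arbitrary: v)
 case (Suc m)
 let ?C = "%v. v - r *\<^sub>R A v"
 have lin: "linear A" using assms by (rule bounded_linear.linear)
 have "(?C ^^ Suc m) v = (?C ^^ m) v - r *\<^sub>R A ((?C ^^ m) v)" by simp
 also have "A ((?C ^^ m) v) = (\<Sum>j\<le>m. bc r m j *\<^sub>R (A ^^ Suc j) v)"
  unfolding Suc by (simp add: linear_sum[OF lin] linear_scale[OF lin])
 finally show ?case unfolding Suc by (simp only: bc_Suc)
qed simp

context tracial_tuple begin

lemma contraction_entry_bound:
 assumes "bounded_clinear B" "!!v. norm (B v) <= norm v"
 shows "norm (matrix_entry B i j x) <= norm (x :: 'a hs)"
proof -
 have "norm (matrix_entry B i j x) <= norm (B (axis j x))"
  by (simp add: matrix_entry_def Finite_Cartesian_Product.norm_nth_le)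
 also have "... <= norm (axis j x :: 'a hs ^ _)" by (rule assms)
 also have "... = norm x"
  unfolding norm_vec_def L2_set_def axis_def
  by (simp add: if_distrib[of norm] if_distrib[of "%t. t^2"] sum.delta cong: if_cong)
 finally show ?thesis .
qed

text \<open>With \<open>R\<close> a bound for the norm of \<open>A\<close>, the operator
  \<open>C\<close>, which is 1 minus \<open>A / R\<close>, lies between 0 and 1 and has the kernel
  of \<open>A\<close> as its fixed space. Its powers converge strongly to \<open>P\<close>, and
  \<open>tau_limit\<close> carries the convergence over to the traces of the diagonal
  entries.\<close>

lemma nullity_moments_aux:
 shows "\<exists>R>0. (%m. \<Sum>j\<le>m. bc (1/R) m j *\<^sub>R S (A ^^ j)) \<longlonglongrightarrow> S P"
  and "matrix_entry P c c \<in> Q"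
proof -
 obtain R where R: "R > 0" "!!v. norm (A v) <= norm v * R" using bounded_clinear_bound[OF A_clinear] by blast
 define C where "C v = v - (1/R) *\<^sub>R A v" for v
 have bC: "bounded_clinear C" unfolding C_def
  by (intro bounded_clinear_diff bounded_clinear_id bounded_clinear_scaleR A_clinear)
 have sC: "selfadj C" unfolding selfadj_def using bC
  by (auto simp: C_def cinner_diff_left cinner_diff_right selfadjD(2)[OF A_selfadj])
 have AR: "Re (cinner (A v) v) <= R * (norm v)^2" for v
 proof -
  have "Re (cinner (A v) v) <= norm (A v) * norm v"
   using cinner_cauchy_schwarz complex_Re_le_cmod order_trans by blast
  also have "... <= norm v * R * norm v" by (intro mult_right_mono R) simp
  finally show ?thesis by (simp add: power2_eq_square mult_ac)
 qed
 have Cpos: "0 <= Re (cinner (C v) v)" for v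
  using AR[of v] R(1) by (simp add: C_def cinner_diff_left Re_cinner_self field_simps)
 have Cle: "Re (cinner (C v) v) <= (norm v)^2" for v
  using A_pos[of v] R(1) by (simp add: C_def cinner_diff_left Re_cinner_self)
 have fix_C: "{v. C v = v} = kernel A" using R(1) by (auto simp: C_def kernel_def)
 note lim = contraction_powers_tendsto(2)[OF sC Cpos Cle, unfolded fix_C P_def[symmetric]]
 note bd = contraction_powers_tendsto(1)[OF sC Cpos Cle]
 have bCm: "bounded_clinear (C ^^ m)" for m by (rule bounded_clinear_funpow[OF bC])
 have Cm: "(C ^^ m) v = (\<Sum>j\<le>m. bc (1/R) m j *\<^sub>R (A ^^ j) v)" for m v
  unfolding C_def by (rule bc_op[OF bounded_clinearD(1)[OF A_clinear]])
 have ent: "matrix_entry (C ^^ m) c c = (%v. \<Sum>j\<le>m. of_real (bc (1/R) m j) *\<^sub>C matrix_entry (A ^^ j) c c v)" for m c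
  by (rule ext) (simp add: matrix_entry_def Cm scaleC_of_real)
 have entQ: "matrix_entry (C ^^ m) c c \<in> Q \<and> \<tau> (matrix_entry (C ^^ m) c c)
   = (\<Sum>j\<le>m. of_real (bc (1/R) m j) * \<tau> (matrix_entry (A ^^ j) c c))" for m c
  unfolding ent by (rule tau_sum) (auto simp: A_pow_entry evX_in)
 have SC: "S (C ^^ m) = (\<Sum>j\<le>m. bc (1/R) m j *\<^sub>R S (A ^^ j))" for m
  using sum.swap[of "%c j. of_real (bc (1/R) m j) * \<tau> (matrix_entry (A ^^ j) c c)" "{..m}" UNIV]
  by (simp add: S_def entQ scaleR_conv_of_real sum_distrib_left)
 have limE: "(%m. matrix_entry (C ^^ m) c c v) \<longlonglongrightarrow> matrix_entry P c c v" for c v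
  unfolding matrix_entry_def by (intro tendsto_intros lim)
 have PQ: "matrix_entry P c c \<in> Q" for c
  by (rule Q_limit[OF _ limE]) (use entQ in \<open>auto intro!: matrix_entry_clinear simp: P_def proj_bounded_clinear[OF kc]\<close>)
 then show "matrix_entry P c c \<in> Q" .
 have "(%m. S (C ^^ m)) \<longlonglongrightarrow> S P"
  unfolding S_def
  by (intro tendsto_sum tau_limit[OF _ PQ limE] contraction_entry_bound bCm bd) (use entQ in blast)
 then show "\<exists>R>0. (%m. \<Sum>j\<le>m. bc (1/R) m j *\<^sub>R S (A ^^ j)) \<longlonglongrightarrow> S P"
  using R(1) unfolding SC by blast
qed

lemma Rank_Nullity: "Rank \<tau> T = 2 * real CARD('n) - Nullity \<tau> T"
proof -
 have "\<tau> (matrix_entry (%v. v - P v) c c) = 1 - \<tau> (matrix_entry P c c)" for c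
 proof -
  have "matrix_entry (%v. v - P v) c c = (%v. id v + (-1) *\<^sub>C matrix_entry P c c v)"
   by (rule ext) (simp add: matrix_entry_def scaleC_minus_left)
  then have "\<tau> (matrix_entry (%v. v - P v) c c) = \<tau> id + (-1) * \<tau> (matrix_entry P c c)"
   by (simp only: tau_add[OF Q_id Q_scaleC[OF nullity_moments_aux(2)]] tau_scaleC[OF nullity_moments_aux(2)])
  then show ?thesis by (simp add: tau_id)
 qed
 then have "Rank \<tau> T = Re (\<Sum>c\<in>(UNIV :: ('n \<times> bool) set). 1 - \<tau> (matrix_entry P c c))"
  unfolding Rank_def amplified_trace_def A_def[symmetric]
  using spectral_projection_pos(2)[OF A_selfadj A_pos] by (simp add: P_def)
 then show ?thesis by (simp add: Nullity_eq S_def sum_subtractf)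
qed

definition mX :: "nat => complex" where
 "mX j = (\<Sum>c\<in>UNIV. trX (tpow (glist F) j c c))"

text \<open>The even exponent \<open>2 * N\<close> is meant for matrices, whose spectrum may extend
  beyond \<open>R\<close>.\<close>

lemma nullity_moments:
 assumes "\<eta> > 0"
 shows "\<exists>R>0. \<exists>N. (\<Sum>j\<le>2*N. bc (1/R) (2*N) j * Re (mX j)) <= Nullity \<tau> T + \<eta>"
proof -
 obtain R where R: "R > 0" and lim: "(%m. \<Sum>j\<le>m. bc (1/R) m j *\<^sub>R S (A ^^ j)) \<longlonglongrightarrow> S P"
  using nullity_moments_aux(1) by blast
 have "S (A ^^ j) = mX j" for j by (simp add: S_def mX_def A_pow_entry tau_evX)
 then have "(%m. \<Sum>j\<le>m. bc (1/R) m j * Re (mX j)) \<longlonglongrightarrow> Nullity \<tau> T"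
  using tendsto_Re[OF lim] by (simp add: Nullity_eq)
 then obtain N where N: "!!m. m >= N ==> norm ((\<Sum>j\<le>m. bc (1/R) m j * Re (mX j)) - Nullity \<tau> T) < \<eta>"
  using LIMSEQ_D[OF _ assms] by blast
 have "norm ((\<Sum>j\<le>2*N. bc (1/R) (2*N) j * Re (mX j)) - Nullity \<tau> T) < \<eta>" by (rule N) simp
 then have "(\<Sum>j\<le>2*N. bc (1/R) (2*N) j * Re (mX j)) <= Nullity \<tau> T + \<eta>" by (simp add: abs_less_iff)
 then show ?thesis using R by blast
qed

end

section \<open>Matrices as functions and dyadic Schatten norms\<close>

text \<open>Matrices are functions of two indices; only the entries in a finite index set \<open>I\<close> matter,
  but associativity holds without any carrier condition.\<close>

definition mm :: "'i set => ('a => 'i => 'r::comm_semiring_1) => ('i => 'b => 'r) => 'a => 'b => 'r" where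
 "mm I f g = (%a b. \<Sum>c\<in>I. f a c * g c b)"

definition idm :: "'i => 'i => 'r::comm_semiring_1" where "idm a b = (if a = b then 1 else 0)"

definition mstar :: "('a => 'b => complex) => 'b => 'a => complex" where "mstar f = (%a b. cnj (f b a))"

definition mtr :: "'i set => ('i => 'i => 'r::comm_semiring_1) => 'r" where "mtr I f = (\<Sum>a\<in>I. f a a)"

definition hs2 :: "'i set => ('i => 'i => complex) => real" where
 "hs2 I f = (\<Sum>a\<in>I. \<Sum>b\<in>I. (cmod (f a b))^2)"

lemma mm_assoc: "mm I (mm J f g) h = mm J f (mm I g h)"
proof (intro ext)
 fix a b
 have "mm I (mm J f g) h a b = (\<Sum>c\<in>I. \<Sum>d\<in>J. f a d * g d c * h c b)" by (simp add: mm_def sum_distrib_right)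
 also have "... = (\<Sum>d\<in>J. \<Sum>c\<in>I. f a d * g d c * h c b)" by (rule sum.swap)
 also have "... = mm J f (mm I g h) a b" by (simp add: mm_def sum_distrib_left mult.assoc)
 finally show "mm I (mm J f g) h a b = mm J f (mm I g h) a b" .
qed

lemma mtr_comm: "mtr I (mm J f g) = mtr J (mm I g f)"
 unfolding mtr_def mm_def by (subst sum.swap) (simp add: mult.commute)

lemma mstar_mm: "mstar (mm I f g) = mm I (mstar g) (mstar f)"
 by (auto simp: mstar_def mm_def mult.commute)

lemma mstar_mstar [simp]: "mstar (mstar f) = f" by (simp add: mstar_def)

lemma mm_idm_left: "finite I ==> a \<in> I ==> mm I idm f a b = f a b"
 by (simp add: mm_def idm_def if_distrib if_distribR sum.delta cong: if_cong)

lemma mm_idm_right: "finite I ==> b \<in> I ==> mm I f idm a b = f a b"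
 by (simp add: mm_def idm_def if_distrib if_distribR sum.delta cong: if_cong)

lemma mm_add_right: "mm I f (%a b. g a b + h a b) = (%a b. mm I f g a b + mm I f h a b)"
 by (simp add: mm_def algebra_simps sum.distrib)

lemma mm_add_left: "mm I (%a b. g a b + h a b) f = (%a b. mm I g f a b + mm I h f a b)"
 by (simp add: mm_def algebra_simps sum.distrib)

lemma mm_sum_list_right: "mm I f (%a b. \<Sum>x\<leftarrow>xs. g x a b) = (%a b. \<Sum>x\<leftarrow>xs. mm I f (g x) a b)"
 by (induction xs) (auto simp: mm_add_right, simp add: mm_def)

lemma hs2_nonneg: "0 <= hs2 I f" by (simp add: hs2_def sum_nonneg)

lemma hs2_mstar: "hs2 I (mstar f) = hs2 I f"
 unfolding hs2_def mstar_def by (subst sum.swap) simp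

lemma mtr_star_self: "mtr I (mm I f (mstar f)) = of_real (hs2 I f)"
 by (simp add: mtr_def mm_def mstar_def hs2_def complex_norm_square del: of_real_power)

lemma mtr_star_self': "mtr I (mm I (mstar f) f) = of_real (hs2 I f)"
 by (simp add: mtr_comm[of I I "mstar f"] mtr_star_self)

lemma hs2_L2: "finite I ==> sqrt (hs2 I f) = L2_set (%(a, b). cmod (f a b)) (I \<times> I)"
 by (simp add: hs2_def L2_set_def sum.cartesian_product case_prod_unfold)

lemma mtr_cauchy_schwarz:
 assumes "finite I" shows "cmod (mtr I (mm I f g)) <= sqrt (hs2 I f) * sqrt (hs2 I g)"
proof -
 have "cmod (mtr I (mm I f g)) = cmod (\<Sum>(a, b)\<in>I \<times> I. f a b * g b a)"
  by (simp add: mtr_def mm_def sum.cartesian_product)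
 also have "... <= (\<Sum>p\<in>I \<times> I. cmod (case p of (a, b) => f a b * g b a))" by (rule norm_sum)
 also have "... = (\<Sum>p\<in>I \<times> I. \<bar>cmod (f (fst p) (snd p))\<bar> * \<bar>cmod (mstar g (fst p) (snd p))\<bar>)"
  by (simp add: case_prod_unfold norm_mult mstar_def)
 also have "... <= L2_set (%p. cmod (f (fst p) (snd p))) (I \<times> I) * L2_set (%p. cmod (mstar g (fst p) (snd p))) (I \<times> I)"
  by (rule L2_set_mult_ineq)
 also have "... = sqrt (hs2 I f) * sqrt (hs2 I (mstar g))"
  using assms by (simp add: hs2_L2 case_prod_unfold)
 finally show ?thesis by (simp add: hs2_mstar)
qed

lemma hs2_triangle:
 assumes "finite I" shows "sqrt (hs2 I (%a b. f a b + g a b)) <= sqrt (hs2 I f) + sqrt (hs2 I g)"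
proof -
 have "L2_set (%p. cmod (f (fst p) (snd p) + g (fst p) (snd p))) (I \<times> I)
   <= L2_set (%p. cmod (f (fst p) (snd p)) + cmod (g (fst p) (snd p))) (I \<times> I)"
  by (intro L2_set_mono norm_triangle_ineq) auto
 also have "... <= L2_set (%p. cmod (f (fst p) (snd p))) (I \<times> I) + L2_set (%p. cmod (g (fst p) (snd p))) (I \<times> I)"
  by (rule L2_set_triangle_ineq)
 finally show ?thesis using assms by (simp add: hs2_L2 case_prod_unfold)
qed

lemma hs2_sum_list:
 assumes "finite I" "!!x. x \<in> set xs ==> sqrt (hs2 I x) <= c"
 shows "sqrt (hs2 I (%a b. \<Sum>x\<leftarrow>xs. x a b)) <= real (length xs) * c"
 using assms(2)
proof (induction xs)
 case Nil then show ?case by (simp add: hs2_def)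
next
 case (Cons x xs)
 have "sqrt (hs2 I (%a b. x a b + (\<Sum>x\<leftarrow>xs. x a b))) <= sqrt (hs2 I x) + sqrt (hs2 I (%a b. \<Sum>x\<leftarrow>xs. x a b))"
  by (rule hs2_triangle[OF assms(1)])
 also have "... <= c + real (length xs) * c" using Cons by (intro add_mono) auto
 finally show ?case by (simp add: algebra_simps)
qed

text \<open>The power of \<open>f\<close> with exponent \<open>2 ^ j\<close>. Repeated squaring
  suffices because all Schatten exponents in use are dyadic.\<close>

primrec msq :: "'i set => nat => ('i => 'i => complex) => 'i => 'i => complex" where
 "msq I 0 f = f"
| "msq I (Suc j) f = mm I (msq I j f) (msq I j f)"

lemma msq_Suc': "msq I (Suc j) f = msq I j (mm I f f)"
 by (induction j) auto

lemma mstar_msq: "mstar (msq I j f) = msq I j (mstar f)"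
 by (induction j) (auto simp: mstar_mm)

text \<open>The power of \<open>f g\<close> has the form \<open>f Z\<close>, and the same power of
  \<open>g f\<close> is \<open>Z f\<close> with the same \<open>Z\<close>; squaring replaces
  \<open>Z\<close> by \<open>Z f Z\<close>.\<close>

lemma msq_cyclic: "mtr I (msq I j (mm I f g)) = mtr I (msq I j (mm I g f))"
proof -
 have "\<exists>Z. msq I j (mm I f g) = mm I f Z \<and> msq I j (mm I g f) = mm I Z f"
 proof (induction j)
  case 0 then show ?case by auto
 next
  case (Suc j)
  then obtain Z where "msq I j (mm I f g) = mm I f Z" "msq I j (mm I g f) = mm I Z f" by blast
  then show ?case by (intro exI[of _ "mm I Z (mm I f Z)"]) (simp add: mm_assoc)
 qed
 then show ?thesis using mtr_comm by metis
qed

lemma mtr_msq_herm: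
 assumes "mstar P = P" shows "mtr I (msq I (Suc j) P) = of_real (hs2 I (msq I j P))"
 using mtr_star_self[of I "msq I j P"] assms by (simp add: mstar_msq)

text \<open>The two inequalities \<open>|tr X^(2^(j+1))| \<le> tr (X* X)^(2^j)\<close> and
  \<open>tr (P Q)^(2^j) \<le> tr P^(2^j) Q^(2^j)\<close> are proved by a simultaneous induction.\<close>

lemma trace_power_inequalities:
 assumes I: "finite I"
 shows "(\<forall>X. cmod (mtr I (msq I (Suc j) X)) <= Re (mtr I (msq I j (mm I (mstar X) X)))) \<and>
  (\<forall>P Q. mstar P = P --> mstar Q = Q -->
    Re (mtr I (msq I j (mm I P Q))) <= Re (mtr I (mm I (msq I j P) (msq I j Q))))"
proof (induction j)
 case 0
 have "cmod (mtr I (mm I X X)) <= hs2 I X" for X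
  using mtr_cauchy_schwarz[OF I, of X X] by (simp add: hs2_nonneg)
 then show ?case by (simp add: mtr_star_self')
next
 case (Suc j)
 have S: "cmod (mtr I (msq I (Suc j) X)) <= Re (mtr I (msq I j (mm I (mstar X) X)))" for X using Suc by blast
 have R: "Re (mtr I (msq I j (mm I P Q))) <= Re (mtr I (mm I (msq I j P) (msq I j Q)))"
  if "mstar P = P" "mstar Q = Q" for P Q using Suc that by blast
 show ?case
 proof (intro conjI allI impI)
  fix X :: "'a => 'a => complex"
  define P where "P = mm I (mstar X) X" define Q where "Q = mm I X (mstar X)"
  have h: "mstar P = P" "mstar Q = Q" by (simp_all add: P_def Q_def mstar_mm)
  have "cmod (mtr I (msq I (Suc (Suc j)) X)) <= Re (mtr I (msq I j (mm I (mstar (mm I X X)) (mm I X X))))"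
   using S[of "mm I X X"] by (simp only: msq_Suc'[of I "Suc j"])
  also have "mm I (mstar (mm I X X)) (mm I X X) = mm I (mstar X) (mm I (mstar X) (mm I X X))"
   by (simp add: mstar_mm mm_assoc)
  \<comment> \<open>Moving the leading adjoint of \<open>X\<close> to the end under the trace
    regroups the product as \<open>P\<close> times \<open>Q\<close>.\<close>
  also have "mtr I (msq I j ...) = mtr I (msq I j (mm I P Q))"
   unfolding msq_cyclic[of I j "mstar X"] by (simp add: P_def Q_def mm_assoc)
  also have "Re (mtr I (msq I j (mm I P Q))) <= Re (mtr I (mm I (msq I j P) (msq I j Q)))" by (rule R[OF h])
  also have "... <= sqrt (hs2 I (msq I j P)) * sqrt (hs2 I (msq I j Q))"
   using mtr_cauchy_schwarz[OF I] complex_Re_le_cmod order_trans by blast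
  also have "hs2 I (msq I j Q) = hs2 I (msq I j P)"
  proof -
   have "mtr I (msq I (Suc j) Q) = mtr I (msq I (Suc j) P)" unfolding P_def Q_def by (rule msq_cyclic)
   then show ?thesis unfolding mtr_msq_herm[OF h(1)] mtr_msq_herm[OF h(2)] by (simp only: of_real_eq_iff)
  qed
  also have "sqrt (hs2 I (msq I j P)) * sqrt (hs2 I (msq I j P)) = Re (mtr I (msq I (Suc j) P))"
   by (simp only: mtr_msq_herm[OF h(1)]) (simp add: hs2_nonneg)
  finally show "cmod (mtr I (msq I (Suc (Suc j)) X)) <= Re (mtr I (msq I (Suc j) (mm I (mstar X) X)))"
   unfolding P_def .
 next
  fix P Q :: "'a => 'a => complex" assume h: "mstar P = P" "mstar Q = Q"
  have "Re (mtr I (msq I (Suc j) (mm I P Q))) <= Re (mtr I (msq I j (mm I (mstar (mm I P Q)) (mm I P Q))))"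
   using S complex_Re_le_cmod order_trans by blast
  also have "mm I (mstar (mm I P Q)) (mm I P Q) = mm I Q (mm I (mm I P P) Q)" by (simp add: mstar_mm h mm_assoc)
  also have "mtr I (msq I j ...) = mtr I (msq I j (mm I (mm I P P) (mm I Q Q)))"
   unfolding msq_cyclic[of I j Q] by (simp add: mm_assoc)
  also have "Re (mtr I (msq I j (mm I (mm I P P) (mm I Q Q)))) <= Re (mtr I (mm I (msq I j (mm I P P)) (msq I j (mm I Q Q))))"
   by (rule R) (simp_all add: mstar_mm h)
  finally show "Re (mtr I (msq I (Suc j) (mm I P Q))) <= Re (mtr I (mm I (msq I (Suc j) P) (msq I (Suc j) Q)))"
   by (simp only: msq_Suc')
 qed
qed

text \<open>\<open>nrm I j A\<close> is the power \<open>2 ^ (j + 1)\<close> of the unnormalized Schatten norm with exponent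
  \<open>2 ^ (j + 1)\<close>.\<close>

definition nrm :: "'i set => nat => ('i => 'i => complex) => real" where
 "nrm I j A = Re (mtr I (msq I j (mm I (mstar A) A)))"

lemma nrm_0: "nrm I 0 A = hs2 I A" by (simp add: nrm_def mtr_star_self')

lemma nrm_Suc: "nrm I (Suc j) A = hs2 I (msq I j (mm I (mstar A) A))"
 unfolding nrm_def by (subst mtr_msq_herm) (simp_all add: mstar_mm)

lemma nrm_nonneg: "0 <= nrm I j A"
 by (cases j) (auto simp: nrm_0 nrm_Suc hs2_nonneg)

lemma nrm_mstar: "nrm I j (mstar A) = nrm I j A"
 unfolding nrm_def by (subst msq_cyclic) simp

text \<open>Hoelder's inequality for dyadic exponents: the trace of the power of \<open>?P\<close>
  times \<open>?Q\<close> is separated into the two powers and then estimated by Cauchy-Schwarz. The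
  exponent for the factors is twice that for the product, so each multiplication costs one
  level.\<close>

lemma nrm_mm:
 assumes I: "finite I" shows "nrm I j (mm I A B) <= sqrt (nrm I (Suc j) A) * sqrt (nrm I (Suc j) B)"
proof -
 let ?P = "mm I (mstar A) A" let ?Q = "mm I B (mstar B)"
 have "mm I (mstar (mm I A B)) (mm I A B) = mm I (mstar B) (mm I (mstar A) (mm I A B))"
  by (simp add: mstar_mm mm_assoc)
 then have "nrm I j (mm I A B) = Re (mtr I (msq I j (mm I ?P ?Q)))"
  unfolding nrm_def by (simp add: msq_cyclic[of I j "mstar B"] mm_assoc)
 also have "... <= Re (mtr I (mm I (msq I j ?P) (msq I j ?Q)))"
  using trace_power_inequalities[OF I, of j] by (simp add: mstar_mm)
 also have "... <= sqrt (hs2 I (msq I j ?P)) * sqrt (hs2 I (msq I j ?Q))"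
  using mtr_cauchy_schwarz[OF I] complex_Re_le_cmod order_trans by blast
 also have "hs2 I (msq I j ?Q) = nrm I (Suc j) B"
  using nrm_Suc[of I j "mstar B"] by (simp add: nrm_mstar)
 finally show ?thesis by (simp add: nrm_Suc)
qed

text \<open>All normalized Schatten norms with exponents 2, 4, up to \<open>2 ^ Suc J\<close> are at
  most \<open>c\<close>. This replaces an operator norm bound at a microstate, of which only
  finitely many moments are under control; \<open>J\<close> counts the multiplications that remain
  possible.\<close>

definition lbd :: "'i set => nat => ('i => 'i => complex) => real => bool" where
 "lbd I J A c \<longleftrightarrow> (\<forall>j\<le>J. nrm I j A <= real (card I) * c ^ (2 ^ Suc j))"

lemma lbd_mono: "lbd I J A c ==> 0 <= c ==> c <= d ==> K <= J ==> lbd I K A d"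
 unfolding lbd_def by (meson mult_left_mono of_nat_0_le_iff order_trans power_mono)

lemma lbd_mstar: "lbd I J (mstar A) c = lbd I J A c" by (simp add: lbd_def nrm_mstar)

lemma lbd_mm:
 assumes I: "finite I" and A: "lbd I (Suc J) A c" and B: "lbd I (Suc J) B d" and cd: "0 <= c" "0 <= d"
 shows "lbd I J (mm I A B) (c * d)"
 unfolding lbd_def
proof (intro allI impI)
 fix j assume j: "j <= J"
 have "nrm I j (mm I A B) <= sqrt (nrm I (Suc j) A) * sqrt (nrm I (Suc j) B)" by (rule nrm_mm[OF I])
 also have "... <= sqrt (real (card I) * c ^ 2 ^ Suc (Suc j)) * sqrt (real (card I) * d ^ 2 ^ Suc (Suc j))"
  using A B j unfolding lbd_def
  by (intro mult_mono real_sqrt_le_mono real_sqrt_ge_zero nrm_nonneg mult_nonneg_nonneg zero_le_power cd) auto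
 also have "... = sqrt ((real (card I) * (c * d) ^ 2 ^ Suc j)^2)"
  by (simp add: real_sqrt_mult[symmetric] power_mult_distrib power_mult[symmetric] power2_eq_square mult_ac
    power_add[symmetric])
 also have "... = real (card I) * (c * d) ^ 2 ^ Suc j" using cd by (intro real_sqrt_abs[THEN trans] abs_of_nonneg) simp
 finally show "nrm I j (mm I A B) <= real (card I) * (c * d) ^ 2 ^ Suc j" .
qed

lemma lbd_hs2: "lbd I J A c ==> 0 <= c ==> sqrt (hs2 I A) <= sqrt (real (card I)) * c"
 unfolding lbd_def using real_sqrt_le_mono[of "hs2 I A" "real (card I) * c^2"]
 by (auto simp: real_sqrt_mult nrm_0 dest: spec[of _ 0])

lemma mstar_idm: "mstar idm = idm" by (auto simp: mstar_def idm_def fun_eq_iff)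

lemma msq_cong:
 assumes "!!a b. a \<in> I ==> b \<in> I ==> f a b = g a b" "a \<in> I" "b \<in> I"
 shows "msq I j f a b = msq I j g a b"
 using assms(2,3) by (induction j arbitrary: a b) (auto simp: assms(1) mm_def)

lemma msq_idm: "finite I ==> a \<in> I ==> b \<in> I ==> msq I j idm a b = idm a b"
proof (induction j arbitrary: a b)
 case (Suc j)
 have "msq I (Suc j) idm a b = mm I idm idm a b"
  unfolding msq.simps mm_def by (intro sum.cong) (simp_all add: Suc)
 then show ?case using Suc mm_idm_left by metis
qed simp

lemma lbd_idm: "finite I ==> lbd I J idm 1"
 unfolding lbd_def
proof (intro allI impI)
 fix j assume I: "finite I"
 have "msq I j (mm I (mstar idm) idm) a a = idm a a" if "a \<in> I" for a
 proof -
  have "mm I (mstar idm) idm a b = idm a b" if "a \<in> I" "b \<in> I" for a b :: 'a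
   unfolding mstar_idm by (rule mm_idm_left[OF I that(1)])
  then have "msq I j (mm I (mstar idm) idm) a a = msq I j idm a a" using that by (intro msq_cong)
  also have "... = idm a a" by (rule msq_idm[OF I that that])
  finally show ?thesis .
 qed
 then show "nrm I j idm <= real (card I) * 1 ^ 2 ^ Suc j"
  by (simp add: nrm_def mtr_def idm_def)
qed

section \<open>Operator norm bounds\<close>

definition opb :: "'i set => ('i => 'i => complex) => real => bool" where
 "opb I e d \<longleftrightarrow> (\<forall>x. (\<Sum>a\<in>I. (cmod (\<Sum>b\<in>I. e a b * x b))^2) <= d^2 * (\<Sum>b\<in>I. (cmod (x b))^2))"

lemma opb_mm:
 assumes "opb I e c" "opb I f d" shows "opb I (mm I e f) (c * d)"
 unfolding opb_def
proof
 fix x :: "'a => complex"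
 have "(\<Sum>b\<in>I. mm I e f a b * x b) = (\<Sum>c\<in>I. e a c * (\<Sum>b\<in>I. f c b * x b))" for a
  unfolding mm_def sum_distrib_left sum_distrib_right by (subst sum.swap) (simp add: mult.assoc)
 then have "(\<Sum>a\<in>I. (cmod (\<Sum>b\<in>I. mm I e f a b * x b))^2)
   <= c^2 * (\<Sum>c\<in>I. (cmod (\<Sum>b\<in>I. f c b * x b))^2)"
  using assms(1) unfolding opb_def by simp
 also have "... <= c^2 * (d^2 * (\<Sum>b\<in>I. (cmod (x b))^2))"
  using assms(2) unfolding opb_def by (intro mult_left_mono) auto
 finally show "(\<Sum>a\<in>I. (cmod (\<Sum>b\<in>I. mm I e f a b * x b))^2) <= (c * d)^2 * (\<Sum>b\<in>I. (cmod (x b))^2)"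
  by (simp add: power_mult_distrib mult.assoc)
qed

lemma opb_mstar:
 assumes I: "finite I" and e: "opb I e d" shows "opb I (mstar e) d"
 unfolding opb_def
proof
 fix y :: "'a => complex"
 define z where "z a = (\<Sum>b\<in>I. mstar e a b * y b)" for a
 define w where "w a = (\<Sum>b\<in>I. e a b * z b)" for a
 define Z where "Z = (\<Sum>a\<in>I. (cmod (z a))^2)"
 define Y where "Y = (\<Sum>b\<in>I. (cmod (y b))^2)"
 have Z0: "Z >= 0" "Y >= 0" by (simp_all add: Z_def Y_def sum_nonneg)
 have "complex_of_real Z = (\<Sum>a\<in>I. cnj (z a) * z a)"
  by (simp add: Z_def complex_norm_square mult.commute del: of_real_power)
 also have "... = (\<Sum>a\<in>I. \<Sum>b\<in>I. cnj (y b) * (e b a * z a))"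
  by (simp add: z_def[of a for a] sum_distrib_right mstar_def) (simp add: z_def mstar_def mult_ac)
 also have "... = (\<Sum>b\<in>I. cnj (y b) * w b)"
  by (subst sum.swap) (simp add: w_def sum_distrib_left)
 finally have "Z = cmod (\<Sum>b\<in>I. cnj (y b) * w b)" using Z0 by (metis abs_of_nonneg norm_of_real)
 also have "... <= (\<Sum>b\<in>I. cmod (cnj (y b) * w b))" by (rule norm_sum)
 also have "... = (\<Sum>b\<in>I. \<bar>cmod (y b)\<bar> * \<bar>cmod (w b)\<bar>)" by (simp add: norm_mult)
 also have "... <= L2_set (%b. cmod (y b)) I * L2_set (%b. cmod (w b)) I" by (rule L2_set_mult_ineq)
 finally have "Z <= sqrt Y * sqrt (\<Sum>b\<in>I. (cmod (w b))^2)" by (simp add: L2_set_def Y_def)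
 also have "... <= sqrt Y * sqrt (d^2 * Z)"
  using e Z0 unfolding opb_def w_def Z_def by (intro mult_left_mono real_sqrt_le_mono) auto
 finally have "Z^2 <= (sqrt Y * sqrt (d^2 * Z))^2" using Z0 by (intro power_mono)
 also have "... = Y * (d^2 * Z)" using Z0 by (simp add: power_mult_distrib)
 finally have "Z <= d^2 * Y" using Z0 by (cases "Z = 0") (auto simp: power2_eq_square mult_ac)
 then show "(\<Sum>a\<in>I. (cmod (\<Sum>b\<in>I. mstar e a b * y b))^2) <= d^2 * (\<Sum>b\<in>I. (cmod (y b))^2)"
  by (simp add: Z_def Y_def z_def)
qed

lemma opb_hs2:
 assumes I: "finite I" and e: "opb I e d" shows "hs2 I e <= real (card I) * d^2"
proof -
 have "hs2 I e = (\<Sum>b\<in>I. \<Sum>a\<in>I. (cmod (e a b))^2)" unfolding hs2_def by (rule sum.swap)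
 also have "... <= (\<Sum>b\<in>I. d^2)"
 proof (rule sum_mono)
  fix b assume b: "b \<in> I"
  have "(\<Sum>a\<in>I. (cmod (\<Sum>c\<in>I. e a c * (if c = b then 1 else 0)))^2) <= d^2 * (\<Sum>c\<in>I. (cmod (if c = b then 1 else 0))^2)"
   using e unfolding opb_def by (rule allE)
  then show "(\<Sum>a\<in>I. (cmod (e a b))^2) <= d^2"
   using b I by (simp add: if_distrib[of cmod] if_distrib[of "%t. t^2"] if_distrib[of "%t. _ * t"] sum.delta cong: if_cong)
 qed
 finally show ?thesis by simp
qed

lemma opb_msq: "opb I e d ==> opb I (msq I j e) (d ^ 2 ^ j)"
 by (induction j) (auto simp: mult_2 power_add intro: opb_mm)

text \<open>The increments between points of a piece are bounded in operator norm. Here that bound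
  enters the Hoelder estimates, at every level and with the same constant.\<close>

lemma opb_lbd:
 assumes I: "finite I" and e: "opb I e d" shows "lbd I J e d"
 unfolding lbd_def
proof (intro allI impI)
 fix j
 show "nrm I j e <= real (card I) * d ^ 2 ^ Suc j"
 proof (cases j)
  case 0 then show ?thesis using opb_hs2[OF I e] by (simp add: nrm_0)
 next
  case (Suc i)
  have "opb I (msq I i (mm I (mstar e) e)) ((d * d) ^ 2 ^ i)" by (intro opb_msq opb_mm opb_mstar I e)
  from opb_hs2[OF I this] show ?thesis
   unfolding Suc nrm_Suc by (simp add: power2_eq_square[symmetric] power_mult[symmetric] mult_ac)
 qed
qed

section \<open>Evaluation of words and polynomials in matrices\<close>

definition ltr :: "('n => 'i => 'i => complex) => 'n \<times> bool => 'i => 'i => complex" where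
 "ltr xi l = (if snd l then mstar (xi (fst l)) else xi (fst l))"

primrec wm :: "'i set => ('n => 'i => 'i => complex) => 'n star_word => 'i => 'i => complex" where
 "wm I xi [] = idm"
| "wm I xi (l # w) = mm I (ltr xi l) (wm I xi w)"

text \<open>The derivative at \<open>xi\<close> in the direction \<open>v\<close> of the evaluation
  of a word, by the Leibniz rule. It is only real linear in \<open>v\<close>, since starred letters
  use the adjoint of \<open>v\<close>.\<close>

primrec dw :: "'i set => ('n => 'i => 'i => complex) => ('n => 'i => 'i => complex) => 'n star_word => 'i => 'i => complex" where
 "dw I xi v [] = (%_ _. 0)"
| "dw I xi v (l # w) = (%a b. mm I (ltr xi l) (dw I xi v w) a b + mm I (ltr v l) (wm I xi w) a b)"

text \<open>A sum of at most \<open>n\<close> terms with Schatten norms bounded up to level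
  \<open>J\<close>. The terms are kept apart so that each can still be multiplied by means of
  \<open>lbd_mm\<close>; they are added only at the end, by the triangle inequality of the
  2-norm.\<close>

definition spr :: "'i set => nat => nat => real => ('i => 'i => complex) => bool" where
 "spr I J n c M \<longleftrightarrow> (\<exists>xs. length xs <= n \<and> (\<forall>x\<in>set xs. lbd I J x c) \<and> M = (%a b. \<Sum>x\<leftarrow>xs. x a b))"

lemma spr_zero: "spr I J n c (%_ _. 0)"
 unfolding spr_def by (intro exI[of _ "[]"]) auto

lemma spr_single: "lbd I J M c ==> spr I J 1 c M"
 unfolding spr_def by (intro exI[of _ "[M]"]) auto

lemma spr_add: "spr I J n c M ==> spr I J m c N ==> spr I J (n + m) c (%a b. M a b + N a b)"
 unfolding spr_def
proof (elim exE conjE)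
 fix xs ys assume "length xs <= n" "\<forall>x\<in>set xs. lbd I J x c" "M = (%a b. \<Sum>x\<leftarrow>xs. x a b)"
  "length ys <= m" "\<forall>x\<in>set ys. lbd I J x c" "N = (%a b. \<Sum>x\<leftarrow>ys. x a b)"
 then show "\<exists>zs. length zs <= n + m \<and> (\<forall>x\<in>set zs. lbd I J x c) \<and> (%a b. M a b + N a b) = (%a b. \<Sum>x\<leftarrow>zs. x a b)"
  by (intro exI[of _ "xs @ ys"]) auto
qed

lemma spr_mm:
 assumes I: "finite I" and A: "lbd I (Suc J) A c" and M: "spr I (Suc J) n d M" and cd: "0 <= c" "0 <= d"
 shows "spr I J n (c * d) (mm I A M)"
proof -
 obtain xs where xs: "length xs <= n" "\<forall>x\<in>set xs. lbd I (Suc J) x d" "M = (%a b. \<Sum>x\<leftarrow>xs. x a b)"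
  using M unfolding spr_def by blast
 show ?thesis unfolding spr_def
  by (intro exI[of _ "map (mm I A) xs"])
   (use xs lbd_mm[OF I A _ cd] mm_sum_list_right[of I A "%x. x" xs] in \<open>auto simp: o_def\<close>)
qed

lemma spr_mono: "spr I J n c M ==> 0 <= c ==> c <= d ==> K <= J ==> n <= m ==> spr I K m d M"
 unfolding spr_def
proof (elim exE conjE)
 fix xs assume cd: "0 <= c" "c <= d" "K <= J" and "n <= m" "length xs <= n" and xs: "\<forall>x\<in>set xs. lbd I J x c"
  and "M = (%a b. \<Sum>x\<leftarrow>xs. x a b)"
 moreover have "\<forall>x\<in>set xs. lbd I K x d" using xs lbd_mono[OF _ cd] by blast
 ultimately show "\<exists>xs. length xs <= m \<and> (\<forall>x\<in>set xs. lbd I K x d) \<and> M = (%a b. \<Sum>x\<leftarrow>xs. x a b)"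
  by (intro exI[of _ xs]) simp
qed

lemma spr_hs2:
 assumes "finite I" "spr I J n c M" "0 <= c"
 shows "sqrt (hs2 I M) <= real n * (sqrt (real (card I)) * c)"
proof -
 obtain xs where xs: "length xs <= n" "\<forall>x\<in>set xs. lbd I J x c" "M = (%a b. \<Sum>x\<leftarrow>xs. x a b)"
  using assms unfolding spr_def by blast
 have "sqrt (hs2 I M) <= real (length xs) * (sqrt (real (card I)) * c)"
  unfolding xs(3) by (rule hs2_sum_list[OF assms(1)]) (use xs(2) lbd_hs2 assms(3) in blast)
 also have "... <= real n * (sqrt (real (card I)) * c)" using xs(1) assms(3) by (intro mult_right_mono) auto
 finally show ?thesis .
qed

lemma lbd_ltr: "(!!i. lbd I J (xi i) c) ==> lbd I J (ltr xi l) c"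
 by (auto simp: ltr_def lbd_mstar)

lemma lbd_wm:
 assumes I: "finite I" and xi: "!!i. lbd I (J + length w) (xi i) K" and K: "K >= 1"
 shows "lbd I J (wm I xi w) (K ^ length w)"
 using xi
proof (induction w arbitrary: J)
 case Nil then show ?case using lbd_idm[OF I] by simp
next
 case (Cons l w)
 have "lbd I (Suc J) (wm I xi w) (K ^ length w)" using Cons by simp
 moreover have "lbd I (Suc J) (ltr xi l) K"
  by (rule lbd_ltr) (rule lbd_mono[OF Cons.prems], use K in auto)
 ultimately show ?case using lbd_mm[OF I, of J "ltr xi l" K "wm I xi w"] K by simp
qed

text \<open>Let \<open>D\<close> be the difference and \<open>R\<close> the Taylor remainder for the
  word \<open>w\<close>. A further letter \<open>l\<close> turns \<open>D\<close> into
  \<open>ltr xi l\<close> times \<open>D\<close> plus \<open>ltr v l\<close> times the word at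
  \<open>xi'\<close>, and \<open>R\<close> into \<open>ltr xi l\<close> times \<open>R\<close> plus
  \<open>ltr v l\<close> times \<open>D\<close>. The last term is quadratic because \<open>D\<close>
  already carries a factor \<open>\<delta>\<close>. The number of terms grows from
  \<open>n^2\<close> to \<open>n^2 + n\<close>, which is at most \<open>(n + 1)^2\<close>.\<close>

lemma spr_word_diff:
 assumes I: "finite I" and xi: "!!i. lbd I (J + length w) (xi i) K" and xi': "!!i. lbd I (J + length w) (xi' i) K"
  and v: "!!i. lbd I (J + length w) (v i) \<delta>" and veq: "!!i a b. xi' i a b = xi i a b + v i a b"
  and K: "K >= 1" and \<delta>: "\<delta> >= 0"
 shows "spr I J (length w) (K ^ length w * \<delta>) (%a b. wm I xi' w a b - wm I xi w a b)"
  and "spr I J ((length w)^2) (K ^ length w * \<delta>^2) (%a b. wm I xi' w a b - wm I xi w a b - dw I xi v w a b)"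
proof -
 have l: "ltr xi' l a b = ltr xi l a b + ltr v l a b" for l a b by (simp add: ltr_def mstar_def veq)
 have K0: "0 <= K ^ m * \<delta>" "0 <= K ^ m * \<delta>^2" for m using K \<delta> by auto
 have both: "spr I J (length w) (K ^ length w * \<delta>) (%a b. wm I xi' w a b - wm I xi w a b) \<and>
  spr I J ((length w)^2) (K ^ length w * \<delta>^2) (%a b. wm I xi' w a b - wm I xi w a b - dw I xi v w a b)"
  using xi xi' v
 proof (induction w arbitrary: J)
  case Nil then show ?case by (simp add: spr_zero)
 next
  case (Cons l w)
  let ?D = "%a b. wm I xi' w a b - wm I xi w a b"
  let ?R = "%a b. wm I xi' w a b - wm I xi w a b - dw I xi v w a b"
  have IH: "spr I (Suc J) (length w) (K ^ length w * \<delta>) ?D" "spr I (Suc J) ((length w)^2) (K ^ length w * \<delta>^2) ?R"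
   using Cons.IH[of "Suc J"] Cons.prems by auto
  have lv: "lbd I (Suc J) (ltr v l) \<delta>" by (rule lbd_ltr) (rule lbd_mono[OF Cons.prems(3)], use \<delta> in auto)
  have lx: "lbd I (Suc J) (ltr xi l) K" by (rule lbd_ltr) (rule lbd_mono[OF Cons.prems(1)], use K in auto)
  have W: "lbd I (Suc J) (wm I xi' w) (K ^ length w)" by (rule lbd_wm[OF I _ K]) (use Cons.prems(2) in simp)
  have KK: "K ^ length w <= K ^ Suc (length w)" using K by simp
  have 1: "spr I J (length w) (K * (K ^ length w * \<delta>)) (mm I (ltr xi l) ?D)"
   by (rule spr_mm[OF I lx IH(1)]) (use K K0 in auto)
  have "spr I J 1 (\<delta> * K ^ length w) (mm I (ltr v l) (wm I xi' w))"
   by (rule spr_mm[OF I lv spr_single[OF W]]) (use K \<delta> in auto)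
  then have 2: "spr I J 1 (K * (K ^ length w * \<delta>)) (mm I (ltr v l) (wm I xi' w))"
   by (rule spr_mono) (use K \<delta> mult_left_mono[OF KK \<delta>] in \<open>auto simp: mult_ac\<close>)
  have e1: "(%a b. wm I xi' (l # w) a b - wm I xi (l # w) a b)
    = (%a b. mm I (ltr xi l) ?D a b + mm I (ltr v l) (wm I xi' w) a b)"
   by (auto simp: mm_def l algebra_simps sum.distrib sum_subtractf fun_eq_iff)
  have A: "spr I J (length (l # w)) (K ^ length (l # w) * \<delta>) (%a b. wm I xi' (l # w) a b - wm I xi (l # w) a b)"
   unfolding e1 using spr_add[OF 1 2] by (simp add: mult_ac)
  have 3: "spr I J ((length w)^2) (K * (K ^ length w * \<delta>^2)) (mm I (ltr xi l) ?R)"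
   by (rule spr_mm[OF I lx IH(2)]) (use K K0 in auto)
  have "spr I J (length w) (\<delta> * (K ^ length w * \<delta>)) (mm I (ltr v l) ?D)"
   by (rule spr_mm[OF I lv IH(1)]) (use \<delta> K0 in auto)
  then have 4: "spr I J (length w) (K * (K ^ length w * \<delta>^2)) (mm I (ltr v l) ?D)"
   by (rule spr_mono)
    (use K \<delta> mult_right_mono[OF KK, of "\<delta>^2"] in \<open>auto simp: mult_ac power2_eq_square\<close>)
  have e2: "(%a b. wm I xi' (l # w) a b - wm I xi (l # w) a b - dw I xi v (l # w) a b)
    = (%a b. mm I (ltr xi l) ?R a b + mm I (ltr v l) ?D a b)"
   by (auto simp: mm_def l algebra_simps sum.distrib sum_subtractf fun_eq_iff)
  have "spr I J ((length w)^2 + length w) (K * (K ^ length w * \<delta>^2))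
    (%a b. wm I xi' (l # w) a b - wm I xi (l # w) a b - dw I xi v (l # w) a b)"
   unfolding e2 using spr_add[OF 3 4] .
  then have "spr I J ((length (l # w))^2) (K ^ length (l # w) * \<delta>^2)
    (%a b. wm I xi' (l # w) a b - wm I xi (l # w) a b - dw I xi v (l # w) a b)"
   by (rule spr_mono) (use K K0 in \<open>auto simp: power2_eq_square mult_ac\<close>)
  with A show ?case by blast
 qed
 then show "spr I J (length w) (K ^ length w * \<delta>) (%a b. wm I xi' w a b - wm I xi w a b)"
  "spr I J ((length w)^2) (K ^ length w * \<delta>^2) (%a b. wm I xi' w a b - wm I xi w a b - dw I xi v w a b)"
  by blast+
qed

section \<open>Linear extension from words to polynomials\<close>

definition lin :: "('k => complex) => ('k \<Rightarrow>\<^sub>0 complex) => complex" where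
 "lin f g = (\<Sum>k\<in>Poly_Mapping.keys g. Poly_Mapping.lookup g k * f k)"

lemma lin_superset:
 "finite S ==> Poly_Mapping.keys g \<subseteq> S ==> lin f g = (\<Sum>k\<in>S. Poly_Mapping.lookup g k * f k)"
 unfolding lin_def by (intro sum.mono_neutral_left) (auto simp: in_keys_iff)

lemma lin_add: "lin f (g + h) = lin f g + lin f h"
proof -
 let ?S = "Poly_Mapping.keys g \<union> Poly_Mapping.keys h"
 have "lin f (g + h) = (\<Sum>k\<in>?S. Poly_Mapping.lookup (g + h) k * f k)"
  by (rule lin_superset) (auto simp: Poly_Mapping.keys_add)
 also have "... = (\<Sum>k\<in>?S. Poly_Mapping.lookup g k * f k) + (\<Sum>k\<in>?S. Poly_Mapping.lookup h k * f k)"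
  by (simp add: lookup_add algebra_simps sum.distrib)
 finally show ?thesis using lin_superset[of ?S g f] lin_superset[of ?S h f] by simp
qed

lemma lin_zero [simp]: "lin f 0 = 0" by (simp add: lin_def)

lemma lin_minus: "lin f (- g) = - lin f g"
 using lin_add[of f "- g" g] by (simp add: eq_neg_iff_add_eq_0)

lemma lin_diff: "lin f (g - h) = lin f g - lin f h"
 using lin_add[of f g "- h"] by (simp add: lin_minus)

lemma lookup_pm_scale: "Poly_Mapping.lookup (pm_scale c g) k = c * Poly_Mapping.lookup g k"
 by (simp add: pm_scale_def map.rep_eq when_def)

lemma lin_scale: "lin f (pm_scale c g) = c * lin f g"
proof -
 have "lin f (pm_scale c g) = (\<Sum>k\<in>Poly_Mapping.keys g. Poly_Mapping.lookup (pm_scale c g) k * f k)"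
  by (rule lin_superset) (auto simp: in_keys_iff lookup_pm_scale)
 then show ?thesis by (simp add: lin_def lookup_pm_scale sum_distrib_left mult.assoc)
qed

lemma lin_single: "lin f (Poly_Mapping.single k c) = c * f k"
 using lin_superset[of "{k}" "Poly_Mapping.single k c" f] by simp

lemma lin_sum: "lin f (\<Sum>i\<in>S. g i) = (\<Sum>i\<in>S. lin f (g i))"
 by (induction S rule: infinite_finite_induct) (auto simp: lin_add)

lemma lin_poly_star: "lin f (poly_star g) = (\<Sum>w\<in>Poly_Mapping.keys g. cnj (Poly_Mapping.lookup g w) * f (word_star w))"
 by (simp add: poly_star_def lin_sum lin_single)

lemma lin_poly_part: "lin f (poly_part r g) = (lin f g + (if r then -1 else 1) * lin f (poly_star g)) / 2"
 by (simp add: poly_part_def lin_scale lin_add lin_diff)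

lemma lin_word_deriv:
 "lin f (word_deriv sk j w) = (\<Sum>l | l < length w \<and> fst (w ! l) = j.
   (if sk \<and> snd (w ! l) then - 1 else 1) * f (take l w, drop (Suc l) w))"
 by (simp add: word_deriv_def lin_sum lin_single)

lemma lin_poly_deriv: "lin f (poly_deriv sk j g) = lin (%w. lin f (word_deriv sk j w)) g"
 by (simp add: poly_deriv_def lin_sum lin_scale lin_def[of "%w. lin f (word_deriv sk j w)"])

definition pm :: "'i set => ('n => 'i => 'i => complex) => 'n star_poly => 'i => 'i => complex" where
 "pm I xi g = (%a b. lin (%w. wm I xi w a b) g)"

definition dpm :: "'i set => ('n => 'i => 'i => complex) => ('n => 'i => 'i => complex) => 'n star_poly => 'i => 'i => complex" where
 "dpm I xi v g = (%a b. lin (%w. dw I xi v w a b) g)"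

lemma hs2_scale: "hs2 I (%a b. c * f a b) = (cmod c)^2 * hs2 I f"
 by (simp add: hs2_def norm_mult power_mult_distrib sum_distrib_left)

lemma hs2_sum:
 assumes "finite I" shows "sqrt (hs2 I (%a b. \<Sum>s\<in>S. f s a b)) <= (\<Sum>s\<in>S. sqrt (hs2 I (f s)))"
proof (induction S rule: infinite_finite_induct)
 case (insert x S)
 then show ?case using hs2_triangle[OF assms, of "f x" "%a b. \<Sum>s\<in>S. f s a b"] by simp
qed (simp_all add: hs2_def)

text \<open>The order of the quantifiers matters: the level \<open>J\<close> depends on the
  polynomial alone, the bound \<open>K\<close> for microstates is found only after \<open>J\<close>
  is known, and \<open>C\<close> must be independent of the size of the matrices.\<close>

lemma polynomial_remainder:
 fixes g :: "'n star_poly"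
 shows "\<exists>J. \<forall>K\<ge>1. \<exists>C\<ge>0. \<forall>(I :: 'i set) xi xi' v \<delta>. finite I --> \<delta> >= 0 --> (\<forall>i. lbd I J (xi i) K) --> (\<forall>i. lbd I J (xi' i) K)
  --> (\<forall>i. lbd I J (v i) \<delta>) --> (\<forall>i a b. xi' i a b = xi i a b + v i a b) -->
  sqrt (hs2 I (%a b. pm I xi' g a b - pm I xi g a b - dpm I xi v g a b)) <= C * \<delta>^2 * sqrt (real (card I))"
proof -
 let ?k = "Poly_Mapping.keys g"
 \<comment> \<open>This is at least the length of every word of \<open>g\<close>, and each letter
   uses up one level.\<close>
 define J where "J = (\<Sum>w\<in>?k. length w)"
 have main: "\<exists>C\<ge>0. \<forall>(I :: 'i set) xi xi' v \<delta>. finite I --> \<delta> >= 0 --> (\<forall>i. lbd I J (xi i) K) --> (\<forall>i. lbd I J (xi' i) K)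
  --> (\<forall>i. lbd I J (v i) \<delta>) --> (\<forall>i a b. xi' i a b = xi i a b + v i a b) -->
  sqrt (hs2 I (%a b. pm I xi' g a b - pm I xi g a b - dpm I xi v g a b)) <= C * \<delta>^2 * sqrt (real (card I))"
  if K: "K >= 1" for K
 proof -
 define C where "C = (\<Sum>w\<in>?k. cmod (Poly_Mapping.lookup g w) * (real ((length w)^2) * K ^ length w))"
 have C0: "C >= 0" unfolding C_def using K by (intro sum_nonneg) auto
 have "sqrt (hs2 I (%a b. pm I xi' g a b - pm I xi g a b - dpm I xi v g a b)) <= C * \<delta>^2 * sqrt (real (card I))"
  if I: "finite I" and \<delta>: "\<delta> >= 0" and xi: "!!i. lbd I J (xi i) K" and xi': "!!i. lbd I J (xi' i) K" and v: "!!i. lbd I J (v i) \<delta>"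
   and veq: "!!i a b. xi' i a b = xi i a b + v i a b" for I :: "'i set" and xi xi' v \<delta>
 proof -
  let ?r = "%w a b. wm I xi' w a b - wm I xi w a b - dw I xi v w a b"
  have "(%a b. pm I xi' g a b - pm I xi g a b - dpm I xi v g a b)
    = (%a b. \<Sum>w\<in>?k. Poly_Mapping.lookup g w * ?r w a b)"
   by (simp add: pm_def dpm_def lin_def sum_subtractf algebra_simps)
  then have "sqrt (hs2 I (%a b. pm I xi' g a b - pm I xi g a b - dpm I xi v g a b))
    <= (\<Sum>w\<in>?k. sqrt (hs2 I (%a b. Poly_Mapping.lookup g w * ?r w a b)))"
   using hs2_sum[OF I, of "%w a b. Poly_Mapping.lookup g w * ?r w a b" ?k] by simp
  also have "... <= (\<Sum>w\<in>?k. cmod (Poly_Mapping.lookup g w) * (real ((length w)^2) * (sqrt (real (card I)) * (K ^ length w * \<delta>^2))))"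
  proof (rule sum_mono)
   fix w assume w: "w \<in> ?k"
   have J: "0 + length w <= J" unfolding J_def using w by (simp add: member_le_sum)
   have "spr I 0 ((length w)^2) (K ^ length w * \<delta>^2) (?r w)"
    by (rule spr_word_diff(2)[OF I _ _ _ veq K \<delta>]; rule lbd_mono[OF xi _ order_refl J] lbd_mono[OF xi' _ order_refl J] lbd_mono[OF v \<delta> order_refl J])
     (use K in auto)
   then have "sqrt (hs2 I (?r w)) <= real ((length w)^2) * (sqrt (real (card I)) * (K ^ length w * \<delta>^2))"
    by (rule spr_hs2[OF I]) (use K in auto)
   then show "sqrt (hs2 I (%a b. Poly_Mapping.lookup g w * ?r w a b))
     <= cmod (Poly_Mapping.lookup g w) * (real ((length w)^2) * (sqrt (real (card I)) * (K ^ length w * \<delta>^2)))"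
    by (simp add: hs2_scale real_sqrt_mult mult_left_mono)
  qed
  also have "... = C * \<delta>^2 * sqrt (real (card I))" by (simp add: C_def sum_distrib_left sum_distrib_right mult_ac)
  finally show ?thesis .
 qed
 then show ?thesis using C0 by (intro exI[of _ C] conjI) auto
 qed
 show ?thesis by (intro exI[of _ J] allI impI) (rule main)
qed

section \<open>The derivative as a matrix of kernels\<close>

lemma wm_append: "finite I ==> a \<in> I ==> wm I xi (u @ v) a b = mm I (wm I xi u) (wm I xi v) a b"
proof (induction u arbitrary: a)
 case (Cons l u)
 have "wm I xi ((l # u) @ v) a b = (\<Sum>c\<in>I. ltr xi l a c * wm I xi (u @ v) c b)" by (simp add: mm_def)
 also have "... = (\<Sum>c\<in>I. ltr xi l a c * mm I (wm I xi u) (wm I xi v) c b)" using Cons by (intro sum.cong) auto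
 also have "... = mm I (mm I (ltr xi l) (wm I xi u)) (wm I xi v) a b" unfolding mm_assoc by (simp add: mm_def)
 finally show ?case by simp
qed (simp add: mm_idm_left)

lemma ltr_star: "mstar (ltr xi l) = ltr xi (fst l, \<not> snd l)" by (simp add: ltr_def)

lemma word_star_Cons: "word_star (l # w) = word_star w @ [(fst l, \<not> snd l)]"
 by (simp add: word_star_def case_prod_unfold)

lemma wm_star: "finite I ==> a \<in> I ==> b \<in> I ==> wm I xi (word_star w) a b = cnj (wm I xi w b a)"
proof (induction w arbitrary: a b)
 case Nil then show ?case by (simp add: word_star_def idm_def)
next
 case (Cons l w)
 have "wm I xi (word_star (l # w)) a b = mm I (wm I xi (word_star w)) (wm I xi [(fst l, \<not> snd l)]) a b"
  unfolding word_star_Cons by (rule wm_append) (use Cons.prems in auto)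
 also have "... = (\<Sum>c\<in>I. cnj (wm I xi w c a) * mstar (ltr xi l) c b)"
  unfolding mm_def ltr_star using Cons mm_idm_right[of I b "ltr xi (fst l, \<not> snd l)"]
  by (intro sum.cong) (auto simp: mm_def)
 also have "... = cnj (wm I xi (l # w) b a)" by (simp add: mm_def mstar_def mult.commute)
 finally show ?case .
qed

lemma dw_append:
 "finite I ==> a \<in> I ==> dw I xi v (u @ w) a b = mm I (dw I xi v u) (wm I xi w) a b + mm I (wm I xi u) (dw I xi v w) a b"
proof (induction u arbitrary: a)
 case Nil
 then show ?case by (simp add: mm_idm_left) (simp add: mm_def)
next
 case (Cons l u)
 have "dw I xi v ((l # u) @ w) a b = (\<Sum>c\<in>I. ltr xi l a c * dw I xi v (u @ w) c b) + (\<Sum>c\<in>I. ltr v l a c * wm I xi (u @ w) c b)"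
  by (simp add: mm_def)
 also have "(\<Sum>c\<in>I. ltr xi l a c * dw I xi v (u @ w) c b)
   = (\<Sum>c\<in>I. ltr xi l a c * (mm I (dw I xi v u) (wm I xi w) c b + mm I (wm I xi u) (dw I xi v w) c b))"
  using Cons by (intro sum.cong) auto
 also have "... = mm I (ltr xi l) (mm I (dw I xi v u) (wm I xi w)) a b + mm I (ltr xi l) (mm I (wm I xi u) (dw I xi v w)) a b"
  by (simp add: mm_def[of I "ltr xi l"] distrib_left sum.distrib)
 also have "(\<Sum>c\<in>I. ltr v l a c * wm I xi (u @ w) c b) = (\<Sum>c\<in>I. ltr v l a c * mm I (wm I xi u) (wm I xi w) c b)"
  using Cons.prems by (intro sum.cong) (auto simp: wm_append)
 also have "... = mm I (ltr v l) (mm I (wm I xi u) (wm I xi w)) a b" by (simp add: mm_def)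
 finally show ?case by (simp add: mm_assoc[symmetric] mm_add_left)
qed

lemma dw_star: "finite I ==> a \<in> I ==> b \<in> I ==> dw I xi v (word_star w) a b = cnj (dw I xi v w b a)"
proof (induction w arbitrary: a b)
 case Nil then show ?case by (simp add: word_star_def)
next
 case (Cons l w)
 let ?l = "(fst l, \<not> snd l)"
 have "dw I xi v (word_star (l # w)) a b
   = mm I (dw I xi v (word_star w)) (wm I xi [?l]) a b + mm I (wm I xi (word_star w)) (dw I xi v [?l]) a b"
  unfolding word_star_Cons by (rule dw_append) (use Cons.prems in auto)
 also have "mm I (dw I xi v (word_star w)) (wm I xi [?l]) a b = (\<Sum>c\<in>I. cnj (dw I xi v w c a) * mstar (ltr xi l) c b)"
  unfolding mm_def ltr_star using Cons mm_idm_right[of I b "ltr xi ?l"]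
  by (intro sum.cong) (auto simp: mm_def)
 also have "mm I (wm I xi (word_star w)) (dw I xi v [?l]) a b = (\<Sum>c\<in>I. cnj (wm I xi w c a) * mstar (ltr v l) c b)"
  unfolding mm_def ltr_star using Cons.prems wm_star[of I a _ xi w] mm_idm_right[of I b "ltr v ?l"]
  by (intro sum.cong) (auto simp: mm_def)
 finally show ?case by (simp add: mm_def mstar_def mult.commute add.commute)
qed

lemma dpm_part:
 assumes "finite I" "a \<in> I" "b \<in> I"
 shows "dpm I xi v (poly_part r g) a b = (dpm I xi v g a b + (if r then -1 else 1) * cnj (dpm I xi v g b a)) / 2"
  and "pm I xi (poly_part r g) a b = (pm I xi g a b + (if r then -1 else 1) * cnj (pm I xi g b a)) / 2"
 by (simp_all add: dpm_def pm_def lin_poly_part lin_poly_star dw_star[OF assms] wm_star[OF assms])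
   (simp_all add: lin_def)

lemma dw_sum:
 assumes I: "finite I" and a: "a \<in> I"
 shows "dw I xi v w a b = (\<Sum>l<length w. mm I (wm I xi (take l w)) (mm I (ltr v (w ! l)) (wm I xi (drop (Suc l) w))) a b)"
 using a
proof (induction w arbitrary: a)
 case (Cons l w)
 have "dw I xi v (l # w) a b = (\<Sum>c\<in>I. ltr xi l a c * dw I xi v w c b) + mm I (ltr v l) (wm I xi w) a b"
  by (simp add: mm_def)
 also have "(\<Sum>c\<in>I. ltr xi l a c * dw I xi v w c b)
  = (\<Sum>c\<in>I. ltr xi l a c * (\<Sum>k<length w. mm I (wm I xi (take k w)) (mm I (ltr v (w ! k)) (wm I xi (drop (Suc k) w))) c b))"
  using Cons by (intro sum.cong) auto
 also have "... = (\<Sum>k<length w. mm I (ltr xi l) (mm I (wm I xi (take k w)) (mm I (ltr v (w ! k)) (wm I xi (drop (Suc k) w)))) a b)"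
  unfolding mm_def[of I "ltr xi l"] sum_distrib_left by (rule sum.swap)
 finally show ?case
  by (simp add: lessThan_Suc_eq_insert_0 sum.reindex mm_assoc mm_idm_left[OF I Cons.prems] zero_notin_Suc_image add.commute)
qed simp

text \<open>The matrix, indexed by pairs, of the map that sends \<open>m\<close> to the product
  \<open>f m g\<close>; it is the tensor of \<open>f\<close> with the opposite of \<open>g\<close>
  in coordinates.\<close>

definition kern :: "('i => 'i => complex) => ('i => 'i => complex) => 'i \<times> 'i => 'i \<times> 'i => complex" where
 "kern f g = (%p q. f (fst p) (fst q) * g (snd q) (snd p))"

definition evM :: "'i set => ('n => 'i => 'i => complex) => 'n tlist => 'i \<times> 'i => 'i \<times> 'i => complex" where
 "evM I xi t = (%p q. \<Sum>(c, u, v)\<leftarrow>t. c * kern (wm I xi u) (wm I xi v) p q)"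

lemma kern_apply: "(\<Sum>q\<in>I \<times> I. kern f g (a, b) q * m (fst q) (snd q)) = mm I f (mm I m g) a b"
 by (simp add: kern_def mm_def sum_distrib_left sum.cartesian_product case_prod_unfold mult_ac)

text \<open>The self-adjoint and skew-adjoint parts of a tuple.\<close>

definition iota :: "('n => 'i => 'i => complex) => 'n \<times> bool => 'i => 'i => complex" where
 "iota v js a b = (v (fst js) a b + (if snd js then -1 else 1) * cnj (v (fst js) b a)) / 2"

lemma tlist_of_lin: "(\<Sum>(c, u, v)\<leftarrow>tlist_of g. c * f (u, v)) = lin f g"
 using tlist_of_sum[of "%c u v. c * f (u, v)" g] by (simp add: lin_def case_prod_unfold)

lemma iota_ltr: "iota v (j, False) a b + (if s then -1 else 1) * iota v (j, True) a b = ltr v (j, s) a b"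
 by (simp add: iota_def ltr_def mstar_def field_simps)

text \<open>At an occurrence of a letter of index \<open>j\<close> the two derivations insert the
  self-adjoint part of \<open>v j\<close> plus its skew-adjoint part, or minus it if the letter is
  starred. The result is \<open>v j\<close> or its adjoint in place of the letter. This identifies
  the formal derivative matrix at \<open>xi\<close> with the differential of the parts of
  \<open>F\<close>.\<close>

lemma derivative_kernel:
 fixes F :: "'p => 'n::finite star_poly" and I :: "'i set"
 assumes I: "finite I" and a: "a \<in> I"
 shows "(\<Sum>js\<in>UNIV. \<Sum>q\<in>I \<times> I. evM I xi (dlist F ir js) (a, b) q * iota v js (fst q) (snd q))
  = dpm I xi v (poly_part (snd ir) (F (fst ir))) a b"
proof -
 define g where "g = poly_part (snd ir) (F (fst ir))"
 define h where "h m p = mm I (wm I xi (fst p)) (mm I m (wm I xi (snd p))) a b" for m and p :: "'n star_word \<times> 'n star_word"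
 have hadd: "h (%a b. m a b + e * n a b) p = h m p + e * h n p" for m n p e
  by (simp add: h_def mm_def algebra_simps sum.distrib sum_distrib_left)
 have step: "(\<Sum>q\<in>I \<times> I. evM I xi (dlist F ir js) (a, b) q * iota v js (fst q) (snd q))
   = lin (%w. lin (h (iota v js)) (word_deriv (snd js) (fst js) w)) g" for js
 proof -
  have "(\<Sum>q\<in>I \<times> I. evM I xi t (a, b) q * iota v js (fst q) (snd q)) = (\<Sum>(c, u, v')\<leftarrow>t. c * h (iota v js) (u, v'))" for t
  proof (induction t)
   case Nil then show ?case by (simp add: evM_def)
  next
   case (Cons x t)
   obtain c u v' where x: "x = (c, u, v')" by (cases x)
   have "(\<Sum>q\<in>I \<times> I. evM I xi (x # t) (a, b) q * iota v js (fst q) (snd q))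
     = c * (\<Sum>q\<in>I \<times> I. kern (wm I xi u) (wm I xi v') (a, b) q * iota v js (fst q) (snd q))
      + (\<Sum>q\<in>I \<times> I. evM I xi t (a, b) q * iota v js (fst q) (snd q))"
    unfolding sum_distrib_left sum.distrib[symmetric]
    by (intro sum.cong) (simp_all add: evM_def x distrib_right)
   then show ?case using Cons by (simp add: x kern_apply h_def)
  qed
  then show ?thesis by (simp add: dlist_def tlist_of_lin g_def[symmetric] lin_poly_deriv)
 qed
 have word: "(\<Sum>js\<in>UNIV. lin (h (iota v js)) (word_deriv (snd js) (fst js) w)) = dw I xi v w a b" for w
 proof -
  define T where "T j s l = (if fst (w ! l) = j then
      (if s \<and> snd (w ! l) then - 1 else 1) * h (iota v (j, s)) (take l w, drop (Suc l) w) else 0)" for j s l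
  have "lin (h (iota v js)) (word_deriv (snd js) (fst js) w) = (\<Sum>l<length w. T (fst js) (snd js) l)" for js
  proof -
   have "{l. l < length w \<and> fst (w ! l) = fst js} = {l \<in> {..<length w}. fst (w ! l) = fst js}" by auto
   then show ?thesis by (simp only: lin_word_deriv T_def sum.inter_filter finite_lessThan prod.collapse)
  qed
  then have "(\<Sum>js\<in>UNIV. lin (h (iota v js)) (word_deriv (snd js) (fst js) w))
    = (\<Sum>js\<in>UNIV. \<Sum>l<length w. T (fst js) (snd js) l)" by simp
  also have "... = (\<Sum>l<length w. \<Sum>js\<in>UNIV. T (fst js) (snd js) l)" by (rule sum.swap)
  also have "... = (\<Sum>l<length w. \<Sum>j\<in>UNIV. \<Sum>s\<in>UNIV. T j s l)"
   by (simp only: UNIV_Times_UNIV[symmetric] sum.cartesian_product case_prod_unfold)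
  also have "... = (\<Sum>l<length w. \<Sum>j\<in>UNIV. \<Sum>s\<in>UNIV. if fst (w ! l) = j then
      (if s \<and> snd (w ! l) then - 1 else 1) * h (iota v (j, s)) (take l w, drop (Suc l) w) else 0)"
   by (simp only: T_def)
  also have "... = (\<Sum>l<length w. h (ltr v (w ! l)) (take l w, drop (Suc l) w))"
  proof (rule sum.cong[OF refl])
   fix l
   obtain j s where js: "w ! l = (j, s)" by (cases "w ! l")
   let ?p = "(take l w, drop (Suc l) w)"
   have "(\<Sum>j'\<in>UNIV. \<Sum>s'\<in>UNIV. if fst (w ! l) = j' then
      (if s' \<and> snd (w ! l) then - 1 else 1) * h (iota v (j', s')) ?p else 0)
     = (\<Sum>s'\<in>UNIV. (if s' \<and> s then - 1 else 1) * h (iota v (j, s')) ?p)"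
    by (subst sum.swap) (simp add: js)
   also have "... = h (iota v (j, False)) ?p + (if s then -1 else 1) * h (iota v (j, True)) ?p"
    by (simp add: UNIV_bool)
   also have "... = h (ltr v (j, s)) ?p"
    unfolding hadd[symmetric] iota_ltr ..
   finally show "(\<Sum>j'\<in>UNIV. \<Sum>s'\<in>UNIV. if fst (w ! l) = j' then
      (if s' \<and> snd (w ! l) then - 1 else 1) * h (iota v (j', s')) ?p else 0) = h (ltr v (w ! l)) ?p"
    by (simp add: js)
  qed
  also have "... = dw I xi v w a b" by (simp add: dw_sum[OF I a] h_def)
  finally show ?thesis .
 qed
 have "(\<Sum>js\<in>UNIV. lin (%w. lin (h (iota v js)) (word_deriv (snd js) (fst js) w)) g)
   = lin (%w. \<Sum>js\<in>UNIV. lin (h (iota v js)) (word_deriv (snd js) (fst js) w)) g"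
  unfolding lin_def[of _ g] sum_distrib_left by (rule sum.swap)
 then show ?thesis unfolding step word by (simp add: dpm_def g_def)
qed

section \<open>Counting lattice points\<close>

lemma int_geometric_sum:
 fixes t :: real assumes t: "0 < t" "t <= 1"
 shows "(\<Sum>n\<in>{- int m..int m}. exp (- t * real_of_int \<bar>n\<bar>)) <= 4 / t"
proof -
 let ?f = "%n. exp (- t * real_of_int \<bar>n\<bar>)"
 define q where "q = exp (- t)"
 have q: "0 < q" "q <= 1 - t / 2"
 proof -
  have "q = 1 / exp t" by (simp add: q_def exp_minus field_simps)
  also have "... <= 1 / (1 + t)" using t exp_ge_add_one_self[of t] by (intro divide_left_mono) auto
  also have "... <= 1 - t / 2"
  proof -
   have "t * t <= t" using t by (simp add: mult_left_le)
   then have "1 <= (1 - t / 2) * (1 + t)" by (simp add: algebra_simps)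
   then show ?thesis using t by (simp add: divide_le_eq)
  qed
  finally show "q <= 1 - t / 2" .
 qed (simp add: q_def)
 have geo: "(\<Sum>i\<le>m. q ^ i) <= 2 / t"
 proof -
  have "(1 - q) * (\<Sum>i\<le>m. q ^ i) <= 1" unfolding sum_gp_basic using q by simp
  moreover have "t / 2 * (\<Sum>i\<le>m. q ^ i) <= (1 - q) * (\<Sum>i\<le>m. q ^ i)"
   using q t by (intro mult_right_mono sum_nonneg) auto
  ultimately have "t / 2 * (\<Sum>i\<le>m. q ^ i) <= 1" by linarith
  then show ?thesis using t by (simp add: field_simps)
 qed
 have fq: "?f (int i) = q ^ i" "?f (- int i) = q ^ i" for i
  by (simp_all add: q_def exp_of_nat_mult[symmetric] mult.commute)
 let ?A = "int ` {..m}" let ?B = "(%i. - int i) ` {..m}"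
 have "sum ?f {- int m..int m} <= sum ?f (?A \<union> ?B)"
 proof (rule sum_mono2)
  show "{- int m..int m} \<subseteq> ?A \<union> ?B"
  proof
   fix n assume "n \<in> {- int m..int m}"
   then show "n \<in> ?A \<union> ?B"
   proof (cases "n >= 0")
    case True
    then have "n = int (nat n)" "nat n \<in> {..m}" using \<open>n \<in> {- int m..int m}\<close> by auto
    then show ?thesis by blast
   next
    case False
    then have "n = - int (nat (- n))" "nat (- n) \<in> {..m}" using \<open>n \<in> {- int m..int m}\<close> by auto
    then show ?thesis by blast
   qed
  qed
 qed auto
 also have "... <= sum ?f ?A + sum ?f ?B"
 proof -
  have "sum ?f (?A \<union> ?B) + sum ?f (?A \<inter> ?B) = sum ?f ?A + sum ?f ?B" by (rule sum.union_inter) auto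
  moreover have "0 <= sum ?f (?A \<inter> ?B)" by (intro sum_nonneg) auto
  ultimately show ?thesis by linarith
 qed
 also have "sum ?f ?A = (\<Sum>i\<le>m. q ^ i)" by (subst sum.reindex) (simp_all only: fq o_def inj_on_of_nat)
 also have "sum ?f ?B = (\<Sum>i\<le>m. q ^ i)"
  by (subst sum.reindex, simp add: inj_on_def) (simp only: fq o_def)
 finally show ?thesis using geo by simp
qed

text \<open>The generating function bound: each vector counted is given weight at least
  \<open>exp (- card D)\<close> by \<open>exp (- t |z|)\<close>.\<close>

lemma int_vector_count:
 fixes D :: "'d set" and t :: real
 assumes D: "finite D" and t: "0 < t" "t <= 1"
 defines "Z \<equiv> {z \<in> PiE D (%_. UNIV :: int set). (\<Sum>i\<in>D. real_of_int \<bar>z i\<bar>) <= real (card D) / t}"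
 shows "finite Z" "real (card Z) <= (12 / t) ^ card D"
proof -
 define m where "m = nat \<lfloor>real (card D) / t\<rfloor>"
 let ?B = "PiE D (%_. {- int m..int m})"
 have sub: "Z \<subseteq> ?B"
 proof
  fix z assume z: "z \<in> Z"
  have "z i \<in> {- int m..int m}" if i: "i \<in> D" for i
  proof -
   have "real_of_int \<bar>z i\<bar> <= (\<Sum>i\<in>D. real_of_int \<bar>z i\<bar>)" by (rule member_le_sum[OF i]) (auto simp: D)
   also have "... <= real (card D) / t" using z by (simp add: Z_def)
   finally have "\<bar>z i\<bar> <= \<lfloor>real (card D) / t\<rfloor>" by (simp add: le_floor_iff)
   moreover have "0 <= \<lfloor>real (card D) / t\<rfloor>" using t by simp
   ultimately have "\<bar>z i\<bar> <= int m" unfolding m_def by simp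
   then show ?thesis by (simp add: abs_le_iff)
  qed
  then show "z \<in> ?B" using z unfolding Z_def PiE_iff by simp
 qed
 have fB: "finite ?B" using D by (intro finite_PiE) auto
 show fZ: "finite Z" using sub fB by (rule finite_subset)
 have "real (card Z) * exp (- real (card D)) = (\<Sum>z\<in>Z. exp (- real (card D)))" by simp
 also have "... <= (\<Sum>z\<in>Z. exp (- t * (\<Sum>i\<in>D. real_of_int \<bar>z i\<bar>)))"
 proof (rule sum_mono)
  fix z assume "z \<in> Z"
  then have "t * (\<Sum>i\<in>D. real_of_int \<bar>z i\<bar>) <= real (card D)" using t by (simp add: Z_def field_simps)
  then show "exp (- real (card D)) <= exp (- t * (\<Sum>i\<in>D. real_of_int \<bar>z i\<bar>))" by simp
 qed
 also have "... <= (\<Sum>z\<in>?B. exp (- t * (\<Sum>i\<in>D. real_of_int \<bar>z i\<bar>)))" by (rule sum_mono2[OF fB sub]) auto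
 also have "... = (\<Sum>z\<in>?B. \<Prod>i\<in>D. exp (- t * real_of_int \<bar>z i\<bar>))"
  by (simp add: exp_sum[OF D, symmetric] sum_distrib_left sum_negf)
 also have "... = (\<Prod>i\<in>D. \<Sum>n\<in>{- int m..int m}. exp (- t * real_of_int \<bar>n\<bar>))"
  by (rule prod_sum_PiE[symmetric]) (auto simp: D)
 also have "... <= (\<Prod>i\<in>D. 4 / t)" by (intro prod_mono conjI sum_nonneg int_geometric_sum t) auto
 also have "... = (4 / t) ^ card D" by simp
 finally have "real (card Z) * exp (- real (card D)) <= (4 / t) ^ card D" .
 then have "real (card Z) <= (4 / t) ^ card D * exp (real (card D))" by (simp add: exp_minus field_simps)
 also have "exp (real (card D)) = exp 1 ^ card D" by (simp add: exp_of_nat_mult[symmetric])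
 \<comment> \<open>Bounding Euler's number by 3 turns the 4 of the geometric sum into the constant
   12.\<close>
 also have "(4 / t) ^ card D * exp 1 ^ card D <= (4 / t) ^ card D * 3 ^ card D"
  using t exp_le by (intro mult_left_mono power_mono) auto
 also have "... = (12 / t) ^ card D" by (simp add: power_mult_distrib[symmetric])
 finally show "real (card Z) <= (12 / t) ^ card D" .
qed

lemma sum_abs_le_sqrt:
 fixes x :: "'d => real"
 shows "(\<Sum>i\<in>D. \<bar>x i\<bar>) <= sqrt (real (card D)) * sqrt (\<Sum>i\<in>D. (x i)^2)"
 using L2_set_mult_ineq[of "%_. 1" x D] by (simp add: L2_set_def)

section \<open>Coverings by sets of small diameter\<close>

text \<open>The pieces are subsets of \<open>S\<close> with a condition on pairs of their points,
  not balls with centres: a piece can be covered again, and hypotheses on \<open>S\<close> pass to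
  it. The bound \<open>n\<close> is a real number so that it can be an exponential.\<close>

definition cov :: "('s => 's => bool) => 's set => real => bool" where
 "cov P S n \<longleftrightarrow> (\<exists>\<C>. finite \<C> \<and> real (card \<C>) <= n \<and> S = \<Union>\<C> \<and> (\<forall>C\<in>\<C>. \<forall>x\<in>C. \<forall>y\<in>C. P x y))"

lemma cov_colouring:
 assumes Z: "finite Z" "real (card Z) <= n" and col: "!!x. x \<in> S ==> f x \<in> Z"
  and P: "!!x y. x \<in> S ==> y \<in> S ==> f x = f y ==> P x y"
 shows "cov P S n"
 unfolding cov_def
proof (intro exI[of _ "(%z. {x \<in> S. f x = z}) ` Z"] conjI ballI)
 show "real (card ((%z. {x \<in> S. f x = z}) ` Z)) <= n"
  using card_image_le[OF Z(1), of "%z. {x \<in> S. f x = z}"] Z(2) by linarith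
 show "S = \<Union> ((%z. {x \<in> S. f x = z}) ` Z)" using col by auto
qed (use Z P in auto)

lemma cov_mono:
 assumes "cov P S n" "n <= m" and PQ: "!!x y. x \<in> S ==> y \<in> S ==> P x y ==> Q x y"
 shows "cov Q S m"
proof -
 obtain \<C> where \<C>: "finite \<C>" "real (card \<C>) <= n" "S = \<Union>\<C>" "\<forall>C\<in>\<C>. \<forall>x\<in>C. \<forall>y\<in>C. P x y"
  using assms(1) unfolding cov_def by blast
 have "Q x y" if "C \<in> \<C>" "x \<in> C" "y \<in> C" for C x y
  using that \<C>(3,4) by (intro PQ) blast+
 then show ?thesis unfolding cov_def using \<C>(1-3) assms(2) by (intro exI[of _ \<C>]) auto
qed

lemma cov_trans:
 assumes S: "cov P S n" and m: "0 <= m"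
  and C: "!!C. C \<subseteq> S ==> (!!x y. x \<in> C ==> y \<in> C ==> P x y) ==> cov Q C m"
 shows "cov Q S (n * m)"
proof -
 obtain \<C> where \<C>: "finite \<C>" "real (card \<C>) <= n" "S = \<Union>\<C>" "!!C x y. C \<in> \<C> ==> x \<in> C ==> y \<in> C ==> P x y"
  using S unfolding cov_def by blast
 have "\<forall>C\<in>\<C>. \<exists>\<D>. finite \<D> \<and> real (card \<D>) <= m \<and> C = \<Union>\<D> \<and> (\<forall>D\<in>\<D>. \<forall>x\<in>D. \<forall>y\<in>D. Q x y)"
 proof
  fix D assume D: "D \<in> \<C>"
  have "cov Q D m" by (rule C) (use D \<C>(3,4) in auto)
  then show "\<exists>\<D>. finite \<D> \<and> real (card \<D>) <= m \<and> D = \<Union>\<D> \<and> (\<forall>D\<in>\<D>. \<forall>x\<in>D. \<forall>y\<in>D. Q x y)"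
   unfolding cov_def .
 qed
 then obtain \<D> where \<D>: "!!C. C \<in> \<C> ==> finite (\<D> C) \<and> real (card (\<D> C)) <= m \<and> C = \<Union>(\<D> C) \<and> (\<forall>D\<in>\<D> C. \<forall>x\<in>D. \<forall>y\<in>D. Q x y)"
  by metis
 have "card (\<Union>C\<in>\<C>. \<D> C) <= (\<Sum>C\<in>\<C>. card (\<D> C))" by (rule card_UN_le[OF \<C>(1)])
 then have "real (card (\<Union>C\<in>\<C>. \<D> C)) <= (\<Sum>C\<in>\<C>. real (card (\<D> C)))" by (metis of_nat_le_iff of_nat_sum)
 also have "... <= (\<Sum>C\<in>\<C>. m)" using \<D> by (intro sum_mono) blast
 also have "... = real (card \<C>) * m" by simp
 also have "... <= n * m" using \<C>(2) m by (rule mult_right_mono)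
 finally have "real (card (\<Union>C\<in>\<C>. \<D> C)) <= n * m" .
 moreover have "finite (\<Union>C\<in>\<C>. \<D> C)" using \<C>(1) \<D> by blast
 moreover have "S = \<Union>(\<Union>C\<in>\<C>. \<D> C)"
 proof -
  have "\<Union>(\<Union>C\<in>\<C>. \<D> C) = (\<Union>C\<in>\<C>. \<Union>(\<D> C))" by blast
  also have "... = (\<Union>C\<in>\<C>. C)" using \<D> by (intro SUP_cong) auto
  finally show ?thesis using \<C>(3) by simp
 qed
 moreover have "\<forall>D\<in>(\<Union>C\<in>\<C>. \<D> C). \<forall>x\<in>D. \<forall>y\<in>D. Q x y" using \<D> by blast
 ultimately show ?thesis unfolding cov_def by blast
qed

lemma real_cover:
 fixes f :: "'s => 'd => real"
 assumes N: "finite N" and \<rho>: "\<rho> > 0" and th: "0 < th" "th <= 1"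
  and S: "!!x y. x \<in> S ==> y \<in> S ==> (\<Sum>i\<in>N. (f x i - f y i)^2) <= \<rho>^2"
 shows "cov (%x y. (\<Sum>i\<in>N. (f x i - f y i)^2) <= (th * \<rho>)^2) S ((24 / th) ^ card N)"
proof (cases "S = {} \<or> N = {}")
 case True
 then show ?thesis
 proof
  assume "S = {}" then show ?thesis unfolding cov_def using th by (intro exI[of _ "{}"]) auto
 next
  assume "N = {}" then show ?thesis unfolding cov_def by (intro exI[of _ "{S}"]) auto
 qed
next
 case False
 then obtain x0 where x0: "x0 \<in> S" by blast
 define c where "c = real (card N)"
 have c: "c > 0" using False N by (simp add: c_def card_gt_0_iff)
 \<comment> \<open>Points of the same colour differ by at most \<open>h\<close> in each of the
   \<open>c\<close> coordinates, hence by at most \<open>th * \<rho>\<close> altogether.\<close>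
 define h where "h = th * \<rho> / sqrt c"
 have h: "h > 0" using th \<rho> c by (simp add: h_def)
 define col where "col x = (\<lambda>i\<in>N. \<lfloor>(f x i - f x0 i) / h\<rfloor>)" for x
 \<comment> \<open>The distance to \<open>x0\<close> contributes \<open>c / th\<close> to the sum of
   absolute values and the rounding at most \<open>c\<close>, together at most
   \<open>c / (th / 2)\<close>. This doubles the 12 of \<open>int_vector_count\<close> to
   24.\<close>
 define Z where "Z = {z \<in> PiE N (%_. UNIV :: int set). (\<Sum>i\<in>N. real_of_int \<bar>z i\<bar>) <= real (card N) / (th / 2)}"
 have Z: "finite Z" "real (card Z) <= (12 / (th / 2)) ^ card N"
  unfolding Z_def using int_vector_count[OF N, of "th / 2"] th by auto
 show ?thesis
 proof (rule cov_colouring[OF Z(1)])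
  show "real (card Z) <= (24 / th) ^ card N" using Z(2) by simp
 next
  fix x assume x: "x \<in> S"
  have "(\<Sum>i\<in>N. real_of_int \<bar>col x i\<bar>) <= (\<Sum>i\<in>N. \<bar>f x i - f x0 i\<bar> / h + 1)"
  proof (rule sum_mono)
   fix i assume "i \<in> N"
   then have "real_of_int \<bar>col x i\<bar> = \<bar>real_of_int \<lfloor>(f x i - f x0 i) / h\<rfloor>\<bar>" by (simp add: col_def)
   also have "... <= \<bar>(f x i - f x0 i) / h\<bar> + 1" by linarith
   finally show "real_of_int \<bar>col x i\<bar> <= \<bar>f x i - f x0 i\<bar> / h + 1" using h by (simp add: abs_divide)
  qed
  also have "... = (\<Sum>i\<in>N. \<bar>f x i - f x0 i\<bar>) / h + c" by (simp add: sum.distrib sum_divide_distrib c_def)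
  also have "(\<Sum>i\<in>N. \<bar>f x i - f x0 i\<bar>) <= sqrt c * sqrt (\<Sum>i\<in>N. (f x i - f x0 i)^2)"
   unfolding c_def by (rule sum_abs_le_sqrt)
  also have "... <= sqrt c * \<rho>"
   using S[OF x x0] \<rho> c by (intro mult_left_mono real_le_lsqrt) auto
  finally have "(\<Sum>i\<in>N. real_of_int \<bar>col x i\<bar>) <= sqrt c * \<rho> / h + c" using h by (simp add: divide_right_mono)
  also have "sqrt c * \<rho> / h = c / th" using th \<rho> c by (simp add: h_def field_simps)
  also have "c / th + c <= c / (th / 2)" using th c by (simp add: field_simps)
  finally show "col x \<in> Z" by (simp add: Z_def c_def) (simp add: col_def)
 next
  fix x y assume "x \<in> S" "y \<in> S" and eq: "col x = col y"
  have "(f x i - f y i)^2 <= h^2" if i: "i \<in> N" for i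
  proof -
   have "\<lfloor>(f x i - f x0 i) / h\<rfloor> = \<lfloor>(f y i - f x0 i) / h\<rfloor>" using fun_cong[OF eq, of i] i by (simp add: col_def)
   then have "\<bar>(f x i - f x0 i) / h - (f y i - f x0 i) / h\<bar> <= 1" by linarith
   then have "\<bar>f x i - f y i\<bar> <= h" using h by (simp add: diff_divide_distrib[symmetric] abs_divide)
   then show ?thesis using h by (simp add: abs_le_square_iff[symmetric])
  qed
  then have "(\<Sum>i\<in>N. (f x i - f y i)^2) <= (\<Sum>i\<in>N. h^2)" by (intro sum_mono) auto
  also have "... = (th * \<rho>)^2" using c by (simp add: h_def c_def power_divide)
  finally show "(\<Sum>i\<in>N. (f x i - f y i)^2) <= (th * \<rho>)^2" .
 qed
qed

section \<open>Rounding a matrix with a small error in operator norm\<close>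

text \<open>Hoeffding's lemma for the variable that is \<open>th\<close> with probability
  \<open>1 - th\<close> and \<open>th - 1\<close> with probability \<open>th\<close>, which has mean
  0 and range 1. It is the error of rounding at random to one of the two neighbouring
  integers.\<close>

lemma two_point_mgf:
 fixes th s :: real assumes "0 <= th" "th <= 1"
 shows "(1 - th) * exp (s * th) + th * exp (- s * (1 - th)) <= exp (s^2 / 8)"
proof -
 have aux: "(1 - p) * exp (- h * p) + p * exp (h * (1 - p)) <= exp (h^2 / 8)" if hp: "h >= 0" "p >= 0" "p <= 1" for h p :: real
 proof -
  have pos: "1 + p * (exp h - 1) > 0" using hp by (simp add: add_pos_nonneg)
  have "(1 - p) * exp (- h * p) + p * exp (h * (1 - p)) = exp (- h * p) * (1 + p * (exp h - 1))"
   by (simp add: algebra_simps exp_add[symmetric] exp_diff exp_minus field_simps)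
  also have "... = exp (- h * p + ln (1 + p * (exp h - 1)))" unfolding exp_add using pos by simp
  also have "... <= exp (h^2 / 8)" using Hoeffdings_lemma_aux[OF hp(1,2)] by simp
  finally show ?thesis .
 qed
 show ?thesis
 proof (cases "s >= 0")
  case True
  then show ?thesis using aux[of s "1 - th"] assms by (simp add: algebra_simps)
 next
  case False
  then show ?thesis using aux[of "- s" th] assms by (simp add: algebra_simps)
 qed
qed

text \<open>Derandomized rounding: of the two neighbouring lattice points, one does not increase the
  potential, because the average over the mean-preserving two-point law does not.\<close>

lemma weighted_rounding:
 fixes q :: "'t => 'p => real" and a :: "'p => real" and h :: real
 assumes P: "finite P" and h: "h > 0" and W: "!!\<tau>. \<tau> \<in> T ==> 0 <= W \<tau>"
 shows "\<exists>n :: 'p => int. (\<forall>p\<in>P. \<bar>a p - h * n p\<bar> <= h) \<and>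
  (\<Sum>\<tau>\<in>T. W \<tau> * exp (\<Sum>p\<in>P. (a p - h * n p) * q \<tau> p)) <= (\<Sum>\<tau>\<in>T. W \<tau> * exp (h^2 / 8 * (\<Sum>p\<in>P. (q \<tau> p)^2)))"
 using P W
proof (induction P arbitrary: W rule: finite_induct)
 case (insert p P)
 define z where "z = \<lfloor>a p / h\<rfloor>"
 define th where "th = a p / h - z"
 have th: "0 <= th" "th <= 1" unfolding th_def z_def by linarith+
 have ap: "a p = h * (z + th)" using h by (simp add: th_def)
 \<comment> \<open>\<open>V\<close> contains in advance the bounds for the indices still to be
   rounded, as in the method of conditional expectations.\<close>
 define V where "V \<tau> = W \<tau> * exp (h^2 / 8 * (\<Sum>p\<in>P. (q \<tau> p)^2))" for \<tau>
 have V: "0 <= V \<tau>" if "\<tau> \<in> T" for \<tau> using insert.prems[OF that] by (simp add: V_def)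
 have avg: "(1 - th) * (\<Sum>\<tau>\<in>T. V \<tau> * exp ((a p - h * z) * q \<tau> p))
   + th * (\<Sum>\<tau>\<in>T. V \<tau> * exp ((a p - h * (z + 1)) * q \<tau> p)) <= (\<Sum>\<tau>\<in>T. V \<tau> * exp (h^2 / 8 * (q \<tau> p)^2))"
 proof -
  have "(1 - th) * (\<Sum>\<tau>\<in>T. V \<tau> * exp ((a p - h * z) * q \<tau> p))
    + th * (\<Sum>\<tau>\<in>T. V \<tau> * exp ((a p - h * (z + 1)) * q \<tau> p))
   = (\<Sum>\<tau>\<in>T. V \<tau> * ((1 - th) * exp ((h * q \<tau> p) * th) + th * exp (- (h * q \<tau> p) * (1 - th))))"
   by (simp add: sum_distrib_left sum.distrib[symmetric] ap algebra_simps)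
  also have "... <= (\<Sum>\<tau>\<in>T. V \<tau> * exp ((h * q \<tau> p)^2 / 8))"
   by (intro sum_mono mult_left_mono two_point_mgf th V)
  finally show ?thesis by (simp add: power_mult_distrib)
 qed
 have "\<exists>m :: int. \<bar>a p - h * m\<bar> <= h \<and> (\<Sum>\<tau>\<in>T. V \<tau> * exp ((a p - h * m) * q \<tau> p)) <= (\<Sum>\<tau>\<in>T. V \<tau> * exp (h^2 / 8 * (q \<tau> p)^2))"
 proof (rule ccontr)
  assume no: "\<not> ?thesis"
  let ?b = "\<Sum>\<tau>\<in>T. V \<tau> * exp (h^2 / 8 * (q \<tau> p)^2)"
  have no': "?b < (\<Sum>\<tau>\<in>T. V \<tau> * exp ((a p - h * m) * q \<tau> p))" if m: "\<bar>a p - h * real_of_int m\<bar> <= h" for m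
  proof (rule ccontr)
   assume "\<not> ?thesis"
   then have "(\<Sum>\<tau>\<in>T. V \<tau> * exp ((a p - h * m) * q \<tau> p)) <= ?b" unfolding not_less .
   with m show False by (rule notE[OF no exI[of _ m], OF conjI])
  qed
  have "\<bar>a p - h * z\<bar> <= h"
  proof -
   have "a p - h * z = h * th" by (simp add: ap algebra_simps)
   then show ?thesis using th h by (simp add: abs_mult mult_left_le)
  qed
  then have 1: "?b < (\<Sum>\<tau>\<in>T. V \<tau> * exp ((a p - h * z) * q \<tau> p))" by (rule no')
  have "\<bar>a p - h * (z + 1)\<bar> <= h"
  proof -
   have "a p - h * (z + 1) = - (h * (1 - th))" by (simp add: ap algebra_simps)
   then show ?thesis using th h by (simp add: abs_mult mult_left_le)
  qed
  then have 2: "?b < (\<Sum>\<tau>\<in>T. V \<tau> * exp ((a p - h * (z + 1)) * q \<tau> p))"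
   by (rule no')
  have "?b = (1 - th) * ?b + th * ?b" by (simp add: algebra_simps)
  also have "... < (1 - th) * (\<Sum>\<tau>\<in>T. V \<tau> * exp ((a p - h * z) * q \<tau> p))
   + th * (\<Sum>\<tau>\<in>T. V \<tau> * exp ((a p - h * (z + 1)) * q \<tau> p))"
  proof (cases "th = 1")
   case True
   show ?thesis unfolding True diff_self mult_zero_left mult_1 add_0 by (rule 2)
  next
   case False
   then have "(1 - th) * ?b < (1 - th) * (\<Sum>\<tau>\<in>T. V \<tau> * exp ((a p - h * z) * q \<tau> p))"
    using th 1 by (intro mult_strict_left_mono) auto
   moreover have "th * ?b <= th * (\<Sum>\<tau>\<in>T. V \<tau> * exp ((a p - h * (z + 1)) * q \<tau> p))"
    using th 2 by (intro mult_left_mono) auto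
   ultimately show ?thesis by linarith
  qed
  finally show False using avg by linarith
 qed
 then obtain m :: int where m: "\<bar>a p - h * m\<bar> <= h"
  "(\<Sum>\<tau>\<in>T. V \<tau> * exp ((a p - h * m) * q \<tau> p)) <= (\<Sum>\<tau>\<in>T. V \<tau> * exp (h^2 / 8 * (q \<tau> p)^2))" by blast
 define W' where "W' \<tau> = W \<tau> * exp ((a p - h * m) * q \<tau> p)" for \<tau>
 have "!!\<tau>. \<tau> \<in> T ==> 0 <= W' \<tau>" using insert.prems by (simp add: W'_def)
 from insert.IH[of W', OF this] obtain n where n: "\<forall>p\<in>P. \<bar>a p - h * real_of_int (n p)\<bar> <= h"
  "(\<Sum>\<tau>\<in>T. W' \<tau> * exp (\<Sum>p\<in>P. (a p - h * n p) * q \<tau> p)) <= (\<Sum>\<tau>\<in>T. W' \<tau> * exp (h^2 / 8 * (\<Sum>p\<in>P. (q \<tau> p)^2)))"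
  by blast
 show ?case
 proof (intro exI[of _ "n(p := m)"] conjI ballI)
  show "\<bar>a r - h * ((n(p := m)) r)\<bar> <= h" if "r \<in> insert p P" for r using that n(1) m(1) by auto
  have eqP: "(\<Sum>r\<in>P. (a r - h * ((n(p := m)) r)) * q \<tau> r) = (\<Sum>r\<in>P. (a r - h * n r) * q \<tau> r)" for \<tau>
   using insert.hyps by (intro sum.cong) auto
  have "(\<Sum>\<tau>\<in>T. W \<tau> * exp (\<Sum>r\<in>insert p P. (a r - h * ((n(p := m)) r)) * q \<tau> r))
    = (\<Sum>\<tau>\<in>T. W' \<tau> * exp (\<Sum>p\<in>P. (a p - h * n p) * q \<tau> p))"
   by (simp only: sum.insert[OF insert.hyps] eqP exp_add W'_def mult.assoc fun_upd_same)
  also have "... <= (\<Sum>\<tau>\<in>T. W' \<tau> * exp (h^2 / 8 * (\<Sum>p\<in>P. (q \<tau> p)^2)))" by (rule n(2))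
  also have "... = (\<Sum>\<tau>\<in>T. V \<tau> * exp ((a p - h * m) * q \<tau> p))" by (simp add: W'_def V_def mult_ac)
  also have "... <= (\<Sum>\<tau>\<in>T. V \<tau> * exp (h^2 / 8 * (q \<tau> p)^2))" by (rule m(2))
  also have "... = (\<Sum>\<tau>\<in>T. W \<tau> * exp (h^2 / 8 * (\<Sum>r\<in>insert p P. (q \<tau> r)^2)))"
   using insert.hyps by (simp add: V_def distrib_left exp_add mult_ac)
  finally show "(\<Sum>\<tau>\<in>T. W \<tau> * exp (\<Sum>r\<in>insert p P. (a r - h * ((n(p := m)) r)) * q \<tau> r))
    <= (\<Sum>\<tau>\<in>T. W \<tau> * exp (h^2 / 8 * (\<Sum>r\<in>insert p P. (q \<tau> r)^2)))" .
 qed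
qed simp

section \<open>Bilinear forms on the unit ball and on a net\<close>

definition bil :: "'i set => ('i => 'i => real) => ('i => real) => ('i => real) => real" where
 "bil I e x y = (\<Sum>i\<in>I. \<Sum>j\<in>I. e i j * (y i * x j))"

lemma bil_simps:
 "bil I e (%j. c * x j) y = c * bil I e x y" "bil I e x (%j. c * y j) = c * bil I e x y"
 "bil I e (%j. x j + x' j) y = bil I e x y + bil I e x' y" "bil I e x (%j. y j + y' j) = bil I e x y + bil I e x y'"
 by (simp_all add: bil_def sum_distrib_left algebra_simps sum.distrib)

text \<open>Rounding towards zero, so that a point of the unit ball is rounded to a lattice point of
  the unit ball.\<close>

definition itrunc :: "real => int" where "itrunc u = (if u >= 0 then \<lfloor>u\<rfloor> else \<lceil>u\<rceil>)"

lemma itrunc: "\<bar>real_of_int (itrunc u)\<bar> <= \<bar>u\<bar>" "\<bar>u - itrunc u\<bar> <= 1"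
 unfolding itrunc_def by (auto; linarith)+

text \<open>A bilinear form is controlled on the unit ball by its values on the lattice points of mesh
  \<open>1 / (4 \<surd>k)\<close>, of which there are at most exponentially many in \<open>k\<close>.\<close>

lemma net_bound:
 fixes e :: "'i => 'i => real"
 assumes I: "finite I" "I \<noteq> {}"
 defines "c \<equiv> 4 * sqrt (real (card I))"
 defines "N \<equiv> {z \<in> PiE I (%_. UNIV :: int set). (\<Sum>i\<in>I. (real_of_int (z i))^2) <= c^2}"
 assumes M: "!!z w. z \<in> N ==> w \<in> N ==> bil I e (%i. z i / c) (%i. w i / c) <= M"
 assumes x: "(\<Sum>i\<in>I. (x i)^2) <= 1" and y: "(\<Sum>i\<in>I. (y i)^2) <= 1"
 shows "bil I e x y <= 2 * M"
proof -
 have k: "real (card I) > 0" using I by (simp add: card_gt_0_iff)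
 have c: "c > 0" "c^2 = 16 * real (card I)" using k by (simp_all add: c_def power_mult_distrib)
 define B where "B s \<longleftrightarrow> (\<forall>x y. (\<Sum>i\<in>I. (x i)^2) <= 1 --> (\<Sum>i\<in>I. (y i)^2) <= 1 --> bil I e x y <= s)" for s
 have B0: "B (\<Sum>i\<in>I. \<Sum>j\<in>I. \<bar>e i j\<bar>)"
  unfolding B_def
 proof (intro allI impI)
  fix x y :: "'i => real" assume x: "(\<Sum>i\<in>I. (x i)^2) <= 1" and y: "(\<Sum>i\<in>I. (y i)^2) <= 1"
  have le1: "\<bar>z i\<bar> <= 1" if "(\<Sum>i\<in>I. (z i)^2) <= 1" "i \<in> I" for z :: "'i => real" and i
   using member_le_sum[OF that(2), of "%i. (z i)^2"] I(1) that(1) by (simp add: abs_square_le_1[symmetric])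
  show "bil I e x y <= (\<Sum>i\<in>I. \<Sum>j\<in>I. \<bar>e i j\<bar>)"
   unfolding bil_def
  proof (intro sum_mono)
   fix i j assume ij: "i \<in> I" "j \<in> I"
   have "\<bar>y i * x j\<bar> <= 1" using le1[OF x ij(2)] le1[OF y ij(1)] by (simp add: abs_mult mult_le_one)
   then have "\<bar>e i j * (y i * x j)\<bar> <= \<bar>e i j\<bar>" by (simp add: abs_mult[of "e i j"] mult_left_le)
   then show "e i j * (y i * x j) <= \<bar>e i j\<bar>" by linarith
  qed
 qed
 have Bnn: "0 <= s" if "B s" for s
  using that unfolding B_def by (auto dest!: spec[of _ "%_. 0"] simp: bil_def)
 define s where "s = Inf {s. B s}"
 have Bs: "B s" unfolding B_def
 proof (intro allI impI)
  fix x y :: "'i => real" assume "(\<Sum>i\<in>I. (x i)^2) <= 1" "(\<Sum>i\<in>I. (y i)^2) <= 1"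
  then show "bil I e x y <= s" unfolding s_def using B0 by (intro cInf_greatest) (auto simp: B_def)
 qed
 \<comment> \<open>Both arguments are replaced by lattice points of the unit ball. Four times each
   error lies in the unit ball again, so each replacement costs at most a quarter of the optimal
   bound \<open>s\<close>, which therefore satisfies \<open>s <= M + s / 2\<close>.\<close>
 have "B (M + s / 2)" unfolding B_def
 proof (intro allI impI)
  fix x y :: "'i => real" assume x: "(\<Sum>i\<in>I. (x i)^2) <= 1" and y: "(\<Sum>i\<in>I. (y i)^2) <= 1"
  define r where "r u = (\<lambda>i\<in>I. itrunc (c * u i))" for u :: "'i => real"
  define u' where "u' u i = real_of_int (r u i) / c" for u and i :: 'i
  have small: "(\<Sum>i\<in>I. (u' u i)^2) <= 1" if "(\<Sum>i\<in>I. (u i)^2) <= 1" for u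
  proof -
   have "(u' u i)^2 <= (u i)^2" if "i \<in> I" for i
   proof -
    have "\<bar>real_of_int (r u i)\<bar> <= c * \<bar>u i\<bar>" using itrunc(1)[of "c * u i"] c that by (simp add: r_def abs_mult)
    then have "\<bar>u' u i\<bar> <= \<bar>u i\<bar>" using c by (simp add: u'_def abs_divide field_simps)
    then show ?thesis by (simp add: abs_le_square_iff)
   qed
   then have "(\<Sum>i\<in>I. (u' u i)^2) <= (\<Sum>i\<in>I. (u i)^2)" by (rule sum_mono)
   then show ?thesis using that by linarith
  qed
  have mem: "r u \<in> N" if "(\<Sum>i\<in>I. (u i)^2) <= 1" for u
  proof -
   have "(\<Sum>i\<in>I. (real_of_int (r u i))^2) = c^2 * (\<Sum>i\<in>I. (u' u i)^2)"
    using c(1) by (simp add: u'_def power_divide sum_distrib_left)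
   also have "... <= c^2 * 1" using small[OF that] by (intro mult_left_mono) auto
   finally show ?thesis unfolding N_def by (simp add: r_def)
  qed
  have diff: "(\<Sum>i\<in>I. (4 * (u i - u' u i))^2) <= 1" for u
  proof -
   have "(4 * (u i - u' u i))^2 <= 1 / real (card I)" if "i \<in> I" for i
   proof -
    have "\<bar>c * u i - real_of_int (r u i)\<bar> <= 1" using itrunc(2)[of "c * u i"] that by (simp add: r_def)
    then have "(c * u i - real_of_int (r u i))^2 <= 1" by (simp add: abs_square_le_1)
    moreover have "c * u i - real_of_int (r u i) = c * (u i - u' u i)" using c by (simp add: u'_def field_simps)
    ultimately have "c^2 * (u i - u' u i)^2 <= 1" by (simp only: power_mult_distrib)
    then have "16 * (u i - u' u i)^2 * real (card I) <= 1" by (simp only: c(2) mult_ac)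
    then show ?thesis unfolding power_mult_distrib using k by (simp add: pos_le_divide_eq)
   qed
   then have "(\<Sum>i\<in>I. (4 * (u i - u' u i))^2) <= (\<Sum>i\<in>I. 1 / real (card I))" by (rule sum_mono)
   then show ?thesis using k by simp
  qed
  have "bil I e x y = bil I e (u' x) (u' y) + bil I e (%i. x i - u' x i) (u' y) + bil I e x (%i. y i - u' y i)"
   by (simp add: bil_def algebra_simps sum.distrib sum_subtractf)
  moreover have "bil I e (u' x) (u' y) <= M" unfolding u'_def by (rule M[OF mem[OF x] mem[OF y]])
  moreover have "4 * bil I e (%i. x i - u' x i) (u' y) <= s"
   unfolding bil_simps(1)[symmetric] by (rule Bs[unfolded B_def, rule_format, OF diff small[OF y]])
  moreover have "4 * bil I e x (%i. y i - u' y i) <= s"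
   unfolding bil_simps(2)[symmetric] by (rule Bs[unfolded B_def, rule_format, OF x diff])
  ultimately show "bil I e x y <= M + s / 2" by linarith
 qed
 then have "s <= M + s / 2" unfolding s_def by (intro cInf_lower) (auto intro!: bdd_belowI[of _ 0] Bnn)
 then have "s <= 2 * M" by simp
 then show ?thesis using Bs x y unfolding B_def by (meson order_trans)
qed

text \<open>The potential for \<open>weighted_rounding\<close> is the sum, over all pairs of net
  points, of the exponential of \<open>lam\<close> times the form of the rounding error. With
  \<open>lam = sqrt k / h\<close> the variance term is at most \<open>k\<close>, and there are at
  most \<open>exp (6 * k)\<close> net points for each argument, so the potential is at most
  \<open>exp (13 * k)\<close>. A single term then bounds the form on the net by
  \<open>13 * h * sqrt k\<close>, which \<open>net_bound\<close> doubles. The error thus has the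
  norm expected of a random matrix with entries of size \<open>h\<close>.\<close>

lemma operator_rounding:
 fixes a :: "'i => 'i => real"
 assumes I: "finite I" "I \<noteq> {}" and h: "h > 0"
 shows "\<exists>n :: 'i => 'i => int. (\<forall>i\<in>I. \<forall>j\<in>I. \<bar>a i j - h * n i j\<bar> <= h) \<and>
  (\<forall>x y. (\<Sum>i\<in>I. (x i)^2) <= 1 --> (\<Sum>i\<in>I. (y i)^2) <= 1 -->
   bil I (%i j. a i j - h * n i j) x y <= 26 * h * sqrt (real (card I)))"
proof -
 define k where "k = real (card I)"
 have k: "k > 0" using I by (simp add: k_def card_gt_0_iff)
 define c where "c = 4 * sqrt k"
 have c: "c > 0" "c^2 = 16 * k" using k by (simp_all add: c_def power_mult_distrib)
 define N where "N = {z \<in> PiE I (%_. UNIV :: int set). (\<Sum>i\<in>I. (real_of_int (z i))^2) <= c^2}"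
 define Z where "Z = {z \<in> PiE I (%_. UNIV :: int set). (\<Sum>i\<in>I. real_of_int \<bar>z i\<bar>) <= real (card I) / (1/4)}"
 have Z: "finite Z" "real (card Z) <= (12 / (1/4)) ^ card I"
  unfolding Z_def by (rule int_vector_count[OF I(1)]; simp)+
 have "N \<subseteq> Z"
 proof
  fix z assume z: "z \<in> N"
  have "(\<Sum>i\<in>I. real_of_int \<bar>z i\<bar>) <= sqrt k * sqrt (\<Sum>i\<in>I. (real_of_int (z i))^2)"
   using sum_abs_le_sqrt[of "%i. real_of_int (z i)" I] by (simp add: k_def)
  also have "... <= sqrt k * c" using z c k unfolding N_def by (intro mult_left_mono real_le_lsqrt) auto
  also have "... = k / (1/4)" using k by (simp add: c_def)
  finally show "z \<in> Z" using z unfolding N_def Z_def k_def by simp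
 qed
 then have N: "finite N" "real (card N) <= 48 ^ card I"
  using Z finite_subset card_mono[of Z N] by auto
 have "(48::real) <= exp 6"
 proof -
  have "(2::real) <= exp 1" using exp_ge_add_one_self[of "1::real"] by simp
  then have "(2::real) ^ 6 <= exp 1 ^ 6" by (rule power_mono) simp
  also have "exp 1 ^ 6 = (exp 6 :: real)" by (simp add: exp_of_nat_mult[symmetric])
  finally show ?thesis by simp
 qed
 then have "(48::real) ^ card I <= exp 6 ^ card I" by (intro power_mono) auto
 also have "exp 6 ^ card I = exp (6 * k)" by (simp add: exp_of_nat_mult[symmetric] k_def mult.commute)
 finally have cN: "real (card N) <= exp (6 * k)" using N(2) by linarith
 define lam where "lam = sqrt k / h"
 define q :: "('i => int) \<times> ('i => int) => 'i \<times> 'i => real" where "q = (%(z, w) (i, j). lam * ((real_of_int (w i) / c) * (real_of_int (z j) / c)))"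
 obtain n :: "'i \<times> 'i => int" where n: "\<forall>p\<in>I \<times> I. \<bar>(case p of (i, j) => a i j) - h * n p\<bar> <= h"
  "(\<Sum>\<tau>\<in>N \<times> N. 1 * exp (\<Sum>p\<in>I \<times> I. ((case p of (i, j) => a i j) - h * n p) * q \<tau> p))
    <= (\<Sum>\<tau>\<in>N \<times> N. 1 * exp (h^2 / 8 * (\<Sum>p\<in>I \<times> I. (q \<tau> p)^2)))"
  using weighted_rounding[of "I \<times> I" h "N \<times> N" "%_. 1" "%(i, j). a i j" q] I h by auto
 define e where "e i j = a i j - h * n (i, j)" for i j
 have qe: "(\<Sum>p\<in>I \<times> I. ((case p of (i, j) => a i j) - h * n p) * q (z, w) p) = lam * bil I e (%i. z i / c) (%i. w i / c)" for z w
  unfolding bil_def sum.cartesian_product sum_distrib_left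
  by (rule sum.cong) (auto simp: q_def e_def)
 have q2: "h^2 / 8 * (\<Sum>p\<in>I \<times> I. (q \<tau> p)^2) <= k" if \<tau>: "\<tau> \<in> N \<times> N" for \<tau>
 proof -
  obtain z w where zw: "\<tau> = (z, w)" "z \<in> N" "w \<in> N" using \<tau> by auto
  have s1: "(\<Sum>i\<in>I. (real_of_int (u i) / c)^2) <= 1" if "u \<in> N" for u
   using that c k by (simp add: N_def power_divide sum_divide_distrib[symmetric])
  have "(\<Sum>p\<in>I \<times> I. (q \<tau> p)^2) = lam^2 * ((\<Sum>i\<in>I. (real_of_int (w i) / c)^2) * (\<Sum>j\<in>I. (real_of_int (z j) / c)^2))"
  proof -
   have pr: "(\<Sum>i\<in>I. (real_of_int (w i) / c)^2) * (\<Sum>j\<in>I. (real_of_int (z j) / c)^2)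
     = (\<Sum>(i, j)\<in>I \<times> I. (real_of_int (w i) / c)^2 * (real_of_int (z j) / c)^2)"
    by (simp only: sum_product sum.cartesian_product)
   show ?thesis unfolding pr by (subst sum_distrib_left) (auto simp: zw q_def power_mult_distrib power_divide intro!: sum.cong)
  qed
  also have "... <= lam^2 * (1 * 1)"
   using s1[OF zw(2)] s1[OF zw(3)] by (intro mult_left_mono mult_mono) (auto intro: sum_nonneg)
  finally have "h^2 / 8 * (\<Sum>p\<in>I \<times> I. (q \<tau> p)^2) <= h^2 / 8 * lam^2" by (simp add: mult_left_mono)
  also have "... = k / 8" using h k by (simp add: lam_def power_divide)
  finally show ?thesis using k by simp
 qed
 have total: "(\<Sum>\<tau>\<in>N \<times> N. exp (\<Sum>p\<in>I \<times> I. ((case p of (i, j) => a i j) - h * n p) * q \<tau> p)) <= exp (13 * k)"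
 proof -
  have "(\<Sum>\<tau>\<in>N \<times> N. exp (\<Sum>p\<in>I \<times> I. ((case p of (i, j) => a i j) - h * n p) * q \<tau> p))
    <= (\<Sum>\<tau>\<in>N \<times> N. exp (h^2 / 8 * (\<Sum>p\<in>I \<times> I. (q \<tau> p)^2)))" using n(2) by simp
  also have "... <= (\<Sum>\<tau>\<in>N \<times> N. exp k)" using q2 by (intro sum_mono) simp
  also have "... = real (card N) * real (card N) * exp k" by (simp add: card_cartesian_product)
  also have "... <= exp (6 * k) * exp (6 * k) * exp k" using cN by (intro mult_mono) auto
  also have "... = exp (13 * k)" by (simp add: exp_add[symmetric])
  finally show ?thesis .
 qed
 have M: "bil I e (%i. z i / c) (%i. w i / c) <= 13 * h * sqrt k" if "z \<in> N" "w \<in> N" for z w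
 proof -
  have "exp (lam * bil I e (%i. z i / c) (%i. w i / c))
    <= (\<Sum>\<tau>\<in>N \<times> N. exp (\<Sum>p\<in>I \<times> I. ((case p of (i, j) => a i j) - h * n p) * q \<tau> p))"
   unfolding qe[symmetric] by (rule member_le_sum[of "(z, w)"]) (use that N in auto)
  then have "lam * bil I e (%i. z i / c) (%i. w i / c) <= 13 * k" unfolding exp_le_cancel_iff[symmetric, of _ "13 * k"] using total by (rule order_trans)
  then have "bil I e (%i. z i / c) (%i. w i / c) <= 13 * k * h / sqrt k"
   using h k by (simp add: lam_def field_simps)
  also have "13 * k * h / sqrt k = 13 * h * sqrt k" using k by (simp add: field_simps)
  finally show ?thesis .
 qed
 have "bil I e x y <= 2 * (13 * h * sqrt k)" if "(\<Sum>i\<in>I. (x i)^2) <= 1" "(\<Sum>i\<in>I. (y i)^2) <= 1" for x y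
  by (rule net_bound[OF I _ that]) (use M in \<open>simp add: N_def c_def k_def\<close>)
 then show ?thesis using n(1) by (intro exI[of _ "%i j. n (i, j)"]) (auto simp: e_def[abs_def] k_def mult.assoc)
qed

text \<open>The form is tested at \<open>x\<close> and at its image under \<open>e\<close>, both
  scaled to length 1.\<close>

lemma bil_bound_real:
 fixes e :: "'i => 'i => real"
 assumes I: "finite I" and B: "!!x y. (\<Sum>i\<in>I. (x i)^2) <= 1 ==> (\<Sum>i\<in>I. (y i)^2) <= 1 ==> bil I e x y <= B"
 shows "(\<Sum>i\<in>I. (\<Sum>j\<in>I. e i j * x j)^2) <= B^2 * (\<Sum>j\<in>I. (x j)^2)"
proof -
 define y where "y i = (\<Sum>j\<in>I. e i j * x j)" for i
 define N where "N = (\<Sum>i\<in>I. (y i)^2)"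
 define X where "X = (\<Sum>i\<in>I. (x i)^2)"
 have nn: "N >= 0" "X >= 0" by (simp_all add: N_def X_def sum_nonneg)
 have "N <= B^2 * X"
 proof (cases "X = 0 \<or> N = 0")
  case True
  then show ?thesis
  proof
   assume "X = 0"
   then have "x i = 0" if "i \<in> I" for i using that I by (simp add: X_def sum_nonneg_eq_0_iff)
   then have "N = 0" by (simp add: N_def y_def)
   then show ?thesis using nn by simp
  qed (use nn in simp)
 next
  case False
  then have pos: "N > 0" "X > 0" using nn by auto
  have "bil I e x y = N" by (simp add: bil_def N_def power2_eq_square y_def[of i for i] sum_distrib_left mult_ac)
  then have eq: "bil I e (%i. 1 / sqrt X * x i) (%i. 1 / sqrt N * y i) = N / (sqrt X * sqrt N)"
   unfolding bil_simps by simp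
  have "bil I e (%i. 1 / sqrt X * x i) (%i. 1 / sqrt N * y i) <= B"
   by (rule B) (use pos in \<open>simp_all add: power_divide sum_divide_distrib[symmetric] N_def[symmetric] X_def[symmetric]\<close>)
  then have "N <= B * (sqrt X * sqrt N)" unfolding eq using pos by (simp add: pos_divide_le_eq)
  then have "sqrt N * sqrt N <= (B * sqrt X) * sqrt N" using pos by (simp add: mult_ac)
  then have "sqrt N <= B * sqrt X" by (rule mult_right_le_imp_le) (use pos in simp)
  then have "(sqrt N)^2 <= (B * sqrt X)^2" using pos by (intro power_mono) auto
  then show ?thesis using pos by (simp add: power_mult_distrib)
 qed
 then show ?thesis by (simp add: N_def X_def y_def)
qed

lemma opb_of_real:
 fixes e :: "'i => 'i => real"
 assumes I: "finite I" and B: "!!x y. (\<Sum>i\<in>I. (x i)^2) <= 1 ==> (\<Sum>i\<in>I. (y i)^2) <= 1 ==> bil I e x y <= B"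
 shows "opb I (%a b. complex_of_real (e a b)) B"
 unfolding opb_def
proof
 fix x :: "'i => complex"
 have "(\<Sum>a\<in>I. (cmod (\<Sum>b\<in>I. complex_of_real (e a b) * x b))^2)
   = (\<Sum>a\<in>I. (\<Sum>b\<in>I. e a b * Re (x b))^2) + (\<Sum>a\<in>I. (\<Sum>b\<in>I. e a b * Im (x b))^2)"
  by (simp add: cmod_power2 Re_sum Im_sum sum.distrib)
 also have "... <= B^2 * (\<Sum>b\<in>I. (Re (x b))^2) + B^2 * (\<Sum>b\<in>I. (Im (x b))^2)"
  by (intro add_mono bil_bound_real[OF I B])
 also have "... = B^2 * (\<Sum>b\<in>I. (cmod (x b))^2)"
  by (simp add: cmod_power2 sum.distrib distrib_left)
 finally show "(\<Sum>a\<in>I. (cmod (\<Sum>b\<in>I. complex_of_real (e a b) * x b))^2) <= B^2 * (\<Sum>b\<in>I. (cmod (x b))^2)" .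
qed

lemma opb_add:
 assumes "opb I e c" "opb I f d" "0 <= c" "0 <= d"
 shows "opb I (%a b. e a b + f a b) (c + d)"
 unfolding opb_def
proof
 fix x :: "'a => complex"
 define X where "X = (\<Sum>b\<in>I. (cmod (x b))^2)"
 have X: "X >= 0" by (simp add: X_def sum_nonneg)
 have b: "L2_set (%a. cmod (\<Sum>b\<in>I. g a b * x b)) I <= r * sqrt X" if "opb I g r" "0 <= r" for g r
  using that X real_sqrt_le_mono[of _ "r^2 * X"] unfolding opb_def L2_set_def X_def by (force simp: real_sqrt_mult)
 have "L2_set (%a. cmod (\<Sum>b\<in>I. (e a b + f a b) * x b)) I
   <= L2_set (%a. cmod (\<Sum>b\<in>I. e a b * x b) + cmod (\<Sum>b\<in>I. f a b * x b)) I"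
  by (rule L2_set_mono) (auto simp: distrib_right sum.distrib norm_triangle_ineq)
 also have "... <= L2_set (%a. cmod (\<Sum>b\<in>I. e a b * x b)) I + L2_set (%a. cmod (\<Sum>b\<in>I. f a b * x b)) I"
  by (rule L2_set_triangle_ineq)
 also have "... <= c * sqrt X + d * sqrt X" by (intro add_mono b assms)
 finally have "sqrt (\<Sum>a\<in>I. (cmod (\<Sum>b\<in>I. (e a b + f a b) * x b))^2) <= (c + d) * sqrt X"
  by (simp add: L2_set_def distrib_right)
 then have "(sqrt (\<Sum>a\<in>I. (cmod (\<Sum>b\<in>I. (e a b + f a b) * x b))^2))^2 <= ((c + d) * sqrt X)^2"
  by (rule power_mono) (simp add: sum_nonneg)
 then show "(\<Sum>a\<in>I. (cmod (\<Sum>b\<in>I. (e a b + f a b) * x b))^2) <= (c + d)^2 * (\<Sum>b\<in>I. (cmod (x b))^2)"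
  using X by (simp add: power_mult_distrib sum_nonneg X_def)
qed

lemma opb_scale_i: "opb I e c ==> opb I (%a b. \<i> * e a b) c"
 unfolding opb_def by (simp add: mult.assoc sum_distrib_left[symmetric] norm_mult)

lemma bil_diff: "bil I (%i j. e i j - f i j) x y = bil I e x y + bil I f (%i. - x i) y"
 by (simp add: bil_def algebra_simps sum_subtractf sum_negf)

lemma sum_Times: "sum f (A \<times> B) = (\<Sum>x\<in>A. \<Sum>y\<in>B. f (x, y))"
 by (simp add: sum.cartesian_product)

lemma sum_UNIV_prod: "(\<Sum>p\<in>UNIV. f p) = (\<Sum>x\<in>UNIV. \<Sum>y\<in>UNIV. f (x, y))"
 by (simp add: sum.cartesian_product)

text \<open>Rounding costs \<open>2 n k^2 log (const / th)\<close> and turns a bound in normalized 2-norm into one in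
  operator norm.\<close>

lemma op_cover:
 fixes S :: "('n::finite => 'i => 'i => complex) set"
 assumes I: "finite I" "I \<noteq> {}" and \<rho>: "\<rho> > 0" and th: "0 < th" "th <= 1"
  and S: "!!x y. x \<in> S ==> y \<in> S ==> (\<Sum>i\<in>UNIV. hs2 I (%a b. x i a b - y i a b)) <= real (card I) * \<rho>^2"
 shows "cov (%x y. \<forall>i. opb I (%a b. x i a b - y i a b) (th * \<rho>)) S
  ((1260 / th) ^ (2 * CARD('n) * (card I)^2))"
proof (cases "S = {}")
 case True
 then show ?thesis unfolding cov_def using th by (intro exI[of _ "{}"]) auto
next
 case False
 then obtain x0 where x0: "x0 \<in> S" by blast
 define k where "k = real (card I)"
 have k: "k > 0" using I by (simp add: k_def card_gt_0_iff)
 \<comment> \<open>104 is four times 26: two points of a piece are compared, each with an error of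
   norm \<open>26 * h * sqrt k\<close>, and this for the real and for the imaginary parts.\<close>
 define h where "h = th * \<rho> / (104 * sqrt k)"
 have h: "h > 0" using th \<rho> k by (simp add: h_def)
 define prt where "prt s z = (if s then Im z else Re z)" for s z
 have "\<forall>x i s. \<exists>n :: 'i => 'i => int. (\<forall>a\<in>I. \<forall>b\<in>I. \<bar>prt s (x i a b - x0 i a b) - h * n a b\<bar> <= h) \<and>
  (\<forall>u v. (\<Sum>i\<in>I. (u i)^2) <= 1 --> (\<Sum>i\<in>I. (v i)^2) <= 1 -->
   bil I (%a b. prt s (x i a b - x0 i a b) - h * n a b) u v <= 26 * h * sqrt (real (card I)))"
  by (intro allI operator_rounding I h)
 then obtain n :: "('n => 'i => 'i => complex) => 'n => bool => 'i => 'i => int" where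
  n: "!!x i s a b. a \<in> I ==> b \<in> I ==> \<bar>prt s (x i a b - x0 i a b) - h * n x i s a b\<bar> <= h"
   "!!x i s u v. (\<Sum>i\<in>I. (u i)^2) <= 1 ==> (\<Sum>i\<in>I. (v i)^2) <= 1 ==>
    bil I (%a b. prt s (x i a b - x0 i a b) - h * n x i s a b) u v <= 26 * h * sqrt k"
  unfolding k_def choice_iff by blast
 define D where "D = (UNIV :: ('n \<times> bool) set) \<times> (I \<times> I)"
 have D: "finite D" "card D = 2 * CARD('n) * (card I)^2"
  using I by (simp_all add: D_def card_cartesian_product power2_eq_square)
 define col where "col x = (\<lambda>((i, s), (a, b))\<in>D. n x i s a b)" for x
 \<comment> \<open>The entries contribute 104 and the rounding 1 to the factor 105; 12 times 105 is
   the constant 1260.\<close>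
 define Z where "Z = {z \<in> PiE D (%_. UNIV :: int set). (\<Sum>i\<in>D. real_of_int \<bar>z i\<bar>) <= real (card D) / (th / 105)}"
 have Z: "finite Z" "real (card Z) <= (12 / (th / 105)) ^ card D"
  unfolding Z_def using int_vector_count[OF D(1), of "th / 105"] th by auto
 show ?thesis
 proof (rule cov_colouring[OF Z(1)])
  show "real (card Z) <= (1260 / th) ^ (2 * CARD('n) * (card I)^2)" using Z(2) by (simp add: D(2))
 next
  fix x assume x: "x \<in> S"
  define f where "f = (%((i, s), (a, b)). prt s (x i a b - x0 i a b))"
  have "(\<Sum>p\<in>D. real_of_int \<bar>col x p\<bar>) <= (\<Sum>p\<in>D. \<bar>f p\<bar> / h + 1)"
  proof (rule sum_mono)
   fix p assume p: "p \<in> D"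
   obtain i s a b where q: "p = ((i, s), (a, b))" by (metis surj_pair)
   have "h * \<bar>real_of_int (n x i s a b)\<bar> = \<bar>h * n x i s a b\<bar>" using h by (simp add: abs_mult)
   also have "... <= \<bar>f p\<bar> + h" using n(1)[of a b s x i] p unfolding q by (simp add: f_def D_def)
   finally have "\<bar>real_of_int (n x i s a b)\<bar> <= (\<bar>f p\<bar> + h) / h" using h by (simp add: pos_le_divide_eq mult.commute)
   then show "real_of_int \<bar>col x p\<bar> <= \<bar>f p\<bar> / h + 1" using p h by (simp add: col_def q add_divide_distrib)
  qed
  then have 1: "(\<Sum>p\<in>D. real_of_int \<bar>col x p\<bar>) <= (\<Sum>p\<in>D. \<bar>f p\<bar>) / h + real (card D)"
   by (simp add: sum.distrib sum_divide_distrib)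
  have "(\<Sum>p\<in>D. (f p)^2) = (\<Sum>i\<in>UNIV. \<Sum>s\<in>UNIV. \<Sum>a\<in>I. \<Sum>b\<in>I. (prt s (x i a b - x0 i a b))^2)"
   unfolding D_def sum_Times sum_UNIV_prod by (simp add: f_def)
  also have "... = (\<Sum>i\<in>UNIV. hs2 I (%a b. x i a b - x0 i a b))"
   by (simp add: UNIV_bool prt_def hs2_def cmod_power2 sum.distrib add.commute)
  finally have 2: "(\<Sum>p\<in>D. (f p)^2) <= k * \<rho>^2" using S[OF x x0] by (simp add: k_def)
  have "(\<Sum>p\<in>D. \<bar>f p\<bar>) <= sqrt (real (card D)) * sqrt (\<Sum>p\<in>D. (f p)^2)" by (rule sum_abs_le_sqrt)
  also have "... <= sqrt (real (card D)) * sqrt (k * \<rho>^2)"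
   by (intro mult_left_mono real_sqrt_le_mono 2) auto
  finally have "(\<Sum>p\<in>D. \<bar>f p\<bar>) / h <= sqrt (real (card D)) * sqrt (k * \<rho>^2) / h"
   using h by (simp add: divide_right_mono)
  also have "... = sqrt (real (card D)) * (k * 104 / th)"
   using k \<rho> th by (simp add: h_def real_sqrt_mult)
  also have "... <= sqrt (real (card D)) * (sqrt (real (card D)) * 104 / th)"
  proof -
   have "(card I)^2 <= card D" unfolding D(2) by (cases "CARD('n)") auto
   then have "k^2 <= real (card D)" unfolding k_def by (metis of_nat_le_iff of_nat_power)
   then have "k <= sqrt (real (card D))" by (rule real_le_rsqrt)
   then show ?thesis using th by (intro mult_left_mono divide_right_mono) auto
  qed
  also have "... = real (card D) * 104 / th" by (simp add: mult.assoc[symmetric])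
  finally have 3: "(\<Sum>p\<in>D. \<bar>f p\<bar>) / h <= real (card D) * 104 / th" .
  have 4: "real (card D) * 104 / th + real (card D) <= real (card D) / (th / 105)"
  proof -
   have "real (card D) * th <= real (card D)" using th by (simp add: mult_left_le)
   then show ?thesis using th by (simp add: field_simps)
  qed
  have "(\<Sum>p\<in>D. real_of_int \<bar>col x p\<bar>) <= real (card D) / (th / 105)" using 1 3 4 by linarith
  then show "col x \<in> Z" unfolding Z_def by (simp add: col_def)
 next
  fix x y assume "x \<in> S" "y \<in> S" and eq: "col x = col y"
  have neq: "n x i s a b = n y i s a b" if "a \<in> I" "b \<in> I" for i s a b
   using fun_cong[OF eq, of "((i, s), (a, b))"] that by (simp add: col_def D_def)
  have part: "opb I (%a b. complex_of_real (prt s (x i a b - y i a b))) (52 * h * sqrt k)" for i s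
  proof (rule opb_of_real[OF I(1)])
   fix u v :: "'i => real" assume u: "(\<Sum>i\<in>I. (u i)^2) <= 1" and v: "(\<Sum>i\<in>I. (v i)^2) <= 1"
   have "bil I (%a b. prt s (x i a b - y i a b)) u v
    = bil I (%a b. (prt s (x i a b - x0 i a b) - h * n x i s a b) - (prt s (y i a b - x0 i a b) - h * n y i s a b)) u v"
    unfolding bil_def by (intro sum.cong refl) (simp add: neq prt_def)
   also have "... = bil I (%a b. prt s (x i a b - x0 i a b) - h * n x i s a b) u v
     + bil I (%a b. prt s (y i a b - x0 i a b) - h * n y i s a b) (%i. - u i) v" by (rule bil_diff)
   also have "... <= 26 * h * sqrt k + 26 * h * sqrt k" by (intro add_mono n(2)) (use u v in auto)
   finally show "bil I (%a b. prt s (x i a b - y i a b)) u v <= 52 * h * sqrt k" by simp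
  qed
  show "\<forall>i. opb I (%a b. x i a b - y i a b) (th * \<rho>)"
  proof
   fix i
   have "opb I (%a b. complex_of_real (prt False (x i a b - y i a b)) + \<i> * complex_of_real (prt True (x i a b - y i a b)))
     (52 * h * sqrt k + 52 * h * sqrt k)"
    using h k by (intro opb_add opb_scale_i part) auto
   moreover have "52 * h * sqrt k + 52 * h * sqrt k = th * \<rho>" using k by (simp add: h_def)
   moreover have "complex_of_real (prt False z) + \<i> * complex_of_real (prt True z) = z" for z
    by (simp add: prt_def complex_eq_iff)
   ultimately show "opb I (%a b. x i a b - y i a b) (th * \<rho>)" by simp
  qed
 qed
qed

section \<open>Diagonalization of real symmetric matrices\<close>

definition orthm :: "'d set => ('d => 'd => real) => bool" where
 "orthm D u \<longleftrightarrow> (\<forall>i\<in>D. \<forall>j\<in>D. (\<Sum>a\<in>D. u i a * u j a) = idm i j) \<and>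
   (\<forall>a\<in>D. \<forall>b\<in>D. (\<Sum>i\<in>D. u i a * u i b) = idm a b)"

definition qf :: "'d set => ('d => 'd => real) => ('d => real) => ('d => real) => real" where
 "qf D g x y = (\<Sum>a\<in>D. \<Sum>b\<in>D. g a b * (x a * y b))"

lemma qf_combine:
 assumes "!!a b. a \<in> D ==> b \<in> D ==> g a b = g b a"
 shows "qf D g (%a. c * x a + s * y a) (%a. c * x a + s * y a) = c^2 * qf D g x x + 2 * (c * s) * qf D g x y + s^2 * qf D g y y"
proof -
 have sym: "qf D g y x = qf D g x y"
 proof -
  have "qf D g y x = (\<Sum>b\<in>D. \<Sum>a\<in>D. g a b * (y a * x b))" unfolding qf_def by (rule sum.swap)
  also have "... = qf D g x y" unfolding qf_def
   by (intro sum.cong refl) (use assms in \<open>simp add: mult.commute\<close>)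
  finally show ?thesis .
 qed
 have "qf D g (%a. c * x a + s * y a) (%a. c * x a + s * y a)
   = c^2 * qf D g x x + (c * s) * qf D g x y + (c * s) * qf D g y x + s^2 * qf D g y y"
  unfolding qf_def sum_distrib_left sum.distrib[symmetric]
  by (intro sum.cong refl) (simp add: algebra_simps power2_eq_square)
 then show ?thesis by (simp add: sym)
qed

definition rot :: "'d => 'd => real => real => ('d => 'd => real) => 'd => 'd => real" where
 "rot i j c s u = u(i := (%a. c * u i a + s * u j a), j := (%a. (- s) * u i a + c * u j a))"

lemma sum_two:
 fixes f :: "'d => real"
 assumes "finite D" "i \<in> D" "j \<in> D" "i \<noteq> j"
 shows "sum f D = f i + f j + sum f (D - {i, j})"
proof -
 have "sum f D = f i + sum f (D - {i})" using assms by (simp add: sum.remove)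
 also have "sum f (D - {i}) = f j + sum f (D - {i} - {j})" using assms by (intro sum.remove) auto
 also have "D - {i} - {j} = D - {i, j}" by auto
 finally show ?thesis by simp
qed

lemma orthm_rot:
 assumes D: "finite D" and u: "orthm D u" and ij: "i \<in> D" "j \<in> D" "i \<noteq> j" and cs: "c^2 + s^2 = 1"
 shows "orthm D (rot i j c s u)"
proof -
 define v where "v = rot i j c s u"
 have vi: "v i = (%a. c * u i a + s * u j a)" and vj: "v j = (%a. (- s) * u i a + c * u j a)"
  and vk: "k \<noteq> i ==> k \<noteq> j ==> v k = u k" for k using ij by (auto simp: v_def rot_def)
 have row: "(\<Sum>a\<in>D. u p a * u q a) = idm p q" if "p \<in> D" "q \<in> D" for p q using u that unfolding orthm_def by blast
 have lin: "(\<Sum>a\<in>D. (x * f a + y * g a) * h a) = x * (\<Sum>a\<in>D. f a * h a) + y * (\<Sum>a\<in>D. g a * h a)"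
  "(\<Sum>a\<in>D. h a * (x * f a + y * g a)) = x * (\<Sum>a\<in>D. h a * f a) + y * (\<Sum>a\<in>D. h a * g a)"
  for x y :: real and f g h :: "'a => real"
  by (simp_all add: algebra_simps sum.distrib sum_distrib_left)
 have "(\<Sum>a\<in>D. v p a * v q a) = idm p q" if pq: "p \<in> D" "q \<in> D" for p q
 proof -
  have cs': "c * c + s * s = 1" using cs by (simp add: power2_eq_square)
  have vu: "(\<Sum>a\<in>D. v k a * u q a) = (if k = i then c * idm i q + s * idm j q else if k = j then (- s) * idm i q + c * idm j q else idm k q)"
   if "k \<in> D" "q \<in> D" for k q
   by (cases "k = i"; cases "k = j") (simp_all only: vi vj vk lin row that ij if_True if_False simp_thms)
  have "(\<Sum>a\<in>D. v p a * v q a) = (if q = i then c * (\<Sum>a\<in>D. v p a * u i a) + s * (\<Sum>a\<in>D. v p a * u j a)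
    else if q = j then (- s) * (\<Sum>a\<in>D. v p a * u i a) + c * (\<Sum>a\<in>D. v p a * u j a) else (\<Sum>a\<in>D. v p a * u q a))"
   by (cases "q = i"; cases "q = j") (simp_all only: vi[THEN fun_cong] vj[THEN fun_cong] vk lin if_True if_False simp_thms)
  then show ?thesis unfolding vu[OF pq(1) ij(1)] vu[OF pq(1) ij(2)] vu[OF pq]
   using ij cs' by (auto simp: idm_def algebra_simps)
 qed
 moreover have "(\<Sum>k\<in>D. v k a * v k b) = idm a b" if ab: "a \<in> D" "b \<in> D" for a b
 proof -
  have "v i a * v i b + v j a * v j b = (c^2 + s^2) * (u i a * u i b + u j a * u j b)"
   by (simp add: vi vj algebra_simps power2_eq_square)
  then have 1: "v i a * v i b + v j a * v j b = u i a * u i b + u j a * u j b" by (simp add: cs)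
  have "(\<Sum>k\<in>D. v k a * v k b) = v i a * v i b + v j a * v j b + (\<Sum>k\<in>D - {i, j}. v k a * v k b)"
   by (rule sum_two[OF D ij])
  also have "(\<Sum>k\<in>D - {i, j}. v k a * v k b) = (\<Sum>k\<in>D - {i, j}. u k a * u k b)"
   by (intro sum.cong refl) (simp add: vk)
  also have "v i a * v i b + v j a * v j b + (\<Sum>k\<in>D - {i, j}. u k a * u k b) = (\<Sum>k\<in>D. u k a * u k b)"
   unfolding 1 by (rule sum_two[OF D ij, symmetric])
  also have "... = idm a b" using u ab unfolding orthm_def by blast
  finally show ?thesis .
 qed
 ultimately show ?thesis unfolding orthm_def v_def by blast
qed

text \<open>A maximizer of a trace with distinct weights over the orthogonal group diagonalizes the form:
  otherwise rotating two of the vectors would increase it.\<close>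

lemma orthogonal_diagonalization:
 fixes g :: "'d => 'd => real"
 assumes D: "finite D" and g: "!!a b. a \<in> D ==> b \<in> D ==> g a b = g b a"
 shows "\<exists>u. orthm D u \<and> (\<forall>i\<in>D. \<forall>j\<in>D. i \<noteq> j --> qf D g (u i) (u j) = 0)"
proof -
 obtain w :: "'d => nat" where w: "inj_on w D" using D finite_imp_inj_to_nat_seg by blast
 \<comment> \<open>Entries outside \<open>D \<times> D\<close> are fixed to 0, so that the
   orthogonal matrices form a compact set in the product topology and the maximum is
   attained.\<close>
 define B where "B = (%p. if p \<in> D \<times> D then {-1..1::real} else {0})"
 define K where "K = {U. U \<in> PiE UNIV B \<and> orthm D (%i a. U (i, a))}"
 define \<Phi> where "\<Phi> U = (\<Sum>i\<in>D. real (w i) * qf D g (%a. U (i, a)) (%a. U (i, a)))" for U :: "'d \<times> 'd => real"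
 have cont: "continuous_on UNIV (%U :: 'd \<times> 'd => real. U p)" for p by simp
 have "compactin (product_topology (%_. euclidean) UNIV) (PiE UNIV B)"
  unfolding compactin_PiE by (intro disjI2 ballI) (simp add: B_def)
 then have "compact (PiE UNIV B)" by (simp only: euclidean_product_topology compactin_euclidean_iff)
 moreover have "closed {U :: 'd \<times> 'd => real. orthm D (%i a. U (i, a))}"
  unfolding orthm_def Ball_def
  by (intro closed_Collect_conj closed_Collect_all closed_Collect_imp open_Collect_const closed_Collect_eq
    continuous_on_sum continuous_on_mult cont continuous_on_const)
 ultimately have K: "compact K" unfolding K_def Collect_conj_eq Collect_mem_eq by (rule compact_Int_closed)
 have unit: "\<bar>u i a\<bar> <= 1" if "orthm D u" "i \<in> D" "a \<in> D" for u i a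
 proof -
  have "(u i a)^2 <= (\<Sum>a\<in>D. (u i a)^2)" by (rule member_le_sum[OF that(3)]) (auto simp: D)
  also have "... = 1" using that(1,2) unfolding orthm_def by (simp add: power2_eq_square idm_def)
  finally show ?thesis by (simp add: abs_square_le_1)
 qed
 have inK: "(%(i, a). if i \<in> D \<and> a \<in> D then u i a else 0) \<in> K" if u: "orthm D u" for u
 proof -
  have "orthm D (%i a. if i \<in> D \<and> a \<in> D then u i a else 0)" using u unfolding orthm_def by simp
  then show ?thesis unfolding K_def B_def using unit[OF u] by (auto simp: abs_le_iff PiE_iff)
 qed
 have id1: "(\<Sum>a\<in>D. idm i a * idm j a) = (idm i j :: real)" if "i \<in> D" for i j
 proof -
  have "(\<Sum>a\<in>D. idm i a * idm j a) = (\<Sum>a\<in>D. if a = i then idm i j else 0 :: real)"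
   by (intro sum.cong refl) (simp add: idm_def)
  then show ?thesis using D that by simp
 qed
 have id2: "idm a b = (idm b a :: real)" for a b :: 'd by (simp add: idm_def)
 have "(\<Sum>i\<in>D. idm i a * idm i b) = (idm a b :: real)" if "a \<in> D" for a b
  unfolding id1[OF that, of b, symmetric] by (intro sum.cong refl arg_cong2[of _ _ _ _ "(*)"] id2)
 then have "orthm D idm" using id1 unfolding orthm_def by simp
 then have "K \<noteq> {}" using inK by blast
 moreover have "continuous_on K \<Phi>"
  unfolding \<Phi>_def qf_def
  by (intro continuous_on_sum continuous_on_mult continuous_on_const continuous_on_subset[OF cont]) auto
 ultimately obtain U where U: "U \<in> K" "!!V. V \<in> K ==> \<Phi> V <= \<Phi> U"
  using continuous_attains_sup[OF K] by blast
 define u where "u i a = U (i, a)" for i a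
 have u: "orthm D u" using U(1) by (simp add: K_def u_def[abs_def])
 define W where "W v = (\<Sum>i\<in>D. real (w i) * qf D g (v i) (v i))" for v
 have max: "W v <= W u" if v: "orthm D v" for v
 proof -
  have "W v = \<Phi> (%(i, a). if i \<in> D \<and> a \<in> D then v i a else 0)"
   unfolding W_def \<Phi>_def qf_def by (intro sum.cong arg_cong[of _ _ "(*) _"] refl) simp
  also have "... <= \<Phi> U" by (rule U(2)[OF inK[OF v]])
  finally show ?thesis by (simp add: W_def \<Phi>_def u_def[abs_def])
 qed
 have "qf D g (u i) (u j) = 0" if ij: "i \<in> D" "j \<in> D" "i \<noteq> j" for i j
 proof (rule ccontr)
  define b where "b = qf D g (u i) (u j)"
  assume "qf D g (u i) (u j) \<noteq> 0"
  then have b: "b \<noteq> 0" by (simp add: b_def)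
  define e where "e = real (w i) - real (w j)"
  have e: "e \<noteq> 0" using w ij by (auto simp: e_def dest: inj_onD)
  define d where "d = qf D g (u j) (u j) - qf D g (u i) (u i)"
  have rotate: "e * (s^2 * d + 2 * (c * s) * b) <= 0" if cs: "c^2 + s^2 = 1" for c s
  proof -
   let ?v = "rot i j c s u"
   have vi: "?v i = (%a. c * u i a + s * u j a)" and vj: "?v j = (%a. (- s) * u i a + c * u j a)"
    and vk: "k \<noteq> i ==> k \<noteq> j ==> ?v k = u k" for k using ij by (auto simp: rot_def)
   have rest: "(\<Sum>k\<in>D - {i, j}. real (w k) * qf D g (?v k) (?v k)) = (\<Sum>k\<in>D - {i, j}. real (w k) * qf D g (u k) (u k))"
    by (intro sum.cong refl) (simp add: vk)
   have "W ?v - W u = real (w i) * (qf D g (?v i) (?v i) - qf D g (u i) (u i)) + real (w j) * (qf D g (?v j) (?v j) - qf D g (u j) (u j))"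
    unfolding W_def sum_two[OF D ij] rest by (simp add: algebra_simps)
   also have "... = e * (s^2 * d + 2 * (c * s) * b)"
   proof -
    have c2: "c^2 = 1 - s^2" using cs by simp
    have qc: "qf D g (%a. c * x a + s * y a) (%a. c * x a + s * y a) = c^2 * qf D g x x + 2 * (c * s) * qf D g x y + s^2 * qf D g y y" for x y c s
     by (rule qf_combine) (rule g)
    show ?thesis unfolding vi vj qc by (simp add: c2 e_def d_def b_def algebra_simps)
   qed
   finally show ?thesis using max[OF orthm_rot[OF D u ij cs]] by simp
  qed
  \<comment> \<open>The rotation changes the weighted trace by
    \<open>e * (s^2 * d + 2 * (c * s) * b)\<close>. The sign \<open>t\<close> makes the term of
    first order positive, and \<open>r\<close> is so small that the term with \<open>d\<close>
    cannot outweigh it.\<close>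
  define t where "t = (if e * b > 0 then 1 else -1 :: real)"
  define r where "r = \<bar>b\<bar> / (\<bar>b\<bar> + \<bar>d\<bar>)"
  have r: "0 < r" "r <= 1" using b by (auto simp: r_def field_simps)
  define s where "s = t * r / sqrt (1 + r^2)"
  define c where "c = 1 / sqrt (1 + r^2)"
  have q: "1 + r^2 > 0" by (simp add: add_pos_nonneg)
  have t2: "t^2 = 1" by (simp add: t_def)
  have "c^2 + s^2 = 1" using q by (simp add: c_def s_def power_divide power_mult_distrib t2 add_divide_distrib[symmetric])
  from rotate[OF this] have "e * (s^2 * d + 2 * (c * s) * b) <= 0" .
  also have "e * (s^2 * d + 2 * (c * s) * b) = (e * d * r^2 + 2 * (t * (e * b)) * r) / (1 + r^2)"
  proof -
   have "s^2 = r^2 / (1 + r^2)" using q by (simp add: s_def power_divide power_mult_distrib t2)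
   moreover have "c * s = t * r / (1 + r^2)" using q by (simp add: s_def c_def)
   ultimately show ?thesis by (simp add: algebra_simps add_divide_distrib)
  qed
  also have "t * (e * b) = \<bar>e\<bar> * \<bar>b\<bar>" using e b by (auto simp: t_def abs_mult[symmetric] abs_if zero_less_mult_iff)
  finally have "e * d * r^2 + 2 * (\<bar>e\<bar> * \<bar>b\<bar>) * r <= 0" using q by (simp add: divide_le_0_iff)
  moreover have "- (\<bar>e\<bar> * \<bar>d\<bar> * r^2) <= e * d * r^2"
  proof -
   have "- (\<bar>e\<bar> * \<bar>d\<bar>) <= e * d" by (simp add: abs_mult[symmetric] abs_if)
   then show ?thesis using mult_right_mono[of "- (\<bar>e\<bar> * \<bar>d\<bar>)" "e * d" "r^2"] by simp
  qed
  moreover have "\<bar>d\<bar> * r <= \<bar>b\<bar>"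
  proof -
   have "\<bar>d\<bar> * \<bar>b\<bar> <= \<bar>b\<bar> * (\<bar>b\<bar> + \<bar>d\<bar>)" by (simp add: algebra_simps)
   then show ?thesis using b by (simp add: r_def pos_divide_le_eq add_pos_nonneg)
  qed
  then have "\<bar>e\<bar> * \<bar>d\<bar> * r^2 <= \<bar>e\<bar> * \<bar>b\<bar> * r"
   using r mult_left_mono[of "\<bar>d\<bar> * r" "\<bar>b\<bar>" "\<bar>e\<bar> * r"] by (simp add: power2_eq_square mult_ac)
  moreover have "0 < \<bar>e\<bar> * \<bar>b\<bar> * r" using e b r by simp
  ultimately show False by (simp add: mult_ac)
 qed
 then show ?thesis using u by blast
qed

definition mpow :: "'d set => ('d => 'd => 'r::comm_semiring_1) => nat => 'd => 'd => 'r" where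
 "mpow D g j = (mm D g ^^ j) idm"

lemma mpow_simps [simp]: "mpow D g 0 = idm" "mpow D g (Suc j) = mm D g (mpow D g j)"
 by (simp_all add: mpow_def)

lemma spectral_decomposition:
 fixes g :: "'d => 'd => real"
 assumes D: "finite D" and g: "!!a b. a \<in> D ==> b \<in> D ==> g a b = g b a"
 obtains u \<Lambda> where
  "!!x. (\<Sum>i\<in>D. (\<Sum>a\<in>D. u i a * x a)^2) = (\<Sum>a\<in>D. (x a)^2)"
  "!!x. qf D g x x = (\<Sum>i\<in>D. \<Lambda> i * (\<Sum>a\<in>D. u i a * x a)^2)"
  "!!j. mtr D (mpow D g j) = (\<Sum>i\<in>D. \<Lambda> i ^ j)"
  "!!i. i \<in> D ==> qf D g (u i) (u i) = \<Lambda> i"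
proof -
 obtain u where u: "orthm D u" and off: "!!i j. i \<in> D ==> j \<in> D ==> i \<noteq> j ==> qf D g (u i) (u j) = 0"
  using orthogonal_diagonalization[of D g, OF D g] by blast
 define \<Lambda> where "\<Lambda> i = qf D g (u i) (u i)" for i
 have row: "(\<Sum>a\<in>D. u i a * u j a) = idm i j" if "i \<in> D" "j \<in> D" for i j using u that unfolding orthm_def by blast
 have col: "(\<Sum>i\<in>D. u i a * u i b) = idm a b" if "a \<in> D" "b \<in> D" for a b using u that unfolding orthm_def by blast
 have expand: "(\<Sum>i\<in>D. u i b * (\<Sum>a\<in>D. u i a * x a)) = x b" if "b \<in> D" for b and x
 proof -
  have "(\<Sum>i\<in>D. u i b * (\<Sum>a\<in>D. u i a * x a)) = (\<Sum>a\<in>D. (\<Sum>i\<in>D. u i b * u i a) * x a)"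
   unfolding sum_distrib_left sum_distrib_right by (subst sum.swap) (simp add: mult.assoc)
  also have "... = (\<Sum>a\<in>D. idm b a * x a)" using col that by (intro sum.cong) auto
  also have "... = x b" using D that by (simp add: idm_def if_distrib[of "%t. t * _"] sum.delta cong: if_cong)
  finally show ?thesis .
 qed
 have eig: "(\<Sum>b\<in>D. g a b * u i b) = \<Lambda> i * u i a" if i: "i \<in> D" and a: "a \<in> D" for i a
 proof -
  have "(\<Sum>b\<in>D. g a b * u i b) = (\<Sum>j\<in>D. u j a * (\<Sum>c\<in>D. u j c * (\<Sum>b\<in>D. g c b * u i b)))"
   using expand[OF a, of "%a. \<Sum>b\<in>D. g a b * u i b"] by simp
  also have "... = (\<Sum>j\<in>D. u j a * qf D g (u j) (u i))"
   by (simp add: qf_def sum_distrib_left mult_ac)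
  also have "... = (\<Sum>j\<in>D. if j = i then u i a * \<Lambda> i else 0)"
   using off i by (intro sum.cong refl) (auto simp: \<Lambda>_def)
  also have "... = \<Lambda> i * u i a" using i D by (simp add: sum.delta)
  finally show ?thesis .
 qed
 have gdec: "g a b = (\<Sum>i\<in>D. \<Lambda> i * (u i a * u i b))" if "a \<in> D" "b \<in> D" for a b
 proof -
  have "(\<Sum>i\<in>D. u i b * (\<Sum>c\<in>D. u i c * g a c)) = g a b" by (rule expand[OF that(2)])
  moreover have "(\<Sum>c\<in>D. u i c * g a c) = \<Lambda> i * u i a" if "i \<in> D" for i
   using eig[OF that \<open>a \<in> D\<close>] by (simp add: mult.commute)
  ultimately show ?thesis by (simp add: mult_ac)
 qed
 have pow: "mpow D g j a b = (\<Sum>i\<in>D. \<Lambda> i ^ j * (u i a * u i b))" if "a \<in> D" "b \<in> D" for a b j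
  using that(1)
 proof (induction j arbitrary: a)
  case 0
  then show ?case using col[of a b] that(2) by simp
 next
  case (Suc j)
  have "mpow D g (Suc j) a b = (\<Sum>c\<in>D. g a c * (\<Sum>i\<in>D. \<Lambda> i ^ j * (u i c * u i b)))"
   using Suc by (simp add: mm_def)
  also have "... = (\<Sum>i\<in>D. \<Lambda> i ^ j * (u i b * (\<Sum>c\<in>D. g a c * u i c)))"
   unfolding sum_distrib_left by (subst sum.swap) (simp add: mult_ac)
  also have "... = (\<Sum>i\<in>D. \<Lambda> i ^ Suc j * (u i a * u i b))"
   using eig[OF _ Suc.prems] by (intro sum.cong refl) (simp add: mult_ac)
  finally show ?case .
 qed
 show thesis
 proof (rule that[of u \<Lambda>])
  fix x
  have "(\<Sum>i\<in>D. (\<Sum>a\<in>D. u i a * x a)^2) = (\<Sum>i\<in>D. \<Sum>b\<in>D. (u i b * (\<Sum>a\<in>D. u i a * x a)) * x b)"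
   by (simp add: power2_eq_square sum_distrib_right[symmetric] sum_distrib_left mult_ac)
  also have "... = (\<Sum>b\<in>D. (\<Sum>i\<in>D. u i b * (\<Sum>a\<in>D. u i a * x a)) * x b)"
   unfolding sum_distrib_right by (rule sum.swap)
  also have "... = (\<Sum>a\<in>D. (x a)^2)" by (intro sum.cong refl) (simp add: expand power2_eq_square)
  finally show "(\<Sum>i\<in>D. (\<Sum>a\<in>D. u i a * x a)^2) = (\<Sum>a\<in>D. (x a)^2)" .
  have "qf D g x x = (\<Sum>a\<in>D. \<Sum>b\<in>D. (\<Sum>i\<in>D. \<Lambda> i * (u i a * u i b)) * (x a * x b))"
   unfolding qf_def by (intro sum.cong refl) (simp add: gdec)
  also have "... = (\<Sum>a\<in>D. \<Sum>b\<in>D. \<Sum>i\<in>D. \<Lambda> i * ((u i a * x a) * (u i b * x b)))"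
   unfolding sum_distrib_right by (intro sum.cong refl) (simp add: mult_ac)
  also have "... = (\<Sum>a\<in>D. \<Sum>i\<in>D. \<Sum>b\<in>D. \<Lambda> i * ((u i a * x a) * (u i b * x b)))"
   by (intro sum.cong refl sum.swap)
  also have "... = (\<Sum>i\<in>D. \<Sum>a\<in>D. \<Sum>b\<in>D. \<Lambda> i * ((u i a * x a) * (u i b * x b)))" by (rule sum.swap)
  also have "... = (\<Sum>i\<in>D. \<Lambda> i * (\<Sum>a\<in>D. u i a * x a)^2)"
   unfolding power2_eq_square sum_product by (simp only: sum_distrib_left)
  finally show "qf D g x x = (\<Sum>i\<in>D. \<Lambda> i * (\<Sum>a\<in>D. u i a * x a)^2)" .
 next
  fix j
  have "mtr D (mpow D g j) = (\<Sum>a\<in>D. \<Sum>i\<in>D. \<Lambda> i ^ j * (u i a * u i a))"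
   unfolding mtr_def by (intro sum.cong refl pow)
  also have "... = (\<Sum>i\<in>D. \<Lambda> i ^ j * (\<Sum>a\<in>D. u i a * u i a))"
   unfolding sum_distrib_left by (rule sum.swap)
  also have "... = (\<Sum>i\<in>D. \<Lambda> i ^ j)" by (intro sum.cong refl) (simp add: row idm_def)
  finally show "mtr D (mpow D g j) = (\<Sum>i\<in>D. \<Lambda> i ^ j)" .
 next
  fix i assume "i \<in> D"
  show "qf D g (u i) (u i) = \<Lambda> i" by (simp add: \<Lambda>_def)
 qed
qed

section \<open>The spectrum of the derivative at a microstate\<close>

lemma evM_Nil [simp]: "evM I xi [] = (%_ _. 0)" by (simp add: evM_def fun_eq_iff)

lemma evM_Cons: "evM I xi ((c, u, v) # t) p q = c * kern (wm I xi u) (wm I xi v) p q + evM I xi t p q"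
 by (simp add: evM_def)

lemma evM_append: "evM I xi (s @ t) p q = evM I xi s p q + evM I xi t p q"
 by (simp add: evM_def)

lemma evM_concat: "evM I xi (concat (map f xs)) p q = (\<Sum>x\<leftarrow>xs. evM I xi (f x) p q)"
 by (induction xs) (simp_all add: evM_append)

lemma kern_mm:
 "(\<Sum>q\<in>I \<times> I. kern f g p q * kern f' g' q r) = kern (mm I f f') (mm I g' g) p r"
 by (simp add: kern_def mm_def sum_Times sum_product mult_ac)

lemma evM_tmul:
 assumes I: "finite I" and p: "p \<in> I \<times> I" and r: "r \<in> I \<times> I"
 shows "evM I xi (tmul s t) p r = mm (I \<times> I) (evM I xi s) (evM I xi t) p r"
proof (induction s)
 case Nil
 then show ?case by (simp add: tmul_def mm_def)
next
 case (Cons x s)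
 obtain c u v where x: "x = (c, u, v)" by (cases x)
 have 1: "evM I xi (map (%(d, u', v'). (c * d, u @ u', v' @ v)) t) p r
   = c * (\<Sum>q\<in>I \<times> I. kern (wm I xi u) (wm I xi v) p q * evM I xi t q r)"
 proof (induction t)
  case Nil
  then show ?case by simp
 next
  case (Cons y t)
  obtain d u' v' where y: "y = (d, u', v')" by (cases y)
  have "kern (wm I xi (u @ u')) (wm I xi (v' @ v)) p r = (\<Sum>q\<in>I \<times> I. kern (wm I xi u) (wm I xi v) p q * kern (wm I xi u') (wm I xi v') q r)"
   unfolding kern_mm using p r by (simp add: kern_def wm_append[OF I] mem_Times_iff)
  then show ?case using Cons
   by (simp add: y evM_Cons distrib_left sum.distrib) (simp add: sum_distrib_left mult_ac)
 qed
 have "evM I xi (tmul (x # s) t) p r = evM I xi (map (%(d, u', v'). (c * d, u @ u', v' @ v)) t) p r + evM I xi (tmul s t) p r"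
  by (simp add: tmul_def x evM_append)
 also have "... = mm (I \<times> I) (evM I xi (x # s)) (evM I xi t) p r"
  unfolding 1 Cons by (simp add: mm_def x evM_Cons distrib_right sum.distrib sum_distrib_left mult.assoc)
 finally show ?case .
qed

lemma evM_tadj:
 assumes I: "finite I" and p: "p \<in> I \<times> I" and r: "r \<in> I \<times> I"
 shows "evM I xi (tadj t) p r = cnj (evM I xi t r p)"
proof (induction t)
 case (Cons x t)
 obtain c u v where x: "x = (c, u, v)" by (cases x)
 have "evM I xi (tadj (x # t)) p r = cnj c * kern (wm I xi (word_star u)) (wm I xi (word_star v)) p r + evM I xi (tadj t) p r"
  by (simp add: tadj_def x evM_Cons)
 also have "... = cnj (evM I xi (x # t) r p)"
  using p r Cons by (simp add: x evM_Cons kern_def wm_star[OF I] mem_Times_iff)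
 finally show ?case .
qed (simp add: tadj_def)

definition big :: "'i set => ('n => 'i => 'i => complex) => ('r => 'c => 'n tlist) => 'r \<times> ('i \<times> 'i) => 'c \<times> ('i \<times> 'i) => complex" where
 "big I xi P = (%x y. evM I xi (P (fst x) (fst y)) (snd x) (snd y))"

lemma big_tmm:
 assumes I: "finite I" and "snd x \<in> I \<times> I" "snd y \<in> I \<times> I"
 shows "big I xi (tmm P Q) x y = mm (UNIV \<times> (I \<times> I)) (big I xi P) (big I xi Q) x y"
 using assms by (simp add: big_def tmm_def evM_concat sum_list_ulist evM_tmul mm_def sum_Times[of _ UNIV])

lemma mm_cong:
 "(!!c. c \<in> D ==> f a c = f' a c) ==> (!!c. c \<in> D ==> g c b = g' c b) ==> mm D f g a b = mm D f' g' a b"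
 unfolding mm_def by (intro sum.cong refl) simp

lemma big_tpow:
 assumes I: "finite I" and "snd x \<in> I \<times> I" "snd y \<in> I \<times> I"
 shows "big I xi (tpow P j) x y = mpow (UNIV \<times> (I \<times> I)) (big I xi P) j x y"
 using assms(2)
proof (induction j arbitrary: x)
 case 0
 have k: "kern (wm I xi []) (wm I xi []) p q = idm p q" if "q \<in> I \<times> I" for p q
  using that by (cases p; cases q) (simp add: kern_def idm_def)
 show ?case by (cases x; cases y) (use k[OF assms(3)] in \<open>auto simp: big_def evM_Cons idm_def\<close>)
next
 case (Suc j)
 have "big I xi (tpow P (Suc j)) x y = mm (UNIV \<times> (I \<times> I)) (big I xi P) (big I xi (tpow P j)) x y"
  using big_tmm[OF I Suc.prems assms(3)] by simp
 also have "... = mm (UNIV \<times> (I \<times> I)) (big I xi P) (mpow (UNIV \<times> (I \<times> I)) (big I xi P) j) x y"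
  by (rule mm_cong) (use Suc.IH in auto)
 finally show ?case by simp
qed

definition wtr :: "'i set => ('n => 'i => 'i => complex) => 'n tlist => complex" where
 "wtr I xi t = (\<Sum>(c, u, v)\<leftarrow>t. c * (mtr I (wm I xi u) * mtr I (wm I xi v)))"

lemma mtr_evM: "mtr (I \<times> I) (evM I xi t) = wtr I xi t"
proof (induction t)
 case (Cons x t)
 obtain c u v where x: "x = (c, u, v)" by (cases x)
 have "mtr (I \<times> I) (evM I xi (x # t)) = c * mtr (I \<times> I) (kern (wm I xi u) (wm I xi v)) + mtr (I \<times> I) (evM I xi t)"
  by (simp add: mtr_def x evM_Cons sum.distrib sum_distrib_left)
 moreover have "mtr (I \<times> I) (kern f g) = mtr I f * mtr I g" for f g :: "'a => 'a => complex"
  by (simp add: mtr_def kern_def sum_Times sum_product)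
 ultimately show ?case using Cons by (simp add: wtr_def x)
qed (simp add: wtr_def mtr_def)

lemma mtr_mpow_big:
 assumes "finite I"
 shows "mtr (UNIV \<times> (I \<times> I)) (mpow (UNIV \<times> (I \<times> I)) (big I xi P) j) = (\<Sum>c\<in>UNIV. wtr I xi (tpow P j c c))"
proof -
 have "mtr (UNIV \<times> (I \<times> I)) (mpow (UNIV \<times> (I \<times> I)) (big I xi P) j) = mtr (UNIV \<times> (I \<times> I)) (big I xi (tpow P j))"
  unfolding mtr_def by (intro sum.cong refl) (use big_tpow[OF assms, of _ _ xi P j] in auto)
 also have "... = (\<Sum>c\<in>UNIV. wtr I xi (tpow P j c c))"
  by (simp add: mtr_def sum_Times[of _ UNIV] mtr_evM[symmetric] big_def)
 finally show ?thesis .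
qed

text \<open>Coordinates with respect to the real basis consisting of the matrix units and their
  multiples by \<open>\<i>\<close>.\<close>

definition bas :: "('n \<times> bool) \<times> ('i \<times> 'i) => 'n => 'i => 'i => complex" where
 "bas al i a b = (if i = fst (fst al) \<and> a = fst (snd al) \<and> b = snd (snd al) then if snd (fst al) then \<i> else 1 else 0)"

definition crd :: "('n => 'i => 'i => complex) => ('n \<times> bool) \<times> ('i \<times> 'i) => real" where
 "crd v al = (let z = v (fst (fst al)) (fst (snd al)) (snd (snd al)) in if snd (fst al) then Im z else Re z)"

text \<open>The complex matrix that sends the real coordinates \<open>crd v\<close> to the entries
  of \<open>iota v\<close>. It is unitary, so conjugation by it preserves the traces of powers; it
  brings the Gram matrix of the derivative to real coordinates, where it becomes real and
  symmetric.\<close>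

definition umat :: "('n \<times> bool) \<times> ('i \<times> 'i) => ('n \<times> bool) \<times> ('i \<times> 'i) => complex" where
 "umat \<gamma> al = iota (bas al) (fst \<gamma>) (fst (snd \<gamma>)) (snd (snd \<gamma>))"

lemma crd_diff: "crd (%i a b. v i a b - w i a b) al = crd v al - crd w al"
 by (simp add: crd_def Let_def)

lemma crd_norm:
 fixes v :: "'n::finite => 'i => 'i => complex"
 shows "(\<Sum>al\<in>UNIV \<times> (I \<times> I). (crd v al)^2) = (\<Sum>i\<in>UNIV. hs2 I (v i))"
proof -
 have "(\<Sum>al\<in>UNIV \<times> (I \<times> I). (crd v al)^2) = (\<Sum>i\<in>UNIV. \<Sum>s\<in>UNIV. \<Sum>a\<in>I. \<Sum>b\<in>I. (crd v ((i, s), (a, b)))^2)"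
  unfolding sum_Times sum_UNIV_prod ..
 also have "... = (\<Sum>i\<in>UNIV. hs2 I (v i))"
  by (simp add: UNIV_bool crd_def hs2_def cmod_power2 sum.distrib add.commute)
 finally show ?thesis .
qed

lemma umat_apply:
 fixes v :: "'n::finite => 'i => 'i => complex"
 assumes I: "finite I" and ab: "a \<in> I" "b \<in> I"
 shows "(\<Sum>al\<in>UNIV \<times> (I \<times> I). umat (js, (a, b)) al * of_real (crd v al)) = iota v js a b"
proof -
 have pick: "(\<Sum>al\<in>UNIV \<times> (I \<times> I). bas al j c d * of_real (crd v al)) = v j c d"
  if cd: "c \<in> I" "d \<in> I" for j c d
 proof -
  have "(\<Sum>al\<in>UNIV \<times> (I \<times> I). bas al j c d * of_real (crd v al))
    = (\<Sum>i\<in>UNIV. \<Sum>s\<in>UNIV. \<Sum>a'\<in>I. \<Sum>b'\<in>I. bas ((i, s), (a', b')) j c d * of_real (crd v ((i, s), (a', b'))))"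
   unfolding sum_Times sum_UNIV_prod ..
  also have "... = (\<Sum>i\<in>UNIV. if i = j then (\<Sum>s\<in>UNIV. \<Sum>a'\<in>I. if a' = c then (\<Sum>b'\<in>I. if b' = d then
    (if s then \<i> else 1) * of_real (crd v ((j, s), (c, d))) else 0) else 0) else 0)"
   by (intro sum.cong refl) (auto simp: bas_def intro!: sum.cong sum.neutral)
  also have "... = v j c d" using I cd
   by (simp add: UNIV_bool crd_def complex_eq_iff)
  finally show ?thesis .
 qed
 have pick': "(\<Sum>al\<in>UNIV \<times> (I \<times> I). cnj (bas al j c d) * of_real (crd v al)) = cnj (v j c d)"
  if cd: "c \<in> I" "d \<in> I" for j c d
  using arg_cong[OF pick[OF cd], of cnj j] by simp
 have "(\<Sum>al\<in>UNIV \<times> (I \<times> I). umat (js, (a, b)) al * of_real (crd v al))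
   = ((\<Sum>al\<in>UNIV \<times> (I \<times> I). bas al (fst js) a b * of_real (crd v al))
    + (if snd js then -1 else 1) * (\<Sum>al\<in>UNIV \<times> (I \<times> I). cnj (bas al (fst js) b a) * of_real (crd v al))) / 2"
  unfolding sum_distrib_left sum.distrib[symmetric] sum_divide_distrib
  by (intro sum.cong refl) (simp add: umat_def iota_def algebra_simps)
 then show ?thesis using pick[OF ab] pick'[OF ab(2,1)] by (simp add: iota_def)
qed

lemma umat_unitary:
 fixes \<gamma> \<gamma>' :: "('n::finite \<times> bool) \<times> ('i \<times> 'i)"
 assumes I: "finite I" and \<gamma>: "\<gamma> \<in> UNIV \<times> (I \<times> I)" "\<gamma>' \<in> UNIV \<times> (I \<times> I)"
 shows "mm (UNIV \<times> (I \<times> I)) umat (mstar umat) \<gamma> \<gamma>' = idm \<gamma> \<gamma>'"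
proof -
 obtain n s a b where g: "\<gamma> = ((n, s), (a, b))" by (metis surj_pair)
 obtain n' s' a' b' where g': "\<gamma>' = ((n', s'), (a', b'))" by (metis surj_pair)
 have ab: "a \<in> I" "b \<in> I" "a' \<in> I" "b' \<in> I" using \<gamma> by (auto simp: g g')
 define E where "E x y c d = (if x = c \<and> y = d then 1 else 0 :: complex)" for x y c d :: 'i
 define e where "e = (if s then -1 else 1 :: complex)"
 define e' where "e' = (if s' then -1 else 1 :: complex)"
 define w where "w r = (if r then \<i> else 1)" for r
 have bas: "bas ((m, r), (c, d)) j x y = (if m = j then E x y c d * w r else 0)" for m r c d j x y
  by (cases "m = j"; cases "x = c"; cases "y = d") (simp_all add: bas_def E_def w_def)
 have cE: "cnj (E x y c d) = E x y c d" for x y c d by (simp add: E_def)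
 have ce: "cnj e' = e'" by (simp add: e'_def)
 have u: "umat ((n, s), (a, b)) ((m, r), (c, d))
   = (if m = n then (E a b c d * w r + e * (E b a c d * cnj (w r))) / 2 else 0)" for m r c d
  by (cases "m = n") (simp_all only: umat_def iota_def bas fst_conv snd_conv e_def[symmetric] if_True if_False complex_cnj_mult cE simp_thms
   complex_cnj_zero mult_zero_right add_0 div_0)
 have u': "cnj (umat ((n', s'), (a', b')) ((m, r), (c, d)))
   = (if m = n' then (E a' b' c d * cnj (w r) + e' * (E b' a' c d * w r)) / 2 else 0)" for m r c d
  by (cases "m = n'") (simp_all only: umat_def iota_def bas fst_conv snd_conv e'_def[symmetric] if_True if_False complex_cnj_mult cE simp_thms
   complex_cnj_zero mult_zero_right add_0 div_0 complex_cnj_divide complex_cnj_add ce complex_cnj_cnj complex_cnj_numeral)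
 have EE: "(\<Sum>c\<in>I. \<Sum>d\<in>I. E x y c d * E x' y' c d) = (if x = x' \<and> y = y' then 1 else 0)"
  if "x \<in> I" "y \<in> I" for x y x' y'
 proof -
  have "(\<Sum>c\<in>I. \<Sum>d\<in>I. E x y c d * E x' y' c d) = (\<Sum>c\<in>I. if c = x then (\<Sum>d\<in>I. if d = y then E x' y' x y else 0) else 0)"
   by (intro sum.cong refl) (auto simp: E_def intro!: sum.cong sum.neutral)
  also have "... = (if x = x' \<and> y = y' then 1 else 0)" using I that by (auto simp: E_def)
  finally show ?thesis .
 qed
 have "mm (UNIV \<times> (I \<times> I)) umat (mstar umat) \<gamma> \<gamma>'
   = (\<Sum>m\<in>UNIV. \<Sum>r\<in>UNIV. \<Sum>c\<in>I. \<Sum>d\<in>I. umat ((n, s), (a, b)) ((m, r), (c, d)) * cnj (umat ((n', s'), (a', b')) ((m, r), (c, d))))"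
  unfolding mm_def mstar_def g g' sum_Times sum_UNIV_prod ..
 also have "... = (\<Sum>m\<in>UNIV. if m = n then (if n = n' then (\<Sum>r\<in>UNIV. \<Sum>c\<in>I. \<Sum>d\<in>I.
   (E a b c d * w r + e * (E b a c d * cnj (w r))) / 2
   * ((E a' b' c d * cnj (w r) + e' * (E b' a' c d * w r)) / 2)) else 0) else 0)"
  unfolding u u' by (intro sum.cong refl) simp
 also have "... = (if n = n' then (\<Sum>r\<in>UNIV. \<Sum>c\<in>I. \<Sum>d\<in>I.
   (E a b c d * w r + e * (E b a c d * cnj (w r))) / 2
   * ((E a' b' c d * cnj (w r) + e' * (E b' a' c d * w r)) / 2)) else 0)"
  by simp
 also have "... = (if n = n' then (\<Sum>c\<in>I. \<Sum>d\<in>I. (E a b c d * E a' b' c d + (e * e') * (E b a c d * E b' a' c d)) / 2) else 0)"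
 proof -
  \<comment> \<open>In the sum over the two factors 1 and \<open>\<i>\<close> the cross terms
    cancel, because the squares of these factors add up to 0.\<close>
  have key: "(X * w True + e * (Y * cnj (w True))) / 2 * ((X' * cnj (w True) + e' * (Y' * w True)) / 2)
    + (X * w False + e * (Y * cnj (w False))) / 2 * ((X' * cnj (w False) + e' * (Y' * w False)) / 2)
   = (X * X' + (e * e') * (Y * Y')) / 2" for X Y X' Y'
   by (simp add: w_def field_simps)
  have b: "(\<Sum>r\<in>UNIV. h r) = h True + h False" for h :: "bool => complex" by (simp add: UNIV_bool)
  show ?thesis by (simp only: b sum.distrib[symmetric] key)
 qed
 also have "... = (if n = n' then ((\<Sum>c\<in>I. \<Sum>d\<in>I. E a b c d * E a' b' c d) + (e * e') * (\<Sum>c\<in>I. \<Sum>d\<in>I. E b a c d * E b' a' c d)) / 2 else 0)"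
  by (simp only: sum_divide_distrib sum.distrib sum_distrib_left add_divide_distrib)
 also have "... = idm \<gamma> \<gamma>'"
  unfolding EE[OF ab(1,2)] EE[OF ab(2,1)] by (auto simp: idm_def g g' e_def e'_def)
 finally show ?thesis .
qed

text \<open>On indices in \<open>D\<close> the hypotheses give \<open>U G = H U\<close>, which moves
  \<open>U\<close> past every power; cyclicity of the trace then brings \<open>U\<close> next to its
  adjoint.\<close>

lemma mtr_mpow_conj:
 fixes U :: "'d => 'd => complex"
 assumes D: "finite D" and U: "!!a b. a \<in> D ==> b \<in> D ==> mm D U (mstar U) a b = idm a b"
  and G: "!!a b. a \<in> D ==> b \<in> D ==> G a b = mm D (mstar U) (mm D H U) a b"
 shows "mtr D (mpow D G j) = mtr D (mpow D H j)"
proof -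
 have UG: "mm D U (mm D G X) a b = mm D H (mm D U X) a b" if "a \<in> D" for X :: "'d => 'd => complex" and a b
 proof -
  have "mm D U (mm D G X) a b = mm D (mm D U G) X a b" by (simp only: mm_assoc)
  also have "... = mm D (mm D H U) X a b"
  proof (rule mm_cong[OF _ refl])
   fix c assume c: "c \<in> D"
   have "mm D U G a c = mm D U (mm D (mstar U) (mm D H U)) a c" by (rule mm_cong[OF refl]) (rule G[OF _ c])
   also have "... = mm D (mm D U (mstar U)) (mm D H U) a c" by (simp only: mm_assoc)
   also have "... = mm D idm (mm D H U) a c" by (rule mm_cong[OF _ refl]) (rule U[OF that])
   also have "... = mm D H U a c" by (rule mm_idm_left[OF D that])
   finally show "mm D U G a c = mm D H U a c" .
  qed
  finally show ?thesis by (simp only: mm_assoc)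
 qed
 have pow: "mm D U (mpow D G j) a b = mm D (mpow D H j) U a b" if "a \<in> D" "b \<in> D" for a b j
  using that
 proof (induction j arbitrary: a)
  case 0
  then show ?case using D by (simp add: mm_idm_left mm_idm_right)
 next
  case (Suc j)
  have "mm D U (mpow D G (Suc j)) a b = mm D H (mm D U (mpow D G j)) a b" using UG[OF Suc.prems(1)] by simp
  also have "... = mm D H (mm D (mpow D H j) U) a b" by (rule mm_cong[OF refl]) (rule Suc.IH[OF _ Suc.prems(2)])
  finally show ?case by (simp add: mm_assoc)
 qed
 show ?thesis
 proof (cases j)
  case 0 then show ?thesis by simp
 next
  case (Suc i)
  have "mpow D G (Suc i) a a = mm D (mstar U) (mm D (mm D H (mpow D H i)) U) a a" if a: "a \<in> D" for a
  proof -
   have "mpow D G (Suc i) a a = mm D (mm D (mstar U) (mm D H U)) (mpow D G i) a a"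
    unfolding mpow_simps by (rule mm_cong[OF _ refl]) (rule G[OF a])
   also have "... = mm D (mm D (mstar U) H) (mm D U (mpow D G i)) a a" by (simp only: mm_assoc)
   also have "... = mm D (mm D (mstar U) H) (mm D (mpow D H i) U) a a" by (rule mm_cong[OF refl]) (rule pow[OF _ a])
   finally show ?thesis by (simp only: mm_assoc)
  qed
  then have "mtr D (mpow D G j) = mtr D (mm D (mstar U) (mm D (mpow D H j) U))" unfolding mtr_def Suc by simp
  also have "... = mtr D (mm D (mpow D H j) (mm D U (mstar U)))" by (simp only: mtr_comm[of D D "mstar U"] mm_assoc)
  also have "... = mtr D (mpow D H j)"
   unfolding mtr_def
  proof (rule sum.cong[OF refl])
   fix a assume a: "a \<in> D"
   have "mm D (mpow D H j) (mm D U (mstar U)) a a = mm D (mpow D H j) idm a a" by (rule mm_cong[OF refl]) (rule U[OF _ a])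
   then show "mm D (mpow D H j) (mm D U (mstar U)) a a = mpow D H j a a" using mm_idm_right[OF D a] by metis
  qed
  finally show ?thesis .
 qed
qed


lemma mpow_of_real:
 assumes "!!a b. a \<in> D ==> b \<in> D ==> G a b = complex_of_real (g a b)" "a \<in> D" "b \<in> D"
 shows "mpow D G j a b = complex_of_real (mpow D g j a b)"
 using assms(2)
proof (induction j arbitrary: a)
 case 0
 then show ?case by (simp add: idm_def)
next
 case (Suc j)
 then show ?case using assms(1,3) by (simp add: mm_def)
qed

text \<open>\<open>L\<close> gives the coordinates in an eigenbasis of the Gram matrix
  \<open>G\<close> of the differential at \<open>xi\<close>, and \<open>N\<close> collects the
  eigenvalues that are at most \<open>s\<close>. Each of these contributes at least
  \<open>(1 - s / R) ^ (2 * m)\<close> to the trace of the same power of \<open>1 - G / R\<close>,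
  and that trace is a combination of moments of words. Off \<open>N\<close> the form of
  \<open>G\<close> is at least \<open>s\<close> times the squared norm, which is the last
  inequality.\<close>

lemma derivative_coordinates:
 fixes F :: "'p::finite => 'n::finite star_poly" and xi :: "'n => 'i => 'i => complex"
 assumes I: "finite I" and R: "0 < R" and s: "0 <= s" "s < R"
 obtains N :: "(('n \<times> bool) \<times> ('i \<times> 'i)) set" and L where "finite N"
  "real (card N) * (1 - s / R) ^ (2 * m)
   <= (\<Sum>j\<le>2 * m. bc (1 / R) (2 * m) j * Re (\<Sum>c\<in>UNIV. wtr I xi (tpow (glist F) j c c)))"
  "!!al v w. L al (%i a b. v i a b - w i a b) = L al v - L al w"
  "!!v. (\<Sum>al\<in>N. (L al v)^2) <= (\<Sum>i\<in>UNIV. hs2 I (v i))"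
  "!!v. s * ((\<Sum>i\<in>UNIV. hs2 I (v i)) - (\<Sum>al\<in>N. (L al v)^2))
   <= (\<Sum>ir\<in>UNIV. hs2 I (dpm I xi v (poly_part (snd ir) (F (fst ir)))))"
proof -
 define D where "D = (UNIV :: ('n \<times> bool) set) \<times> (I \<times> I)"
 define W where "W = (UNIV :: ('p \<times> bool) set) \<times> (I \<times> I)"
 have D: "finite D" using I by (simp add: D_def)
 define Tm where "Tm = big I xi (dlist F)"
 define H where "H = big I xi (glist F)"
 define P where "P = mm D Tm (umat :: ('n \<times> bool) \<times> ('i \<times> 'i) => _)"
 define G where "G = mm W (mstar P) P"
 have H: "H al \<beta> = mm W (mstar Tm) Tm al \<beta>" if "al \<in> D" "\<beta> \<in> D" for al \<beta>
 proof -
  have "H al \<beta> = mm W (big I xi (%js ir. tadj (dlist F ir js))) Tm al \<beta>"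
   unfolding H_def glist_def W_def Tm_def by (rule big_tmm[OF I]) (use that in \<open>auto simp: D_def\<close>)
  also have "... = mm W (mstar Tm) Tm al \<beta>"
   by (rule mm_cong[OF _ refl]) (use that in \<open>auto simp: W_def D_def Tm_def big_def mstar_def evM_tadj[OF I]\<close>)
  finally show ?thesis .
 qed
 have G: "G al \<beta> = mm D (mstar umat) (mm D H umat) al \<beta>" if "al \<in> D" "\<beta> \<in> D" for al \<beta>
 proof -
  have "G al \<beta> = mm D (mstar umat) (mm D (mm W (mstar Tm) Tm) umat) al \<beta>"
   by (simp only: G_def P_def mstar_mm mm_assoc)
  also have "... = mm D (mstar umat) (mm D H umat) al \<beta>"
   by (intro mm_cong[OF refl] mm_cong[OF _ refl]) (simp add: H)
  finally show ?thesis .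
 qed
 have trace: "mtr D (mpow D G j) = (\<Sum>c\<in>UNIV. wtr I xi (tpow (glist F) j c c))" for j
 proof -
  have "mtr D (mpow D G j) = mtr D (mpow D H j)"
  proof (rule mtr_mpow_conj[OF D])
   show "mm D umat (mstar umat) al \<beta> = idm al \<beta>" if "al \<in> D" "\<beta> \<in> D" for al \<beta> :: "('n \<times> bool) \<times> ('i \<times> 'i)"
    unfolding D_def by (rule umat_unitary[OF I]) (use that in \<open>simp_all add: D_def\<close>)
  qed (rule G)
  also have "... = (\<Sum>c\<in>UNIV. wtr I xi (tpow (glist F) j c c))" unfolding D_def H_def by (rule mtr_mpow_big[OF I])
  finally show ?thesis .
 qed
 have Tiota: "(\<Sum>\<gamma>\<in>D. Tm (ir, (a, b)) \<gamma> * iota v (fst \<gamma>) (fst (snd \<gamma>)) (snd (snd \<gamma>))) = dpm I xi v (poly_part (snd ir) (F (fst ir))) a b"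
  if "a \<in> I" for ir a b v
  using derivative_kernel[OF I that, of xi F ir b v] by (simp add: D_def sum_Times[of _ UNIV] Tm_def big_def)
 have Pd: "P (ir, (a, b)) al = dpm I xi (bas al) (poly_part (snd ir) (F (fst ir))) a b" if "a \<in> I" for ir a b al
  using Tiota[OF that, of ir b "bas al"] by (simp add: P_def mm_def umat_def)
 have Px: "(\<Sum>al\<in>D. P (ir, (a, b)) al * of_real (crd v al)) = dpm I xi v (poly_part (snd ir) (F (fst ir))) a b"
  if a: "a \<in> I" for ir a b v
 proof -
  have "(\<Sum>al\<in>D. P (ir, (a, b)) al * of_real (crd v al)) = (\<Sum>\<gamma>\<in>D. Tm (ir, (a, b)) \<gamma> * (\<Sum>al\<in>D. umat \<gamma> al * of_real (crd v al)))"
   unfolding P_def mm_def sum_distrib_left sum_distrib_right by (subst sum.swap) (simp add: mult.assoc)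
  also have "... = (\<Sum>\<gamma>\<in>D. Tm (ir, (a, b)) \<gamma> * iota v (fst \<gamma>) (fst (snd \<gamma>)) (snd (snd \<gamma>)))"
  proof (intro sum.cong refl arg_cong2[of _ _ _ _ "(*)"])
   fix \<gamma> assume "\<gamma> \<in> D"
   then obtain js c d where "\<gamma> = (js, (c, d))" "c \<in> I" "d \<in> I" by (auto simp: D_def)
   then show "(\<Sum>al\<in>D. umat \<gamma> al * of_real (crd v al)) = iota v (fst \<gamma>) (fst (snd \<gamma>)) (snd (snd \<gamma>))"
    using umat_apply[OF I, of c d js v] by (simp add: D_def)
  qed
  finally show ?thesis unfolding Tiota[OF a] .
 qed
 \<comment> \<open>The parts of \<open>F\<close> are self-adjoint or skew-adjoint, hence so are the
   values of their differentials. Conjugation of \<open>P\<close> therefore exchanges the two matrix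
   indices up to a sign, and the sign cancels in the product.\<close>
 have Gre: "G al \<beta> = of_real (Re (G al \<beta>))" for al \<beta>
 proof -
  define e where "e ir = (if snd ir then -1 else 1 :: complex)" for ir :: "'p \<times> bool"
  have e: "e ir * e ir = 1" "cnj (e ir) = e ir" for ir by (simp_all add: e_def)
  have herm: "cnj (P (ir, (a, b)) al) = e ir * P (ir, (b, a)) al" if ab: "a \<in> I" "b \<in> I" for ir a b al
   unfolding Pd[OF ab(1)] Pd[OF ab(2)] dpm_part(1)[OF I ab] dpm_part(1)[OF I ab(2,1)]
   by (simp add: e_def field_simps)
  have G': "G al \<beta> = (\<Sum>ir\<in>UNIV. \<Sum>a\<in>I. \<Sum>b\<in>I. cnj (P (ir, (a, b)) al) * P (ir, (a, b)) \<beta>)"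
   unfolding G_def mm_def mstar_def W_def sum_Times[of _ UNIV] sum_Times[of _ I] ..
  have "cnj (G al \<beta>) = (\<Sum>ir\<in>UNIV. \<Sum>a\<in>I. \<Sum>b\<in>I. cnj (cnj (P (ir, (a, b)) al)) * cnj (P (ir, (a, b)) \<beta>))"
   unfolding G' by simp
  also have "... = (\<Sum>ir\<in>UNIV. \<Sum>a\<in>I. \<Sum>b\<in>I. cnj (P (ir, (b, a)) al) * P (ir, (b, a)) \<beta>)"
  proof (intro sum.cong refl)
   fix ir a b assume ab: "a \<in> I" "b \<in> I"
   have "cnj (cnj (P (ir, (a, b)) al)) * cnj (P (ir, (a, b)) \<beta>) = (e ir * e ir) * (cnj (P (ir, (b, a)) al) * P (ir, (b, a)) \<beta>)"
    unfolding herm[OF ab] complex_cnj_mult e(2) by (simp only: mult_ac)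
   then show "cnj (cnj (P (ir, (a, b)) al)) * cnj (P (ir, (a, b)) \<beta>) = cnj (P (ir, (b, a)) al) * P (ir, (b, a)) \<beta>"
    by (simp only: e(1) mult_1)
  qed
  also have "... = G al \<beta>" unfolding G' by (rule sum.cong[OF refl], rule sum.swap)
  finally have "Im (G al \<beta>) = 0" by (simp add: complex_eq_iff)
  then show ?thesis by (simp add: complex_eq_iff)
 qed
 define g where "g al \<beta> = Re (G al \<beta>)" for al \<beta>
 have Gg: "G al \<beta> = of_real (g al \<beta>)" for al \<beta> unfolding g_def by (rule Gre)
 have gsym: "g al \<beta> = g \<beta> al" for al \<beta>
 proof -
  have "cnj (G \<beta> al) = G al \<beta>" by (simp add: G_def mm_def mstar_def mult.commute)
  then show ?thesis unfolding g_def by (metis complex_cnj(1) cnj.simps(1))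
 qed
 have qfg: "qf D g x x = (\<Sum>\<rho>\<in>W. (cmod (\<Sum>al\<in>D. P \<rho> al * of_real (x al)))^2)" for x
 proof -
  have "complex_of_real (qf D g x x) = (\<Sum>a\<in>D. \<Sum>b\<in>D. G a b * (of_real (x a) * of_real (x b)))"
   by (simp add: qf_def Gg)
  also have "... = (\<Sum>a\<in>D. \<Sum>b\<in>D. \<Sum>\<rho>\<in>W. cnj (P \<rho> a * of_real (x a)) * (P \<rho> b * of_real (x b)))"
   unfolding G_def mm_def mstar_def sum_distrib_right by (intro sum.cong refl) (simp add: mult_ac)
  also have "... = (\<Sum>a\<in>D. \<Sum>\<rho>\<in>W. \<Sum>b\<in>D. cnj (P \<rho> a * of_real (x a)) * (P \<rho> b * of_real (x b)))"
   by (intro sum.cong refl sum.swap)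
  also have "... = (\<Sum>\<rho>\<in>W. \<Sum>a\<in>D. \<Sum>b\<in>D. cnj (P \<rho> a * of_real (x a)) * (P \<rho> b * of_real (x b)))"
   by (rule sum.swap)
  also have "... = (\<Sum>\<rho>\<in>W. cnj (\<Sum>al\<in>D. P \<rho> al * of_real (x al)) * (\<Sum>al\<in>D. P \<rho> al * of_real (x al)))"
   unfolding cnj_sum sum_product ..
  also have "... = complex_of_real (\<Sum>\<rho>\<in>W. (cmod (\<Sum>al\<in>D. P \<rho> al * of_real (x al)))^2)"
   unfolding of_real_sum complex_norm_square by (simp add: mult.commute)
  finally show ?thesis unfolding of_real_eq_iff .
 qed
 show thesis
 proof (rule spectral_decomposition[of D g, OF D gsym])
 fix u \<Lambda> assume u: "!!x. (\<Sum>i\<in>D. (\<Sum>a\<in>D. u i a * x a)^2) = (\<Sum>a\<in>D. (x a)^2)"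
  "!!x. qf D g x x = (\<Sum>i\<in>D. \<Lambda> i * (\<Sum>a\<in>D. u i a * x a)^2)"
  "!!j. mtr D (mpow D g j) = (\<Sum>i\<in>D. \<Lambda> i ^ j)"
  "!!i. i \<in> D ==> qf D g (u i) (u i) = \<Lambda> i"
 have \<Lambda>: "\<Lambda> i >= 0" if "i \<in> D" for i
 proof -
  have "0 <= qf D g (u i) (u i)" unfolding qfg by (intro sum_nonneg) simp
  then show ?thesis by (simp only: u(4)[OF that])
 qed
 define N where "N = {i \<in> D. \<Lambda> i <= s}"
 define L where "L al v = (\<Sum>a\<in>D. u al a * crd v a)" for al and v :: "'n => 'i => 'i => complex"
 have ND: "N \<subseteq> D" by (auto simp: N_def)
 have Ltot: "(\<Sum>al\<in>D. (L al v)^2) = (\<Sum>i\<in>UNIV. hs2 I (v i))" for v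
  unfolding L_def u(1) unfolding D_def by (rule crd_norm)
 have Lsplit: "(\<Sum>al\<in>D. f al) = (\<Sum>al\<in>N. f al) + (\<Sum>al\<in>D - N. f al)" for f :: "_ => real"
  using sum.subset_diff[OF ND D, of f] by simp
 show thesis
 proof (rule that[of N L])
  show "finite N" using ND D by (rule finite_subset)
  have "real (card N) * (1 - s / R) ^ (2 * m) = (\<Sum>i\<in>N. (1 - s / R) ^ (2 * m))" by simp
  also have "... <= (\<Sum>i\<in>N. (1 - 1 / R * \<Lambda> i) ^ (2 * m))"
  proof (rule sum_mono, rule power_mono)
   fix i assume i: "i \<in> N"
   then show "1 - s / R <= 1 - 1 / R * \<Lambda> i" using R by (simp add: N_def divide_right_mono)
   show "0 <= 1 - s / R" using R s by simp
  qed
  \<comment> \<open>Eigenvalues may exceed \<open>R\<close>; the even exponent keeps the added terms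
    nonnegative.\<close>
  also have "... <= (\<Sum>i\<in>D. (1 - 1 / R * \<Lambda> i) ^ (2 * m))" by (rule sum_mono2[OF D ND]) simp
  also have "... = (\<Sum>i\<in>D. \<Sum>j\<le>2 * m. bc (1 / R) (2 * m) j * \<Lambda> i ^ j)" by (simp only: bc_power)
  also have "... = (\<Sum>j\<le>2 * m. bc (1 / R) (2 * m) j * (\<Sum>i\<in>D. \<Lambda> i ^ j))"
   unfolding sum_distrib_left by (rule sum.swap)
  also have "... = (\<Sum>j\<le>2 * m. bc (1 / R) (2 * m) j * Re (\<Sum>c\<in>UNIV. wtr I xi (tpow (glist F) j c c)))"
  proof (intro sum.cong refl arg_cong2[of _ _ _ _ "(*)"])
   fix j
   have "mtr D (mpow D G j) = of_real (mtr D (mpow D g j))"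
    unfolding mtr_def of_real_sum by (intro sum.cong refl mpow_of_real Gg)
   then show "(\<Sum>i\<in>D. \<Lambda> i ^ j) = Re (\<Sum>c\<in>UNIV. wtr I xi (tpow (glist F) j c c))"
    unfolding trace[symmetric] u(3)[symmetric] by simp
  qed
  finally show "real (card N) * (1 - s / R) ^ (2 * m)
   <= (\<Sum>j\<le>2 * m. bc (1 / R) (2 * m) j * Re (\<Sum>c\<in>UNIV. wtr I xi (tpow (glist F) j c c)))" .
  show "L al (%i a b. v i a b - w i a b) = L al v - L al w" for al v w
   by (simp add: L_def crd_diff algebra_simps sum_subtractf)
  show "(\<Sum>al\<in>N. (L al v)^2) <= (\<Sum>i\<in>UNIV. hs2 I (v i))" for v
   unfolding Ltot[symmetric] by (rule sum_mono2[OF D ND]) simp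
  show "s * ((\<Sum>i\<in>UNIV. hs2 I (v i)) - (\<Sum>al\<in>N. (L al v)^2))
   <= (\<Sum>ir\<in>UNIV. hs2 I (dpm I xi v (poly_part (snd ir) (F (fst ir)))))" for v
  proof -
   have "s * ((\<Sum>i\<in>UNIV. hs2 I (v i)) - (\<Sum>al\<in>N. (L al v)^2)) = (\<Sum>al\<in>D - N. s * (L al v)^2)"
    unfolding Ltot[symmetric] Lsplit by (simp add: sum_distrib_left)
   also have "... <= (\<Sum>al\<in>D - N. \<Lambda> al * (L al v)^2)"
    by (intro sum_mono mult_right_mono) (auto simp: N_def)
   also have "... <= (\<Sum>al\<in>D. \<Lambda> al * (L al v)^2)"
    by (rule sum_mono2[OF D]) (auto intro!: mult_nonneg_nonneg \<Lambda>)
   also have "... = qf D g (crd v) (crd v)" unfolding u(2) L_def ..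
   also have "... = (\<Sum>ir\<in>UNIV. hs2 I (dpm I xi v (poly_part (snd ir) (F (fst ir)))))"
    unfolding qfg W_def sum_Times[of _ UNIV] sum_Times[of _ I] hs2_def by (intro sum.cong refl) (simp add: Px)
   finally show ?thesis .
  qed
 qed
qed
qed

section \<open>Covering a level set of a polynomial map\<close>

lemma mm_diff_right: "mm I f (%a b. g a b - h a b) = (%a b. mm I f g a b - mm I f h a b)" for f :: "_ => _ => complex"
 by (simp add: mm_def algebra_simps sum_subtractf)

lemma mm_diff_left: "mm I (%a b. g a b - h a b) f = (%a b. mm I g f a b - mm I h f a b)" for f :: "_ => _ => complex"
 by (simp add: mm_def algebra_simps sum_subtractf)

lemma dw_diff: "dw I xi (%i a b. v i a b - w i a b) u = (%a b. dw I xi v u a b - dw I xi w u a b)"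
proof (induction u)
 case (Cons l u)
 have l: "ltr (%i a b. v i a b - w i a b) l = (%a b. ltr v l a b - ltr w l a b)"
  by (auto simp: ltr_def mstar_def)
 show ?case by (simp add: Cons l mm_diff_left mm_diff_right fun_eq_iff)
qed simp

lemma dpm_diff: "dpm I xi (%i a b. v i a b - w i a b) g = (%a b. dpm I xi v g a b - dpm I xi w g a b)"
 by (simp add: dpm_def lin_def dw_diff algebra_simps sum_subtractf)

lemma hs2_diff_le: "hs2 I (%a b. f a b - g a b) <= 2 * hs2 I f + 2 * hs2 I g"
proof -
 have "(cmod (x - y))^2 <= 2 * (cmod x)^2 + 2 * (cmod y)^2" for x y
 proof -
  have "(cmod (x - y))^2 <= (cmod x + cmod y)^2" by (intro power_mono norm_triangle_ineq4) auto
  also have "... <= 2 * (cmod x)^2 + 2 * (cmod y)^2"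
   using zero_le_power2[of "cmod x - cmod y"] by (simp add: power2_eq_square algebra_simps)
  finally show ?thesis .
 qed
 then have "hs2 I (%a b. f a b - g a b) <= (\<Sum>a\<in>I. \<Sum>b\<in>I. 2 * (cmod (f a b))^2 + 2 * (cmod (g a b))^2)"
  unfolding hs2_def by (intro sum_mono)
 then show ?thesis by (simp add: hs2_def sum.distrib sum_distrib_left)
qed

lemma hs2_cong: "(!!a b. a \<in> I ==> b \<in> I ==> f a b = g a b) ==> hs2 I f = hs2 I g"
 unfolding hs2_def by (intro sum.cong refl) simp

text \<open>A part is half the sum or half the difference of a polynomial and its adjoint, and both
  have the same 2-norm.\<close>

lemma part_hs2:
 assumes I: "finite I"
 shows "sqrt (hs2 I (%a b. pm I xi' (poly_part r g) a b - pm I xi (poly_part r g) a b))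
  <= sqrt (hs2 I (%a b. pm I xi' g a b - pm I xi g a b))"
proof -
 define d where "d = (%a b. pm I xi' g a b - pm I xi g a b)"
 define e where "e = (if r then -1 else 1 :: complex)"
 have "hs2 I (%a b. pm I xi' (poly_part r g) a b - pm I xi (poly_part r g) a b) = hs2 I (%a b. (1/2) * d a b + (e/2) * mstar d a b)"
  by (rule hs2_cong) (simp add: dpm_part(2)[OF I] d_def e_def mstar_def field_simps)
 also have "sqrt ... <= sqrt (hs2 I (%a b. (1/2) * d a b)) + sqrt (hs2 I (%a b. (e/2) * mstar d a b))"
  by (rule hs2_triangle[OF I])
 also have "... = sqrt (hs2 I d)"
  unfolding hs2_scale hs2_mstar by (simp add: e_def real_sqrt_mult norm_divide)
 finally show ?thesis by (simp add: d_def)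
qed

text \<open>Up to the Taylor remainder, the differential at \<open>xi\<close> applied to
  \<open>xi' - xi\<close> is the difference of the values of the parts of \<open>F\<close>. If those
  values nearly agree, the increment is almost tangent to the level set. The remainder is quadratic
  in \<open>\<delta>\<close> because the increment is bounded in operator norm.\<close>

lemma derivative_bound:
 fixes F :: "'p::finite => 'n star_poly"
 shows "\<exists>J. \<forall>K\<ge>1. \<exists>C\<ge>1. \<forall>(I :: 'i set) xi xi' \<delta> ep. finite I --> \<delta> >= 0 --> ep >= 0 -->
  (\<forall>i. lbd I J (xi i) K) --> (\<forall>i. lbd I J (xi' i) K) --> (\<forall>i. opb I (%a b. xi' i a b - xi i a b) \<delta>) -->
  (\<Sum>i\<in>UNIV. hs2 I (%a b. pm I xi' (F i) a b - pm I xi (F i) a b)) <= real (card I) * ep^2 -->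
  (\<Sum>ir\<in>UNIV. hs2 I (dpm I xi (%i a b. xi' i a b - xi i a b) (poly_part (snd ir) (F (fst ir))))) <= real (card I) * (C * (ep + \<delta>^2))^2"
proof -
 define G where "G ir = poly_part (snd ir) (F (fst ir))" for ir
 define Prop where "Prop J K C g \<longleftrightarrow> (\<forall>(I :: 'i set) xi xi' v \<delta>. finite I --> \<delta> >= 0 --> (\<forall>i. lbd I J (xi i) K) --> (\<forall>i. lbd I J (xi' i) K)
  --> (\<forall>i. lbd I J (v i) \<delta>) --> (\<forall>i a b. xi' i a b = xi i a b + v i a b) -->
  sqrt (hs2 I (%a b. pm I xi' g a b - pm I xi g a b - dpm I xi v g a b)) <= C * \<delta>^2 * sqrt (real (card I)))" for J K C and g :: "'n star_poly"
 have "\<forall>ir. \<exists>J. \<forall>K\<ge>1. \<exists>C\<ge>0. Prop J K C (G ir)" unfolding Prop_def by (intro allI polynomial_remainder)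
 then obtain J' where J': "!!ir K. K >= 1 ==> \<exists>C\<ge>0. Prop (J' ir) K C (G ir)" unfolding choice_iff by blast
 define J where "J = Max (range J')"
 have JJ: "J' ir <= J" for ir unfolding J_def by (rule Max_ge) auto
 have main: "\<exists>C\<ge>1. \<forall>(I :: 'i set) xi xi' \<delta> ep. finite I --> \<delta> >= 0 --> ep >= 0 -->
  (\<forall>i. lbd I J (xi i) K) --> (\<forall>i. lbd I J (xi' i) K) --> (\<forall>i. opb I (%a b. xi' i a b - xi i a b) \<delta>) -->
  (\<Sum>i\<in>UNIV. hs2 I (%a b. pm I xi' (F i) a b - pm I xi (F i) a b)) <= real (card I) * ep^2 -->
  (\<Sum>ir\<in>UNIV. hs2 I (dpm I xi (%i a b. xi' i a b - xi i a b) (G ir))) <= real (card I) * (C * (ep + \<delta>^2))^2"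
  if K: "K >= 1" for K
 proof -
  obtain C' where C': "!!ir. C' ir >= 0" "!!ir. Prop (J' ir) K (C' ir) (G ir)" using J'[OF K] by metis
  define C where "C = (\<Sum>ir\<in>UNIV. 1 + C' ir)"
  have C1: "C >= 1"
  proof -
   have "1 + C' ir <= C" for ir unfolding C_def by (rule member_le_sum) (auto simp: C' add_nonneg_nonneg)
   from this[of undefined] show ?thesis using C'(1)[of undefined] by linarith
  qed
  have "(\<Sum>ir\<in>UNIV. hs2 I (dpm I xi (%i a b. xi' i a b - xi i a b) (G ir))) <= real (card I) * (C * (ep + \<delta>^2))^2"
   if I: "finite I" and \<delta>: "\<delta> >= 0" and ep: "ep >= 0" and xi: "\<forall>i. lbd I J (xi i) K" and xi': "\<forall>i. lbd I J (xi' i) K"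
    and v: "\<forall>i. opb I (%a b. xi' i a b - xi i a b) \<delta>"
    and le: "(\<Sum>i\<in>UNIV. hs2 I (%a b. pm I xi' (F i) a b - pm I xi (F i) a b)) <= real (card I) * ep^2"
   for I :: "'i set" and xi xi' :: "'n => 'i => 'i => complex" and \<delta> ep
  proof -
   let ?k = "sqrt (real (card I))" let ?v = "%i a b. xi' i a b - xi i a b"
   have each: "sqrt (hs2 I (dpm I xi ?v (G ir))) <= ?k * (ep + \<delta>^2) * (1 + C' ir)" for ir
   proof -
    define d where "d = (%a b. pm I xi' (G ir) a b - pm I xi (G ir) a b)"
    have "sqrt (hs2 I (%a b. d a b - dpm I xi ?v (G ir) a b)) <= C' ir * \<delta>^2 * ?k"
    proof -
     have "sqrt (hs2 I (%a b. pm I xi' (G ir) a b - pm I xi (G ir) a b - dpm I xi ?v (G ir) a b)) <= C' ir * \<delta>^2 * ?k"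
     proof (rule C'(2)[unfolded Prop_def, rule_format, OF I \<delta>])
      show "lbd I (J' ir) (xi i) K" "lbd I (J' ir) (xi' i) K" for i
       using lbd_mono[OF spec[OF xi] _ order_refl JJ] lbd_mono[OF spec[OF xi'] _ order_refl JJ] K by auto
      show "lbd I (J' ir) (?v i) \<delta>" for i by (rule opb_lbd[OF I spec[OF v]])
     qed simp
     then show ?thesis by (simp add: d_def)
    qed
    moreover have "sqrt (hs2 I d) <= ?k * ep"
    proof -
     have "sqrt (hs2 I d) <= sqrt (hs2 I (%a b. pm I xi' (F (fst ir)) a b - pm I xi (F (fst ir)) a b))"
      unfolding d_def G_def by (rule part_hs2[OF I])
     also have "hs2 I (%a b. pm I xi' (F (fst ir)) a b - pm I xi (F (fst ir)) a b) <= real (card I) * ep^2"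
      using member_le_sum[of "fst ir" UNIV "%i. hs2 I (%a b. pm I xi' (F i) a b - pm I xi (F i) a b)"] le
      by (simp add: hs2_nonneg)
     then have "sqrt (hs2 I (%a b. pm I xi' (F (fst ir)) a b - pm I xi (F (fst ir)) a b)) <= ?k * ep"
      using ep real_sqrt_le_mono by (fastforce simp: real_sqrt_mult)
     finally show ?thesis .
    qed
    moreover have "sqrt (hs2 I (dpm I xi ?v (G ir))) <= sqrt (hs2 I d) + sqrt (hs2 I (%a b. d a b - dpm I xi ?v (G ir) a b))"
    proof -
     have "sqrt (hs2 I (%a b. d a b + (-1) * (d a b - dpm I xi ?v (G ir) a b)))
       <= sqrt (hs2 I d) + sqrt (hs2 I (%a b. (-1) * (d a b - dpm I xi ?v (G ir) a b)))"
      by (rule hs2_triangle[OF I])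
     then show ?thesis unfolding hs2_scale by simp
    qed
    ultimately have "sqrt (hs2 I (dpm I xi ?v (G ir))) <= ?k * ep + C' ir * \<delta>^2 * ?k" by linarith
    also have "... <= ?k * (ep + \<delta>^2) * (1 + C' ir)"
    proof -
     have "0 <= ?k * ep * C' ir + ?k * \<delta>^2" using C'(1) ep by simp
     then show ?thesis by (simp add: algebra_simps)
    qed
    finally show ?thesis .
   qed
   have "(\<Sum>ir\<in>UNIV. hs2 I (dpm I xi ?v (G ir))) = (L2_set (%ir. sqrt (hs2 I (dpm I xi ?v (G ir)))) UNIV)^2"
    by (simp add: L2_set_def hs2_nonneg sum_nonneg)
   also have "... <= (\<Sum>ir\<in>UNIV. sqrt (hs2 I (dpm I xi ?v (G ir))))^2"
    by (intro power_mono L2_set_le_sum L2_set_nonneg) (simp add: hs2_nonneg)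
   also have "... <= (\<Sum>ir\<in>UNIV. ?k * (ep + \<delta>^2) * (1 + C' ir))^2"
    by (intro power_mono sum_mono each sum_nonneg) (simp add: hs2_nonneg)
   also have "... = (?k * (ep + \<delta>^2) * C)^2" unfolding C_def sum_distrib_left ..
   also have "... = real (card I) * (C * (ep + \<delta>^2))^2" by (simp add: power_mult_distrib mult_ac)
   finally show ?thesis .
  qed
  then show ?thesis using C1 by (intro exI[of _ C] conjI) auto
 qed
 show ?thesis unfolding G_def[symmetric] by (intro exI[of _ J] allI impI) (rule main)
qed

text \<open>What the refinement has to know of a piece: Schatten bounds for the Taylor remainder,
  the moment sum that counts small eigenvalues at each point, and \<open>F\<close> constant up to
  \<open>ep\<close> in normalized 2-norm. All three pass to subsets.\<close>

definition tame :: "'i set => nat => real => nat => real => ('p::finite => 'n::finite star_poly) => real => real =>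
  ('n => 'i => 'i => complex) set => bool" where
 "tame I J K m R F \<nu> ep S \<longleftrightarrow> (\<forall>xi\<in>S. (\<forall>i. lbd I J (xi i) K) \<and>
   (\<Sum>j\<le>2 * m. bc (1 / R) (2 * m) j * Re (\<Sum>c\<in>UNIV. wtr I xi (tpow (glist F) j c c))) <= (real (card I))^2 * \<nu> \<and>
   (\<forall>xi'\<in>S. (\<Sum>i\<in>UNIV. hs2 I (%a b. pm I xi' (F i) a b - pm I xi (F i) a b)) <= real (card I) * ep^2))"

lemma tame_subset: "tame I J K m R F \<nu> ep S ==> S' \<subseteq> S ==> tame I J K m R F \<nu> ep S'"
 unfolding tame_def by (meson subsetD)

definition opd :: "'i set => real => ('n => 'i => 'i => complex) => ('n => 'i => 'i => complex) => bool" where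
 "opd I \<delta> x y \<longleftrightarrow> (\<forall>i. opb I (%a b. x i a b - y i a b) \<delta>)"

text \<open>Colouring by the coordinates of small eigenvalue makes these differ little within a
  piece, and the remaining coordinates of \<open>x - y\<close> are small because its derivative is.
  Together they bound the 2-norm by the scale \<open>r * \<delta>\<close>. A rounding with ratio 1
  then restores the bound in operator norm, at the cost of the term with 1260.\<close>

lemma refine_step:
 fixes F :: "'p::finite => 'n::finite star_poly" and S :: "('n => 'i => 'i => complex) set"
 assumes I: "finite I" "I \<noteq> {}" and S: "tame I J K m R F \<nu> ep S" and op: "!!x y. x \<in> S ==> y \<in> S ==> opd I \<delta> x y"
  and bound: "!!xi xi'. xi \<in> S ==> xi' \<in> S ==>
   (\<Sum>ir\<in>UNIV. hs2 I (dpm I xi (%i a b. xi' i a b - xi i a b) (poly_part (snd ir) (F (fst ir))))) <= real (card I) * (C * (ep + \<delta>^2))^2"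
  and C: "C > 0" and r: "0 < r" "r <= 1" and s: "0 < s" "s < R" and \<delta>: "0 < \<delta>" "\<delta> <= a" and ep: "0 <= ep" "ep <= a * \<delta>"
  and small: "32 * (C * a)^2 <= r^2 * s" and \<beta>: "0 < \<beta>" "\<beta> <= (1 - s / R) ^ (2 * m)"
 shows "cov (opd I (r * \<delta>)) S (exp ((real (card I))^2 * (\<nu> / \<beta> * ln (24 * sqrt (2 * CARD('n)) / r) + 2 * CARD('n) * ln 1260)))"
proof (cases "S = {}")
 case True
 then show ?thesis unfolding cov_def by (intro exI[of _ "{}"]) auto
next
 case False
 then obtain xi0 where xi0: "xi0 \<in> S" by blast
 define k where "k = real (card I)"
 have k: "k > 0" using I by (simp add: k_def card_gt_0_iff)
 define n where "n = real CARD('n)"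
 have n: "n >= 1" unfolding n_def using zero_less_card_finite[where 'a = 'n] by linarith
 define G where "G ir = poly_part (snd ir) (F (fst ir))" for ir
 show ?thesis
 proof (rule derivative_coordinates[OF I(1) _ _ s(2), of m xi0 F])
  show "0 < R" "0 <= s" using s by auto
  fix N :: "(('n \<times> bool) \<times> ('i \<times> 'i)) set" and L :: "('n \<times> bool) \<times> ('i \<times> 'i) => ('n => 'i => 'i => complex) => real"
  assume N: "finite N"
   and cN: "real (card N) * (1 - s / R) ^ (2 * m) <= (\<Sum>j\<le>2 * m. bc (1 / R) (2 * m) j * Re (\<Sum>c\<in>UNIV. wtr I xi0 (tpow (glist F) j c c)))"
   and Ldiff: "!!al v w. L al (%i a b. v i a b - w i a b) = L al v - L al w"
   and Lle: "!!v. (\<Sum>al\<in>N. (L al v)^2) <= (\<Sum>i\<in>UNIV. hs2 I (v i))"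
   and Lge: "!!v. s * ((\<Sum>i\<in>UNIV. hs2 I (v i)) - (\<Sum>al\<in>N. (L al v)^2)) <= (\<Sum>ir\<in>UNIV. hs2 I (dpm I xi0 v (poly_part (snd ir) (F (fst ir)))))"
  have cardN: "real (card N) <= k^2 * (\<nu> / \<beta>)"
  proof -
   have "real (card N) * \<beta> <= real (card N) * (1 - s / R) ^ (2 * m)" by (intro mult_left_mono \<beta>) simp
   also have "... <= k^2 * \<nu>" using cN S xi0 unfolding tame_def k_def by (meson order_trans)
   finally show ?thesis using \<beta>(1) by (simp add: pos_le_divide_eq)
  qed
  \<comment> \<open>Chosen so that the coordinates in \<open>N\<close> contribute half of
    \<open>k * (r * \<delta>)^2\<close>. The other half is left to the large eigenvalues, for which
    \<open>small\<close> provides.\<close>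
  define th where "th = r / sqrt (2 * n)"
  have th: "0 < th" "th <= 1"
  proof -
   have "r <= sqrt (2 * n)" proof -
    have "1 <= sqrt (2 * n)" using n by (simp add: real_sqrt_ge_1_iff)
    then show ?thesis using r(2) by linarith
   qed
   then show "0 < th" "th <= 1" using r n by (auto simp: th_def divide_le_eq_1)
  qed
  define P where "P x y \<longleftrightarrow> (\<Sum>al\<in>N. (L al x - L al y)^2) <= (th * (sqrt (n * k) * \<delta>))^2" for x y
  have c1: "cov P S ((24 / th) ^ card N)"
   unfolding P_def
  proof (rule real_cover[OF N _ th, where f = "%x al. L al x"])
   show "0 < sqrt (n * k) * \<delta>" using n k \<delta> by simp
   fix x y assume xy: "x \<in> S" "y \<in> S"
   have "(\<Sum>al\<in>N. (L al x - L al y)^2) <= (\<Sum>i\<in>UNIV. hs2 I (%a b. x i a b - y i a b))"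
    using Lle[of "%i a b. x i a b - y i a b"] by (simp only: Ldiff)
   also have "... <= (\<Sum>i\<in>(UNIV :: 'n set). k * \<delta>^2)"
    unfolding k_def by (intro sum_mono opb_hs2[OF I(1)]) (use op[OF xy] in \<open>simp add: opd_def\<close>)
   also have "... = (sqrt (n * k) * \<delta>)^2" using n k by (simp add: n_def power_mult_distrib)
   finally show "(\<Sum>al\<in>N. (L al x - L al y)^2) <= (sqrt (n * k) * \<delta>)^2" .
  qed
  have c2: "cov (opd I (r * \<delta>)) S' ((1260 / 1) ^ (2 * CARD('n) * (card I)^2))"
   if S': "S' \<subseteq> S" and P: "!!x y. x \<in> S' ==> y \<in> S' ==> P x y" for S'
  proof -
   have "cov (%x y. \<forall>i. opb I (%a b. x i a b - y i a b) (1 * (r * \<delta>))) S' ((1260 / 1) ^ (2 * CARD('n) * (card I)^2))"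
   proof (rule op_cover[OF I])
    show "0 < r * \<delta>" using r \<delta> by simp
    fix x y assume xy: "x \<in> S'" "y \<in> S'"
    \<comment> \<open>The coordinates belong to the derivative at \<open>xi0\<close>, so
      \<open>x - y\<close> is written as the difference of two increments that start at
      \<open>xi0\<close>.\<close>
    define w where "w i a b = x i a b - y i a b" for i a b
    have "w = (%i a b. (x i a b - xi0 i a b) - (y i a b - xi0 i a b))" by (simp add: w_def fun_eq_iff)
    then have dw: "dpm I xi0 w g = (%a b. dpm I xi0 (%i a b. x i a b - xi0 i a b) g a b - dpm I xi0 (%i a b. y i a b - xi0 i a b) g a b)" for g
     by (simp only: dpm_diff[of I xi0 "%i a b. x i a b - xi0 i a b" "%i a b. y i a b - xi0 i a b"])
    have "(\<Sum>ir\<in>UNIV. hs2 I (dpm I xi0 w (G ir))) <= (\<Sum>ir\<in>UNIV. 2 * hs2 I (dpm I xi0 (%i a b. x i a b - xi0 i a b) (G ir))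
      + 2 * hs2 I (dpm I xi0 (%i a b. y i a b - xi0 i a b) (G ir)))"
     unfolding dw by (intro sum_mono hs2_diff_le)
    also have "... = 2 * (\<Sum>ir\<in>UNIV. hs2 I (dpm I xi0 (%i a b. x i a b - xi0 i a b) (G ir)))
      + 2 * (\<Sum>ir\<in>UNIV. hs2 I (dpm I xi0 (%i a b. y i a b - xi0 i a b) (G ir)))"
     by (simp add: sum.distrib sum_distrib_left)
    also have "... <= 4 * (k * (C * (ep + \<delta>^2))^2)"
     using bound[OF xi0, of x] bound[OF xi0, of y] xy S' unfolding G_def k_def by (simp add: subset_iff)
    also have "... <= 4 * (k * (2 * (C * a) * \<delta>)^2)"
    proof -
     have "\<delta>^2 <= a * \<delta>" using \<delta> by (simp add: power2_eq_square)
     then have "ep + \<delta>^2 <= 2 * a * \<delta>" using ep by simp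
     then have "C * (ep + \<delta>^2) <= C * (2 * a * \<delta>)" using C by (intro mult_left_mono) auto
     then have "(C * (ep + \<delta>^2))^2 <= (2 * (C * a) * \<delta>)^2"
      using C ep by (intro power_mono) (simp_all add: mult_ac)
     then show ?thesis using k by simp
    qed
    also have "... = k * \<delta>^2 * (16 * (C * a)^2)" by (simp add: power_mult_distrib)
    also have "... <= k * \<delta>^2 * (r^2 * s / 2)" using small k by (intro mult_left_mono) auto
    finally have "(\<Sum>ir\<in>UNIV. hs2 I (dpm I xi0 w (G ir))) <= s * (k * \<delta>^2 * (r^2 / 2))" by (simp add: mult_ac)
    then have "s * ((\<Sum>i\<in>UNIV. hs2 I (w i)) - (\<Sum>al\<in>N. (L al w)^2)) <= s * (k * \<delta>^2 * (r^2 / 2))"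
     using Lge[of w] unfolding G_def by linarith
    then have 1: "(\<Sum>i\<in>UNIV. hs2 I (w i)) - (\<Sum>al\<in>N. (L al w)^2) <= k * \<delta>^2 * (r^2 / 2)" using s(1) by simp
    have "L al w = L al x - L al y" for al unfolding w_def[abs_def] by (rule Ldiff)
    then have "(\<Sum>al\<in>N. (L al w)^2) <= (th * (sqrt (n * k) * \<delta>))^2" using P[OF xy] unfolding P_def by simp
    also have "... = k * \<delta>^2 * (r^2 / 2)" using n k by (simp add: th_def power_mult_distrib power_divide)
    finally have 2: "(\<Sum>al\<in>N. (L al w)^2) <= k * \<delta>^2 * (r^2 / 2)" .
    have "k * \<delta>^2 * (r^2 / 2) * 2 = k * (r * \<delta>)^2" by (simp add: power_mult_distrib)
    then have "(\<Sum>i\<in>UNIV. hs2 I (w i)) <= k * (r * \<delta>)^2" using 1 2 by linarith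
    then show "(\<Sum>i\<in>UNIV. hs2 I (%a b. x i a b - y i a b)) <= real (card I) * (r * \<delta>)^2"
     unfolding w_def[abs_def] k_def .
   qed auto
   then show ?thesis by (simp add: opd_def[abs_def])
  qed
  have "cov (opd I (r * \<delta>)) S ((24 / th) ^ card N * (1260 / 1) ^ (2 * CARD('n) * (card I)^2))"
   by (rule cov_trans[OF c1 _ c2]) auto
  then show "cov (opd I (r * \<delta>)) S (exp ((real (card I))^2 * (\<nu> / \<beta> * ln (24 * sqrt (2 * CARD('n)) / r) + 2 * CARD('n) * ln 1260)))"
  proof (rule cov_mono)
   have t: "24 / th = 24 * sqrt (2 * n) / r" using r n by (simp add: th_def)
   have ge: "24 / th >= 1" using th by (simp add: pos_le_divide_eq)
   have "(24 / th) ^ card N = exp (real (card N) * ln (24 / th))"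
   proof -
    have "exp (ln (24 / th)) = 24 / th" using ge by (intro exp_ln) linarith
    then show ?thesis by (simp only: exp_of_nat_mult)
   qed
   also have "... <= exp (k^2 * (\<nu> / \<beta>) * ln (24 / th))"
    unfolding exp_le_cancel_iff by (rule mult_right_mono[OF cardN]) (use ge in simp)
   finally have 1: "(24 / th) ^ card N <= exp (k^2 * (\<nu> / \<beta>) * ln (24 / th))" .
   have 2: "(1260 / 1 :: real) ^ (2 * CARD('n) * (card I)^2) = exp (k^2 * (2 * CARD('n) * ln 1260))"
   proof -
    have "exp (real (2 * CARD('n) * (card I)^2) * ln (1260 :: real)) = exp (ln 1260) ^ (2 * CARD('n) * (card I)^2)"
     by (rule exp_of_nat_mult)
    then show ?thesis by (simp add: k_def mult_ac)
   qed
   have "(24 / th) ^ card N * (1260 / 1) ^ (2 * CARD('n) * (card I)^2)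
     <= exp (k^2 * (\<nu> / \<beta>) * ln (24 / th)) * exp (k^2 * (2 * CARD('n) * ln 1260))"
    unfolding 2 by (intro mult_right_mono 1) simp
   also have "... = exp (k^2 * (\<nu> / \<beta> * ln (24 / th) + 2 * CARD('n) * ln 1260))"
    by (simp add: exp_add[symmetric] distrib_left mult.assoc)
   finally show "(24 / th) ^ card N * (1260 / 1) ^ (2 * CARD('n) * (card I)^2)
    <= exp ((real (card I))^2 * (\<nu> / \<beta> * ln (24 * sqrt (2 * CARD('n)) / r) + 2 * CARD('n) * ln 1260))"
    unfolding t k_def n_def by (simp only: of_nat_mult of_nat_numeral)
  qed
 qed
qed


lemma iterate_cover:
 assumes "cov (opd I \<delta>) S E0" "0 <= E"
  and step: "!!j S'. j < t ==> S' \<subseteq> S ==> (!!x y. x \<in> S' ==> y \<in> S' ==> opd I (r ^ j * \<delta>) x y) ==> cov (opd I (r * (r ^ j * \<delta>))) S' E"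
 shows "cov (opd I (r ^ t * \<delta>)) S (E0 * E ^ t)"
 using step
proof (induction t)
 case 0
 then show ?case using assms(1) by simp
next
 case (Suc t)
 have "cov (opd I (r ^ t * \<delta>)) S (E0 * E ^ t)" by (rule Suc.IH) (rule Suc.prems, auto)
 from cov_trans[OF this assms(2) Suc.prems[of t]] show ?case by (simp add: mult_ac)
qed

lemma power_as_exp: "0 < x ==> x ^ m = exp (real m * ln x)" for x :: real
 by (simp add: exp_of_nat_mult)

text \<open>The moment sum in \<open>tame\<close> bounds the number of small eigenvalues, hence is not negative.\<close>

lemma tame_empty:
 fixes S :: "('n::finite => 'i => 'i => complex) set"
 assumes I: "finite I" "I \<noteq> {}" and S: "tame I J K m R F \<nu> ep S" and \<nu>: "\<nu> < 0" and R: "R > 0"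
 shows "S = {}"
proof (rule ccontr)
 assume "S \<noteq> {}"
 then obtain xi where xi: "xi \<in> S" by blast
 have "0 <= (\<Sum>j\<le>2 * m. bc (1 / R) (2 * m) j * Re (\<Sum>c\<in>UNIV. wtr I xi (tpow (glist F) j c c)))"
 proof (rule derivative_coordinates[OF I(1) R order_refl R, of m xi F])
  fix N :: "(('n \<times> bool) \<times> ('i \<times> 'i)) set"
  assume "real (card N) * (1 - 0 / R) ^ (2 * m)
    <= (\<Sum>j\<le>2 * m. bc (1 / R) (2 * m) j * Re (\<Sum>c\<in>UNIV. wtr I xi (tpow (glist F) j c c)))"
  then show ?thesis by (rule order_trans[rotated]) simp
 qed
 also have "... <= (real (card I))^2 * \<nu>" using S xi unfolding tame_def by blast
 also have "... < 0" using I \<nu> by (simp add: mult_pos_neg card_gt_0_iff)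
 finally show False by simp
qed

text \<open>From scale \<open>a\<close> down to scale \<open>ep\<close> in steps of ratio \<open>r\<close>: each step costs the dimension
  \<open>\<nu>\<close> times \<open>log (1/r)\<close> plus a constant, and \<open>r\<close> is chosen so small that the constant is
  negligible against \<open>log (1/r)\<close>.\<close>

lemma entropy_bound:
 fixes F :: "'p::finite => 'n::finite star_poly"
 shows "\<exists>J. \<forall>K\<ge>1. \<forall>R>0. \<forall>m. \<forall>\<nu>. \<forall>\<kappa>>0. \<exists>B. \<forall>ep (I :: 'i set) S. 0 < ep --> ep < 1 --> finite I --> I \<noteq> {} -->
  tame I J K m R F \<nu> ep S -->
  cov (%x y. (\<Sum>i\<in>UNIV. hs2 I (%a b. x i a b - y i a b)) <= real (card I) * (ep / 4)^2) S
   (exp ((real (card I))^2 * (B + (\<nu> + \<kappa>) * \<bar>ln ep\<bar>)))"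
proof -
 obtain J where J: "!!K. K >= 1 ==> \<exists>C\<ge>1. \<forall>(I :: 'i set) xi xi' \<delta> ep. finite I --> \<delta> >= 0 --> ep >= 0 -->
  (\<forall>i. lbd I J (xi i) K) --> (\<forall>i. lbd I J (xi' i) K) --> (\<forall>i. opb I (%a b. xi' i a b - xi i a b) \<delta>) -->
  (\<Sum>i\<in>UNIV. hs2 I (%a b. pm I xi' (F i) a b - pm I xi (F i) a b)) <= real (card I) * ep^2 -->
  (\<Sum>ir\<in>UNIV. hs2 I (dpm I xi (%i a b. xi' i a b - xi i a b) (poly_part (snd ir) (F (fst ir))))) <= real (card I) * (C * (ep + \<delta>^2))^2"
  using derivative_bound[of F] by blast
 have "\<exists>B. \<forall>ep (I :: 'i set) S. 0 < ep --> ep < 1 --> finite I --> I \<noteq> {} -->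
  tame I J K m R F \<nu> ep S -->
  cov (%x y. (\<Sum>i\<in>UNIV. hs2 I (%a b. x i a b - y i a b)) <= real (card I) * (ep / 4)^2) S
   (exp ((real (card I))^2 * (B + (\<nu> + \<kappa>) * \<bar>ln ep\<bar>)))"
  if K: "K >= 1" and R: "R > 0" and \<kappa>: "\<kappa> > 0" for K R m \<nu> \<kappa>
 proof (cases "\<nu> < 0")
  case True
  have "S = {}" if "finite I" "I \<noteq> {}" "tame I J K m R F \<nu> ep S" for ep and I :: "'i set" and S
   by (rule tame_empty[OF that True R])
  then show ?thesis by (intro exI[of _ 0] allI impI) (simp add: cov_def exI[of _ "{}"])
 next
  case False
  then have \<nu>: "\<nu> >= 0" by simp
  obtain C where C: "C >= 1" and bound: "!!(I :: 'i set) xi xi' \<delta> ep. finite I ==> \<delta> >= 0 ==> ep >= 0 ==>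
   (\<forall>i. lbd I J (xi i) K) ==> (\<forall>i. lbd I J (xi' i) K) ==> (\<forall>i. opb I (%a b. xi' i a b - xi i a b) \<delta>) ==>
   (\<Sum>i\<in>UNIV. hs2 I (%a b. pm I xi' (F i) a b - pm I xi (F i) a b)) <= real (card I) * ep^2 ==>
   (\<Sum>ir\<in>UNIV. hs2 I (dpm I xi (%i a b. xi' i a b - xi i a b) (poly_part (snd ir) (F (fst ir))))) <= real (card I) * (C * (ep + \<delta>^2))^2"
   using J[OF K] by blast
  define n where "n = real CARD('n)"
  have n: "n >= 1" unfolding n_def using zero_less_card_finite[where 'a = 'n] by linarith
  define A where "A = \<nu> + \<kappa> / 3"
  have A: "A > 0" "\<nu> < A" using \<nu> \<kappa> by (simp_all add: A_def)
  \<comment> \<open>By Bernoulli's inequality this \<open>s\<close> gives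
    \<open>\<beta> >= \<nu> / A\<close>, so that the dimension \<open>\<nu> / \<beta>\<close> paid
    in each step is at most \<open>A\<close>. The minimum keeps \<open>s\<close> below
    \<open>R\<close>.\<close>
  define s where "s = R * min (1 / 2) ((1 - \<nu> / A) / (2 * real m + 1))"
  define \<beta> where "\<beta> = (1 - s / R) ^ (2 * m)"
  have q: "0 < 1 - \<nu> / A" using A by simp
  have s: "0 < s" "s < R"
   using R q by (auto simp: s_def min_def)
  have \<beta>: "\<beta> > 0" using s R by (simp add: \<beta>_def)
  have "\<nu> / A <= \<beta>"
  proof -
   have "s / R <= (1 - \<nu> / A) / (2 * real m + 1)" using R by (simp add: s_def)
   then have "(2 * real m + 1) * (s / R) <= 1 - \<nu> / A" by (simp add: pos_le_divide_eq mult.commute)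
   moreover have "0 <= s / R" using s R by simp
   ultimately have "\<nu> / A <= 1 - 2 * real m * (s / R)" unfolding distrib_right by linarith
   also have "... <= \<beta>" using Bernoulli_inequality[of "- (s / R)" "2 * m"] s R by (simp add: \<beta>_def)
   finally show ?thesis .
  qed
  then have \<nu>\<beta>: "\<nu> / \<beta> <= A" using A \<beta> by (simp add: field_simps)
  define c0 where "c0 = ln (24 * sqrt (2 * n))"
  define c1 where "c1 = 2 * n * ln 1260"
  have "sqrt (2 * n) >= 1" using n by simp
  then have "24 * sqrt (2 * n) >= 1" by linarith
  then have c0: "c0 >= 0" unfolding c0_def by (rule ln_ge_zero)
  have c1: "c1 >= 0" using n by (simp add: c1_def)
  \<comment> \<open>\<open>L\<close> is the logarithm of the inverse ratio \<open>1 / r\<close>, so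
    large that a third of \<open>\<kappa>\<close> times \<open>L\<close> absorbs the constant
    \<open>A * c0 + c1\<close> of each step.\<close>
  define L where "L = 3 * (A * c0 + c1) / \<kappa> + 1"
  have L: "L >= 1" using A c0 c1 \<kappa> by (simp add: L_def)
  define r where "r = exp (- L)"
  have r: "0 < r" "r < 1" using L by (simp_all add: r_def)
  define Bs where "Bs = A * (c0 + L) + c1"
  have Bs0: "Bs >= 0" using A c0 c1 L by (simp add: Bs_def)
  have BsL: "Bs <= (\<nu> + \<kappa>) * L"
  proof -
   have "\<kappa> / 3 * L = A * c0 + c1 + \<kappa> / 3" using \<kappa> by (simp add: L_def field_simps)
   then have "A * c0 + c1 <= \<kappa> / 3 * L" using \<kappa> by simp
   then have "Bs <= A * L + \<kappa> / 3 * L" by (simp add: Bs_def algebra_simps)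
   also have "... = (\<nu> + 2 * \<kappa> / 3) * L" by (simp add: A_def algebra_simps)
   also have "... <= (\<nu> + \<kappa>) * L" using \<kappa> L by (intro mult_right_mono) auto
   finally show ?thesis .
  qed
  \<comment> \<open>Below the scale \<open>a\<close> the quadratic error is dominated, as
    \<open>refine_step\<close> requires; the divisor 6 yields 36, which exceeds the 32 in its
    hypothesis.\<close>
  define a where "a = min 1 (r * sqrt s / (6 * C))"
  have a: "0 < a" "a <= 1" using r s C by (auto simp: a_def)
  have small: "32 * (C * a)^2 <= r^2 * s"
  proof -
   have "a <= r * sqrt s / (6 * C)" by (simp add: a_def)
   then have "C * a <= r * sqrt s / 6" using C by (simp add: field_simps)
   then have "(C * a)^2 <= (r * sqrt s / 6)^2" using C a by (intro power_mono) auto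
   also have "... = r^2 * s / 36" using s by (simp add: power_mult_distrib power_divide)
   finally have "(C * a)^2 <= r^2 * s / 36" .
   moreover have "0 <= r^2 * s" using s by simp
   ultimately show ?thesis by linarith
  qed
  define x1 where "x1 = 1260 / (a / (2 * sqrt n * K))"
  define x2 where "x2 = 1260 / (a / (4 * n))"
  have x: "x1 > 0" "x2 > 0" using a n K by (simp_all add: x1_def x2_def)
  define B where "B = 2 * n * ln x1 + 2 * n * ln x2 + Bs"
  have "cov (%x y. (\<Sum>i\<in>UNIV. hs2 I (%a b. x i a b - y i a b)) <= real (card I) * (ep / 4)^2) S
   (exp ((real (card I))^2 * (B + (\<nu> + \<kappa>) * \<bar>ln ep\<bar>)))"
   if ep: "0 < ep" "ep < 1" and I: "finite I" "I \<noteq> {}" and S: "tame I J K m R F \<nu> ep S" for ep and I :: "'i set" and S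
  proof -
   define k where "k = real (card I)"
   have k: "k > 0" using I by (simp add: k_def card_gt_0_iff)
   define E where "E = exp (k^2 * Bs)"
   have lbdS: "lbd I J (xi i) K" if "xi \<in> S" for xi i using S that unfolding tame_def by blast
   \<comment> \<open>The lowest Schatten level bounds the diameter of \<open>S\<close> in 2-norm by
     a constant, from which a single rounding reaches the scale \<open>a\<close> in operator
     norm.\<close>
   have start: "cov (opd I a) S (x1 ^ (2 * CARD('n) * (card I)^2))"
   proof -
    have sn: "sqrt n >= 1" using n by simp
    have "cov (%x y. \<forall>i. opb I (%b c. x i b c - y i b c) (a / (2 * sqrt n * K) * (2 * sqrt n * K))) S
     ((1260 / (a / (2 * sqrt n * K))) ^ (2 * CARD('n) * (card I)^2))"
    proof (rule op_cover[OF I])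
     show "0 < 2 * sqrt n * K" "0 < a / (2 * sqrt n * K)" using n K a by auto
     have "1 * 1 <= sqrt n * K" using sn K by (intro mult_mono) auto
     then show "a / (2 * sqrt n * K) <= 1" using a sn K by (simp add: divide_le_eq_1)
     fix x y assume xy: "x \<in> S" "y \<in> S"
     have h: "hs2 I (z i) <= k * K^2" if "z \<in> S" for z i
     proof -
      have "nrm I 0 (z i) <= real (card I) * K ^ 2 ^ Suc 0" using lbdS[OF that, of i] unfolding lbd_def by blast
      then show ?thesis by (simp add: nrm_0 k_def)
     qed
     have "(\<Sum>i\<in>UNIV. hs2 I (%a b. x i a b - y i a b)) <= (\<Sum>i\<in>(UNIV :: 'n set). 4 * (k * K^2))"
     proof (rule sum_mono)
      fix i
      have "hs2 I (%a b. x i a b - y i a b) <= 2 * hs2 I (x i) + 2 * hs2 I (y i)" by (rule hs2_diff_le)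
      then show "hs2 I (%a b. x i a b - y i a b) <= 4 * (k * K^2)" using h[OF xy(1), of i] h[OF xy(2), of i] by linarith
     qed
     also have "... = k * (2 * sqrt n * K)^2" using n by (simp add: n_def power_mult_distrib)
     finally show "(\<Sum>i\<in>UNIV. hs2 I (%a b. x i a b - y i a b)) <= real (card I) * (2 * sqrt n * K)^2"
      unfolding k_def .
    qed
    moreover have "a / (2 * sqrt n * K) * (2 * sqrt n * K) = a" using sn K by simp
    ultimately show ?thesis unfolding opd_def[abs_def] x1_def by simp
   qed
   have ex: "\<exists>t. a * (r ^ t * a) < ep"
   proof -
    have "(%t. a * (r ^ t * a)) \<longlonglongrightarrow> a * (0 * a)" by (intro tendsto_intros LIMSEQ_power_zero) (use r in auto)
    then have "\<forall>\<^sub>F t in sequentially. a * (r ^ t * a) < ep" by (rule order_tendstoD) (use ep in simp)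
    then show ?thesis by (rule eventually_happens'[OF sequentially_bot])
   qed
   \<comment> \<open>A step from the scale \<open>\<delta>\<close> requires
     \<open>ep <= a * \<delta>\<close>; \<open>t\<close> is the first number of steps after which
     this fails.\<close>
   define t where "t = (LEAST t. a * (r ^ t * a) < ep)"
   have t: "a * (r ^ t * a) < ep" unfolding t_def by (rule LeastI_ex[OF ex])
   have below: "ep <= a * (r ^ j * a)" if "j < t" for j using not_less_Least[OF that[unfolded t_def]] by simp
   \<comment> \<open>After \<open>t - 1\<close> steps the scale is still at least \<open>ep\<close>,
     so \<open>t - 1\<close> times \<open>L\<close> is at most \<open>\<bar>ln ep\<bar>\<close>. The
     one remaining step is the extra \<open>Bs\<close>.\<close>
   have tB: "real t * Bs <= Bs + (\<nu> + \<kappa>) * \<bar>ln ep\<bar>"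
   proof (cases t)
    case 0
    then show ?thesis using Bs0 \<nu> \<kappa> by simp
   next
    case (Suc j)
    have "ep <= a * (r ^ j * a)" by (rule below) (simp add: Suc)
    also have "... <= 1 * (r ^ j * 1)" using a r by (intro mult_mono) auto
    finally have "ep <= exp (- (real j * L))" by (simp add: r_def exp_of_nat_mult[symmetric])
    then have "ln ep <= - (real j * L)" using ep ln_mono[of ep "exp (- (real j * L))"] by simp
    then have "real j * L <= \<bar>ln ep\<bar>" by linarith
    have "real j * Bs <= real j * ((\<nu> + \<kappa>) * L)" by (intro mult_left_mono BsL) simp
    also have "... = (\<nu> + \<kappa>) * (real j * L)" by simp
    also have "... <= (\<nu> + \<kappa>) * \<bar>ln ep\<bar>" using \<nu> \<kappa> \<open>real j * L <= \<bar>ln ep\<bar>\<close> by (intro mult_left_mono) auto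
    finally show ?thesis by (simp add: Suc distrib_right)
   qed
   have iter: "cov (opd I (r ^ t * a)) S (x1 ^ (2 * CARD('n) * (card I)^2) * E ^ t)"
   proof (rule iterate_cover[OF start])
    show "0 <= E" by (simp add: E_def)
    fix j S' assume j: "j < t" and S': "S' \<subseteq> S" and op: "!!x y. x \<in> S' ==> y \<in> S' ==> opd I (r ^ j * a) x y"
    have tS': "tame I J K m R F \<nu> ep S'" by (rule tame_subset[OF S S'])
    have \<delta>: "0 < r ^ j * a" "r ^ j * a <= a" using r a by (simp_all add: power_le_one mult_left_le_one_le)
    have "cov (opd I (r * (r ^ j * a))) S' (exp ((real (card I))^2 * (\<nu> / \<beta> * ln (24 * sqrt (2 * CARD('n)) / r) + 2 * CARD('n) * ln 1260)))"
    proof (rule refine_step[OF I tS' op _ _ r(1) _ s \<delta> _ below[OF j] small \<beta>])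
     fix xi xi' assume xi: "xi \<in> S'" "xi' \<in> S'"
     show "(\<Sum>ir\<in>UNIV. hs2 I (dpm I xi (%i a b. xi' i a b - xi i a b) (poly_part (snd ir) (F (fst ir)))))
      <= real (card I) * (C * (ep + (r ^ j * a)^2))^2"
      by (rule bound) (use I ep \<delta> op[OF xi(2,1)] tS' xi in \<open>auto simp: tame_def opd_def\<close>)
    qed (use C r ep in \<open>auto simp: \<beta>_def\<close>)
    then show "cov (opd I (r * (r ^ j * a))) S' E"
    proof (rule cov_mono)
     have "ln (24 * sqrt (2 * n) / r) = c0 + L"
      using n r by (simp add: ln_div c0_def r_def)
     moreover have "\<nu> / \<beta> * (c0 + L) <= A * (c0 + L)" by (rule mult_right_mono[OF \<nu>\<beta>]) (use c0 L in simp)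
     ultimately have "\<nu> / \<beta> * ln (24 * sqrt (2 * n) / r) + 2 * n * ln 1260 <= Bs"
      by (simp only: Bs_def c1_def add_right_mono)
     then show "exp ((real (card I))^2 * (\<nu> / \<beta> * ln (24 * sqrt (2 * CARD('n)) / r) + 2 * CARD('n) * ln 1260)) <= E"
      unfolding E_def k_def n_def by (simp add: mult_left_mono)
    qed
   qed
   \<comment> \<open>The scale reached is below \<open>ep / a\<close>, a constant multiple of
     \<open>ep\<close>, so one rounding of fixed ratio arrives at \<open>ep / 4\<close>.\<close>
   have last: "cov (%x y. (\<Sum>i\<in>UNIV. hs2 I (%a b. x i a b - y i a b)) <= real (card I) * (ep / 4)^2) S'
     (x2 ^ (2 * CARD('n) * (card I)^2))"
    if op: "!!x y. x \<in> S' ==> y \<in> S' ==> opd I (r ^ t * a) x y" for S' :: "('n => 'i => 'i => complex) set"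
   proof -
    have "cov (%x y. \<forall>i. opb I (%b c. x i b c - y i b c) (a / (4 * n) * (sqrt n * ep / a))) S'
      ((1260 / (a / (4 * n))) ^ (2 * CARD('n) * (card I)^2))"
    proof (rule op_cover[OF I])
     show "0 < sqrt n * ep / a" "0 < a / (4 * n)" "a / (4 * n) <= 1" using n a ep by (auto simp: divide_le_eq_1)
     fix x y assume xy: "x \<in> S'" "y \<in> S'"
     have "(\<Sum>i\<in>UNIV. hs2 I (%a b. x i a b - y i a b)) <= (\<Sum>i\<in>(UNIV :: 'n set). k * (r ^ t * a)^2)"
      unfolding k_def by (intro sum_mono opb_hs2[OF I(1)]) (use op[OF xy] in \<open>simp add: opd_def\<close>)
     also have "... <= (\<Sum>i\<in>(UNIV :: 'n set). k * (ep / a)^2)"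
     proof (intro sum_mono mult_left_mono power_mono)
      show "r ^ t * a <= ep / a" using t a by (simp add: pos_le_divide_eq mult_ac)
     qed (use k r a in auto)
     also have "... = k * (sqrt n * ep / a)^2" using n by (simp add: n_def power_mult_distrib power_divide)
     finally show "(\<Sum>i\<in>UNIV. hs2 I (%a b. x i a b - y i a b)) <= real (card I) * (sqrt n * ep / a)^2"
      unfolding k_def .
    qed
    then show ?thesis
    proof (rule cov_mono)
     fix x y assume "x \<in> S'" "y \<in> S'" and op': "\<forall>i. opb I (%b c. x i b c - y i b c) (a / (4 * n) * (sqrt n * ep / a))"
     have "(\<Sum>i\<in>UNIV. hs2 I (%a b. x i a b - y i a b)) <= (\<Sum>i\<in>(UNIV :: 'n set). k * (a / (4 * n) * (sqrt n * ep / a))^2)"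
      unfolding k_def by (intro sum_mono opb_hs2[OF I(1)]) (use op' in blast)
     also have "... = n * (k * (a / (4 * n) * (sqrt n * ep / a))^2)" by (simp add: n_def)
     also have "a / (4 * n) * (sqrt n * ep / a) = sqrt n * ep / (4 * n)" using a by simp
     also have "n * (k * (sqrt n * ep / (4 * n))^2) = k * (ep / 4)^2"
     proof -
      have "(sqrt n * ep / (4 * n))^2 = ep^2 / (16 * n)"
       using n by (simp add: power_mult_distrib power_divide power2_eq_square[of n])
      then show ?thesis using n by (simp add: power_divide)
     qed
     finally show "(\<Sum>i\<in>UNIV. hs2 I (%a b. x i a b - y i a b)) <= real (card I) * (ep / 4)^2" unfolding k_def .
    qed (simp add: x2_def)
   qed
   have "cov (%x y. (\<Sum>i\<in>UNIV. hs2 I (%a b. x i a b - y i a b)) <= real (card I) * (ep / 4)^2) S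
    (x1 ^ (2 * CARD('n) * (card I)^2) * E ^ t * x2 ^ (2 * CARD('n) * (card I)^2))"
    by (rule cov_trans[OF iter _ last]) (use x in simp)
   then show ?thesis
   proof (rule cov_mono)
    have e: "x ^ (2 * CARD('n) * (card I)^2) = exp (k^2 * (2 * n * ln x))" if "x > 0" for x
     using power_as_exp[OF that, of "2 * CARD('n) * (card I)^2"] by (simp add: k_def n_def mult_ac)
    have "x1 ^ (2 * CARD('n) * (card I)^2) * E ^ t * x2 ^ (2 * CARD('n) * (card I)^2)
      = exp (k^2 * (2 * n * ln x1) + real t * (k^2 * Bs) + k^2 * (2 * n * ln x2))"
     unfolding e[OF x(1)] e[OF x(2)] E_def by (simp add: exp_add exp_of_nat_mult)
    also have "... = exp (k^2 * (2 * n * ln x1 + 2 * n * ln x2 + real t * Bs))" by (simp add: algebra_simps)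
    also have "... <= exp (k^2 * (B + (\<nu> + \<kappa>) * \<bar>ln ep\<bar>))"
     using tB by (simp add: B_def mult_left_mono)
    finally show "x1 ^ (2 * CARD('n) * (card I)^2) * E ^ t * x2 ^ (2 * CARD('n) * (card I)^2)
     <= exp ((real (card I))^2 * (B + (\<nu> + \<kappa>) * \<bar>ln ep\<bar>))" unfolding k_def .
   qed
  qed
  then show ?thesis by (intro exI[of _ B] allI impI)
 qed
 then show ?thesis by (intro exI[of _ J] allI impI)
qed

section \<open>Microstates as matrix-valued functions\<close>

definition fm :: "('n => complex mat) => 'n => nat => nat => complex" where
 "fm xi i a b = xi i $$ (a, b)"

lemma mat_adjoint_carrier: "A \<in> carrier_mat k k ==> mat_adjoint A \<in> carrier_mat k k"
 by (auto simp: mat_adjoint_def mat_of_rows_def)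

lemma mat_adjoint_index:
 fixes A :: "complex mat"
 shows "A \<in> carrier_mat k k ==> a < k ==> b < k ==> mat_adjoint A $$ (a, b) = cnj (A $$ (b, a))"
 by (simp add: mat_adjoint_def mat_of_rows_def)

lemma mult_mat_index:
 fixes A :: "complex mat"
 shows "A \<in> carrier_mat k k ==> B \<in> carrier_mat k k ==> a < k ==> b < k ==>
  (A * B) $$ (a, b) = (\<Sum>c<k. A $$ (a, c) * B $$ (c, b))"
 by (simp add: scalar_prod_def lessThan_atLeast0)

lemma word_mat:
 assumes xi: "xi \<in> mat_tuples k"
 shows "word_mat k xi w \<in> carrier_mat k k \<and> (\<forall>a<k. \<forall>b<k. word_mat k xi w $$ (a, b) = wm {..<k} (fm xi) w a b)"
proof (induction w)
 case Nil
 show ?case by (auto simp: word_mat_def idm_def)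
next
 case (Cons l w)
 define A where "A = (if snd l then mat_adjoint (xi (fst l)) else xi (fst l))"
 have xil: "xi (fst l) \<in> carrier_mat k k" using xi by (simp add: mat_tuples_def)
 then have A: "A \<in> carrier_mat k k" using mat_adjoint_carrier by (auto simp: A_def)
 have Al: "A $$ (a, b) = ltr (fm xi) l a b" if "a < k" "b < k" for a b
  using mat_adjoint_index[OF xil that] by (simp add: A_def ltr_def mstar_def fm_def)
 have eq: "word_mat k xi (l # w) = A * word_mat k xi w"
  by (cases l) (simp add: word_mat_def A_def)
 show ?case unfolding eq
 proof (intro conjI allI impI)
  show "A * word_mat k xi w \<in> carrier_mat k k" using A Cons by (intro mult_carrier_mat) auto
  fix a b assume ab: "a < k" "b < k"
  have "(A * word_mat k xi w) $$ (a, b) = (\<Sum>c<k. A $$ (a, c) * word_mat k xi w $$ (c, b))"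
   using A Cons ab by (intro mult_mat_index) auto
  also have "... = wm {..<k} (fm xi) (l # w) a b"
   unfolding wm.simps mm_def using Cons ab by (intro sum.cong refl) (simp add: Al)
  finally show "(A * word_mat k xi w) $$ (a, b) = wm {..<k} (fm xi) (l # w) a b" .
 qed
qed

text \<open>The normalized trace of a word as a function of the pair of size and microstate, so that
  moments can be treated as limits along \<open>mfilter\<close>.\<close>

definition nt :: "'n star_word => nat \<times> ('n => complex mat) => complex" where
 "nt w p = mtr {..<fst p} (wm {..<fst p} (fm (snd p)) w) / of_nat (fst p)"

lemma normalized_trace_word:
 "xi \<in> mat_tuples k ==> normalized_trace k (word_mat k xi w) = nt w (k, xi)"
 using word_mat[of xi k w] by (simp add: normalized_trace_def nt_def mtr_def)

lemma tuple_norm2_sq: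
 fixes xi :: "'n::finite => complex mat"
 assumes "xi \<in> mat_tuples k" "\<eta> \<in> mat_tuples k"
 shows "tuple_norm2 k (%i. xi i - \<eta> i) = sqrt ((\<Sum>i\<in>UNIV. hs2 {..<k} (%a b. fm xi i a b - fm \<eta> i a b)) / real k)"
proof -
 have "Re (normalized_trace k (mat_adjoint A * A)) = hs2 {..<k} (%a b. A $$ (a, b)) / real k"
  if A: "A \<in> carrier_mat k k" for A :: "complex mat"
 proof -
  have "(mat_adjoint A * A) $$ (b, b) = of_real (\<Sum>a<k. (cmod (A $$ (a, b)))^2)" if "b < k" for b
   unfolding mult_mat_index[OF mat_adjoint_carrier[OF A] A that that] of_real_sum complex_norm_square
   using mat_adjoint_index[OF A that] by (intro sum.cong refl) (simp add: mult.commute)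
  then have "(\<Sum>b<k. (mat_adjoint A * A) $$ (b, b)) = of_real (\<Sum>b<k. \<Sum>a<k. (cmod (A $$ (a, b)))^2)" by simp
  also have "(\<Sum>b<k. \<Sum>a<k. (cmod (A $$ (a, b)))^2) = hs2 {..<k} (%a b. A $$ (a, b))"
   unfolding hs2_def by (rule sum.swap)
  finally show ?thesis unfolding normalized_trace_def by (simp add: Re_divide_of_nat)
 qed
 moreover have "xi i - \<eta> i \<in> carrier_mat k k" for i using assms by (simp add: mat_tuples_def minus_carrier_mat)
 moreover have "hs2 {..<k} (%a b. (xi i - \<eta> i) $$ (a, b)) = hs2 {..<k} (%a b. fm xi i a b - fm \<eta> i a b)" for i
 proof (rule hs2_cong)
  fix a b assume ab: "a \<in> {..<k}" "b \<in> {..<k}"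
  have "\<eta> i \<in> carrier_mat k k" using assms(2) by (simp add: mat_tuples_def)
  then show "(xi i - \<eta> i) $$ (a, b) = fm xi i a b - fm \<eta> i a b" using ab by (simp add: fm_def)
 qed
 ultimately show ?thesis unfolding tuple_norm2_def by (simp add: sum_divide_distrib)
qed

text \<open>Microstates as the degree \<open>m\<close> grows and the tolerance
  \<open>\<gamma>\<close> shrinks, uniformly in the size \<open>k\<close>. A property holds
  eventually if some \<open>m\<close> and \<open>\<gamma>\<close> guarantee it for all
  \<open>k > 0\<close>, which turns finitely many approximations into statements about
  limits.\<close>

definition mfilter ::
  "(('a::complex_hilbert_space => 'a) => complex) => ('n => 'a => 'a) => (nat \<times> ('n => complex mat)) filter" where
 "mfilter \<phi> X = (INF p\<in>UNIV \<times> {(0::real)<..}. principal {(k, xi). 0 < k \<and> xi \<in> microstates \<phi> X (fst p) k (snd p)})"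

lemma microstates_mono: "m' <= m ==> \<gamma> <= \<gamma>' ==> microstates \<phi> X m k \<gamma> \<subseteq> microstates \<phi> X m' k \<gamma>'"
 unfolding microstates_def by (blast intro: order_trans less_le_trans)

lemma eventually_mfilter:
 "eventually P (mfilter \<phi> X) \<longleftrightarrow> (\<exists>m \<gamma>. \<gamma> > 0 \<and> (\<forall>k xi. 0 < k --> xi \<in> microstates \<phi> X m k \<gamma> --> P (k, xi)))"
proof -
 let ?S = "%p :: nat \<times> real. {(k, xi). 0 < k \<and> xi \<in> microstates \<phi> X (fst p) k (snd p)}"
 have "eventually P (mfilter \<phi> X) \<longleftrightarrow> (\<exists>p\<in>UNIV \<times> {(0::real)<..}. eventually P (principal (?S p)))"
  unfolding mfilter_def
 proof (rule eventually_INF_base)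
  show "UNIV \<times> {(0::real)<..} \<noteq> ({} :: (nat \<times> real) set)" by auto
  fix p q :: "nat \<times> real" assume p: "p \<in> UNIV \<times> {(0::real)<..}" and q: "q \<in> UNIV \<times> {(0::real)<..}"
  let ?r = "(max (fst p) (fst q), min (snd p) (snd q))"
  have "microstates \<phi> X (fst ?r) k (snd ?r) \<subseteq> microstates \<phi> X (fst p) k (snd p)"
   "microstates \<phi> X (fst ?r) k (snd ?r) \<subseteq> microstates \<phi> X (fst q) k (snd q)" for k
   by (rule microstates_mono; simp)+
  then have "?S ?r \<subseteq> ?S p \<inter> ?S q" by blast
  then have "principal (?S ?r) <= inf (principal (?S p)) (principal (?S q))" by simp
  moreover have "?r \<in> UNIV \<times> {(0::real)<..}" using p q by auto
  ultimately show "\<exists>x\<in>UNIV \<times> {(0::real)<..}. principal (?S x) <= inf (principal (?S p)) (principal (?S q))" by blast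
 qed
 also have "... \<longleftrightarrow> (\<exists>m \<gamma>. \<gamma> > 0 \<and> (\<forall>k xi. 0 < k --> xi \<in> microstates \<phi> X m k \<gamma> --> P (k, xi)))" (is "?l \<longleftrightarrow> ?r")
 proof
  assume ?l
  then obtain p where p: "p \<in> UNIV \<times> {(0::real)<..}" "\<forall>x\<in>?S p. P x" unfolding eventually_principal by blast
  show ?r by (intro exI[of _ "fst p"] exI[of _ "snd p"] conjI allI impI) (use p in auto)
 next
  assume ?r
  then obtain m \<gamma> where m: "\<gamma> > 0" "\<forall>k xi. 0 < k --> xi \<in> microstates \<phi> X m k \<gamma> --> P (k, xi)" by blast
  show ?l by (intro bexI[of _ "(m, \<gamma>)"]) (use m in \<open>auto simp: eventually_principal\<close>)
 qed
 finally show ?thesis .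
qed

section \<open>Substitution of polynomials into words\<close>

type_synonym 'n wlist = "(complex \<times> 'n star_word) list"

definition plist :: "'n star_poly => 'n wlist" where
 "plist g = map (%w. (Poly_Mapping.lookup g w, w)) (SOME xs. set xs = Poly_Mapping.keys g \<and> distinct xs)"

lemma plist_sum: "(\<Sum>(c, w)\<leftarrow>plist g. f c w) = (\<Sum>w\<in>Poly_Mapping.keys g. f (Poly_Mapping.lookup g w) w)"
proof -
 define xs where "xs = (SOME xs. set xs = Poly_Mapping.keys g \<and> distinct xs)"
 have "set xs = Poly_Mapping.keys g \<and> distinct xs"
  unfolding xs_def by (rule someI_ex) (metis finite_distinct_list finite_keys)
 then show ?thesis
  unfolding plist_def xs_def[symmetric] by (simp add: sum_list_distinct_conv_sum_set o_def)
qed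

definition wstar :: "'n wlist => 'n wlist" where "wstar t = map (%(c, w). (cnj c, word_star w)) t"

definition wmul :: "'n wlist => 'n wlist => 'n wlist" where
 "wmul s t = concat (map (%(c, u). map (%(d, w). (c * d, u @ w)) t) s)"

text \<open>Letters \<open>Inl i\<close> stand for the polynomial \<open>F i\<close> and letters
  \<open>Inr i\<close> for a variable. Together with \<open>wexp\<close> this expands words in the
  values of \<open>F\<close> and the variables, so that moments of the enlarged tuple are
  combinations of moments of the original one.\<close>

definition lexp :: "('p => 'n star_poly) => ('p + 'n) \<times> bool => 'n wlist" where
 "lexp F l = (case fst l of Inl i => if snd l then wstar (plist (F i)) else plist (F i) | Inr i => [(1, [(i, snd l)])])"

primrec wexp :: "('p => 'n star_poly) => ('p + 'n) star_word => 'n wlist" where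
 "wexp F [] = [(1, [])]"
| "wexp F (l # W) = wmul (lexp F l) (wexp F W)"

definition wml :: "'i set => ('n => 'i => 'i => complex) => 'n wlist => 'i => 'i => complex" where
 "wml I xi t a b = (\<Sum>(c, w)\<leftarrow>t. c * wm I xi w a b)"

lemma wml_mul:
 assumes I: "finite I" and a: "a \<in> I"
 shows "wml I xi (wmul s t) a b = mm I (wml I xi s) (wml I xi t) a b"
proof (induction s)
 case Nil
 then show ?case by (simp add: wmul_def wml_def mm_def)
next
 case (Cons x s)
 obtain c u where x: "x = (c, u)" by (cases x)
 have 1: "wml I xi (map (%(d, w). (c * d, u @ w)) t) a b = c * mm I (wm I xi u) (wml I xi t) a b"
 proof (induction t)
  case (Cons y t)
  obtain d w where y: "y = (d, w)" by (cases y)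
  have mmy: "mm I (wm I xi u) (wml I xi (y # t)) a b = d * mm I (wm I xi u) (wm I xi w) a b + mm I (wm I xi u) (wml I xi t) a b"
   by (simp add: mm_def y wml_def algebra_simps sum.distrib sum_distrib_left)
  have "wml I xi (map (%(d, w). (c * d, u @ w)) (y # t)) a b = c * d * wm I xi (u @ w) a b + wml I xi (map (%(d, w). (c * d, u @ w)) t) a b"
   by (simp add: y wml_def)
  then show ?case unfolding Cons mmy wm_append[OF I a] by (simp add: algebra_simps)
 qed (simp add: wml_def mm_def)
 have 2: "mm I (wml I xi (x # s)) (wml I xi t) a b = c * mm I (wm I xi u) (wml I xi t) a b + mm I (wml I xi s) (wml I xi t) a b"
  by (simp add: mm_def x wml_def distrib_right sum.distrib sum_distrib_left mult.assoc)
 have 3: "wml I xi (wmul (x # s) t) a b = wml I xi (map (%(d, w). (c * d, u @ w)) t) a b + wml I xi (wmul s t) a b"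
  by (simp add: wmul_def wml_def x)
 show ?case unfolding 3 1 2 Cons ..
qed

lemma wml_plist: "wml I xi (plist g) a b = pm I xi g a b"
 by (simp add: wml_def plist_sum pm_def lin_def)

lemma wml_wstar:
 "finite I ==> a \<in> I ==> b \<in> I ==> wml I xi (wstar t) a b = cnj (wml I xi t b a)"
 by (induction t) (auto simp: wml_def wstar_def wm_star)

definition pmat :: "('p => 'n star_poly) => nat => ('n => complex mat) => 'p => complex mat" where
 "pmat F k xi i = Matrix.mat k k (%(a, b). pm {..<k} (fm xi) (F i) a b)"

lemma fm_pmat: "a < k ==> b < k ==> fm (pmat F k xi) i a b = pm {..<k} (fm xi) (F i) a b"
 by (simp add: fm_def pmat_def)

lemma wm_pmat:
 "a < k ==> b < k ==> wm {..<k} (fm (case_sum (pmat F k xi) xi)) W a b = wml {..<k} (fm xi) (wexp F W) a b"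
proof (induction W arbitrary: a)
 case Nil
 then show ?case by (simp add: wml_def)
next
 case (Cons l W)
 have letter: "ltr (fm (case_sum (pmat F k xi) xi)) l a c = wml {..<k} (fm xi) (lexp F l) a c" if "c < k" for c
 proof (cases "fst l")
  case (Inl i)
  then show ?thesis using that Cons.prems
   by (simp add: ltr_def lexp_def wml_wstar wml_plist mstar_def) (simp add: fm_def pmat_def)
 next
  case (Inr i)
  have "wm {..<k} (fm xi) [(i, snd l)] a c = ltr (fm xi) (i, snd l) a c"
   using mm_idm_right[of "{..<k}" c "ltr (fm xi) (i, snd l)" a] that by simp
  then show ?thesis using Inr by (simp add: wml_def lexp_def) (simp add: ltr_def fm_def mstar_def)
 qed
 have "wm {..<k} (fm (case_sum (pmat F k xi) xi)) (l # W) a b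
   = mm {..<k} (wml {..<k} (fm xi) (lexp F l)) (wml {..<k} (fm xi) (wexp F W)) a b"
  unfolding wm.simps by (rule mm_cong) (use letter Cons in auto)
 also have "... = wml {..<k} (fm xi) (wexp F (l # W)) a b"
  using wml_mul[of "{..<k}" a "fm xi" "lexp F l" "wexp F W" b] Cons.prems by simp
 finally show ?case .
qed

lemma nt_pmat: "nt W (k, case_sum (pmat F k xi) xi) = (\<Sum>(c, w)\<leftarrow>wexp F W. c * nt w (k, xi))"
proof -
 have "mtr {..<k} (wml {..<k} (fm xi) t) = (\<Sum>(c, w)\<leftarrow>t. c * mtr {..<k} (wm {..<k} (fm xi) w))" for t
  by (induction t) (auto simp: mtr_def wml_def sum.distrib sum_distrib_left)
 moreover have "mtr {..<k} (wm {..<k} (fm (case_sum (pmat F k xi) xi)) W) = mtr {..<k} (wml {..<k} (fm xi) (wexp F W))"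
  unfolding mtr_def by (intro sum.cong refl wm_pmat) auto
 moreover have "(\<Sum>(c, w)\<leftarrow>t. c * x w) / y = (\<Sum>(c, w)\<leftarrow>t. c * (x w / y))" for t and x :: "_ => complex" and y
  by (induction t) (auto simp: add_divide_distrib)
 ultimately show ?thesis by (simp add: nt_def)
qed

text \<open>The word whose value at \<open>xi\<close> is \<open>(xi\<^sub>i\<^sup>* xi\<^sub>i) ^ (2 ^ j)\<close>.\<close>

primrec wp :: "'n => nat => 'n star_word" where
 "wp i 0 = [(i, True), (i, False)]"
| "wp i (Suc j) = wp i j @ wp i j"

text \<open>Dyadic Schatten norms are moments; this is how the microstate condition bounds
  them.\<close>

lemma nrm_wp: "0 < k ==> nrm {..<k} j (fm xi i) = real k * Re (nt (wp i j) (k, xi))"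
proof -
 assume k: "0 < k"
 have "wm {..<k} (fm xi) (wp i j) a b = msq {..<k} j (mm {..<k} (mstar (fm xi i)) (fm xi i)) a b" if "a < k" "b < k" for a b
  using that
 proof (induction j arbitrary: a b)
  case 0
  then show ?case
   using mm_idm_right[of "{..<k}" b "mm {..<k} (mstar (fm xi i)) (fm xi i)" a] by (simp add: ltr_def mm_assoc)
 next
  case (Suc j)
  have "wm {..<k} (fm xi) (wp i (Suc j)) a b = mm {..<k} (wm {..<k} (fm xi) (wp i j)) (wm {..<k} (fm xi) (wp i j)) a b"
   using Suc.prems by (simp add: wm_append)
  also have "... = msq {..<k} (Suc j) (mm {..<k} (mstar (fm xi i)) (fm xi i)) a b"
   unfolding msq.simps by (rule mm_cong) (use Suc in auto)
  finally show ?case .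
 qed
 then have "mtr {..<k} (wm {..<k} (fm xi) (wp i j)) = mtr {..<k} (msq {..<k} j (mm {..<k} (mstar (fm xi i)) (fm xi i)))"
  unfolding mtr_def by (intro sum.cong refl) auto
 then show ?thesis using k by (simp add: nrm_def nt_def Re_divide_of_nat)
qed

section \<open>Limits along the microstates\<close>

context tracial_tuple
begin

lemma phi_linear:
 shows phi_add: "U \<in> M ==> V \<in> M ==> \<phi> (%v. U v + V v) = \<phi> U + \<phi> V"
  and phi_scale: "V \<in> M ==> \<phi> (%v. c *\<^sub>C V v) = c * \<phi> V"
proof -
 obtain u v where uv: "!!V. V \<in> M ==> (%k::nat. cinner (V (u k)) (v k)) sums \<phi> V"
  using tv unfolding tracial_von_neumann_algebra_def normal_functional_def by blast
 show "\<phi> (%v. U v + V v) = \<phi> U + \<phi> V" if "U \<in> M" "V \<in> M"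
  using sums_unique2[OF uv[OF MD(5)[OF that]]] sums_add[OF uv[OF that(1)] uv[OF that(2)]]
  by (simp add: cinner_add_left)
 show "\<phi> (%v. c *\<^sub>C V v) = c * \<phi> V" if "V \<in> M"
  using sums_unique2[OF uv[OF MD(6)[OF that]]] sums_mult[OF uv[OF that], of c]
  by (simp add: cinner_scaleC_left)
qed

lemma phi_id: "\<phi> id = 1" using tv by (simp add: tracial_von_neumann_algebra_def)

definition opl :: "'n wlist => 'a => 'a" where
 "opl t v = (\<Sum>(c, w)\<leftarrow>t. c *\<^sub>C word_op X w v)"

lemma opl_simps: "opl [] = (%_. 0)" "opl ((c, w) # t) = (%v. c *\<^sub>C word_op X w v + opl t v)"
 by (simp_all add: opl_def fun_eq_iff)

lemma scale_zero: "(0::complex) *\<^sub>C (x :: 'a) = 0"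
 using scaleC_of_real[of 0 x] by simp

lemma opl_in: "opl t \<in> M"
proof (induction t)
 case Nil
 have "(%v. 0 *\<^sub>C id v) \<in> M" by (rule MD(6)[OF MD(3)])
 then show ?case by (simp add: opl_simps scale_zero)
next
 case (Cons x t)
 obtain c w where "x = (c, w)" by (cases x)
 then show ?case using MD(5)[OF MD(6)[OF word_op_in] Cons] by (simp add: opl_simps)
qed

lemma phi_opl: "\<phi> (opl t) = (\<Sum>(c, w)\<leftarrow>t. c * \<phi> (word_op X w))"
proof (induction t)
 case Nil
 have "\<phi> (%v. 0 *\<^sub>C id v) = 0 * \<phi> id" by (rule phi_scale[OF MD(3)])
 then show ?case by (simp add: opl_simps scale_zero)
next
 case (Cons x t)
 obtain c w where x: "x = (c, w)" by (cases x)
 show ?case unfolding x opl_simps phi_add[OF MD(6)[OF word_op_in] opl_in] phi_scale[OF word_op_in] Cons by simp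
qed

lemma opl_mul: "opl (wmul s t) = opl s \<circ> opl t"
proof
 fix v
 show "opl (wmul s t) v = (opl s \<circ> opl t) v"
 proof (induction s)
  case Nil
  then show ?case by (simp add: wmul_def opl_def)
 next
  case (Cons x s)
  obtain c u where x: "x = (c, u)" by (cases x)
  note lin = bounded_clinearD[OF word_op_clinear]
  have "opl (map (%(d, w). (c * d, u @ w)) t) v = c *\<^sub>C word_op X u (opl t v)"
  proof (induction t)
   case Nil
   have "c *\<^sub>C (0 :: 'a) = 0" using scaleC_diff_right[of c 0 0] by simp
   then show ?case by (simp add: opl_def lin(5))
  next
   case (Cons y t)
   obtain d w where y: "y = (d, w)" by (cases y)
   show ?case using Cons
    by (simp add: y opl_simps word_op_append lin(2) lin(6) scaleC_add_right scaleC_scaleC)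
  qed
  then show ?case using Cons by (simp add: wmul_def opl_def x)
 qed
qed

lemma cadjoint_opl: "cadjoint (opl t) = opl (wstar t)"
proof (rule cadjoint_eqI)
 show "bounded_clinear (opl (wstar t))" by (rule MD(1)[OF opl_in])
 fix u v
 show "cinner (opl t u) v = cinner u (opl (wstar t) v)"
 proof (induction t)
  case Nil
  have "cinner (0 :: 'a) v = 0" "cinner u (0 :: 'a) = 0"
   using cinner_diff_left[of 0 0 v] cinner_diff_right[of u 0 0] by simp_all
  then show ?case by (simp add: opl_def wstar_def)
 next
  case (Cons x t)
  obtain c w where x: "x = (c, w)" by (cases x)
  have "cinner (word_op X w u) v = cinner u (word_op X (word_star w) v)"
   using cinner_cadjoint[OF word_op_clinear] cadjoint_word_op by simp
  then show ?case using Cons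
   by (simp add: x opl_simps wstar_def cinner_add_left cinner_add_right cinner_scaleC_left cinner_scaleC_right)
 qed
qed

definition Y where "Y i = poly_op X (F i)"

lemma word_op_Y: "word_op (case_sum Y X) W = opl (wexp F W)"
proof (induction W)
 case Nil
 have "word_op X [] = id" for X :: "'q => 'a => 'a" by (simp add: word_op_def)
 moreover have "1 *\<^sub>C v = v" for v :: 'a using scaleC_of_real[of 1 v] by simp
 ultimately show ?case by (simp add: fun_eq_iff opl_def word_op_def)
next
 case (Cons l W)
 obtain i s where l: "l = (i, s)" by (cases l)
 have one: "1 *\<^sub>C v = v" for v :: 'a using scaleC_of_real[of 1 v] by simp
 have "(if s then cadjoint (case_sum Y X i) else case_sum Y X i) = opl (lexp F l)"
 proof (cases i)
  case (Inl j)
  have "Y j = opl (plist (F j))" by (rule ext) (simp add: Y_def poly_op_def opl_def plist_sum)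
  then show ?thesis by (simp add: Inl l lexp_def cadjoint_opl)
 next
  case (Inr j)
  have "word_op X [(j, s)] = (if s then cadjoint (X j) else X j)" by (simp add: word_op_def)
  then show ?thesis by (simp add: Inr l lexp_def opl_simps one)
 qed
 then show ?case unfolding l word_op_Cons Cons by (simp add: opl_mul l)
qed

lemma tendsto_nt: "(nt w \<longlongrightarrow> \<phi> (word_op X w)) (mfilter \<phi> X)"
proof (rule tendstoI)
 fix e :: real assume e: "e > 0"
 show "\<forall>\<^sub>F p in mfilter \<phi> X. dist (nt w p) (\<phi> (word_op X w)) < e"
  unfolding eventually_mfilter
 proof (intro exI conjI allI impI)
  fix k xi assume k: "0 < k" and xi: "xi \<in> microstates \<phi> X (length w) k e"
  show "dist (nt w (k, xi)) (\<phi> (word_op X w)) < e"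
  proof (cases w)
   \<comment> \<open>The empty word is not among those tested by \<open>microstates\<close>, but its
     normalized trace is 1 whenever \<open>k > 0\<close>.\<close>
   case Nil
   have "word_op X [] = id" by (simp add: word_op_def)
   then show ?thesis using k e by (simp add: Nil nt_def mtr_def idm_def phi_id)
  next
   case (Cons l w')
   then have "cmod (\<phi> (word_op X w) - normalized_trace k (word_mat k xi w)) < e"
    using xi unfolding microstates_def by simp
   moreover have "xi \<in> mat_tuples k" using xi unfolding microstates_def by simp
   ultimately show ?thesis by (simp add: normalized_trace_word dist_norm norm_minus_commute)
  qed
 qed (rule e)
qed

lemma eventually_pos: "\<forall>\<^sub>F p in mfilter \<phi> X. 0 < fst p \<and> snd p \<in> mat_tuples (fst p)"
 unfolding eventually_mfilter by (intro exI[of _ 0] exI[of _ 1]) (simp add: microstates_def)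

lemma tendsto_wtr: "((%p. wtr {..<fst p} (fm (snd p)) t / (of_nat (fst p))^2) \<longlongrightarrow> trX t) (mfilter \<phi> X)"
proof (induction t)
 case Nil
 then show ?case by (simp add: wtr_def trX_def)
next
 case (Cons x t)
 obtain c u v where x: "x = (c, u, v)" by (cases x)
 have "((%p. c * (nt u p * nt v p) + wtr {..<fst p} (fm (snd p)) t / (of_nat (fst p))^2)
   \<longlongrightarrow> c * (\<phi> (word_op X u) * \<phi> (word_op X v)) + trX t) (mfilter \<phi> X)"
  by (intro tendsto_intros tendsto_nt Cons)
 then show ?case by (simp add: x wtr_def trX_def nt_def add_divide_distrib power2_eq_square)
qed

lemma eventually_moments:
 assumes "(\<Sum>j\<le>2*m. bc (1/R) (2*m) j * Re (mX j)) < \<nu>"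
 shows "\<forall>\<^sub>F p in mfilter \<phi> X. (\<Sum>j\<le>2*m. bc (1/R) (2*m) j * Re (\<Sum>c\<in>UNIV. wtr {..<fst p} (fm (snd p)) (tpow (glist F) j c c)))
  <= (real (fst p))^2 * \<nu>"
proof -
 have "((%p. \<Sum>j\<le>2*m. bc (1/R) (2*m) j * Re (\<Sum>c\<in>UNIV. wtr {..<fst p} (fm (snd p)) (tpow (glist F) j c c) / (of_nat (fst p))^2))
   \<longlongrightarrow> (\<Sum>j\<le>2*m. bc (1/R) (2*m) j * Re (mX j))) (mfilter \<phi> X)"
  unfolding mX_def by (intro tendsto_intros tendsto_wtr)
 from order_tendstoD(2)[OF this assms] show ?thesis
 proof (eventually_elim)
  case (elim p)
  have e: "Re (\<Sum>c\<in>UNIV. f c / (of_nat (fst p))^2) = Re (sum f UNIV) / (real (fst p))^2" for f :: "'n \<times> bool => complex"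
  proof -
   have "(\<Sum>c\<in>UNIV. f c / (of_nat (fst p))^2) = sum f UNIV / of_real ((real (fst p))^2)" by (simp add: sum_divide_distrib)
   then show ?thesis by (simp only: Re_divide_of_real)
  qed
  define s where "s = (\<Sum>j\<le>2*m. bc (1/R) (2*m) j * Re (\<Sum>c\<in>UNIV. wtr {..<fst p} (fm (snd p)) (tpow (glist F) j c c)))"
  have "s / (real (fst p))^2 < \<nu>" using elim unfolding e s_def sum_divide_distrib by (simp only: times_divide_eq_right)
  then have "s <= (real (fst p))^2 * \<nu> \<or> fst p = 0" by (cases "fst p = 0") (auto simp: pos_divide_less_eq mult.commute)
  moreover have "s = 0" if "fst p = 0" using that by (simp add: s_def wtr_def mtr_def case_prod_unfold)
  ultimately show ?case unfolding s_def[symmetric] by auto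
 qed
qed

text \<open>Only finitely many moments are involved, and each is eventually within 1 of its limit.
  Since \<open>K >= 1\<close>, a bound by \<open>K\<close> is also a bound by the power of
  \<open>K\<close> that \<open>lbd\<close> asks for.\<close>

lemma eventually_lbd:
 "\<exists>K\<ge>1. \<forall>\<^sub>F p in mfilter \<phi> X. \<forall>i. lbd {..<fst p} J (fm (snd p) i) K"
proof -
 define K where "K = 1 + (\<Sum>i\<in>UNIV. \<Sum>j\<le>J. cmod (\<phi> (word_op X (wp i j))) + 1)"
 have K1: "K >= 1" unfolding K_def by (simp add: sum_nonneg)
 have K: "cmod (\<phi> (word_op X (wp i j))) + 1 <= K" if "j <= J" for i j
 proof -
  have "cmod (\<phi> (word_op X (wp i j))) + 1 <= (\<Sum>j\<le>J. cmod (\<phi> (word_op X (wp i j))) + 1)"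
   by (rule member_le_sum[of j "{..J}" "%j. cmod (\<phi> (word_op X (wp i j))) + 1"]) (use that in auto)
  also have "... <= (\<Sum>i\<in>UNIV. \<Sum>j\<le>J. cmod (\<phi> (word_op X (wp i j))) + 1)"
   by (rule member_le_sum[of i UNIV "%i. \<Sum>j\<le>J. cmod (\<phi> (word_op X (wp i j))) + 1"]) (auto intro!: sum_nonneg add_nonneg_nonneg)
  finally show ?thesis by (simp add: K_def)
 qed
 have "\<forall>\<^sub>F p in mfilter \<phi> X. \<forall>q\<in>(UNIV :: 'n set) \<times> {..J}. dist (nt (wp (fst q) (snd q)) p) (\<phi> (word_op X (wp (fst q) (snd q)))) < 1"
  by (intro eventually_ball_finite ballI tendstoD[OF tendsto_nt]) auto
 then have "\<forall>\<^sub>F p in mfilter \<phi> X. \<forall>i. lbd {..<fst p} J (fm (snd p) i) K"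
  using eventually_pos
 proof eventually_elim
  case (elim p)
  show ?case unfolding lbd_def
  proof (intro allI impI)
   fix i j assume j: "j <= J"
   have "dist (nt (wp i j) p) (\<phi> (word_op X (wp i j))) < 1" using elim(1) j by (auto dest!: bspec[of _ _ "(i, j)"])
   then have "cmod (nt (wp i j) p) <= cmod (\<phi> (word_op X (wp i j))) + 1"
    using norm_triangle_ineq2[of "nt (wp i j) p" "\<phi> (word_op X (wp i j))"] by (simp add: dist_norm)
   then have "Re (nt (wp i j) p) <= K" using K[OF j, of i] complex_Re_le_cmod[of "nt (wp i j) p"] by linarith
   also have "K <= K ^ 2 ^ Suc j" using K1 by (intro self_le_power) auto
   finally have "real (fst p) * Re (nt (wp i j) p) <= real (fst p) * K ^ 2 ^ Suc j" by (rule mult_left_mono) simp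
   then show "nrm {..<fst p} j (fm (snd p) i) <= real (card {..<fst p}) * K ^ 2 ^ Suc j"
    using nrm_wp[of "fst p" j "snd p" i] elim(2) by simp
  qed
 qed
 then show ?thesis using K1 by blast
qed

text \<open>The microstate itself serves as the witness for the second half of the tuple. Only the
  finitely many words of length at most \<open>m\<close> are tested, and each expands into words in
  the variables, whose moments converge.\<close>

lemma eventually_rel:
 assumes \<gamma>: "\<gamma> > 0"
 shows "\<forall>\<^sub>F p in mfilter \<phi> X. pmat F (fst p) (snd p) \<in> rel_microstates \<phi> Y X m (fst p) \<gamma>"
proof -
 have fin: "finite {W :: ('p + 'n) star_word. length W <= m}"
  using finite_lists_length_le[of "UNIV :: (('p + 'n) \<times> bool) set" m] by simp
 have "((%p. \<Sum>(c, w)\<leftarrow>t. c * nt w p) \<longlongrightarrow> (\<Sum>(c, w)\<leftarrow>t. c * \<phi> (word_op X w))) (mfilter \<phi> X)" for t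
 proof (induction t)
  case (Cons x t)
  obtain c w where x: "x = (c, w)" by (cases x)
  have "((%p. c * nt w p + (\<Sum>(c, w)\<leftarrow>t. c * nt w p)) \<longlongrightarrow> c * \<phi> (word_op X w) + (\<Sum>(c, w)\<leftarrow>t. c * \<phi> (word_op X w))) (mfilter \<phi> X)"
   by (intro tendsto_intros tendsto_nt Cons)
  then show ?case by (simp add: x)
 qed simp
 then have "((%p. nt W (fst p, case_sum (pmat F (fst p) (snd p)) (snd p))) \<longlongrightarrow> \<phi> (word_op (case_sum Y X) W)) (mfilter \<phi> X)" for W
  by (simp add: nt_pmat word_op_Y phi_opl)
 then have "\<forall>\<^sub>F p in mfilter \<phi> X. \<forall>W\<in>{W. length W <= m}.
   dist (nt W (fst p, case_sum (pmat F (fst p) (snd p)) (snd p))) (\<phi> (word_op (case_sum Y X) W)) < \<gamma>"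
  by (intro eventually_ball_finite fin ballI) (rule tendstoD[OF _ \<gamma>])
 then show ?thesis using eventually_pos
 proof eventually_elim
  case (elim p)
  let ?xi = "case_sum (pmat F (fst p) (snd p)) (snd p)"
  have mt: "?xi \<in> mat_tuples (fst p)"
   using elim(2) by (auto simp: mat_tuples_def pmat_def split: sum.split)
  have "?xi \<in> microstates \<phi> (case_sum Y X) m (fst p) \<gamma>"
   unfolding microstates_def using mt elim(1)
   by (auto simp: normalized_trace_word dist_norm norm_minus_commute)
  then show ?case unfolding rel_microstates_def by blast
 qed
qed

end

section \<open>Comparison of covering numbers\<close>

lemma covering_number_attained:
 assumes "covering_number k ep S = enat c"
 obtains C where "finite C" "C \<subseteq> mat_tuples k" "S \<subseteq> (\<Union>\<eta>\<in>C. tuple_ball k \<eta> ep)" "card C = c"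
proof -
 define Z where "Z = {C. finite C \<and> C \<subseteq> mat_tuples k \<and> S \<subseteq> (\<Union>\<eta>\<in>C. tuple_ball k \<eta> ep)}"
 have c: "covering_number k ep S = Inf ((%C. enat (card C)) ` Z)" by (simp add: covering_number_def Z_def)
 have "Z \<noteq> {}" using assms unfolding c by (auto simp: Inf_enat_def)
 then obtain C0 where "C0 \<in> Z" by blast
 then have "Inf ((%C. enat (card C)) ` Z) \<in> (%C. enat (card C)) ` Z" by (intro wellorder_InfI[of "enat (card C0)"]) simp
 then obtain C where "C \<in> Z" "enat (card C) = enat c" using assms unfolding c by auto
 then show thesis by (intro that[of C]) (auto simp: Z_def)
qed

text \<open>Each ball of an optimal cover of \<open>\<Delta>\<close> has a preimage in
  \<open>\<Gamma>\<close> that is covered by at most \<open>E\<close> balls. Infinite covering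
  numbers and the empty set are absorbed by the values of \<open>log_enat\<close>.\<close>

lemma covering_number_pullback:
 fixes \<Gamma> :: "('n::finite => complex mat) set" and \<Delta> :: "('p::finite => complex mat) set"
 assumes f: "f ` \<Gamma> \<subseteq> \<Delta>" and E: "E > 0"
  and piece: "!!\<eta>. \<eta> \<in> mat_tuples k ==> \<exists>C. finite C \<and> real (card C) <= E \<and> C \<subseteq> mat_tuples k \<and>
   {xi \<in> \<Gamma>. f xi \<in> tuple_ball k \<eta> ep} \<subseteq> (\<Union>\<eta>\<in>C. tuple_ball k \<eta> ep)"
 shows "log_enat (covering_number k ep \<Gamma>) <= log_enat (covering_number k ep \<Delta>) + ereal (ln E)"
proof (cases "covering_number k ep \<Delta>")
 case infinity
 then show ?thesis by simp
next
 case (enat c)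
 then obtain C where C: "finite C" "C \<subseteq> mat_tuples k" "\<Delta> \<subseteq> (\<Union>\<eta>\<in>C. tuple_ball k \<eta> ep)" "card C = c"
  by (rule covering_number_attained)
 have "\<forall>\<eta>\<in>C. \<exists>D. finite D \<and> real (card D) <= E \<and> D \<subseteq> mat_tuples k \<and>
   {xi \<in> \<Gamma>. f xi \<in> tuple_ball k \<eta> ep} \<subseteq> (\<Union>\<eta>\<in>D. tuple_ball k \<eta> ep)"
  using piece C(2) by blast
 then obtain D where D: "\<forall>\<eta>\<in>C. finite (D \<eta>) \<and> real (card (D \<eta>)) <= E \<and> D \<eta> \<subseteq> mat_tuples k \<and>
   {xi \<in> \<Gamma>. f xi \<in> tuple_ball k \<eta> ep} \<subseteq> (\<Union>\<zeta>\<in>D \<eta>. tuple_ball k \<zeta> ep)"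
  unfolding bchoice_iff by blast
 define U where "U = (\<Union>\<eta>\<in>C. D \<eta>)"
 have "card U <= (\<Sum>\<eta>\<in>C. card (D \<eta>))" unfolding U_def by (rule card_UN_le[OF C(1)])
 then have "real (card U) <= real (\<Sum>\<eta>\<in>C. card (D \<eta>))" by (rule of_nat_mono)
 also have "... = (\<Sum>\<eta>\<in>C. real (card (D \<eta>)))" by simp
 also have "... <= (\<Sum>\<eta>\<in>C. E)" using D by (intro sum_mono) blast
 also have "... = real c * E" using C(4) by simp
 finally have cU: "real (card U) <= real c * E" .
 have "\<Gamma> \<subseteq> (\<Union>\<zeta>\<in>U. tuple_ball k \<zeta> ep)"
 proof
  fix xi assume xi: "xi \<in> \<Gamma>"
  then have "f xi \<in> (\<Union>\<eta>\<in>C. tuple_ball k \<eta> ep)" using f C(3) by blast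
  then obtain \<eta> where \<eta>: "\<eta> \<in> C" "f xi \<in> tuple_ball k \<eta> ep" by blast
  then have "{xi \<in> \<Gamma>. f xi \<in> tuple_ball k \<eta> ep} \<subseteq> (\<Union>\<zeta>\<in>D \<eta>. tuple_ball k \<zeta> ep)" using D by blast
  then have "xi \<in> (\<Union>\<zeta>\<in>D \<eta>. tuple_ball k \<zeta> ep)" using xi \<eta>(2) by blast
  then show "xi \<in> (\<Union>\<zeta>\<in>U. tuple_ball k \<zeta> ep)" unfolding U_def using \<eta>(1) by blast
 qed
 moreover have "finite U" "U \<subseteq> mat_tuples k" unfolding U_def using D C(1) by blast+
 ultimately have "covering_number k ep \<Gamma> <= enat (card U)"
  unfolding covering_number_def by (intro INF_lower) simp
 then obtain n where n: "covering_number k ep \<Gamma> = enat n" "n <= card U"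
  by (cases "covering_number k ep \<Gamma>") auto
 show ?thesis
 proof (cases "n = 0")
  case True
  then show ?thesis using n(1) by simp
 next
  case False
  have le: "real n <= real c * E" using n(2) cU by linarith
  then have c0: "c > 0" using False E by (cases "c = 0") auto
  have "ln (real n) <= ln (real c * E)" using False le by (intro ln_mono) auto
  also have "... = ln (real c) + ln E" using c0 E by (simp add: ln_mult)
  finally show ?thesis using n(1) enat False c0 by simp
 qed
qed

lemma ereal_add_divide: "c > 0 ==> (x + ereal b) / ereal c = x / ereal c + ereal (b / c)"
 by (cases x) (auto simp: add_divide_distrib)

section \<open>The entropy inequality\<close>

context tracial_tuple
begin

text \<open>A ball of radius \<open>ep\<close> in the space of values of \<open>F\<close> pulls back
  to a set that is tame for \<open>2 * ep\<close>, to which \<open>entropy_bound\<close> applies.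
  The constant \<open>B\<close> is chosen before \<open>m'\<close> and \<open>\<gamma>'\<close> and
  does not depend on \<open>k\<close>, so that the estimate passes through the limsup over
  \<open>k\<close> and the infima over the parameters.\<close>

lemma covering_bound:
 assumes \<kappa>: "\<kappa> > 0"
 shows "\<exists>B. \<forall>m' \<gamma>'. \<gamma>' > 0 --> (\<exists>m \<gamma>. \<gamma> > 0 \<and> (\<forall>ep k. 0 < ep --> ep < 1 / 2 --> 0 < k -->
  log_enat (covering_number k ep (microstates \<phi> X m k \<gamma>)) / ereal ((real k)^2)
   <= log_enat (covering_number k ep (rel_microstates \<phi> Y X m' k \<gamma>')) / ereal ((real k)^2)
    + ereal (B + (Nullity \<tau> T + \<kappa>) * \<bar>ln (2 * ep)\<bar>)))"
proof -
 obtain J where J: "\<forall>K\<ge>1. \<forall>R>0. \<forall>m. \<forall>\<nu>. \<forall>\<kappa>>0. \<exists>B. \<forall>ep (I :: nat set) S. 0 < ep --> ep < 1 --> finite I --> I \<noteq> {} -->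
  tame I J K m R F \<nu> ep S -->
  cov (%x y. (\<Sum>i\<in>UNIV. hs2 I (%a b. x i a b - y i a b)) <= real (card I) * (ep / 4)^2) S
   (exp ((real (card I))^2 * (B + (\<nu> + \<kappa>) * \<bar>ln ep\<bar>)))"
  using entropy_bound[of F] by (rule exE)
 obtain K where K: "K >= 1" and evK: "\<forall>\<^sub>F p in mfilter \<phi> X. \<forall>i. lbd {..<fst p} J (fm (snd p) i) K"
  using eventually_lbd[of J] by blast
 obtain R N where R: "R > 0" and N: "(\<Sum>j\<le>2*N. bc (1/R) (2*N) j * Re (mX j)) <= Nullity \<tau> T + \<kappa> / 3"
  using nullity_moments[of "\<kappa> / 3"] \<kappa> by (auto simp del: Re_sum)
 \<comment> \<open>One third of \<open>\<kappa>\<close> is spent on approximating the nullity by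
   moments, one on the strict inequality that lets the moments of microstates come close, and one
   inside \<open>entropy_bound\<close>.\<close>
 define \<nu> where "\<nu> = Nullity \<tau> T + 2 * \<kappa> / 3"
 have "(\<Sum>j\<le>2*N. bc (1/R) (2*N) j * Re (mX j)) < \<nu>" using N \<kappa> unfolding \<nu>_def by linarith
 note evM = eventually_moments[OF this]
 have \<nu>\<kappa>: "\<nu> + \<kappa> / 3 = Nullity \<tau> T + \<kappa>" by (simp add: \<nu>_def)
 obtain B where B: "!!ep (I :: nat set) S. 0 < ep ==> ep < 1 ==> finite I ==> I \<noteq> {} ==>
  tame I J K N R F \<nu> ep S ==>
  cov (%x y. (\<Sum>i\<in>UNIV. hs2 I (%a b. x i a b - y i a b)) <= real (card I) * (ep / 4)^2) S
   (exp ((real (card I))^2 * (B + (Nullity \<tau> T + \<kappa>) * \<bar>ln ep\<bar>)))"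
  using J[rule_format, OF K R, of "\<kappa> / 3" N \<nu>] \<kappa> unfolding \<nu>\<kappa> by auto
 have "\<exists>m \<gamma>. \<gamma> > 0 \<and> (\<forall>ep k. 0 < ep --> ep < 1 / 2 --> 0 < k -->
  log_enat (covering_number k ep (microstates \<phi> X m k \<gamma>)) / ereal ((real k)^2)
   <= log_enat (covering_number k ep (rel_microstates \<phi> Y X m' k \<gamma>')) / ereal ((real k)^2)
    + ereal (B + (Nullity \<tau> T + \<kappa>) * \<bar>ln (2 * ep)\<bar>))" if \<gamma>': "\<gamma>' > 0" for m' \<gamma>'
 proof -
  define G where "G p \<longleftrightarrow> (\<forall>i. lbd {..<fst p} J (fm (snd p) i) K) \<and>
   (\<Sum>j\<le>2*N. bc (1/R) (2*N) j * Re (\<Sum>c\<in>UNIV. wtr {..<fst p} (fm (snd p)) (tpow (glist F) j c c))) <= (real (fst p))^2 * \<nu> \<and>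
   pmat F (fst p) (snd p) \<in> rel_microstates \<phi> Y X m' (fst p) \<gamma>'" for p
  have "\<forall>\<^sub>F p in mfilter \<phi> X. G p" unfolding G_def by (intro eventually_conj evK evM eventually_rel \<gamma>')
  then obtain m \<gamma> where \<gamma>: "\<gamma> > 0" and G: "!!k xi. 0 < k ==> xi \<in> microstates \<phi> X m k \<gamma> ==> G (k, xi)"
   unfolding eventually_mfilter by blast
  have "log_enat (covering_number k ep (microstates \<phi> X m k \<gamma>)) / ereal ((real k)^2)
   <= log_enat (covering_number k ep (rel_microstates \<phi> Y X m' k \<gamma>')) / ereal ((real k)^2)
    + ereal (B + (Nullity \<tau> T + \<kappa>) * \<bar>ln (2 * ep)\<bar>)" if ep: "0 < ep" "ep < 1 / 2" and k: "0 < k" for ep k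
  proof -
   define q where "q = B + (Nullity \<tau> T + \<kappa>) * \<bar>ln (2 * ep)\<bar>"
   define \<Gamma> where "\<Gamma> = microstates \<phi> X m k \<gamma>"
   have mt: "xi \<in> mat_tuples k" if "xi \<in> \<Gamma>" for xi using that by (simp add: \<Gamma>_def microstates_def)
   have pm: "pmat F k xi \<in> mat_tuples k" for xi by (simp add: mat_tuples_def pmat_def)
   have GG: "G (k, xi)" if "xi \<in> \<Gamma>" for xi using G[OF k] that by (simp add: \<Gamma>_def)
   have "log_enat (covering_number k ep \<Gamma>) <= log_enat (covering_number k ep (rel_microstates \<phi> Y X m' k \<gamma>')) + ereal (ln (exp ((real k)^2 * q)))"
   proof (rule covering_number_pullback[of "pmat F k"])
    show "pmat F k ` \<Gamma> \<subseteq> rel_microstates \<phi> Y X m' k \<gamma>'" using GG by (auto simp: G_def)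
    fix \<eta> :: "'p => complex mat" assume \<eta>: "\<eta> \<in> mat_tuples k"
    define A where "A = {xi \<in> \<Gamma>. pmat F k xi \<in> tuple_ball k \<eta> ep}"
    have near: "(\<Sum>i\<in>UNIV. hs2 {..<k} (%a b. fm (pmat F k xi) i a b - fm \<eta> i a b)) <= real k * ep^2" if "xi \<in> A" for xi
    proof -
     have "sqrt ((\<Sum>i\<in>UNIV. hs2 {..<k} (%a b. fm (pmat F k xi) i a b - fm \<eta> i a b)) / real k) < ep"
      using that unfolding A_def tuple_ball_def by (simp add: tuple_norm2_sq[OF pm \<eta>])
     then have "(\<Sum>i\<in>UNIV. hs2 {..<k} (%a b. fm (pmat F k xi) i a b - fm \<eta> i a b)) / real k <= ep^2"
      by (intro sqrt_le_D less_imp_le)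
     then show ?thesis using k by (simp add: pos_divide_le_eq mult.commute)
    qed
    have "tame {..<k} J K N R F \<nu> (2 * ep) (fm ` A)"
     unfolding tame_def
    proof (intro ballI conjI)
     fix v assume "v \<in> fm ` A"
     then obtain xi where xi: "v = fm xi" "xi \<in> A" by blast
     then have Gxi: "G (k, xi)" using GG by (simp add: A_def)
     show "\<forall>i. lbd {..<k} J (v i) K" using Gxi by (simp add: G_def xi(1))
     show "(\<Sum>j\<le>2*N. bc (1/R) (2*N) j * Re (\<Sum>c\<in>UNIV. wtr {..<k} v (tpow (glist F) j c c))) <= (real (card {..<k}))^2 * \<nu>"
      using Gxi unfolding G_def fst_conv snd_conv card_lessThan xi(1) by blast
     fix v' assume "v' \<in> fm ` A"
     then obtain xi' where xi': "v' = fm xi'" "xi' \<in> A" by blast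
     have "(\<Sum>i\<in>UNIV. hs2 {..<k} (%a b. pm {..<k} v' (F i) a b - pm {..<k} v (F i) a b))
      <= (\<Sum>i\<in>UNIV. 2 * hs2 {..<k} (%a b. fm (pmat F k xi') i a b - fm \<eta> i a b) + 2 * hs2 {..<k} (%a b. fm (pmat F k xi) i a b - fm \<eta> i a b))"
     proof (rule sum_mono)
      fix i
      have "hs2 {..<k} (%a b. pm {..<k} v' (F i) a b - pm {..<k} v (F i) a b)
       = hs2 {..<k} (%a b. (fm (pmat F k xi') i a b - fm \<eta> i a b) - (fm (pmat F k xi) i a b - fm \<eta> i a b))"
       by (rule hs2_cong) (simp add: fm_pmat xi(1) xi'(1))
      also have "... <= 2 * hs2 {..<k} (%a b. fm (pmat F k xi') i a b - fm \<eta> i a b) + 2 * hs2 {..<k} (%a b. fm (pmat F k xi) i a b - fm \<eta> i a b)"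
       by (rule hs2_diff_le)
      finally show "hs2 {..<k} (%a b. pm {..<k} v' (F i) a b - pm {..<k} v (F i) a b)
       <= 2 * hs2 {..<k} (%a b. fm (pmat F k xi') i a b - fm \<eta> i a b) + 2 * hs2 {..<k} (%a b. fm (pmat F k xi) i a b - fm \<eta> i a b)" .
     qed
     also have "... = 2 * (\<Sum>i\<in>UNIV. hs2 {..<k} (%a b. fm (pmat F k xi') i a b - fm \<eta> i a b))
       + 2 * (\<Sum>i\<in>UNIV. hs2 {..<k} (%a b. fm (pmat F k xi) i a b - fm \<eta> i a b))"
      by (simp add: sum.distrib sum_distrib_left)
     also have "... <= 2 * (real k * ep^2) + 2 * (real k * ep^2)" using near[OF xi(2)] near[OF xi'(2)] by linarith
     also have "... = real (card {..<k}) * (2 * ep)^2" by (simp add: power_mult_distrib)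
     finally show "(\<Sum>i\<in>UNIV. hs2 {..<k} (%a b. pm {..<k} v' (F i) a b - pm {..<k} v (F i) a b)) <= real (card {..<k}) * (2 * ep)^2" .
    qed
    then have "cov (%x y. (\<Sum>i\<in>UNIV. hs2 {..<k} (%a b. x i a b - y i a b)) <= real (card {..<k}) * (2 * ep / 4)^2) (fm ` A)
      (exp ((real (card {..<k}))^2 * q))"
     unfolding q_def by (intro B) (use ep k in auto)
    then obtain \<C> where \<C>: "finite \<C>" "real (card \<C>) <= exp ((real k)^2 * q)" "fm ` A = \<Union>\<C>"
     "\<forall>C\<in>\<C>. \<forall>x\<in>C. \<forall>y\<in>C. (\<Sum>i\<in>UNIV. hs2 {..<k} (%a b. x i a b - y i a b)) <= real k * (2 * ep / 4)^2"
     unfolding cov_def card_lessThan by blast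
    \<comment> \<open>Points of a piece are at distance at most \<open>ep / 2\<close>, so the open
      ball of radius \<open>ep\<close> around any one of them contains the piece.\<close>
    have "\<forall>C\<in>{C \<in> \<C>. C \<noteq> {}}. \<exists>xi. xi \<in> A \<and> fm xi \<in> C"
    proof
     fix C assume C: "C \<in> {C \<in> \<C>. C \<noteq> {}}"
     then obtain v where v: "v \<in> C" by blast
     then have "v \<in> fm ` A" using C unfolding \<C>(3) by blast
     then show "\<exists>xi. xi \<in> A \<and> fm xi \<in> C" using v by blast
    qed
    then obtain g where g: "\<forall>C\<in>{C \<in> \<C>. C \<noteq> {}}. g C \<in> A \<and> fm (g C) \<in> C" unfolding bchoice_iff by blast
    define Z where "Z = g ` {C \<in> \<C>. C \<noteq> {}}"
    have "finite Z" unfolding Z_def using \<C>(1) by simp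
    moreover have "real (card Z) <= exp ((real k)^2 * q)"
    proof -
     have "card Z <= card {C \<in> \<C>. C \<noteq> {}}" unfolding Z_def by (rule card_image_le) (use \<C>(1) in simp)
     also have "... <= card \<C>" by (rule card_mono) (use \<C>(1) in auto)
     finally have "real (card Z) <= real (card \<C>)" by simp
     then show ?thesis using \<C>(2) by linarith
    qed
    moreover have "Z \<subseteq> mat_tuples k" using g mt unfolding Z_def A_def by blast
    moreover have "A \<subseteq> (\<Union>\<zeta>\<in>Z. tuple_ball k \<zeta> ep)"
    proof
     fix xi assume xi: "xi \<in> A"
     then have "fm xi \<in> \<Union>\<C>" using \<C>(3) by blast
     then obtain C where C: "C \<in> \<C>" "fm xi \<in> C" by blast
     then have CZ: "C \<in> {C \<in> \<C>. C \<noteq> {}}" by blast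
     then have gC: "g C \<in> A" "fm (g C) \<in> C" using g by blast+
     have m1: "xi \<in> mat_tuples k" "g C \<in> mat_tuples k" using xi gC mt by (auto simp: A_def)
     have "(\<Sum>i\<in>UNIV. hs2 {..<k} (%a b. fm xi i a b - fm (g C) i a b)) <= real k * (2 * ep / 4)^2"
      using \<C>(4) C gC(2) by blast
     then have "(\<Sum>i\<in>UNIV. hs2 {..<k} (%a b. fm xi i a b - fm (g C) i a b)) / real k <= (2 * ep / 4)^2"
      using k by (simp only: pos_divide_le_eq of_nat_0_less_iff mult.commute[of "(2 * ep / 4)^2"])
     then have "tuple_norm2 k (%i. xi i - g C i) <= sqrt ((2 * ep / 4)^2)"
      unfolding tuple_norm2_sq[OF m1] by (rule real_sqrt_le_mono)
     also have "... < ep" using ep by (simp add: real_sqrt_abs)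
     finally have "xi \<in> tuple_ball k (g C) ep" using m1 by (simp add: tuple_ball_def)
     then show "xi \<in> (\<Union>\<zeta>\<in>Z. tuple_ball k \<zeta> ep)" unfolding Z_def using CZ by blast
    qed
    ultimately show "\<exists>C. finite C \<and> real (card C) <= exp ((real k)^2 * q) \<and> C \<subseteq> mat_tuples k \<and>
      {xi \<in> \<Gamma>. pmat F k xi \<in> tuple_ball k \<eta> ep} \<subseteq> (\<Union>\<eta>\<in>C. tuple_ball k \<eta> ep)"
     unfolding A_def[symmetric] by (intro exI[of _ Z] conjI)
   qed simp
   then have "log_enat (covering_number k ep \<Gamma>) / ereal ((real k)^2)
     <= (log_enat (covering_number k ep (rel_microstates \<phi> Y X m' k \<gamma>')) + ereal ((real k)^2 * q)) / ereal ((real k)^2)"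
    using k by (intro ereal_divide_right_mono) simp_all
   also have "... = log_enat (covering_number k ep (rel_microstates \<phi> Y X m' k \<gamma>')) / ereal ((real k)^2) + ereal q"
    using k by (subst ereal_add_divide) simp_all
   finally show ?thesis unfolding q_def \<Gamma>_def .
  qed
  then show ?thesis using \<gamma> by blast
 qed
 then show ?thesis by (intro exI[of _ B] allI impI)
qed

lemma delta0_bound: "delta0 \<phi> X <= ereal (Nullity \<tau> T) + rel_delta0 \<phi> Y X"
proof (rule ereal_le_epsilon2)
 fix e :: real assume e: "0 < e"
 define \<kappa> where "\<kappa> = e / 2"
 have \<kappa>: "\<kappa> > 0" using e by (simp add: \<kappa>_def)
 obtain B where B: "!!m' \<gamma>'. \<gamma>' > 0 ==> \<exists>m \<gamma>. \<gamma> > 0 \<and> (\<forall>ep k. 0 < ep --> ep < 1 / 2 --> 0 < k -->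
  log_enat (covering_number k ep (microstates \<phi> X m k \<gamma>)) / ereal ((real k)^2)
   <= log_enat (covering_number k ep (rel_microstates \<phi> Y X m' k \<gamma>')) / ereal ((real k)^2)
    + ereal (B + (Nullity \<tau> T + \<kappa>) * \<bar>ln (2 * ep)\<bar>))"
  using covering_bound[OF \<kappa>] by blast
 define q where "q ep = B + (Nullity \<tau> T + \<kappa>) * \<bar>ln (2 * ep)\<bar>" for ep
 have ent: "covering_entropy (microstates \<phi> X) ep <= covering_entropy (rel_microstates \<phi> Y X) ep + ereal (q ep)"
  if ep: "0 < ep" "ep < 1 / 2" for ep
 proof -
  \<comment> \<open>The finite term is moved to the left, so that the right side is an infimum over
    \<open>m'\<close> and \<open>\<gamma>'\<close> alone.\<close>
  have "covering_entropy (microstates \<phi> X) ep - ereal (q ep) <= covering_entropy (rel_microstates \<phi> Y X) ep"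
   unfolding covering_entropy_def[of "rel_microstates \<phi> Y X"]
  proof (intro INF_greatest)
   fix m' :: nat and \<gamma>' :: real assume "\<gamma>' \<in> {0<..}"
   then have "\<gamma>' > 0" by simp
   from B[OF this, of m'] obtain m \<gamma> where \<gamma>: "\<gamma> > 0" and le: "!!k. 0 < k ==>
    log_enat (covering_number k ep (microstates \<phi> X m k \<gamma>)) / ereal ((real k)^2)
     <= log_enat (covering_number k ep (rel_microstates \<phi> Y X m' k \<gamma>')) / ereal ((real k)^2) + ereal (q ep)"
    using ep unfolding q_def by blast
   have "covering_entropy (microstates \<phi> X) ep <= (INF \<gamma>\<in>{0<..}. limsup (%k. log_enat (covering_number k ep (microstates \<phi> X m k \<gamma>)) / ereal ((real k)^2)))"
    unfolding covering_entropy_def by (rule INF_lower) simp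
   also have "... <= limsup (%k. log_enat (covering_number k ep (microstates \<phi> X m k \<gamma>)) / ereal ((real k)^2))"
    by (rule INF_lower) (use \<gamma> in simp)
   also have "... <= limsup (%k. log_enat (covering_number k ep (rel_microstates \<phi> Y X m' k \<gamma>')) / ereal ((real k)^2) + ereal (q ep))"
    by (rule Limsup_mono) (rule eventually_mono[OF eventually_gt_at_top[of 0] le])
   also have "... = limsup (%k. log_enat (covering_number k ep (rel_microstates \<phi> Y X m' k \<gamma>')) / ereal ((real k)^2)) + ereal (q ep)"
    by (rule Limsup_add_ereal_right) simp_all
   finally show "covering_entropy (microstates \<phi> X) ep - ereal (q ep)
     <= limsup (%k. log_enat (covering_number k ep (rel_microstates \<phi> Y X m' k \<gamma>')) / ereal ((real k)^2))"
    by (subst ereal_minus_le) simp_all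
  qed
  then show ?thesis by (subst (asm) ereal_minus_le) simp_all
 qed
 define B' where "B' = B - (Nullity \<tau> T + \<kappa>) * ln 2"
 \<comment> \<open>Below \<open>b\<close> the term \<open>\<kappa> * \<bar>ln ep\<bar>\<close>
   absorbs the constant \<open>B'\<close>, which also contains the change from
   \<open>ln (2 * ep)\<close> to \<open>ln ep\<close>.\<close>
 define b where "b = min (1 / 2) (exp (- (\<bar>B'\<bar> / \<kappa> + 1)))"
 have small: "covering_entropy (microstates \<phi> X) ep / ereal \<bar>ln ep\<bar>
   <= covering_entropy (rel_microstates \<phi> Y X) ep / ereal \<bar>ln ep\<bar> + ereal (Nullity \<tau> T + e)" if ep: "0 < ep" "ep < b" for ep
 proof -
  have ep2: "ep < 1 / 2" and "ep < exp (- (\<bar>B'\<bar> / \<kappa> + 1))" using ep(2) by (simp_all add: b_def)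
  then have "ln ep < ln (exp (- (\<bar>B'\<bar> / \<kappa> + 1)))" using ep(1) by (subst ln_less_cancel_iff) auto
  then have l: "\<bar>B'\<bar> / \<kappa> + 1 < - ln ep" by simp
  have "0 <= \<bar>B'\<bar> / \<kappa>" using \<kappa> by simp
  then have l0: "\<bar>ln ep\<bar> = - ln ep" "0 < - ln ep" using l by linarith+
  have "ln (2 * ep) = ln 2 + ln ep" using ep(1) by (simp add: ln_mult)
  moreover have "ln (2 * ep) < 0" using ep(1) ep2 by simp
  ultimately have l2: "\<bar>ln (2 * ep)\<bar> = - ln ep - ln 2" by linarith
  have "q ep = B' + (Nullity \<tau> T + \<kappa>) * (- ln ep)" unfolding q_def B'_def l2 by (simp add: algebra_simps)
  moreover have "B' <= \<kappa> * (- ln ep)"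
  proof -
   have "\<bar>B'\<bar> / \<kappa> <= - ln ep" using l by linarith
   then have "\<bar>B'\<bar> <= (- ln ep) * \<kappa>" using \<kappa> by (simp only: pos_divide_le_eq)
   then show ?thesis by (simp add: mult.commute)
  qed
  ultimately have "q ep <= (Nullity \<tau> T + e) * (- ln ep)" by (simp add: \<kappa>_def algebra_simps)
  then have "q ep / (- ln ep) <= Nullity \<tau> T + e" using l0(2) by (simp only: pos_divide_le_eq)
  then have qq: "ereal (q ep / (- ln ep)) <= ereal (Nullity \<tau> T + e)" by simp
  have "covering_entropy (microstates \<phi> X) ep / ereal (- ln ep)
    <= (covering_entropy (rel_microstates \<phi> Y X) ep + ereal (q ep)) / ereal (- ln ep)"
   using l0(2) by (intro ereal_divide_right_mono ent ep ep2) simp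
  also have "... = covering_entropy (rel_microstates \<phi> Y X) ep / ereal (- ln ep) + ereal (q ep / (- ln ep))"
   by (rule ereal_add_divide[OF l0(2)])
  also have "... <= covering_entropy (rel_microstates \<phi> Y X) ep / ereal (- ln ep) + ereal (Nullity \<tau> T + e)"
   by (rule add_left_mono[OF qq])
  finally show ?thesis unfolding l0(1) .
 qed
 have "b > 0" by (simp add: b_def)
 then have ev: "\<forall>\<^sub>F ep in at_right 0. covering_entropy (microstates \<phi> X) ep / ereal \<bar>ln ep\<bar>
   <= covering_entropy (rel_microstates \<phi> Y X) ep / ereal \<bar>ln ep\<bar> + ereal (Nullity \<tau> T + e)"
  unfolding eventually_at_right_field using small by blast
 have "delta0 \<phi> X <= Limsup (at_right 0) (%ep. covering_entropy (rel_microstates \<phi> Y X) ep / ereal \<bar>ln ep\<bar> + ereal (Nullity \<tau> T + e))"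
  unfolding delta0_def covering_dimension_def by (rule Limsup_mono[OF ev])
 also have "... = rel_delta0 \<phi> Y X + ereal (Nullity \<tau> T + e)"
  unfolding rel_delta0_def covering_dimension_def by (rule Limsup_add_ereal_right) simp_all
 also have "... = ereal (Nullity \<tau> T) + rel_delta0 \<phi> Y X + ereal e"
  by (cases "rel_delta0 \<phi> Y X") (simp_all add: algebra_simps)
 finally show "delta0 \<phi> X <= ereal (Nullity \<tau> T) + rel_delta0 \<phi> Y X + ereal e" .
qed

end

theorem corollary4p8:
  fixes M :: "('a::complex_hilbert_space \<Rightarrow> 'a) set"
    and \<phi> :: "('a \<Rightarrow> 'a) \<Rightarrow> complex"
    and X :: "'n::finite \<Rightarrow> 'a \<Rightarrow> 'a"
    and F :: "'p::finite \<Rightarrow> 'n star_poly"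
  assumes "tracial_von_neumann_algebra M \<phi>"
    and "\<And>i. X i \<in> M"
  shows "delta0 \<phi> X
           \<le> ereal (Nullity (tensor_op_trace M \<phi>) (Ds F X))
               + rel_delta0 \<phi> (\<lambda>i. poly_op X (F i)) X
       \<and> ereal (Nullity (tensor_op_trace M \<phi>) (Ds F X))
               + rel_delta0 \<phi> (\<lambda>i. poly_op X (F i)) X
         = ereal (2 * real CARD('n) - Rank (tensor_op_trace M \<phi>) (Ds F X))
               + rel_delta0 \<phi> (\<lambda>i. poly_op X (F i)) X"
proof -
 interpret tracial_tuple M \<phi> X F by (rule tracial_tuple.intro) (fact assms)+
 have "2 * real CARD('n) - Rank (tensor_op_trace M \<phi>) (Ds F X) = Nullity (tensor_op_trace M \<phi>) (Ds F X)"
  using Rank_Nullity unfolding \<tau>_def by simp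
 then show ?thesis using delta0_bound unfolding \<tau>_def Y_def[abs_def] by simp
qed

end
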